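(* Let $T\in\mathcal{BC}^{0,1}(V_n)$ and let $M,N\ge1$ be integers. (I) If $F\in\mathcal{PN}^N(\sigma_S(T))$ and $G\in\mathcal{PS}^M_L(\sigma_S(T))$, then $(FG)(T)=F(T)G(T)$. (II) If $F\in\mathcal{PS}^N_R(\sigma_S(T))$ and $G\in\mathcal{PN}^M(\sigma_S(T))$, then $(FG)(T)=F(T)G(T)$. Here $FG$ is the pointwise product, which is a left (in case (I)), respectively right (in case (II)), poly slice monogenic function of order $M+N-1$.
   Context: $\mathbb{R}_n$ is the real Clifford algebra generated by $e_1,\dots,e_n$ with $e_\ell e_m+e_me_\ell=0$ ($\ell\ne m$), $e_\ell^2=-1$, with basis $e_A$. A point of $\mathbb{R}^{n+1}$ is identified with the paravector $x=x_0+\sum_{\ell=1}^n x_\ell e_\ell$; $\mathrm{Re}(x)=x_0$, $\overline{x}=x_0-\sum x_\ell e_\ell$. $\mathbb{S}=\{\sum_{\ell=1}^n x_\ell e_\ell:\sum x_\ell^2=1\}$; $\mathbb{C}_{\mathrm{j}}=\mathbb{R}+\mathrm{j}\mathbb{R}$ for $\mathrm{j}\in\mathbb{S}$. For $x=x_0+\underline{x}$, $[x]=\{x_0+\mathrm{j}|\underline{x}|:\mathrm{j}\in\mathbb{S}\}$; $U$ is axially symmetric if $[x]\subset U$ for all $x\in U$. For $U$ axially symmetric open and $\mathcal{U}=\{(u,v):u+\mathbb{S}v\subset U\}$, $F:U\to\mathbb{R}_n$ is left (right) poly slice monogenic of order $M$ if $F(u+\mathrm{j}v)=F_0(u,v)+\mathrm{j}F_1(u,v)$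 (resp. $F_0(u,v)+F_1(u,v)\mathrm{j}$) for all $\mathrm{j}\in\mathbb{S}$, with $F_0,F_1:\mathcal{U}\to\mathbb{R}_n$ of class $\mathcal{C}^M$, $F_0$ even and $F_1$ odd in $v$, and $\frac{1}{2^M}(\partial_u+\mathrm{j}\partial_v)^M(F_0+\mathrm{j}F_1)=0$ (resp. $(F_0+F_1\mathrm{j})\frac{1}{2^M}(\partial_u+\mathrm{j}\partial_v)^M=0$, $\mathrm{j}$ acting from the right) for all $\mathrm{j}\in\mathbb{S}$. It is intrinsic if $F_0,F_1$ are real-valued. Order $1$ gives left (right, intrinsic) slice monogenic functions. Each left (right) poly slice monogenic $F$ has a unique decomposition $F(x)=\sum_{k=0}^{M-1}\overline{x}^kf_k(x)$ (resp. $\sum_{k=0}^{M-1} f_k(x)\overline{x}^k$) with left (right) slice monogenic $f_k$, the components of $F$. In case (I) the pointwise product has decomposition $F(x)G(x)=\sum_{\ell=0}^{N+M-2}\overline{x}^\ell\sum_{k+h=\ell}f_k(x)g_h(x)$, and in case (II) $F(x)G(x)=\sum_{\ell=0}^{N+M-2}\big(\sum_{k+h=\ell}f_k(x)g_h(x)\big)\overline{x}^\ell$. A slice Cauchy domain is an axially symmetric open set $U$ such that for every $\mathrm{j}\in\mathbb{S}$ the boundary $\partial(U\cap\mathbb{C}_{\mathrm{j}})$ is a finite union of non-intersecting piecewise continuously differentiable Jordan curves (positively oriented). $V$ is a real Banach space, $V_n=V\otimes\mathbb{R}_n$ with elements $\sum_Av_Ae_A$ and $\|v\|^2=\sum_A\|v_A\|^2$,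 a two-sided $\mathbb{R}_n$-module. $\mathcal{B}(V_n)$ is the set of Clifford operators $T=\sum_Ae_AT_A$, $T_A$ bounded linear on $V$, acting by $T(\sum_B v_Be_B)=\sum_{A,B}T_A(v_B)e_Ae_B$; for $a\in\mathbb{R}_n$, $(aT)(v)=a\,T(v)$, $(Ta)(v)=T(av)$. $\mathcal{BC}^{0,1}(V_n)$ is the set of paravector operators $T=T_0+\sum_{j=1}^ne_jT_j$ with mutually commuting components $T_0,\dots,T_n$; $\overline{T}=T_0-\sum_{j=1}^ne_jT_j$. For $s\in\mathbb{R}^{n+1}$: $\mathcal{Q}_s(T)=T^2-2\mathrm{Re}(s)T+|s|^2\mathcal{I}$; $\rho_S(T)=\{s\in\mathbb{R}^{n+1}:\mathcal{Q}_s(T)\text{ invertible in }\mathcal{B}(V_n)\}$, $\sigma_S(T)=\mathbb{R}^{n+1}\setminus\rho_S(T)$. For $s\in\rho_S(T)$: $S_L^{-1}(s,T)=-\mathcal{Q}_s(T)^{-1}(T-\overline{s}\mathcal{I})$, $S_R^{-1}(s,T)=-(T-\overline{s}\mathcal{I})\mathcal{Q}_s(T)^{-1}$. $\mathcal{PS}^M_L(\sigma_S(T))$, $\mathcal{PS}^M_R(\sigma_S(T))$, $\mathcal{PN}^M(\sigma_S(T))$ denote the left, right, intrinsic poly slice monogenic functions $F$ of order $M$ on an axially symmetric open set $\mathrm{dom}(F)$ for which there is a bounded slice Cauchy domain $U$ with $\sigma_S(T)\subset U$, $\overline U\subset\mathrm{dom}(F)$. The $PS$-functional calculus is, with $ds_{\mathrm{j}}=ds(-\mathrm{j})$,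 $$F(T)=\frac{1}{2\pi}\int_{\partial(U\cap\mathbb{C}_{\mathrm{j}})}\sum_{\ell=0}^{M-1}\overline{T}^\ell S_L^{-1}(s,T)\,ds_{\mathrm{j}}\,f_\ell(s)\quad\text{for }F\in\mathcal{PS}^M_L(\sigma_S(T)),$$ $$F(T)=\frac{1}{2\pi}\int_{\partial(U\cap\mathbb{C}_{\mathrm{j}})}\sum_{\ell=0}^{M-1}f_\ell(s)\,ds_{\mathrm{j}}\,S_R^{-1}(s,T)\overline{T}^\ell\quad\text{for }F\in\mathcal{PS}^M_R(\sigma_S(T)),$$ independent of $U$ and $\mathrm{j}$; for $F$ intrinsic and $T\in\mathcal{BC}^{0,1}(V_n)$ both formulas give the same operator. *)

theory Defs
  imports "HOL-Complex_Analysis.Complex_Analysis"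
begin

section \<open>The Clifford algebra and its paravectors\<close>

text \<open>
  The algebra has one generator for each element of a finite, linearly ordered index type
  \<open>'n\<close> (so \<open>n = CARD('n) \<ge> 1\<close>), and an element is the vector of its coordinates
  with respect to the basis \<open>e_A\<close>, \<open>A\<close> a subset of \<open>'n\<close>. The componentwise
  multiplication that the library puts on \<open>real ^ 'i\<close> is not used.
\<close>

type_synonym 'n clifford = "real ^ ('n set)"

definition cbasis :: "('n::finite) set \<Rightarrow> 'n clifford" where
  "cbasis A = axis A 1"

text \<open>
  \<open>e_A e_B = csign A B \<cdot> e_(A \<triangle> B)\<close>: sorting the generators costs one transposition for
  each pair \<open>a > b\<close>, and each pair \<open>a = b\<close> contributes \<open>e_a\<^sup>2 = -1\<close>.
\<close>

definition csign :: "('n::{finite,linorder}) set \<Rightarrow> 'n set \<Rightarrow> real" where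
  "csign A B = (- 1) ^ card {(a, b). a \<in> A \<and> b \<in> B \<and> b \<le> a}"

definition cmult :: "('n::{finite,linorder}) clifford \<Rightarrow> 'n clifford \<Rightarrow> 'n clifford"
    (infixl \<open>\<odot>\<close> 70) where
  "x \<odot> y = (\<Sum>A\<in>UNIV. \<Sum>B\<in>UNIV. (x $ A * y $ B * csign A B) *\<^sub>R cbasis (sym_diff A B))"

definition cpow :: "('n::{finite,linorder}) clifford \<Rightarrow> nat \<Rightarrow> 'n clifford" where
  "cpow x k = ((\<odot>) x ^^ k) (cbasis {})"

lemma cbasis_mult: "cbasis A \<odot> cbasis B = csign A B *\<^sub>R cbasis (sym_diff A B)"
proof -
  have *: "(cbasis A $ C * cbasis B $ D * csign C D) *\<^sub>R cbasis (sym_diff C D)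
      = (if D = B then if C = A then csign C D *\<^sub>R cbasis (sym_diff C D) else 0 else 0)" for C D
    by (auto simp: cbasis_def axis_def)
  show ?thesis
    unfolding cmult_def * by (simp add: sum.delta)
qed

lemma cbasis_generator_square:
  fixes i :: "'n::{finite,linorder}"
  shows "cbasis {i} \<odot> cbasis {i} = - cbasis {}"
proof -
  have "{(a, b). a \<in> {i} \<and> b \<in> {i} \<and> b \<le> a} = {(i, i)}" by auto
  then show ?thesis by (simp add: cbasis_mult csign_def)
qed

lemma cbasis_generators_anticommute:
  fixes i k :: "'n::{finite,linorder}"
  assumes "i \<noteq> k"
  shows "cbasis {i} \<odot> cbasis {k} + cbasis {k} \<odot> cbasis {i} = 0"
proof -
  have 1: "{(a, b). a \<in> {i} \<and> b \<in> {k} \<and> b \<le> a} = (if k < i then {(i, k)} else {})"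
    and 2: "{(a, b). a \<in> {k} \<and> b \<in> {i} \<and> b \<le> a} = (if k < i then {} else {(k, i)})"
    using assms by auto
  have 3: "sym_diff {i} {k} = sym_diff {k} {i}" by auto
  show ?thesis
    unfolding cbasis_mult csign_def 1 2 3 by simp
qed

lemma cbasis_insert:
  fixes i :: "'n::{finite,linorder}"
  assumes "\<And>a. a \<in> A \<Longrightarrow> i < a"
  shows "cbasis (insert i A) = cbasis {i} \<odot> cbasis A"
proof -
  have 1: "{(a, b). a \<in> {i} \<and> b \<in> A \<and> b \<le> a} = {}" and 2: "sym_diff {i} A = insert i A"
    using assms by fastforce+
  show ?thesis
    unfolding cbasis_mult csign_def 1 2 by simp
qed

text \<open>
  A point of \<open>\<real>\<^sup>n\<^sup>+\<^sup>1\<close> is a pair of its real part and its vector part; \<open>para\<close> is the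
  identification with paravectors. The product norm is the Euclidean norm.
\<close>

type_synonym 'n point = "real \<times> (real ^ 'n)"

definition para :: "('n::finite) point \<Rightarrow> 'n clifford" where
  "para x = fst x *\<^sub>R cbasis {} + (\<Sum>i\<in>UNIV. (snd x $ i) *\<^sub>R cbasis {i})"

definition pconj :: "('n::finite) point \<Rightarrow> 'n point" where
  "pconj x = (fst x, - snd x)"

definition unit_vectors :: "(real ^ ('n::finite)) set" (\<open>\<S>\<close>) where
  "\<S> = {j. norm j = 1}"

definition imag_unit :: "real ^ ('n::finite) \<Rightarrow> 'n clifford" where
  "imag_unit j = para (0, j)"

text \<open>The identification of the complex numbers with \<open>\<complex>\<^sub>j\<close>, \<open>u + iv \<mapsto> u + jv\<close>.\<close>

definition slice_point :: "real ^ ('n::finite) \<Rightarrow> complex \<Rightarrow> 'n point" where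
  "slice_point j z = (Re z, Im z *\<^sub>R j)"

definition axially_symmetric :: "('n::finite) point set \<Rightarrow> bool" where
  "axially_symmetric U \<longleftrightarrow> (\<forall>x\<in>U. \<forall>j\<in>\<S>. (fst x, norm (snd x) *\<^sub>R j) \<in> U)"


section \<open>Poly slice monogenic functions\<close>

definition dpart_u :: "(real \<times> real \<Rightarrow> 'a::real_normed_vector) \<Rightarrow> real \<times> real \<Rightarrow> 'a" where
  "dpart_u h p = vector_derivative (\<lambda>t. h (t, snd p)) (at (fst p))"

definition dpart_v :: "(real \<times> real \<Rightarrow> 'a::real_normed_vector) \<Rightarrow> real \<times> real \<Rightarrow> 'a" where
  "dpart_v h p = vector_derivative (\<lambda>t. h (fst p, t)) (at (snd p))"

text \<open>Class \<open>C\<^sup>k\<close> on an open subset of the plane.\<close>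

fun Ck_on :: "nat \<Rightarrow> (real \<times> real) set \<Rightarrow> (real \<times> real \<Rightarrow> 'a::real_normed_vector) \<Rightarrow> bool" where
  "Ck_on 0 S h \<longleftrightarrow> continuous_on S h"
| "Ck_on (Suc k) S h \<longleftrightarrow> continuous_on S h \<and>
     (\<forall>p\<in>S. (\<lambda>t. h (t, snd p)) differentiable (at (fst p)) \<and>
            (\<lambda>t. h (fst p, t)) differentiable (at (snd p))) \<and>
     Ck_on k S (dpart_u h) \<and> Ck_on k S (dpart_v h)"

definition plane_domain :: "('n::finite) point set \<Rightarrow> (real \<times> real) set" where
  "plane_domain U = {(u, v). \<forall>j\<in>\<S>. (u, v *\<^sub>R j) \<in> U}"

definition stem_pair :: "nat \<Rightarrow> ('n::finite) point set \<Rightarrow>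
    (real \<times> real \<Rightarrow> 'n clifford) \<Rightarrow> (real \<times> real \<Rightarrow> 'n clifford) \<Rightarrow> bool" where
  "stem_pair M U F0 F1 \<longleftrightarrow> Ck_on M (plane_domain U) F0 \<and> Ck_on M (plane_domain U) F1 \<and>
     (\<forall>(u, v) \<in> plane_domain U. F0 (u, - v) = F0 (u, v) \<and> F1 (u, - v) = - F1 (u, v))"

definition left_stem :: "nat \<Rightarrow> ('n::{finite,linorder}) point set \<Rightarrow> ('n point \<Rightarrow> 'n clifford) \<Rightarrow>
    (real \<times> real \<Rightarrow> 'n clifford) \<Rightarrow> (real \<times> real \<Rightarrow> 'n clifford) \<Rightarrow> bool" where
  "left_stem M U F F0 F1 \<longleftrightarrow> stem_pair M U F0 F1 \<and>
     (\<forall>(u, v) \<in> plane_domain U. \<forall>j\<in>\<S>.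
        F (u, v *\<^sub>R j) = F0 (u, v) + imag_unit j \<odot> F1 (u, v)) \<and>
     (\<forall>j\<in>\<S>. \<forall>p \<in> plane_domain U.
        (1 / 2 ^ M) *\<^sub>R ((\<lambda>h q. dpart_u h q + imag_unit j \<odot> dpart_v h q) ^^ M)
          (\<lambda>q. F0 q + imag_unit j \<odot> F1 q) p = 0)"

definition right_stem :: "nat \<Rightarrow> ('n::{finite,linorder}) point set \<Rightarrow> ('n point \<Rightarrow> 'n clifford) \<Rightarrow>
    (real \<times> real \<Rightarrow> 'n clifford) \<Rightarrow> (real \<times> real \<Rightarrow> 'n clifford) \<Rightarrow> bool" where
  "right_stem M U F F0 F1 \<longleftrightarrow> stem_pair M U F0 F1 \<and>
     (\<forall>(u, v) \<in> plane_domain U. \<forall>j\<in>\<S>.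
        F (u, v *\<^sub>R j) = F0 (u, v) + F1 (u, v) \<odot> imag_unit j) \<and>
     (\<forall>j\<in>\<S>. \<forall>p \<in> plane_domain U.
        (1 / 2 ^ M) *\<^sub>R ((\<lambda>h q. dpart_u h q + dpart_v h q \<odot> imag_unit j) ^^ M)
          (\<lambda>q. F0 q + F1 q \<odot> imag_unit j) p = 0)"

text \<open>Functions on \<open>U\<close> are total functions whose values outside \<open>U\<close> are irrelevant.\<close>

definition left_poly_slice_monogenic ::
    "nat \<Rightarrow> ('n::{finite,linorder}) point set \<Rightarrow> ('n point \<Rightarrow> 'n clifford) \<Rightarrow> bool" where
  "left_poly_slice_monogenic M U F \<longleftrightarrow>
     open U \<and> axially_symmetric U \<and> (\<exists>F0 F1. left_stem M U F F0 F1)"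

definition right_poly_slice_monogenic ::
    "nat \<Rightarrow> ('n::{finite,linorder}) point set \<Rightarrow> ('n point \<Rightarrow> 'n clifford) \<Rightarrow> bool" where
  "right_poly_slice_monogenic M U F \<longleftrightarrow>
     open U \<and> axially_symmetric U \<and> (\<exists>F0 F1. right_stem M U F F0 F1)"

text \<open>For real-valued \<open>F\<^sub>0\<close>, \<open>F\<^sub>1\<close> the left and the right conditions coincide.\<close>

definition intrinsic_poly_slice_monogenic ::
    "nat \<Rightarrow> ('n::{finite,linorder}) point set \<Rightarrow> ('n point \<Rightarrow> 'n clifford) \<Rightarrow> bool" where
  "intrinsic_poly_slice_monogenic M U F \<longleftrightarrow>
     open U \<and> axially_symmetric U \<and>
     (\<exists>F0 F1. left_stem M U F F0 F1 \<and>
        (\<forall>p \<in> plane_domain U. (\<exists>r. F0 p = r *\<^sub>R cbasis {}) \<and> (\<exists>r. F1 p = r *\<^sub>R cbasis {})))"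

definition left_components :: "nat \<Rightarrow> ('n::{finite,linorder}) point set \<Rightarrow>
    ('n point \<Rightarrow> 'n clifford) \<Rightarrow> (nat \<Rightarrow> 'n point \<Rightarrow> 'n clifford) \<Rightarrow> bool" where
  "left_components M U F f \<longleftrightarrow>
     (\<forall>k<M. left_poly_slice_monogenic 1 U (f k)) \<and>
     (\<forall>x\<in>U. F x = (\<Sum>k<M. cpow (para (pconj x)) k \<odot> f k x))"

definition right_components :: "nat \<Rightarrow> ('n::{finite,linorder}) point set \<Rightarrow>
    ('n point \<Rightarrow> 'n clifford) \<Rightarrow> (nat \<Rightarrow> 'n point \<Rightarrow> 'n clifford) \<Rightarrow> bool" where
  "right_components M U F f \<longleftrightarrow>
     (\<forall>k<M. right_poly_slice_monogenic 1 U (f k)) \<and>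
     (\<forall>x\<in>U. F x = (\<Sum>k<M. f k x \<odot> cpow (para (pconj x)) k))"


section \<open>Slice Cauchy domains\<close>

text \<open>
  The boundary curves of a bounded open set \<open>W\<close> of the plane: disjoint piecewise \<open>C\<^sup>1\<close> Jordan
  curves whose union is the boundary. The system is positively oriented if its total winding
  number is 1 about the points of \<open>W\<close> and 0 about the exterior points.
\<close>

definition boundary_curves :: "(real \<Rightarrow> complex) list \<Rightarrow> complex set \<Rightarrow> bool" where
  "boundary_curves \<Gamma> W \<longleftrightarrow>
     (\<forall>\<gamma>\<in>set \<Gamma>. valid_path \<gamma> \<and> simple_path \<gamma> \<and> pathfinish \<gamma> = pathstart \<gamma>) \<and>
     (\<forall>i<length \<Gamma>. \<forall>k<length \<Gamma>. i \<noteq> k \<longrightarrow> path_image (\<Gamma> ! i) \<inter> path_image (\<Gamma> ! k) = {}) \<and>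
     frontier W = (\<Union>\<gamma>\<in>set \<Gamma>. path_image \<gamma>) \<and>
     (\<forall>z\<in>W. (\<Sum>\<gamma>\<leftarrow>\<Gamma>. winding_number \<gamma> z) = 1) \<and>
     (\<forall>z. z \<notin> closure W \<longrightarrow> (\<Sum>\<gamma>\<leftarrow>\<Gamma>. winding_number \<gamma> z) = 0)"

definition slice :: "real ^ ('n::finite) \<Rightarrow> 'n point set \<Rightarrow> complex set" where
  "slice j U = {z. slice_point j z \<in> U}"

definition bounded_slice_Cauchy_domain :: "('n::finite) point set \<Rightarrow> bool" where
  "bounded_slice_Cauchy_domain U \<longleftrightarrow> bounded U \<and> open U \<and> axially_symmetric U \<and>
     (\<forall>j\<in>\<S>. \<exists>\<Gamma>. boundary_curves \<Gamma> (slice j U))"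


section \<open>Clifford operators\<close>

text \<open>
  \<open>V\<^sub>n\<close> is \<open>'v ^ ('n set)\<close>, whose library norm is the one of the square root of the sum of the
  squared norms of the components. A family \<open>T\<close> of bounded operators on \<open>V\<close> acts as
  \<open>\<Sum>\<^sub>A e_A T_A\<close>.
\<close>

type_synonym ('v, 'n) cop = "('v ^ ('n set)) \<Rightarrow>\<^sub>L ('v ^ ('n set))"

definition cop_fun :: "('n::{finite,linorder} set \<Rightarrow> ('v::real_normed_vector) \<Rightarrow>\<^sub>L 'v) \<Rightarrow>
    'v ^ ('n set) \<Rightarrow> 'v ^ ('n set)" where
  "cop_fun T v = (\<Sum>A\<in>UNIV. \<Sum>B\<in>UNIV.
     axis (sym_diff A B) (csign A B *\<^sub>R blinfun_apply (T A) (v $ B)))"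

definition cop_of :: "('n::{finite,linorder} set \<Rightarrow> ('v::real_normed_vector) \<Rightarrow>\<^sub>L 'v) \<Rightarrow>
    ('v, 'n) cop" where
  "cop_of T = Blinfun (cop_fun T)"

lemma bounded_linear_axis:
  "bounded_linear (axis i :: 'a::real_normed_vector \<Rightarrow> 'a ^ ('i::finite))"
proof (rule bounded_linear_intro[where K = 1])
  show "norm (axis i x :: 'a ^ 'i) \<le> norm x * 1" for x
  proof -
    have "(norm ((axis i x :: 'a ^ 'i) $ k))\<^sup>2 = (if k = i then (norm x)\<^sup>2 else 0)" for k
      by (simp add: axis_def)
    then show ?thesis by (simp add: norm_vec_def L2_set_def)
  qed
qed (auto simp: axis_def vec_eq_iff)

lemma bounded_linear_cop_fun: "bounded_linear (cop_fun T)"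
  unfolding cop_fun_def
  by (intro bounded_linear_sum bounded_linear_compose[OF bounded_linear_axis]
      bounded_linear_const_scaleR bounded_linear_compose[OF blinfun.bounded_linear_right]
      bounded_linear_vec_nth)

lemma blinfun_apply_cop_of: "blinfun_apply (cop_of T) = cop_fun T"
  unfolding cop_of_def by (rule bounded_linear_Blinfun_apply[OF bounded_linear_cop_fun])

definition clifford_operators :: "('v::real_normed_vector, 'n::{finite,linorder}) cop set" where
  "clifford_operators = range cop_of"

text \<open>Left multiplication by a Clifford number: \<open>aT\<close> is \<open>lmul a o\<^sub>L T\<close> and \<open>Ta\<close> is
  \<open>T o\<^sub>L lmul a\<close>.\<close>

definition lmul :: "('n::{finite,linorder}) clifford \<Rightarrow> ('v::real_normed_vector, 'n) cop" where
  "lmul a = cop_of (\<lambda>A. (a $ A) *\<^sub>R id_blinfun)"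

definition cop_pow :: "('v::real_normed_vector, 'n::finite) cop \<Rightarrow> nat \<Rightarrow> ('v, 'n) cop" where
  "cop_pow X k = ((o\<^sub>L) X ^^ k) id_blinfun"

definition cop_invertible :: "('v::real_normed_vector, 'n::{finite,linorder}) cop \<Rightarrow> bool" where
  "cop_invertible X \<longleftrightarrow>
     (\<exists>Y\<in>clifford_operators. X o\<^sub>L Y = id_blinfun \<and> Y o\<^sub>L X = id_blinfun)"

definition cop_inverse ::
    "('v::real_normed_vector, 'n::{finite,linorder}) cop \<Rightarrow> ('v, 'n) cop" where
  "cop_inverse X =
     (THE Y. Y \<in> clifford_operators \<and> X o\<^sub>L Y = id_blinfun \<and> Y o\<^sub>L X = id_blinfun)"

text \<open>Paravector operators are given by their components \<open>(T\<^sub>0, (T\<^sub>1, \<dots>, T\<^sub>n))\<close>;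
  \<open>pop\<close> is the resulting Clifford operator.\<close>

type_synonym ('v, 'n) pvop = "('v \<Rightarrow>\<^sub>L 'v) \<times> (('v \<Rightarrow>\<^sub>L 'v) ^ 'n)"

definition pop :: "('v::real_normed_vector, 'n::{finite,linorder}) pvop \<Rightarrow> ('v, 'n) cop" where
  "pop T = cop_of (\<lambda>A. if A = {} then fst T
                       else if \<exists>i. A = {i} then snd T $ (the_elem A) else 0)"

definition pop_conj :: "('v::real_normed_vector, 'n::finite) pvop \<Rightarrow> ('v, 'n) pvop" where
  "pop_conj T = (fst T, - snd T)"

definition BC01 :: "('v::real_normed_vector, 'n::finite) pvop set" where
  "BC01 = {T. (\<forall>i. fst T o\<^sub>L snd T $ i = snd T $ i o\<^sub>L fst T) \<and>
              (\<forall>i k. snd T $ i o\<^sub>L snd T $ k = snd T $ k o\<^sub>L snd T $ i)}"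

definition Qop :: "('n::{finite,linorder}) point \<Rightarrow> ('v::real_normed_vector, 'n) pvop \<Rightarrow>
    ('v, 'n) cop" where
  "Qop s T = (pop T o\<^sub>L pop T) - (2 * fst s) *\<^sub>R pop T + (norm s)\<^sup>2 *\<^sub>R id_blinfun"

definition S_resolvent_set ::
    "('v::real_normed_vector, 'n::{finite,linorder}) pvop \<Rightarrow> 'n point set" where
  "S_resolvent_set T = {s. cop_invertible (Qop s T)}"

definition S_spectrum ::
    "('v::real_normed_vector, 'n::{finite,linorder}) pvop \<Rightarrow> 'n point set" where
  "S_spectrum T = UNIV - S_resolvent_set T"

definition SL_inv :: "('n::{finite,linorder}) point \<Rightarrow> ('v::real_normed_vector, 'n) pvop \<Rightarrow>
    ('v, 'n) cop" where
  "SL_inv s T = - (cop_inverse (Qop s T) o\<^sub>L (pop T - lmul (para (pconj s))))"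

definition SR_inv :: "('n::{finite,linorder}) point \<Rightarrow> ('v::real_normed_vector, 'n) pvop \<Rightarrow>
    ('v, 'n) cop" where
  "SR_inv s T = - ((pop T - lmul (para (pconj s))) o\<^sub>L cop_inverse (Qop s T))"


section \<open>The functional calculus\<close>

definition admissible ::
    "('v::real_normed_vector, 'n::{finite,linorder}) pvop \<Rightarrow> 'n point set \<Rightarrow> 'n point set \<Rightarrow> bool"
    where
  "admissible T D U \<longleftrightarrow>
     bounded_slice_Cauchy_domain U \<and> S_spectrum T \<subseteq> U \<and> closure U \<subseteq> D"

text \<open>The function \<open>F\<close> with domain \<open>D\<close> belongs to the class in question.\<close>

definition PS_L :: "nat \<Rightarrow> ('v::real_normed_vector, 'n::{finite,linorder}) pvop \<Rightarrow>
    'n point set \<Rightarrow> ('n point \<Rightarrow> 'n clifford) \<Rightarrow> bool" where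
  "PS_L M T D F \<longleftrightarrow> left_poly_slice_monogenic M D F \<and> (\<exists>U. admissible T D U)"

definition PS_R :: "nat \<Rightarrow> ('v::real_normed_vector, 'n::{finite,linorder}) pvop \<Rightarrow>
    'n point set \<Rightarrow> ('n point \<Rightarrow> 'n clifford) \<Rightarrow> bool" where
  "PS_R M T D F \<longleftrightarrow> right_poly_slice_monogenic M D F \<and> (\<exists>U. admissible T D U)"

definition PN :: "nat \<Rightarrow> ('v::real_normed_vector, 'n::{finite,linorder}) pvop \<Rightarrow>
    'n point set \<Rightarrow> ('n point \<Rightarrow> 'n clifford) \<Rightarrow> bool" where
  "PN M T D F \<longleftrightarrow> intrinsic_poly_slice_monogenic M D F \<and> (\<exists>U. admissible T D U)"

text \<open>For \<open>s = \<gamma>(t)\<close> on a path in \<open>\<complex>\<^sub>j\<close>, the differential \<open>ds (-j)\<close> is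
  \<open>ds_slice j \<gamma> t dt\<close>.\<close>

definition ds_slice ::
    "real ^ ('n::{finite,linorder}) \<Rightarrow> (real \<Rightarrow> complex) \<Rightarrow> real \<Rightarrow> 'n clifford" where
  "ds_slice j \<gamma> t =
     para (slice_point j (vector_derivative \<gamma> (at t within {0..1}))) \<odot> (- imag_unit j)"

definition left_integral :: "nat \<Rightarrow> ('v::banach, 'n::{finite,linorder}) pvop \<Rightarrow>
    real ^ ('n::{finite,linorder}) \<Rightarrow> (real \<Rightarrow> complex) list \<Rightarrow> (nat \<Rightarrow> 'n point \<Rightarrow> 'n clifford) \<Rightarrow> ('v, 'n) cop" where
  "left_integral M T j \<Gamma> f = (1 / (2 * pi)) *\<^sub>R (\<Sum>\<gamma>\<leftarrow>\<Gamma>. integral {0..1} (\<lambda>t.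
     \<Sum>l<M. cop_pow (pop (pop_conj T)) l o\<^sub>L SL_inv (slice_point j (\<gamma> t)) T o\<^sub>L
       lmul (ds_slice j \<gamma> t) o\<^sub>L lmul (f l (slice_point j (\<gamma> t)))))"

definition right_integral :: "nat \<Rightarrow> ('v::banach, 'n::{finite,linorder}) pvop \<Rightarrow>
    real ^ ('n::{finite,linorder}) \<Rightarrow> (real \<Rightarrow> complex) list \<Rightarrow> (nat \<Rightarrow> 'n point \<Rightarrow> 'n clifford) \<Rightarrow> ('v, 'n) cop" where
  "right_integral M T j \<Gamma> f = (1 / (2 * pi)) *\<^sub>R (\<Sum>\<gamma>\<leftarrow>\<Gamma>. integral {0..1} (\<lambda>t.
     \<Sum>l<M. lmul (f l (slice_point j (\<gamma> t))) o\<^sub>L lmul (ds_slice j \<gamma> t) o\<^sub>L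
       SR_inv (slice_point j (\<gamma> t)) T o\<^sub>L cop_pow (pop (pop_conj T)) l))"

text \<open>
  \<open>F(T)\<close> is the common value of the integrals over all admissible \<open>U\<close>, \<open>j\<close> and
  parametrisations of the boundary; the components of \<open>F\<close> are unique on \<open>D\<close>.
\<close>

definition PS_calc_L :: "nat \<Rightarrow> ('v::banach, 'n::{finite,linorder}) pvop \<Rightarrow>
    'n point set \<Rightarrow> ('n point \<Rightarrow> 'n clifford) \<Rightarrow> ('v, 'n) cop" where
  "PS_calc_L M T D F = (THE X. \<exists>U j \<Gamma> f. admissible T D U \<and> j \<in> \<S> \<and>
     boundary_curves \<Gamma> (slice j U) \<and> left_components M D F f \<and> X = left_integral M T j \<Gamma> f)"

definition PS_calc_R :: "nat \<Rightarrow> ('v::banach, 'n::{finite,linorder}) pvop \<Rightarrow>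
    'n point set \<Rightarrow> ('n point \<Rightarrow> 'n clifford) \<Rightarrow> ('v, 'n) cop" where
  "PS_calc_R M T D F = (THE X. \<exists>U j \<Gamma> f. admissible T D U \<and> j \<in> \<S> \<and>
     boundary_curves \<Gamma> (slice j U) \<and> right_components M D F f \<and> X = right_integral M T j \<Gamma> f)"

text \<open>For intrinsic \<open>F\<close> the left and the right formula agree; the left one is used.\<close>

definition PN_calc :: "nat \<Rightarrow> ('v::banach, 'n::{finite,linorder}) pvop \<Rightarrow>
    'n point set \<Rightarrow> ('n point \<Rightarrow> 'n clifford) \<Rightarrow> ('v, 'n) cop" where
  "PN_calc = PS_calc_L"

end

theory Submission
  imports Defs
begin

text \<open>
  Fix an axially symmetric open set and identify \<open>u + jv\<close> with the complex number
  \<open>u + iv\<close>. Writing the stem functions in the basis \<open>e\<^sub>A\<close>, the components of a left poly slice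
  monogenic function are \<open>f\<^sub>l(u + jv) = \<Sum>\<^sub>A c\<^sub>l\<^sub>A(u + jv) e\<^sub>A\<close>, where each \<open>c\<^sub>l\<^sub>A\<close> is an ordinary
  holomorphic function with \<open>c\<^sub>l\<^sub>A(\<bar>z) = \<bar>c\<^sub>l\<^sub>A(z)\<close> and its imaginary unit is read as \<open>j\<close>. So all of
  the Clifford structure sits in the constants \<open>e\<^sub>A\<close>, and the calculus reduces to a scalar one:
  \<open>F(T) = \<Sum>\<^sub>l \<Sum>\<^sub>A T*\<^sup>l c\<^sub>l\<^sub>A(T) e\<^sub>A\<close>, where \<open>T*\<close> is the conjugate operator and \<open>c(T)\<close> is the
  Riesz-Dunford calculus of \<open>T\<close> as an operator on the real Banach space \<open>V\<^sub>n\<close>. On the right side the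
  same holds with \<open>e\<^sub>A c\<^sub>l\<^sub>A(T) T*\<^sup>l\<close>. An intrinsic function has only the term \<open>A = {}\<close>, so
  \<open>F(T) = \<Sum>\<^sub>k T*\<^sup>k a\<^sub>k(T)\<close>. Since the components of \<open>T\<close> commute, \<open>T\<close> commutes with \<open>T*\<close>, hence so does
  every \<open>a\<^sub>k(T)\<close>, and with \<open>(a b)(T) = a(T) b(T)\<close> the product rule is

  \<open>\<Sum>\<^sub>k\<^sub>,\<^sub>h\<^sub>,\<^sub>A T*\<^sup>k\<^sup>+\<^sup>h (a\<^sub>k b\<^sub>h\<^sub>A)(T) e\<^sub>A = (\<Sum>\<^sub>k T*\<^sup>k a\<^sub>k(T)) (\<Sum>\<^sub>h\<^sub>,\<^sub>A T*\<^sup>h b\<^sub>h\<^sub>A(T) e\<^sub>A)\<close>.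

  The basis elements do not commute with the operators, which is why the intrinsic factor has to
  stand on the left in the first case and on the right in the second.

  Four ingredients carry this.

  (a) The scalar calculus (\<open>fcalc_mult\<close>, \<open>fcalc_unique\<close>). The resolvent \<open>(z - T)\<^sup>-\<^sup>1\<close> lives in the
  complexified operator algebra, whose elements are represented as pairs of operators; the S-resolvents arise
  from it by replacing \<open>i\<close> with left or right multiplication by \<open>j\<close>. Conjugation symmetry of the
  domain and of the function makes the resulting operator real. Identities between integrals
  are tested against bounded functionals, so that only scalar contour integrals occur; the
  Hahn-Banach theorem provides enough functionals.

  (b) The homology form of the Cauchy theorem for finite systems of closed curves (\<open>Cauchy_theorem_cycle\<close>),
  since the boundary of a slice Cauchy domain is such a system and different domains have to be
  compared. It follows from the Cauchy formula for one explicit region, a finite union of bricks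
  of a brick wall (\<open>exists_Cauchy_region\<close>).

  (c) The decomposition \<open>\<Sum>\<^sub>k \<bar>z\<^sup>k c\<^sub>k(z)\<close> of the stem functions and its uniqueness
  (\<open>polyanalytic_decomposition\<close>, \<open>polyanalytic_unique\<close>), which identifies the components of the product
  with the convolution of the components of the factors.

  (d) A slice Cauchy domain around the spectrum inside the intersection of the two domains
  (\<open>admissible_Int\<close>). It is obtained by rotating the region of (b), which for this purpose is symmetric under
  conjugation and bounded by disjoint Jordan curves.
\<close>

section \<open>The combinatorics of a brick wall\<close>

text \<open>
  The bricks are indexed by \<open>int \<times> int\<close> in such a way that consecutive rows are shifted by half a brick. Then every
  brick has six neighbours and at most three bricks meet in a point, as in a honeycomb. This is what
  makes the boundary of every finite union of bricks a disjoint union of simple closed curves; in a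
  square grid two squares may touch in a corner only.
\<close>

definition hex_dir :: "nat \<Rightarrow> int \<times> int" where
  "hex_dir i = [(1,0), (0,1), (-1,1), (-1,0), (0,-1), (1,-1)] ! (i mod 6)"

text \<open>
  The six corners in counterclockwise order from the lower right one; the two long sides are divided
  in the middle, where the bricks of the next row meet. Side \<open>i\<close>, from corner \<open>i\<close> to corner \<open>i + 1\<close>, is the
  one shared with the neighbour in direction \<open>i\<close>.
\<close>

definition corner :: "int \<times> int \<Rightarrow> nat \<Rightarrow> int \<times> int" where
  "corner c i = (2 * fst c + snd c, snd c) + [(2,-1), (2,0), (1,0), (0,0), (0,-1), (1,-1)] ! (i mod 6)"

lemma less_6_cases: "i < 6 \<longleftrightarrow> i = 0 \<or> i = 1 \<or> i = 2 \<or> i = 3 \<or> i = 4 \<or> i = (5::nat)"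
  by auto

lemma hex_dir_mod: "hex_dir (i mod 6) = hex_dir i" by (simp add: hex_dir_def)
lemma corner_mod: "corner c (i mod 6) = corner c i" by (simp add: corner_def)

lemma mod6_cases: "i mod 6 = 0 \<or> i mod 6 = 1 \<or> i mod 6 = 2 \<or> i mod 6 = 3 \<or> i mod 6 = 4 \<or> i mod 6 = (5::nat)"
  using less_6_cases[of "i mod 6"] by simp

lemma hex_dir_opposite: "hex_dir (i + 3) = - hex_dir i"
proof -
  have "(i + 3) mod 6 = (i mod 6 + 3) mod 6" by (simp add: mod_simps)
  then show ?thesis using mod6_cases[of i] by (auto simp: hex_dir_def)
qed

lemma hex_dir_hexagon: "hex_dir i + hex_dir (i + 2) = hex_dir (i + 1)"
proof -
  have "(i + 2) mod 6 = (i mod 6 + 2) mod 6" "(i + 1) mod 6 = (i mod 6 + 1) mod 6"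
    by (simp_all add: mod_simps)
  then show ?thesis using mod6_cases[of i] by (auto simp: hex_dir_def)
qed

lemma corner_reverse:
  "corner (c + hex_dir i) (i + 4) = corner c i" "corner (c + hex_dir i) (i + 3) = corner c (i + 1)"
proof -
  have "(i + 4) mod 6 = (i mod 6 + 4) mod 6" "(i + 3) mod 6 = (i mod 6 + 3) mod 6"
    "(i + 1) mod 6 = (i mod 6 + 1) mod 6"
    by (simp_all add: mod_simps)
  then show "corner (c + hex_dir i) (i + 4) = corner c i" "corner (c + hex_dir i) (i + 3) = corner c (i + 1)"
    using mod6_cases[of i] by (auto simp: corner_def hex_dir_def)
qed

lemma corner_next: "corner (c + hex_dir (i + 1)) (i + 5) = corner c (i + 1)"
  using corner_reverse(1)[of c "i + 1"] by (simp add: numeral_eq_Suc)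

lemma corner_step:
  "corner c (i + 1) - corner c i \<in> {(1,0), (-1,0), (0,1), (0,-1)}"
proof -
  have "(i + 1) mod 6 = (i mod 6 + 1) mod 6"
    by (simp_all add: mod_simps)
  then show ?thesis
    using mod6_cases[of i] by (auto simp: corner_def)
qed

text \<open>
  A lattice point is a corner of three bricks only. This is the source of the injectivity
  statements below.
\<close>

lemma corner_eq_cases:
  assumes "corner c i = corner c' j"
  shows "c' = c \<and> j mod 6 = i mod 6 \<or> c' = c + hex_dir i \<and> j mod 6 = (i + 4) mod 6 \<or>
         c' = c + hex_dir (i + 5) \<and> j mod 6 = (i + 2) mod 6"
proof -
  obtain q r where c: "c = (q, r)" by (cases c)
  obtain u w where uw: "c' - c = (u, w)" by (cases "c' - c")
  then have c': "c' = (q + u, r + w)" by (cases c') (auto simp: c)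
  have m: "(i + 4) mod 6 = (i mod 6 + 4) mod 6" "(i + 5) mod 6 = (i mod 6 + 5) mod 6"
    "(i + 2) mod 6 = (i mod 6 + 2) mod 6"
    by (simp_all add: mod_simps)
  show ?thesis
    using mod6_cases[of i] mod6_cases[of j] assms
    unfolding c c' corner_def hex_dir_def m
    by (elim disjE; simp; presburger)
qed

text \<open>
  An edge is a brick together with the number of one of its sides; the brick lies to the left of the edge.
\<close>

definition boundary_edges :: "(int \<times> int) set \<Rightarrow> ((int \<times> int) \<times> nat) set" where
  "boundary_edges N = {(c, i). c \<in> N \<and> i < 6 \<and> c + hex_dir i \<notin> N}"

definition edge_tail where "edge_tail e = corner (fst e) (snd e)"
definition edge_head where "edge_head e = corner (fst e) (snd e + 1)"

text \<open>
  At the head of a boundary edge the third brick, besides the one on the left and the one on the right,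
  decides where the boundary continues: around it if it belongs to the set, and along the old brick otherwise.
\<close>

definition edge_next :: "(int \<times> int) set \<Rightarrow> (int \<times> int) \<times> nat \<Rightarrow> (int \<times> int) \<times> nat" where
  "edge_next N e = (let c' = fst e + hex_dir (snd e + 1) in
     if c' \<in> N then (c', (snd e + 5) mod 6) else (fst e, (snd e + 1) mod 6))"

lemma finite_boundary_edges: "finite N \<Longrightarrow> finite (boundary_edges N)"
  by (rule finite_subset[of _ "N \<times> {..<6}"]) (auto simp: boundary_edges_def)

lemma edge_tail_edge_next: "edge_tail (edge_next N e) = edge_head e"
  using corner_next[of "fst e" "snd e"] by (auto simp: edge_next_def Let_def edge_tail_def edge_head_def corner_mod simp del: add_Suc_right One_nat_def)

lemma edge_next_boundary_edges: "e \<in> boundary_edges N \<Longrightarrow> edge_next N e \<in> boundary_edges N"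
proof -
  assume e: "e \<in> boundary_edges N"
  obtain c i where ci: "e = (c, i)" by (cases e)
  have "c + hex_dir (i + 1) + hex_dir (i + 5) = c + hex_dir i"
    using hex_dir_hexagon[of i] hex_dir_opposite[of "i + 2"] by (simp add: numeral_eq_Suc algebra_simps)
  moreover have "hex_dir (i + 5) = hex_dir ((i + 5) mod 6)" "hex_dir (i + 1) = hex_dir ((i + 1) mod 6)"
    by (simp_all add: hex_dir_mod)
  ultimately have "c + hex_dir (i + 1) + hex_dir ((i + 5) mod 6) = c + hex_dir i"
    "hex_dir ((i + 1) mod 6) = hex_dir (i + 1)"
    by (simp_all only:)
  then show ?thesis using e
    unfolding ci boundary_edges_def edge_next_def Let_def mem_Collect_eq prod.case fst_conv snd_conv
    by (simp add: hex_dir_mod add.assoc)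
qed

lemma edge_tail_inj: "inj_on edge_tail (boundary_edges N)"
proof (rule inj_onI)
  fix e e' assume e: "e \<in> boundary_edges N" "e' \<in> boundary_edges N" "edge_tail e = edge_tail e'"
  obtain c i c' j where ci: "e = (c, i)" "e' = (c', j)" by (cases e, cases e') auto
  note N = e(1,2)[unfolded ci boundary_edges_def mem_Collect_eq prod.case]
  have "corner c i = corner c' j" using e(3) by (simp add: ci edge_tail_def)
  from corner_eq_cases[OF this] show "e = e'"
  proof (elim disjE conjE)
    assume a: "c' = c + hex_dir (i + 5)" "j mod 6 = (i + 2) mod 6"
    have "hex_dir j = hex_dir (i + 2)" using a(2) hex_dir_mod by metis
    moreover have "hex_dir (i + 5) = - hex_dir (i + 2)"
      using hex_dir_opposite[of "i + 2"] by (simp add: numeral_eq_Suc)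
    ultimately have "c' + hex_dir j = c"
      using a(1) by simp
    then show ?thesis using N by simp
  next
    assume "c' = c" "j mod 6 = i mod 6"
    then show ?thesis using N ci by simp
  next
    assume "c' = c + hex_dir i"
    then show ?thesis using N by simp
  qed
qed

lemma edge_head_inj: "inj_on edge_head (boundary_edges N)"
proof (rule inj_onI)
  fix e e' assume e: "e \<in> boundary_edges N" "e' \<in> boundary_edges N" "edge_head e = edge_head e'"
  obtain c i c' j where ci: "e = (c, i)" "e' = (c', j)" by (cases e, cases e') auto
  note N = e(1,2)[unfolded ci boundary_edges_def mem_Collect_eq prod.case]
  have ij: "i < 6" "j < 6" using N by simp_all
  have "corner c (i + 1) = corner c' (j + 1)" using e(3) by (simp add: ci edge_head_def)
  from corner_eq_cases[OF this] show "e = e'"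
  proof (elim disjE conjE)
    assume a: "c' = c" "(j + 1) mod 6 = (i + 1) mod 6"
    have "i = j" using ij a(2) unfolding less_6_cases by (elim disjE) simp_all
    then show ?thesis using a ci by simp
  next
    assume a: "c' = c + hex_dir (i + 1)" "(j + 1) mod 6 = (i + 1 + 4) mod 6"
    have "j mod 6 = (i + 4) mod 6" using ij a(2) unfolding less_6_cases by (elim disjE) simp_all
    then have "hex_dir j = hex_dir (i + 4)" using hex_dir_mod by metis
    moreover have "hex_dir (i + 4) = - hex_dir (i + 1)"
      using hex_dir_opposite[of "i + 1"] by (simp add: numeral_eq_Suc)
    ultimately have "c' + hex_dir j = c"
      using a(1) by simp
    then show ?thesis using N by simp
  next
    assume a: "c' = c + hex_dir (i + 1 + 5)"
    moreover have "(i + 1 + 5) mod 6 = i mod 6" by presburger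
    then have "hex_dir (i + 1 + 5) = hex_dir i" by (metis hex_dir_mod)
    ultimately show ?thesis using N by simp
  qed
qed

text \<open>
  Boundary edges are determined by their heads, so the successor map is injective, and it is a
  permutation because the set is finite. Its cycles are the boundary curves.
\<close>

lemma edge_next_bij: assumes "finite N" shows "bij_betw (edge_next N) (boundary_edges N) (boundary_edges N)"
proof -
  have "inj_on (edge_next N) (boundary_edges N)"
    by (metis (no_types, lifting) edge_head_inj edge_tail_edge_next inj_on_def)
  moreover have "edge_next N ` boundary_edges N \<subseteq> boundary_edges N" using edge_next_boundary_edges by auto
  ultimately show ?thesis
    using endo_inj_surj[OF finite_boundary_edges[OF assms]] by (auto simp: bij_betw_def)
qed

lemma boundary_edges_no_reverse:
  assumes "e \<in> boundary_edges N" "e' \<in> boundary_edges N" "edge_tail e = edge_head e'" "edge_head e = edge_tail e'"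
  shows False
proof -
  obtain c i c' j where ci: "e = (c, i)" "e' = (c', j)" by (cases e, cases e') auto
  have ij: "i < 6" "j < 6" "c \<in> N" "c' \<in> N" "c + hex_dir i \<notin> N" "c' + hex_dir j \<notin> N"
    using assms(1,2)[unfolded ci boundary_edges_def mem_Collect_eq prod.case] by simp_all
  have e: "corner c i = corner c' (j + 1)" "corner c (i + 1) = corner c' j"
    using assms by (auto simp: ci edge_tail_def edge_head_def)
  have nz: "hex_dir k \<noteq> 0" for k
    using mod6_cases[of k] by (auto simp: hex_dir_def zero_prod_def)
  have m: "(j + 1) mod 6 = i mod 6 \<Longrightarrow> j mod 6 = (i + 5) mod 6"
      "(j + 1) mod 6 = (i + 2) mod 6 \<Longrightarrow> j mod 6 = (i + 1) mod 6"
    using ij(1,2) unfolding less_6_cases by (elim disjE; simp)+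
  have m2: "(i + 5) mod 6 \<noteq> (i + 1) mod 6" "(i + 5) mod 6 \<noteq> (i + 1 + 2) mod 6"
    "(i + 1) mod 6 \<noteq> (i + 1 + 4) mod 6" "(i + 1) mod 6 \<noteq> (i + 1 + 2) mod 6"
    using ij(1) unfolding less_6_cases by (elim disjE; simp)+
  show False
    using corner_eq_cases[OF e(1)]
  proof (elim disjE conjE)
    assume a: "c' = c" "(j + 1) mod 6 = i mod 6"
    then show False using corner_eq_cases[OF e(2)] m(1) m2 nz[of "i + 1"] by (metis add_cancel_right_right)
  next
    assume a: "c' = c + hex_dir (i + 5)" "(j + 1) mod 6 = (i + 2) mod 6"
    then show False using corner_eq_cases[OF e(2)] m(2) m2 nz[of "i + 5"] by (metis add_cancel_right_right)
  next
    assume a: "c' = c + hex_dir i"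
    then show False using ij by simp
  qed
qed

section \<open>The geometry of a brick wall\<close>

text \<open>
  The shift by one half puts the real axis in the middle of a row of bricks, so that complex conjugation
  permutes the bricks.
\<close>

definition place :: "real \<Rightarrow> int \<times> int \<Rightarrow> complex" where
  "place d v = Complex (d * of_int (fst v)) (d * (of_int (snd v) + 1 / 2))"

definition brick :: "real \<Rightarrow> int \<times> int \<Rightarrow> complex set" where
  "brick d c = cbox (place d (corner c 4)) (place d (corner c 1))"

definition brick_interior :: "real \<Rightarrow> int \<times> int \<Rightarrow> complex set" where
  "brick_interior d c = box (place d (corner c 4)) (place d (corner c 1))"

definition side :: "real \<Rightarrow> (int \<times> int) \<times> nat \<Rightarrow> complex set" where
  "side d e = closed_segment (place d (edge_tail e)) (place d (edge_head e))"

lemma in_brick: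
  assumes "d > 0"
  shows "z \<in> brick d (q, r) \<longleftrightarrow> 2 * of_int q + of_int r \<le> Re z / d \<and> Re z / d \<le> 2 * of_int q + of_int r + 2 \<and>
     of_int r - 1 / 2 \<le> Im z / d \<and> Im z / d \<le> of_int r + 1 / 2"
  using assms by (simp add: brick_def in_cbox_complex_iff place_def corner_def field_simps)

lemma in_brick_interior:
  assumes "d > 0"
  shows "z \<in> brick_interior d (q, r) \<longleftrightarrow> 2 * of_int q + of_int r < Re z / d \<and> Re z / d < 2 * of_int q + of_int r + 2 \<and>
     of_int r - 1 / 2 < Im z / d \<and> Im z / d < of_int r + 1 / 2"
  using assms by (simp add: brick_interior_def in_box_complex_iff place_def corner_def field_simps)

lemma brick_cover:
  assumes "d > 0" shows "\<exists>c. z \<in> brick d c"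
proof -
  define r where "r = \<lfloor>Im z / d + 1 / 2\<rfloor>"
  define q where "q = \<lfloor>(Re z / d - of_int r) / 2\<rfloor>"
  have "of_int r \<le> Im z / d + 1 / 2" "Im z / d + 1 / 2 < of_int r + 1"
    "of_int q \<le> (Re z / d - of_int r) / 2" "(Re z / d - of_int r) / 2 < of_int q + 1"
    unfolding r_def q_def by linarith+
  then have "z \<in> brick d (q, r)"
    unfolding in_brick[OF assms] by argo
  then show ?thesis ..
qed

lemma bricks_adjacent:
  assumes "d > 0" "z \<in> brick d c" "z \<in> brick d c'" "c \<noteq> c'"
  shows "\<exists>i<6. c' = c + hex_dir i"
proof -
  obtain q r where c: "c = (q, r)" by (cases c)
  obtain q' r' where c': "c' = (q', r')" by (cases c')
  define u w where "u = q' - q" and "w = r' - r"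
  have "real_of_int r' \<le> real_of_int (r + 1)" "real_of_int r \<le> real_of_int (r' + 1)"
    "real_of_int (2 * q + r) \<le> real_of_int (2 * q' + r' + 2)"
    "real_of_int (2 * q' + r') \<le> real_of_int (2 * q + r + 2)"
    using assms(2,3) unfolding c c' in_brick[OF assms(1)] by auto
  then have "r' \<le> r + 1" "r \<le> r' + 1" "2 * q + r \<le> 2 * q' + r' + 2" "2 * q' + r' \<le> 2 * q + r + 2"
    unfolding of_int_le_iff by blast+
  then have "w \<le> 1" "-1 \<le> w" "2 * u + w \<le> 2" "-2 \<le> 2 * u + w"
    by (simp_all add: u_def w_def)
  moreover have "(u, w) \<noteq> (0, 0)" using assms(4) by (auto simp: u_def w_def c c')
  ultimately have "(u, w) \<in> {(1,0), (0,1), (-1,1), (-1,0), (0,-1), (1,-1)}" by auto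
  then have "\<exists>i<6. (u, w) = hex_dir i"
    unfolding less_6_cases ex_disj_distrib conj_disj_distribR by (auto simp: hex_dir_def)
  moreover have "c' = c + (u, w)" by (simp add: c c' u_def w_def)
  ultimately show ?thesis by auto
qed

lemma brick_interior_disjoint:
  assumes "d > 0" "z \<in> brick_interior d c" "z \<in> brick d c'"
  shows "c = c'"
proof -
  obtain q r where c: "c = (q, r)" by (cases c)
  obtain q' r' where c': "c' = (q', r')" by (cases c')
  have "real_of_int r' < real_of_int (r + 1)" "real_of_int r < real_of_int (r' + 1)"
    "real_of_int (2 * q + r) < real_of_int (2 * q' + r' + 2)"
    "real_of_int (2 * q' + r') < real_of_int (2 * q + r + 2)"
    using assms(2,3) unfolding c c' in_brick[OF assms(1)] in_brick_interior[OF assms(1)] by auto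
  then have "r = r'" "q = q'"
    unfolding of_int_less_iff by presburger+
  then show ?thesis by (simp add: c c')
qed

lemma brick_inter:
  assumes "d > 0"
  shows "brick d c \<inter> brick d (c + hex_dir i) = side d (c, i)"
proof -
  obtain q r where c: "c = (q, r)" by (cases c)
  have m: "(i + 1) mod 6 = (i mod 6 + 1) mod 6" by (simp add: mod_simps)
  have "z \<in> brick d c \<and> z \<in> brick d (c + hex_dir i) \<longleftrightarrow> z \<in> side d (c, i)" for z
    using mod6_cases[of i] unfolding c hex_dir_def side_def edge_tail_def edge_head_def corner_def m fst_conv snd_conv
    apply (elim disjE)
         apply (simp_all add: in_brick[OF assms] place_def closed_segment_same_Re closed_segment_same_Im)
    using assms
         apply (simp_all add: closed_segment_eq_real_ivl field_simps)
         apply argo+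
    done
  then show ?thesis by blast
qed

lemma unit_segment_cases:
  assumes "d > 0" "z \<in> closed_segment (place d v) (place d v')" "v' - v \<in> {(1,0), (-1,0), (0,1), (0,-1)}"
  shows "(\<exists>m k. {v, v'} = {(m, k), (m + 1, k)} \<and> Im z / d = of_int k + 1 / 2 \<and>
              of_int m \<le> Re z / d \<and> Re z / d \<le> of_int m + 1) \<or>
         (\<exists>m k. {v, v'} = {(m, k), (m, k + 1)} \<and> Re z / d = of_int m \<and>
              of_int k + 1 / 2 \<le> Im z / d \<and> Im z / d \<le> of_int k + 3 / 2)"
proof -
  obtain a b where v: "v = (a, b)" by (cases v)
  consider "v' = (a + 1, b)" | "v' = (a - 1, b)" | "v' = (a, b + 1)" | "v' = (a, b - 1)"
    using assms(3) by (cases v') (auto simp: v algebra_simps)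
  then show ?thesis
  proof cases
    case 1
    then show ?thesis using assms(1,2)
      by (intro disjI1 exI[of _ a] exI[of _ b])
         (auto simp: v place_def closed_segment_same_Im closed_segment_eq_real_ivl field_simps)
  next
    case 2
    then show ?thesis using assms(1,2)
      by (intro disjI1 exI[of _ "a - 1"] exI[of _ b])
         (auto simp: v place_def closed_segment_same_Im closed_segment_eq_real_ivl field_simps)
  next
    case 3
    then show ?thesis using assms(1,2)
      by (intro disjI2 exI[of _ a] exI[of _ b])
         (auto simp: v place_def closed_segment_same_Re closed_segment_eq_real_ivl field_simps)
  next
    case 4
    then show ?thesis using assms(1,2)
      by (intro disjI2 exI[of _ a] exI[of _ "b - 1"])
         (auto simp: v place_def closed_segment_same_Re closed_segment_eq_real_ivl field_simps)
  qed
qed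

lemma place_eqI:
  assumes "d > 0" "Re z / d = of_int m" "Im z / d = of_int k + 1 / 2"
  shows "z = place d (m, k)"
  using assms by (auto simp: place_def complex_eq_iff field_simps)

text \<open>
  The sides are edges of the unit square lattice, which meet in lattice points only. The
  proof distinguishes horizontal and vertical edges.
\<close>

lemma unit_segments_meet:
  assumes d: "d > 0"
    and z: "z \<in> closed_segment (place d v) (place d v')" "z \<in> closed_segment (place d w) (place d w')"
    and u: "v' - v \<in> {(1,0), (-1,0), (0,1), (0,-1)}" "w' - w \<in> {(1,0), (-1,0), (0,1), (0,-1)}"
    and ne: "{v, v'} \<noteq> {w, w'}"
  shows "\<exists>p \<in> {v, v'} \<inter> {w, w'}. z = place d p"
  using unit_segment_cases[OF d z(1) u(1)] unit_segment_cases[OF d z(2) u(2)]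
proof (elim disjE exE conjE)
  fix m k m' k'
  assume A: "{v, v'} = {(m, k), (m + 1, k)}" "Im z / d = of_int k + 1 / 2"
    "of_int m \<le> Re z / d" "Re z / d \<le> of_int m + 1"
    and B: "{w, w'} = {(m', k'), (m' + 1, k')}" "Im z / d = of_int k' + 1 / 2"
    "of_int m' \<le> Re z / d" "Re z / d \<le> of_int m' + 1"
  have k: "k = k'" using A(2) B(2) by simp
  have "m \<noteq> m'" using ne A(1) B(1) k by auto
  moreover have "real_of_int m \<le> real_of_int (m' + 1)" "real_of_int m' \<le> real_of_int (m + 1)"
    using A(3,4) B(3,4) by auto
  then have "m \<le> m' + 1" "m' \<le> m + 1" unfolding of_int_le_iff .
  ultimately consider "m' = m + 1" | "m = m' + 1" by linarith
  then show ?thesis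
  proof cases
    case 1
    then have "z = place d (m', k)" using A B by (intro place_eqI[OF d]) auto
    then show ?thesis unfolding A(1) B(1) using 1 k by auto
  next
    case 2
    then have "z = place d (m, k)" using A B by (intro place_eqI[OF d]) auto
    then show ?thesis unfolding A(1) B(1) using 2 k by auto
  qed
next
  fix m k m' k'
  assume A: "{v, v'} = {(m, k), (m, k + 1)}" "Re z / d = of_int m"
    "of_int k + 1 / 2 \<le> Im z / d" "Im z / d \<le> of_int k + 3 / 2"
    and B: "{w, w'} = {(m', k'), (m', k' + 1)}" "Re z / d = of_int m'"
    "of_int k' + 1 / 2 \<le> Im z / d" "Im z / d \<le> of_int k' + 3 / 2"
  have m: "m = m'" using A(2) B(2) by simp
  have "k \<noteq> k'" using ne A(1) B(1) m by auto
  moreover have "real_of_int k \<le> real_of_int (k' + 1)" "real_of_int k' \<le> real_of_int (k + 1)"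
    using A(3,4) B(3,4) by auto
  then have "k \<le> k' + 1" "k' \<le> k + 1" unfolding of_int_le_iff .
  ultimately consider "k' = k + 1" | "k = k' + 1" by linarith
  then show ?thesis
  proof cases
    case 1
    then have "z = place d (m, k')" using A B by (intro place_eqI[OF d]) auto
    then show ?thesis unfolding A(1) B(1) using 1 m by auto
  next
    case 2
    then have "z = place d (m, k)" using A B by (intro place_eqI[OF d]) auto
    then show ?thesis unfolding A(1) B(1) using 2 m by auto
  qed
next
  fix m k m' k'
  assume A: "{v, v'} = {(m, k), (m + 1, k)}" "Im z / d = of_int k + 1 / 2"
    "of_int m \<le> Re z / d" "Re z / d \<le> of_int m + 1"
    and B: "{w, w'} = {(m', k'), (m', k' + 1)}" "Re z / d = of_int m'"
    "of_int k' + 1 / 2 \<le> Im z / d" "Im z / d \<le> of_int k' + 3 / 2"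
  have "real_of_int m \<le> real_of_int m'" "real_of_int m' \<le> real_of_int (m + 1)"
    "real_of_int k' \<le> real_of_int k" "real_of_int k \<le> real_of_int (k' + 1)"
    using A B by auto
  then have "m' = m \<or> m' = m + 1" "k = k' \<or> k = k' + 1" unfolding of_int_le_iff by linarith+
  moreover have "z = place d (m', k)" using A B by (intro place_eqI[OF d]) auto
  ultimately show ?thesis unfolding A(1) B(1) by auto
next
  fix m k m' k'
  assume A: "{w, w'} = {(m, k), (m + 1, k)}" "Im z / d = of_int k + 1 / 2"
    "of_int m \<le> Re z / d" "Re z / d \<le> of_int m + 1"
    and B: "{v, v'} = {(m', k'), (m', k' + 1)}" "Re z / d = of_int m'"
    "of_int k' + 1 / 2 \<le> Im z / d" "Im z / d \<le> of_int k' + 3 / 2"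
  have "real_of_int m \<le> real_of_int m'" "real_of_int m' \<le> real_of_int (m + 1)"
    "real_of_int k' \<le> real_of_int k" "real_of_int k \<le> real_of_int (k' + 1)"
    using A B by auto
  then have "m' = m \<or> m' = m + 1" "k = k' \<or> k = k' + 1" unfolding of_int_le_iff by linarith+
  moreover have "z = place d (m', k)" using A B by (intro place_eqI[OF d]) auto
  ultimately show ?thesis unfolding A(1) B(1) by auto
qed

text \<open>
  Two boundary edges with a common point have a common end point; two equal heads or two equal tails are
  excluded by injectivity.
\<close>

lemma boundary_edges_sides_meet:
  assumes d: "d > 0" and e: "e \<in> boundary_edges N" "e' \<in> boundary_edges N" "e \<noteq> e'"
    and z: "z \<in> side d e" "z \<in> side d e'"
  shows "edge_head e = edge_tail e' \<and> z = place d (edge_head e) \<or> edge_tail e = edge_head e' \<and> z = place d (edge_tail e)"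
proof -
  have t: "edge_tail e \<noteq> edge_tail e'" "edge_head e \<noteq> edge_head e'"
    using edge_tail_inj edge_head_inj e by (auto simp: inj_on_def)
  have ne: "{edge_tail e, edge_head e} \<noteq> {edge_tail e', edge_head e'}"
    using boundary_edges_no_reverse[OF e(1,2)] t by (auto simp: doubleton_eq_iff)
  have st: "edge_head x - edge_tail x \<in> {(1,0), (-1,0), (0,1), (0,-1)}" for x
    unfolding edge_tail_def edge_head_def by (rule corner_step)
  show ?thesis
    using unit_segments_meet[OF d z[unfolded side_def] st st ne] t by auto
qed

section \<open>The Cauchy formula for a union of bricks\<close>

lemma finite_bricks_meeting:
  assumes d: "d > 0" and S: "bounded S"
  shows "finite {c. brick d c \<inter> S \<noteq> {}}"
proof -
  obtain B where B: "\<And>z. z \<in> S \<Longrightarrow> norm z \<le> B" using S by (auto simp: bounded_iff)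
  define m where "m = \<lceil>B / d\<rceil> + 3"
  have "{c. brick d c \<inter> S \<noteq> {}} \<subseteq> {-m..m} \<times> {-m..m}"
  proof clarify
    fix q r assume "brick d (q, r) \<inter> S \<noteq> {}"
    then obtain z where z: "z \<in> brick d (q, r)" "z \<in> S" by auto
    have "\<bar>Re z\<bar> / d \<le> B / d" "\<bar>Im z\<bar> / d \<le> B / d"
      using abs_Re_le_cmod[of z] abs_Im_le_cmod[of z] B[OF z(2)] d
      by (auto intro!: divide_right_mono)
    then have "\<bar>Re z / d\<bar> \<le> of_int m - 3" "\<bar>Im z / d\<bar> \<le> of_int m - 3"
      using d unfolding m_def by (simp_all add: abs_divide) linarith+
    then have "real_of_int r \<le> of_int m" "- of_int m \<le> real_of_int r"
       "real_of_int q \<le> of_int m" "- of_int m \<le> real_of_int q"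
      using z(1) unfolding in_brick[OF d] by linarith+
    then show "q \<in> {-m..m} \<and> r \<in> {-m..m}" by simp
  qed
  then show ?thesis by (rule finite_subset) simp
qed

text \<open>
  Only finitely many bricks come near \<open>z\<close>, so those outside \<open>N\<close> form a closed set, and it avoids \<open>z\<close>.
\<close>

lemma interior_bricksI:
  assumes d: "d > 0" and z: "\<And>c. z \<in> brick d c \<Longrightarrow> c \<in> N"
  shows "z \<in> interior (\<Union>c\<in>N. brick d c)"
proof -
  define M where "M = {c. brick d c \<inter> cball z 1 \<noteq> {} \<and> z \<notin> brick d c}"
  have "finite M"
    by (rule finite_subset[OF _ finite_bricks_meeting[OF d bounded_cball[of z 1]]]) (auto simp: M_def)
  then have "open (ball z 1 - (\<Union>c\<in>M. brick d c))"
    by (intro open_Diff open_ball closed_UN) (auto simp: brick_def)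
  moreover have "z \<in> ball z 1 - (\<Union>c\<in>M. brick d c)" by (auto simp: M_def)
  moreover have "ball z 1 - (\<Union>c\<in>M. brick d c) \<subseteq> (\<Union>c\<in>N. brick d c)"
  proof
    fix y assume y: "y \<in> ball z 1 - (\<Union>c\<in>M. brick d c)"
    obtain c where c: "y \<in> brick d c" using brick_cover[OF d] by blast
    have "c \<notin> M" "y \<in> cball z 1" using y c by auto
    then have "z \<in> brick d c" using c by (auto simp: M_def)
    then show "y \<in> (\<Union>c\<in>N. brick d c)" using z[of c] c by blast
  qed
  ultimately show ?thesis by (meson interiorI)
qed

lemma brick_interior_nonempty: "d > 0 \<Longrightarrow> brick_interior d c \<noteq> {}"
  by (auto simp: brick_interior_def box_ne_empty place_def corner_def Basis_complex_def)

lemma closure_brick_interior: "d > 0 \<Longrightarrow> closure (brick_interior d c) = brick d c"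
  using brick_interior_nonempty[of d c] by (simp add: brick_interior_def brick_def closure_box)

lemma brick_interior_subset: "brick_interior d c \<subseteq> brick d c"
  by (simp add: brick_interior_def brick_def box_subset_cbox)

lemma open_brick_interior: "open (brick_interior d c)"
  by (simp add: brick_interior_def open_box)

lemma closure_interior_bricks:
  assumes d: "d > 0" and N: "finite N"
  shows "closure (interior (\<Union>c\<in>N. brick d c)) = (\<Union>c\<in>N. brick d c)"
proof
  have "closed (\<Union>c\<in>N. brick d c)" using N by (auto simp: brick_def)
  then show "closure (interior (\<Union>c\<in>N. brick d c)) \<subseteq> (\<Union>c\<in>N. brick d c)"
    by (simp add: closure_minimal interior_subset)
  show "(\<Union>c\<in>N. brick d c) \<subseteq> closure (interior (\<Union>c\<in>N. brick d c))"
  proof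
    fix z assume "z \<in> (\<Union>c\<in>N. brick d c)"
    then obtain c where c: "c \<in> N" "z \<in> brick d c" by auto
    have "brick_interior d c \<subseteq> interior (\<Union>c\<in>N. brick d c)"
      using c(1) brick_interior_subset by (intro interior_maximal open_brick_interior) blast
    then show "z \<in> closure (interior (\<Union>c\<in>N. brick d c))"
      using c(2) closure_brick_interior[OF d] closure_mono by blast
  qed
qed

lemma frontier_interior_bricks:
  assumes d: "d > 0" and N: "finite N"
  shows "frontier (interior (\<Union>c\<in>N. brick d c)) = (\<Union>e\<in>boundary_edges N. side d e)"
proof -
  let ?C = "\<Union>c\<in>N. brick d c"
  have "z \<in> ?C \<and> z \<notin> interior ?C \<longleftrightarrow> (\<exists>e\<in>boundary_edges N. z \<in> side d e)" for z
  proof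
    assume z: "z \<in> ?C \<and> z \<notin> interior ?C"
    then obtain c where c: "c \<in> N" "z \<in> brick d c" by auto
    obtain c' where c': "c' \<notin> N" "z \<in> brick d c'" using interior_bricksI[OF d, of z N] z by auto
    obtain i where i: "i < 6" "c' = c + hex_dir i"
      using bricks_adjacent[OF d c(2) c'(2)] c(1) c'(1) by auto
    have "z \<in> side d (c, i)" using brick_inter[OF d, of c i] i(2) c c' by auto
    then show "\<exists>e\<in>boundary_edges N. z \<in> side d e" using i c(1) c'(1) by (intro bexI[of _ "(c, i)"]) (auto simp: boundary_edges_def)
  next
    assume "\<exists>e\<in>boundary_edges N. z \<in> side d e"
    then obtain c i where ci: "c \<in> N" "c + hex_dir i \<notin> N" "z \<in> side d (c, i)" by (auto simp: boundary_edges_def)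
    then have z: "z \<in> brick d c" "z \<in> brick d (c + hex_dir i)" using brick_inter[OF d, of c i] by auto
    have "z \<notin> interior ?C"
    proof
      assume "z \<in> interior ?C"
      moreover have "z \<in> closure (brick_interior d (c + hex_dir i))" using z closure_brick_interior[OF d] by simp
      ultimately obtain y where y: "y \<in> interior ?C" "y \<in> brick_interior d (c + hex_dir i)"
        using open_Int_closure_eq_empty[of "interior ?C"] by blast
      then obtain c' where "c' \<in> N" "y \<in> brick d c'" using interior_subset by blast
      then show False using brick_interior_disjoint[OF d y(2)] ci(2) by auto
    qed
    then show "z \<in> ?C \<and> z \<notin> interior ?C" using z(1) ci(1) by auto
  qed
  then show ?thesis unfolding frontier_def closure_interior_bricks[OF d N] by auto
qed

definition side_integral :: "real \<Rightarrow> (complex \<Rightarrow> complex) \<Rightarrow> (int \<times> int) \<times> nat \<Rightarrow> complex" where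
  "side_integral d g e = contour_integral (linepath (place d (edge_tail e)) (place d (edge_head e))) g"

lemma brick_integral:
  assumes d: "d > 0" and g: "continuous_on (brick d c - brick_interior d c) g"
  shows "(\<Sum>i<6. side_integral d g (c, i)) =
    contour_integral (rectpath (place d (corner c 4)) (place d (corner c 1))) g"
proof -
  obtain q r where c: "c = (q, r)" by (cases c)
  define p where "p i = place d (corner c i)" for i
  have p6: "p 6 = p 0" by (simp add: p_def corner_def)
  have ri: "Re (p 0) = Re (p 1)" "Im (p 1) = Im (p 2)" "Im (p 2) = Im (p 3)" "Re (p 3) = Re (p 4)"
    "Im (p 4) = Im (p 5)" "Im (p 5) = Im (p 0)"
    "Re (p 4) \<le> Re (p 5)" "Re (p 5) \<le> Re (p 0)" "Re (p 3) \<le> Re (p 2)" "Re (p 2) \<le> Re (p 1)"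
    "Im (p 0) \<le> Im (p 1)"
    using d by (auto simp: p_def place_def corner_def c)
  have bd: "brick d c - brick_interior d c = path_image (rectpath (p 4) (p 1))"
    using ri by (subst path_image_rectpath_cbox_minus_box) (auto simp: brick_def brick_interior_def p_def)
  have corners: "Complex (Re (p 1)) (Im (p 4)) = p 0" "Complex (Re (p 4)) (Im (p 1)) = p 3"
    using ri by (auto simp: complex_eq_iff)
  have rect: "rectpath (p 4) (p 1) = linepath (p 4) (p 0) +++ linepath (p 0) (p 1) +++ linepath (p 1) (p 3) +++ linepath (p 3) (p 4)"
    by (simp only: rectpath_def Let_def corners)
  have img: "brick d c - brick_interior d c = closed_segment (p 4) (p 0) \<union> closed_segment (p 0) (p 1) \<union>
     closed_segment (p 1) (p 3) \<union> closed_segment (p 3) (p 4)"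
    unfolding bd rect by (simp add: path_image_join Un_assoc)
  have cont: "continuous_on (closed_segment (p 4) (p 0)) g" "continuous_on (closed_segment (p 0) (p 1)) g"
     "continuous_on (closed_segment (p 1) (p 3)) g" "continuous_on (closed_segment (p 3) (p 4)) g"
    by (rule continuous_on_subset[OF g], unfold img, blast)+
  note int = cont[THEN contour_integrable_continuous_linepath]
  have mid: "p 5 \<in> closed_segment (p 4) (p 0)" "p 2 \<in> closed_segment (p 1) (p 3)"
    using ri by (auto simp: closed_segment_same_Im closed_segment_eq_real_ivl)
  note s = contour_integral_split_linepath[OF cont(1) mid(1)] contour_integral_split_linepath[OF cont(3) mid(2)]
  have "contour_integral (rectpath (p 4) (p 1)) g = contour_integral (linepath (p 4) (p 0)) g +
     (contour_integral (linepath (p 0) (p 1)) g + (contour_integral (linepath (p 1) (p 3)) g +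
      contour_integral (linepath (p 3) (p 4)) g))"
    unfolding rect using int by simp
  moreover have "side_integral d g (c, i) = contour_integral (linepath (p i) (p (i + 1))) g" for i
    by (simp add: side_integral_def edge_tail_def edge_head_def p_def)
  moreover have "(\<Sum>i<6. h i) = h 0 + h 1 + h 2 + h 3 + h 4 + h 5" for h :: "nat \<Rightarrow> complex"
    by (simp add: eval_nat_numeral)
  ultimately show ?thesis unfolding s p_def[symmetric] by (simp add: p6 flip: numeral_2_eq_2)
qed

text \<open>
  A side between two bricks of \<open>N\<close> is traversed once in each direction, so its contributions cancel.
\<close>

lemma sum_bricks_eq_sum_boundary_edges:
  assumes d: "d > 0" and N: "finite N" and g: "\<And>c. c \<in> N \<Longrightarrow> continuous_on (brick d c - brick_interior d c) g"
  shows "(\<Sum>c\<in>N. \<Sum>i<6. side_integral d g (c, i)) = (\<Sum>e\<in>boundary_edges N. side_integral d g e)"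
proof -
  define In where "In = {(c, i). c \<in> N \<and> i < (6::nat) \<and> c + hex_dir i \<in> N}"
  \<comment> \<open>\<open>\<sigma>\<close> describes an edge from the neighbouring brick, which reverses its direction.\<close>
  define \<sigma> where "\<sigma> e = (fst e + hex_dir (snd e), (snd e + 3) mod 6)" for e
  have fin: "finite In" by (rule finite_subset[of _ "N \<times> {..<6}"]) (use N in \<open>auto simp: In_def\<close>)
  have ss: "\<sigma> (\<sigma> e) = e" "\<sigma> e \<in> In" if eIn: "e \<in> In" for e
  proof -
    obtain c i where e: "e = (c, i)" "i < 6" "c \<in> N" "c + hex_dir i \<in> N"
      using eIn unfolding In_def by blast
    have m: "((i + 3) mod 6 + 3) mod 6 = i" using e(2) unfolding less_6_cases by (elim disjE) simp_all
    have "hex_dir ((i + 3) mod 6) = - hex_dir i" by (simp only: hex_dir_mod hex_dir_opposite)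
    then show "\<sigma> (\<sigma> e) = e" "\<sigma> e \<in> In" using e m by (auto simp: \<sigma>_def In_def)
  qed
  have "side_integral d g (\<sigma> e) = - side_integral d g e" if eIn: "e \<in> In" for e
  proof -
    obtain c i where e: "e = (c, i)" "i < 6" "c \<in> N" "c + hex_dir i \<in> N"
      using eIn unfolding In_def by blast
    have "edge_tail (\<sigma> e) = edge_head e"
      using corner_reverse(2)[of c i] by (simp add: e \<sigma>_def edge_tail_def edge_head_def corner_mod)
    moreover have "corner (c + hex_dir i) ((i + 3) mod 6 + 1) = corner (c + hex_dir i) (i + 4)"
      using e(2) unfolding less_6_cases by (elim disjE) (simp_all add: corner_def)
    then have "edge_head (\<sigma> e) = edge_tail e"
      using corner_reverse(1)[of c i] by (simp add: e \<sigma>_def edge_tail_def edge_head_def)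
    moreover have "continuous_on (side d e) g"
    proof (rule continuous_on_subset[OF g[OF e(3)]])
      have "hex_dir i \<noteq> 0" using mod6_cases[of i] by (auto simp: hex_dir_def zero_prod_def)
      then show "side d e \<subseteq> brick d c - brick_interior d c"
        using brick_inter[OF d, of c i] brick_interior_disjoint[OF d, of _ c "c + hex_dir i"] by (auto simp: e)
    qed
    ultimately show ?thesis
      using contour_integral_reverse_linepath[of "place d (edge_tail e)" "place d (edge_head e)" g]
      by (simp add: side_integral_def side_def)
  qed
  moreover have "(\<Sum>e\<in>In. side_integral d g e) = (\<Sum>e\<in>In. side_integral d g (\<sigma> e))"
    by (rule sum.reindex_bij_witness[of _ \<sigma> \<sigma>]) (auto simp: ss)
  ultimately have "(\<Sum>e\<in>In. side_integral d g e) = 0"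
    by (simp add: sum_negf)
  moreover have "N \<times> {..<6} = boundary_edges N \<union> In" "boundary_edges N \<inter> In = {}" by (auto simp: boundary_edges_def In_def)
  then have "(\<Sum>e\<in>N \<times> {..<6}. side_integral d g e) = (\<Sum>e\<in>boundary_edges N. side_integral d g e) + (\<Sum>e\<in>In. side_integral d g e)"
    using fin finite_boundary_edges[OF N] by (simp add: sum.union_disjoint)
  moreover have "(\<Sum>c\<in>N. \<Sum>i<6. side_integral d g (c, i)) = (\<Sum>e\<in>N \<times> {..<6}. side_integral d g e)"
    by (simp add: sum.cartesian_product)
  ultimately show ?thesis by simp
qed

lemma linepath_Cauchy_kernel:
  assumes "continuous_on (closed_segment a b) f"
  shows "(\<lambda>w. contour_integral (linepath a b) (\<lambda>z. f z / (z - w))) holomorphic_on - closed_segment a b"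
proof (rule holomorphic_onI)
  fix w assume w: "w \<in> - closed_segment a b"
  define F where "F w = contour_integral (linepath a b) (\<lambda>z. f z / (z - w))" for w
  have int: "((\<lambda>z. f z / (z - w) ^ 1) has_contour_integral F w) (linepath a b)"
    if "w \<in> UNIV - path_image (linepath a b)" for w
    unfolding F_def using that assms
    by (auto intro!: has_contour_integral_integral contour_integrable_continuous_linepath continuous_intros)
  have "(F has_field_derivative of_nat 1 * contour_integral (linepath a b) (\<lambda>u. f u / (u - w) ^ Suc 1)) (at w)"
    by (rule Cauchy_next_derivative(2)[where B = "norm (b - a)" and S = UNIV])
       (use assms w int in auto)
  then show "F field_differentiable at w within - closed_segment a b"
    using field_differentiable_at_within field_differentiable_def by blast
qed

lemma brick_side_avoids_interior:
  assumes "d > 0" "w \<in> brick_interior d c0" "z \<in> brick d c - brick_interior d c"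
  shows "z \<noteq> w"
  using brick_interior_disjoint[OF assms(1,2), of c] assms by auto

text \<open>
  For \<open>w\<close> inside one of the bricks this is the sum over all bricks of the Cauchy formula or the Cauchy theorem
  for a rectangle. The formula extends by continuity to the points of the region that lie on sides.
\<close>

lemma region_Cauchy_formula:
  assumes d: "d > 0" and N: "finite N" and f: "f holomorphic_on S" "open S" "(\<Union>c\<in>N. brick d c) \<subseteq> S"
    and w: "w \<in> interior (\<Union>c\<in>N. brick d c)"
  shows "(\<Sum>e\<in>boundary_edges N. side_integral d (\<lambda>z. f z / (z - w)) e) = 2 * pi * \<i> * f w"
proof -
  let ?C = "\<Union>c\<in>N. brick d c"
  define H where "H w = (\<Sum>e\<in>boundary_edges N. side_integral d (\<lambda>z. f z / (z - w)) e) - 2 * pi * \<i> * f w" for w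
  have fc: "continuous_on S f" using f by (simp add: holomorphic_on_imp_continuous_on)
  \<comment> \<open>Only the brick around \<open>w\<close> contributes.\<close>
  have in0: "H w = 0" if w: "w \<in> brick_interior d c0" "c0 \<in> N" for w c0
  proof -
    let ?g = "\<lambda>z. f z / (z - w)"
    have cont: "continuous_on (brick d c - brick_interior d c) ?g" if "c \<in> N" for c
      using that f(3) brick_side_avoids_interior[OF d w(1), of _ c]
      by (intro continuous_intros continuous_on_subset[OF fc]) auto
    let ?R = "\<lambda>c. rectpath (place d (corner c 4)) (place d (corner c 1))"
    have le: "Re (place d (corner c 4)) \<le> Re (place d (corner c 1))" "Im (place d (corner c 4)) \<le> Im (place d (corner c 1))" for c
      using d by (auto simp: place_def corner_def)
    have img: "path_image (?R c) = brick d c - brick_interior d c" for c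
      unfolding brick_def brick_interior_def by (rule path_image_rectpath_cbox_minus_box[OF le])
    have other: "contour_integral (?R c) ?g = 0" if c: "c \<in> N" "c \<noteq> c0" for c
    proof (rule contour_integral_unique, rule Cauchy_theorem_convex_simple[of _ "brick d c"])
      have "w \<notin> brick d c" using brick_interior_disjoint[OF d w(1), of c] c(2) by auto
      then show "?g holomorphic_on brick d c"
        using f(3) c(1) by (intro holomorphic_intros holomorphic_on_subset[OF f(1)]) auto
    qed (auto simp: img brick_def simp del: One_nat_def)
    have "contour_integral (?R c0) ?g = 2 * pi * \<i> * winding_number (?R c0) w * f w"
    proof (rule contour_integral_unique, rule Cauchy_integral_formula_convex_simple[of "brick d c0"])
      show "f holomorphic_on brick d c0" using f(3) w(2) by (intro holomorphic_on_subset[OF f(1)]) auto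
      show "w \<in> interior (brick d c0)"
        using w(1) by (simp add: brick_def brick_interior_def)
      show "path_image (?R c0) \<subseteq> brick d c0 - {w}" using w(1) by (auto simp: img simp del: One_nat_def)
    qed (auto simp: brick_def)
    also have "winding_number (?R c0) w = 1"
      using w(1) by (intro winding_number_rectpath) (auto simp: brick_interior_def)
    finally have "(\<Sum>c\<in>N. contour_integral (?R c) ?g) = 2 * pi * \<i> * f w"
      using other by (subst sum.remove[OF N w(2)]) auto
    then show ?thesis
      using sum_bricks_eq_sum_boundary_edges[OF d N, of ?g] cont brick_integral[OF d cont] by (simp add: H_def)
  qed
  have "continuous_on (interior ?C) H"
  proof -
    have "continuous_on (interior ?C) (\<lambda>w. side_integral d (\<lambda>z. f z / (z - w)) e)" if "e \<in> boundary_edges N" for e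
    proof -
      have sub: "side d e \<subseteq> frontier (interior ?C)" using that frontier_interior_bricks[OF d N] by auto
      also have "\<dots> \<subseteq> ?C" using closure_interior_bricks[OF d N] by (auto simp: frontier_def)
      finally have "continuous_on (side d e) f"
        using f(3) by (intro continuous_on_subset[OF fc]) auto
      then have "(\<lambda>w. side_integral d (\<lambda>z. f z / (z - w)) e) holomorphic_on - side d e"
        unfolding side_def side_integral_def by (rule linepath_Cauchy_kernel)
      moreover have "interior ?C \<subseteq> - side d e"
        using sub by (auto simp: frontier_def)
      ultimately show ?thesis using holomorphic_on_imp_continuous_on continuous_on_subset by blast
    qed
    then show ?thesis unfolding H_def
      using f(3) interior_subset[of ?C] by (intro continuous_intros continuous_on_subset[OF fc]) auto
  qed
  then have op: "open (interior ?C \<inter> H -` (- {0}))"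
    by (rule continuous_open_preimage) auto
  have "H w = 0"
  proof (rule ccontr)
    assume "H w \<noteq> 0"
    obtain c where c: "c \<in> N" "w \<in> brick d c" using w interior_subset by blast
    then have "w \<in> closure (brick_interior d c)" by (simp add: closure_brick_interior[OF d])
    moreover have "w \<in> interior ?C \<inter> H -` (- {0})" using w \<open>H w \<noteq> 0\<close> by auto
    ultimately obtain y where "y \<in> interior ?C \<inter> H -` (- {0})" "y \<in> brick_interior d c"
      using open_Int_closure_eq_empty[OF op] by blast
    then show False using in0 c(1) by auto
  qed
  then show ?thesis by (simp add: H_def)
qed

lemma region_exterior:
  assumes d: "d > 0" and N: "finite N" and w: "w \<notin> (\<Union>c\<in>N. brick d c)"
  shows "(\<Sum>e\<in>boundary_edges N. side_integral d (\<lambda>z. 1 / (z - w)) e) = 0"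
proof -
  let ?g = "\<lambda>z. 1 / (z - w)"
  have cont: "continuous_on (brick d c - brick_interior d c) ?g" if "c \<in> N" for c
    using that w by (intro continuous_intros) auto
  have "contour_integral (rectpath (place d (corner c 4)) (place d (corner c 1))) ?g = 0" if c: "c \<in> N" for c
  proof (rule contour_integral_unique, rule Cauchy_theorem_convex_simple[of _ "brick d c"])
    show "?g holomorphic_on brick d c"
      using w c(1) by (intro holomorphic_intros) auto
    show "path_image (rectpath (place d (corner c 4)) (place d (corner c 1))) \<subseteq> brick d c"
      unfolding brick_def by (rule path_image_rectpath_subset_cbox) (use d in \<open>auto simp: place_def corner_def\<close>)
  qed (auto simp: brick_def)
  then show ?thesis
    using sum_bricks_eq_sum_boundary_edges[OF d N, of ?g] cont brick_integral[OF d cont] by simp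
qed

section \<open>Boundary curves of a union of bricks\<close>

text \<open>
  The cycles of a permutation as lists, in a form which can be traversed as a path.
\<close>

lemma permutation_cycles:
  assumes "finite A" "bij_betw f A A"
  shows "\<exists>Ls. distinct (concat Ls) \<and> set (concat Ls) = A \<and>
     (\<forall>l\<in>set Ls. l \<noteq> [] \<and> successively (\<lambda>x y. y = f x) l \<and> hd l = f (last l))"
  using assms
proof (induction "card A" arbitrary: A rule: less_induct)
  case less
  show ?case
  proof (cases "A = {}")
    case True
    then show ?thesis by (intro exI[of _ "[]"]) auto
  next
    case False
    then obtain x where x: "x \<in> A" by auto
    note bk = bij_betw_funpow[OF less.prems(2)]
    have inA: "(f ^^ k) x \<in> A" for k using bk[of k] x by (auto simp: bij_betw_def)
    have "\<not> inj (\<lambda>k. (f ^^ k) x)"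
      using finite_subset[of "range (\<lambda>k. (f ^^ k) x)" A] less.prems(1) inA finite_imageD by blast
    then obtain i j where ij: "i < j" "(f ^^ i) x = (f ^^ j) x"
      by (metis (mono_tags, lifting) injI linorder_neqE_nat)
    have period: "(f ^^ (j - i)) x = x" if "i < j" "(f ^^ i) x = (f ^^ j) x" for i j
    proof -
      have "(f ^^ i) ((f ^^ (j - i)) x) = (f ^^ i) x"
        using that by (simp flip: funpow_add comp_apply[of "f ^^ i"])
      then show ?thesis using bk[of i] inA x by (auto simp: bij_betw_def inj_on_def)
    qed
    define n where "n = (LEAST n. 0 < n \<and> (f ^^ n) x = x)"
    have ex: "\<exists>n. 0 < n \<and> (f ^^ n) x = x" using period[OF ij] ij(1) by (intro exI[of _ "j - i"]) auto
    have n: "0 < n" "(f ^^ n) x = x" using LeastI_ex[OF ex] by (auto simp: n_def)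
    have least: "\<not> (0 < k \<and> (f ^^ k) x = x)" if "k < n" for k
      using not_less_Least[of k "\<lambda>n. 0 < n \<and> (f ^^ n) x = x"] that unfolding n_def by blast
    define l where "l = map (\<lambda>k. (f ^^ k) x) [0..<n]"
    have dl: "distinct l"
    proof -
      have "(f ^^ a) x \<noteq> (f ^^ b) x" if "a < b" "b < n" for a b
        using least[of "b - a"] period[of a b] that by auto
      then have "inj_on (\<lambda>k. (f ^^ k) x) {0..<n}"
        by (intro inj_onI) (metis atLeastLessThan_iff linorder_neqE_nat)
      then show ?thesis by (simp add: l_def distinct_map)
    qed
    have fl: "f ` set l = set l"
    proof -
      have "f ` set l = (\<lambda>k. (f ^^ Suc k) x) ` {0..<n}" by (auto simp: l_def)
      also have "\<dots> = (\<lambda>k. (f ^^ k) x) ` {1..<Suc n}"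
        unfolding image_image[symmetric, of "\<lambda>k. (f ^^ k) x" Suc] by simp
      also have "{1..<Suc n} = insert n {1..<n}" using n(1) by auto
      also have "(\<lambda>k. (f ^^ k) x) ` insert n {1..<n} = (\<lambda>k. (f ^^ k) x) ` insert 0 {1..<n}" using n(2) by simp
      also have "insert 0 {1..<n} = {0..<n}" using n(1) by auto
      finally show ?thesis by (simp add: l_def)
    qed
    have sub: "set l \<subseteq> A" using inA by (auto simp: l_def)
    have "bij_betw f (A - set l) (A - set l)"
      using less.prems(2) fl sub bij_betw_subset[OF less.prems(2) sub fl] by (intro bij_betw_DiffI)
    moreover have "x \<in> set l" using n(1) unfolding l_def by (auto intro!: image_eqI[of _ _ 0])
    then have "card (A - set l) < card A"
      using less.prems(1) x by (intro psubset_card_mono) auto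
    ultimately obtain Ls where Ls: "distinct (concat Ls)" "set (concat Ls) = A - set l"
      "\<forall>l\<in>set Ls. l \<noteq> [] \<and> successively (\<lambda>x y. y = f x) l \<and> hd l = f (last l)"
      using less.hyps[of "A - set l"] less.prems(1) by auto
    have "successively (\<lambda>x y. y = f x) l"
      by (simp add: l_def successively_conv_nth)
    moreover have "hd l = f (last l)"
    proof -
      have "hd l = l ! 0" "last l = l ! (n - 1)" using n(1) by (auto simp: l_def hd_conv_nth last_conv_nth)
      moreover have "(f ^^ n) x = f ((f ^^ (n - 1)) x)" using n(1) by (cases n) auto
      ultimately show ?thesis using n by (simp add: l_def)
    qed
    ultimately show ?thesis
      using Ls dl sub \<open>x \<in> set l\<close> by (intro exI[of _ "l # Ls"]) auto
  qed
qed

lemma cycle_closed: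
  assumes "l \<noteq> []" "successively (\<lambda>x y. y = f x) l" "hd l = f (last l)" "x \<in> set l"
  shows "f x \<in> set l"
proof -
  obtain i where i: "i < length l" "x = l ! i" using assms(4) by (auto simp: in_set_conv_nth)
  show ?thesis
  proof (cases "Suc i < length l")
    case True
    then have "l ! Suc i = f x" using assms(2) i(2) unfolding successively_conv_nth by blast
    then show ?thesis using True nth_mem by metis
  next
    case False
    then have "i = length l - 1" using i(1) by linarith
    then have "f x = hd l" using i(2) assms(1,3) by (simp add: last_conv_nth)
    then show ?thesis using assms(1) by simp
  qed
qed

fun edge_path :: "real \<Rightarrow> ((int \<times> int) \<times> nat) list \<Rightarrow> real \<Rightarrow> complex" where
  "edge_path d [] = linepath 0 0"
| "edge_path d [e] = linepath (place d (edge_tail e)) (place d (edge_head e))"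
| "edge_path d (e # e' # r) = linepath (place d (edge_tail e)) (place d (edge_head e)) +++ edge_path d (e' # r)"

abbreviation "chain \<equiv> successively (\<lambda>e e'. edge_head e = edge_tail e')"

lemma edge_path_ends:
  assumes "es \<noteq> []"
  shows "pathstart (edge_path d es) = place d (edge_tail (hd es))" "pathfinish (edge_path d es) = place d (edge_head (last es))"
  using assms by (induction d es rule: edge_path.induct) auto

lemma edge_path_basic:
  assumes "es \<noteq> []" "chain es"
  shows "valid_path (edge_path d es)" "path_image (edge_path d es) = (\<Union>e\<in>set es. side d e)"
  using assms
  by (induction d es rule: edge_path.induct)
     (auto simp: side_def path_image_join edge_path_ends valid_path_join)

lemma contour_integral_edge_path:
  assumes "es \<noteq> []" "chain es" "continuous_on (\<Union>e\<in>set es. side d e) g"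
  shows "g contour_integrable_on edge_path d es \<and>
     contour_integral (edge_path d es) g = (\<Sum>e\<leftarrow>es. side_integral d g e)"
  using assms
proof (induction d es rule: edge_path.induct)
  case (2 d e)
  then show ?case by (simp add: side_integral_def side_def contour_integrable_continuous_linepath)
next
  case (3 d e e' r)
  have "continuous_on (side d e) g" by (rule continuous_on_subset[OF 3(4)]) auto
  then have "g contour_integrable_on linepath (place d (edge_tail e)) (place d (edge_head e))"
    unfolding side_def by (rule contour_integrable_continuous_linepath)
  moreover have "continuous_on (\<Union>e\<in>set (e' # r). side d e) g" by (rule continuous_on_subset[OF 3(4)]) auto
  ultimately show ?case using 3 by (simp add: side_integral_def edge_path_basic)
qed simp

lemma edge_tail_neq_edge_head: "edge_tail e \<noteq> edge_head e"
  using corner_step[of "fst e" "snd e"] by (auto simp: edge_tail_def edge_head_def zero_prod_def)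

lemma place_inject: "d > 0 \<Longrightarrow> place d v = place d w \<longleftrightarrow> v = w"
  by (cases v, cases w) (auto simp: place_def)

lemma arc_edge_path:
  assumes d: "d > 0" and "es \<noteq> []" "chain es" "distinct es" "set es \<subseteq> boundary_edges N" "edge_tail (hd es) \<notin> edge_head ` set es"
  shows "arc (edge_path d es)"
  using assms(2-)
proof (induction es rule: induct_list012)
  case (2 e)
  then show ?case using d edge_tail_neq_edge_head by (auto simp: place_inject intro!: arc_linepath)
next
  case (3 e e' r)
  have he: "edge_head e = edge_tail e'" using 3(4) by simp
  have "edge_tail e' \<notin> edge_head ` set (e' # r)"
  proof
    assume "edge_tail e' \<in> edge_head ` set (e' # r)"
    then obtain x where x: "x \<in> set (e' # r)" "edge_head x = edge_head e" unfolding he by (metis imageE)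
    then have "x = e" using edge_head_inj[of N] 3(6) by (auto simp: inj_on_def)
    then show False using x(1) 3(5) by auto
  qed
  then have IH: "arc (edge_path d (e' # r))" using 3 by auto
  have "side d e \<inter> side d x \<subseteq> {place d (edge_tail e')}" if "x \<in> set (e' # r)" for x
  proof
    fix z assume z: "z \<in> side d e \<inter> side d x"
    have "e \<noteq> x" using that 3(5) by auto
    then show "z \<in> {place d (edge_tail e')}"
      using boundary_edges_sides_meet[OF d, of e N x z] z that 3(6,7) he by (auto simp del: insert_iff simp: insert_iff)
  qed
  then have "side d e \<inter> (\<Union>x\<in>set (e' # r). side d x) \<subseteq> {place d (edge_tail e')}" by blast
  moreover have ch: "chain (e' # r)" using 3(4) by simp
  ultimately have "path_image (linepath (place d (edge_tail e)) (place d (edge_head e))) \<inter> path_image (edge_path d (e' # r))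
      \<subseteq> {pathstart (edge_path d (e' # r))}"
    using edge_path_basic(2)[of "e' # r" d] edge_path_ends(1)[of "e' # r" d]
    by (simp only: path_image_linepath side_def[symmetric] list.sel list.distinct not_False_eq_True simp_thms)
  moreover have "arc (linepath (place d (edge_tail e)) (place d (edge_head e)))"
    using d edge_tail_neq_edge_head[of e] by (auto simp: place_inject intro!: arc_linepath)
  ultimately have "arc (linepath (place d (edge_tail e)) (place d (edge_head e)) +++ edge_path d (e' # r))"
    using IH he by (intro arc_join) (auto simp: edge_path_ends)
  then show ?case by simp
qed simp

lemma simple_edge_path:
  assumes d: "d > 0" and es: "es \<noteq> []" "chain es" "distinct es" "set es \<subseteq> boundary_edges N" "edge_tail (hd es) = edge_head (last es)"
  shows "simple_path (edge_path d es)"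
proof -
  obtain e r where er: "es = e # r" using es(1) by (cases es) auto
  then have "r \<noteq> []" using es(5) edge_tail_neq_edge_head[of e] by auto
  then obtain e' r' where r: "r = e' # r'" by (cases r) auto
  have he: "edge_head e = edge_tail e'" using es(2) by (simp add: er r)
  have "edge_tail e' \<notin> edge_head ` set (e' # r')"
  proof
    assume "edge_tail e' \<in> edge_head ` set (e' # r')"
    then obtain x where x: "x \<in> set (e' # r')" "edge_head x = edge_head e" unfolding he by (metis imageE)
    then have "x = e" using edge_head_inj[of N] es(4) by (auto simp: inj_on_def er r)
    then show False using x(1) es(3) by (auto simp: er r)
  qed
  then have a: "arc (edge_path d (e' # r'))"
    using es by (intro arc_edge_path[OF d, of _ N]) (auto simp: er r)
  have "side d e \<inter> side d x \<subseteq> {place d (edge_tail e), place d (edge_tail e')}" if "x \<in> set (e' # r')" for x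
  proof
    fix z assume z: "z \<in> side d e \<inter> side d x"
    have "e \<noteq> x" "e \<in> boundary_edges N" "x \<in> boundary_edges N" using that es(3,4) by (auto simp: er r)
    then show "z \<in> {place d (edge_tail e), place d (edge_tail e')}"
      using boundary_edges_sides_meet[OF d, of e N x z] z he by auto
  qed
  then have "side d e \<inter> (\<Union>x\<in>set (e' # r'). side d x) \<subseteq> {place d (edge_tail e), place d (edge_tail e')}" by blast
  moreover have ch: "chain (e' # r')" using es(2) by (simp add: er r)
  ultimately have "path_image (linepath (place d (edge_tail e)) (place d (edge_head e))) \<inter> path_image (edge_path d (e' # r'))
      \<subseteq> {pathstart (linepath (place d (edge_tail e)) (place d (edge_head e))), pathstart (edge_path d (e' # r'))}"
    using edge_path_basic(2)[of "e' # r'" d] edge_path_ends(1)[of "e' # r'" d]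
    by (simp only: path_image_linepath side_def[symmetric] list.sel list.distinct not_False_eq_True simp_thms
        pathstart_linepath)
  moreover have "arc (linepath (place d (edge_tail e)) (place d (edge_head e)))"
    using d edge_tail_neq_edge_head[of e] by (auto simp: place_inject intro!: arc_linepath)
  ultimately have "simple_path (linepath (place d (edge_tail e)) (place d (edge_head e)) +++ edge_path d (e' # r'))"
    using a he es(5) by (intro simple_path_join_loop) (auto simp: edge_path_ends er r)
  then show ?thesis by (simp add: er r)
qed

lemma bricks_cnj:
  assumes d: "d > 0"
  shows "cnj z \<in> brick d (q, r) \<longleftrightarrow> z \<in> brick d (q + r, - r)"
  using d by (auto simp: in_brick)

text \<open>
  Take all bricks of a fine wall that meet \<open>K\<close>. The list \<open>E\<close> of oriented boundary segments is kept in addition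
  to the curves, because integrals over segments are holomorphic in parameters by elementary means.
\<close>

theorem exists_Cauchy_region:
  assumes K: "compact K" and S: "open S" "K \<subseteq> S"
  obtains W \<Gamma> E where "open W" "bounded W" "K \<subseteq> W" "closure W \<subseteq> S" "\<And>z. (\<forall>z\<in>K. cnj z \<in> K) \<Longrightarrow> z \<in> W \<Longrightarrow> cnj z \<in> W"
    "boundary_curves \<Gamma> W" "frontier W = (\<Union>(a, b)\<in>set E. closed_segment a b)"
    "\<And>g. continuous_on (frontier W) g \<Longrightarrow>
       (\<Sum>\<gamma>\<leftarrow>\<Gamma>. contour_integral \<gamma> g) = (\<Sum>(a, b)\<leftarrow>E. contour_integral (linepath a b) g)"
    "\<And>f w. f holomorphic_on S \<Longrightarrow> w \<in> W \<Longrightarrow>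
       (\<Sum>(a, b)\<leftarrow>E. contour_integral (linepath a b) (\<lambda>z. f z / (z - w))) = 2 * pi * \<i> * f w"
proof -
  obtain \<epsilon> where \<epsilon>: "\<epsilon> > 0" "(\<Union>z\<in>K. ball z \<epsilon>) \<subseteq> S"
    using compact_subset_open_imp_ball_epsilon_subset[OF K S] by blast
  \<comment> \<open>The diameter of a brick is less than \<open>3 d\<close>, so bricks meeting \<open>K\<close> stay in \<open>S\<close>.\<close>
  define d where "d = \<epsilon> / 4"
  have d: "d > 0" using \<epsilon> by (simp add: d_def)
  define N where "N = {c. brick d c \<inter> K \<noteq> {}}"
  have N: "finite N" unfolding N_def by (rule finite_bricks_meeting[OF d compact_imp_bounded[OF K]])
  let ?C = "\<Union>c\<in>N. brick d c"
  define W where "W = interior ?C"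
  have CS: "?C \<subseteq> S"
  proof clarify
    fix z q r assume a: "(q, r) \<in> N" "z \<in> brick d (q, r)"
    then obtain k where k: "k \<in> K" "k \<in> brick d (q, r)" by (auto simp: N_def)
    have "\<bar>Re k / d - Re z / d\<bar> \<le> 2" "\<bar>Im k / d - Im z / d\<bar> \<le> 1"
      using a(2) k(2) unfolding in_brick[OF d] by linarith+
    then have "\<bar>Re (k - z)\<bar> \<le> 2 * d" "\<bar>Im (k - z)\<bar> \<le> d"
      using d by (auto simp: diff_divide_distrib[symmetric] abs_divide field_simps)
    then have "norm (k - z) \<le> 3 * d" using cmod_le[of "k - z"] by linarith
    then have "z \<in> ball k \<epsilon>" using \<epsilon>(1) by (simp add: d_def dist_norm)
    then show "z \<in> S" using \<epsilon>(2) k(1) by blast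
  qed
  have cl: "closure W = ?C" unfolding W_def by (rule closure_interior_bricks[OF d N])
  have fr: "frontier W = (\<Union>e\<in>boundary_edges N. side d e)" unfolding W_def by (rule frontier_interior_bricks[OF d N])
  have KW: "K \<subseteq> W"
  proof
    fix z assume "z \<in> K"
    then show "z \<in> W" unfolding W_def by (intro interior_bricksI[OF d]) (auto simp: N_def)
  qed
  have symN: "(q + r, - r) \<in> N" if "\<forall>z\<in>K. cnj z \<in> K" "(q, r) \<in> N" for q r
  proof -
    obtain z where "z \<in> K" "z \<in> brick d (q, r)" using \<open>(q, r) \<in> N\<close> by (auto simp: N_def)
    then have "cnj z \<in> K" "cnj z \<in> brick d (q + r, - r)" using that(1) by (auto simp: bricks_cnj[OF d])
    then show ?thesis by (auto simp: N_def)
  qed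
  have symC: "cnj z \<in> ?C" if sym: "\<forall>z\<in>K. cnj z \<in> K" and z: "z \<in> ?C" for z
  proof -
    obtain q r where "(q, r) \<in> N" "z \<in> brick d (q, r)" using z by auto
    then have "(q + r, - r) \<in> N" "cnj z \<in> brick d (q + r, - r)" using symN[OF sym] by (auto simp: bricks_cnj[OF d])
    then show ?thesis by blast
  qed
  have symW: "cnj z \<in> W" if sym: "\<forall>z\<in>K. cnj z \<in> K" and "z \<in> W" for z
  proof -
    have "cnj ` W \<subseteq> W" unfolding W_def
    proof (rule interior_maximal)
      show "cnj ` interior ?C \<subseteq> ?C" using symC[OF sym] interior_subset by blast
      have "cnj ` interior ?C = cnj -` interior ?C" by (auto simp: image_iff) (metis complex_cnj_cnj)+
      then show "open (cnj ` interior ?C)" by (auto intro!: open_vimage continuous_intros)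
    qed
    then show ?thesis using that(2) by auto
  qed
  obtain Ls where Ls: "distinct (concat Ls)" "set (concat Ls) = boundary_edges N"
     "\<And>l. l\<in>set Ls \<Longrightarrow> l \<noteq> [] \<and> successively (\<lambda>x y. y = edge_next N x) l \<and> hd l = edge_next N (last l)"
    using permutation_cycles[OF finite_boundary_edges[OF N] edge_next_bij[OF N]] by blast
  have L: "l \<noteq> []" "chain l" "distinct l" "set l \<subseteq> boundary_edges N" "edge_tail (hd l) = edge_head (last l)" if "l \<in> set Ls" for l
  proof -
    show "l \<noteq> []" "edge_tail (hd l) = edge_head (last l)" using Ls(3)[OF that] by (auto simp: edge_tail_edge_next)
    show "chain l" using Ls(3)[OF that] by (auto elim!: successively_mono simp: edge_tail_edge_next)
    show "distinct l" "set l \<subseteq> boundary_edges N" using Ls(1,2) that by (auto simp: distinct_concat_iff)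
  qed
  define \<Gamma> where "\<Gamma> = map (edge_path d) Ls"
  define E where "E = map (\<lambda>e. (place d (edge_tail e), place d (edge_head e))) (concat Ls)"
  have sumE: "(\<Sum>(a, b)\<leftarrow>E. contour_integral (linepath a b) g) = (\<Sum>e\<in>boundary_edges N. side_integral d g e)" for g
    using Ls(1,2) by (simp add: E_def o_def side_integral_def sum_list_distinct_conv_sum_set del: set_concat)
  have sum\<Gamma>: "(\<Sum>\<gamma>\<leftarrow>\<Gamma>. contour_integral \<gamma> g) = (\<Sum>(a, b)\<leftarrow>E. contour_integral (linepath a b) g)"
    if "continuous_on (frontier W) g" for g
  proof -
    have "contour_integral (edge_path d l) g = (\<Sum>e\<leftarrow>l. side_integral d g e)" if "l \<in> set Ls" for l
      using contour_integral_edge_path[OF L(1,2)[OF that], of d g] L(4)[OF that]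
      by (meson SUP_subset_mono UN_mono continuous_on_subset fr order_refl \<open>continuous_on (frontier W) g\<close>[unfolded fr])
    then have "(\<Sum>\<gamma>\<leftarrow>\<Gamma>. contour_integral \<gamma> g) = (\<Sum>l\<leftarrow>Ls. \<Sum>e\<leftarrow>l. side_integral d g e)"
      unfolding \<Gamma>_def by (simp add: o_def cong: map_cong)
    also have "\<dots> = (\<Sum>e\<leftarrow>concat Ls. side_integral d g e)" by (induction Ls) auto
    finally show ?thesis by (simp add: E_def o_def side_integral_def)
  qed
  have Cauchy: "(\<Sum>(a, b)\<leftarrow>E. contour_integral (linepath a b) (\<lambda>z. f z / (z - w))) = 2 * pi * \<i> * f w"
    if "f holomorphic_on S" "w \<in> W" for f w
    unfolding sumE using region_Cauchy_formula[OF d N that(1) S(1) CS] that(2) by (simp add: W_def)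
  have wn: "(\<Sum>\<gamma>\<leftarrow>\<Gamma>. winding_number \<gamma> w) = 1 / (2 * pi * \<i>) * (\<Sum>(a, b)\<leftarrow>E. contour_integral (linepath a b) (\<lambda>z. 1 / (z - w)))"
    if w: "w \<notin> frontier W" for w
  proof -
    have "winding_number (edge_path d l) w = 1 / (2 * pi * \<i>) * contour_integral (edge_path d l) (\<lambda>z. 1 / (z - w))" if l: "l \<in> set Ls" for l
      using L(4)[OF l] w edge_path_basic[OF L(1,2)[OF l], of d] unfolding fr
      by (intro winding_number_valid_path) auto
    then have "map (\<lambda>\<gamma>. winding_number \<gamma> w) \<Gamma> = map (\<lambda>\<gamma>. 1 / (2 * pi * \<i>) * contour_integral \<gamma> (\<lambda>z. 1 / (z - w))) \<Gamma>"
      unfolding \<Gamma>_def by simp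
    then have "(\<Sum>\<gamma>\<leftarrow>\<Gamma>. winding_number \<gamma> w) = 1 / (2 * pi * \<i>) * (\<Sum>\<gamma>\<leftarrow>\<Gamma>. contour_integral \<gamma> (\<lambda>z. 1 / (z - w)))"
      by (simp only: sum_list_const_mult)
    moreover have "continuous_on (frontier W) (\<lambda>z. 1 / (z - w))" using w by (intro continuous_intros) auto
    ultimately show ?thesis by (simp add: sum\<Gamma>)
  qed
  have bc: "boundary_curves \<Gamma> W"
    unfolding boundary_curves_def
  proof (intro conjI allI impI ballI)
    fix \<gamma> assume "\<gamma> \<in> set \<Gamma>"
    then obtain l where l: "\<gamma> = edge_path d l" "l \<in> set Ls" by (auto simp: \<Gamma>_def)
    show "valid_path \<gamma>" using L[OF l(2)] by (simp add: l edge_path_basic)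
    show "simple_path \<gamma>" unfolding l by (rule simple_edge_path[OF d L[OF l(2)]])
    show "pathfinish \<gamma> = pathstart \<gamma>" using L[OF l(2)] by (simp add: l edge_path_ends)
  next
    fix i k assume ik: "i < length \<Gamma>" "k < length \<Gamma>" "i \<noteq> k"
    then have len: "i < length Ls" "k < length Ls" by (auto simp: \<Gamma>_def)
    have l: "Ls ! i \<in> set Ls" "Ls ! k \<in> set Ls" using len by auto
    have disj: "set (Ls ! i) \<inter> set (Ls ! k) = {}"
    proof -
      have "[] \<notin> set Ls" using Ls(3) by auto
      then have "distinct Ls" using Ls(1) by (simp add: distinct_concat_iff)
      then have ne: "Ls ! i \<noteq> Ls ! k" using len ik(3) by (simp add: nth_eq_iff_index_eq)
      then show ?thesis using Ls(1) l unfolding distinct_concat_iff by blast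
    qed
    have "False" if "z \<in> side d e" "z \<in> side d e'" "e \<in> set (Ls ! i)" "e' \<in> set (Ls ! k)" for z e e'
    proof -
      have e: "e \<noteq> e'" "e \<in> boundary_edges N" "e' \<in> boundary_edges N" using that disj L(4) l by auto
      \<comment> \<open>Sides with a common point are successive in one cycle, so sides of different cycles are disjoint.\<close>
      have nxt: "y = edge_next N x" if "x \<in> boundary_edges N" "y \<in> boundary_edges N" "edge_head x = edge_tail y" for x y
        using that edge_tail_inj[of N] edge_next_boundary_edges[of x N] edge_tail_edge_next[of N x] by (auto simp: inj_on_def)
      have "edge_head e = edge_tail e' \<or> edge_head e' = edge_tail e"
        using boundary_edges_sides_meet[OF d e(2,3,1) that(1,2)] by auto
      then have "e' = edge_next N e \<or> e = edge_next N e'" using nxt e by blast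
      then show False
        using cycle_closed[of "Ls ! i" "edge_next N" e] cycle_closed[of "Ls ! k" "edge_next N" e']
          Ls(3)[OF l(1)] Ls(3)[OF l(2)] that(3,4) disj by blast
    qed
    then show "path_image (\<Gamma> ! i) \<inter> path_image (\<Gamma> ! k) = {}"
      using len L[OF l(1)] L[OF l(2)] by (auto simp: \<Gamma>_def edge_path_basic)
  next
    show "frontier W = (\<Union>\<gamma>\<in>set \<Gamma>. path_image \<gamma>)"
    proof -
      have "path_image (edge_path d l) = (\<Union>e\<in>set l. side d e)" if "l \<in> set Ls" for l
        using edge_path_basic(2)[OF L(1,2)[OF that]] .
      then have "(\<Union>\<gamma>\<in>set \<Gamma>. path_image \<gamma>) = (\<Union>e\<in>set (concat Ls). side d e)"
        by (simp add: \<Gamma>_def UN_UN_flatten)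
      then show ?thesis unfolding Ls(2) fr by simp
    qed
  next
    fix w assume w: "w \<in> W"
    then have "w \<notin> frontier W" by (auto simp: frontier_def W_def)
    then show "(\<Sum>\<gamma>\<leftarrow>\<Gamma>. winding_number \<gamma> w) = 1"
      using Cauchy[of "\<lambda>_. 1" w] w by (simp add: wn)
  next
    fix w assume w: "w \<notin> closure W"
    then have "w \<notin> frontier W" by (auto simp: frontier_def)
    then show "(\<Sum>\<gamma>\<leftarrow>\<Gamma>. winding_number \<gamma> w) = 0"
      using region_exterior[OF d N, of w] w by (simp add: wn sumE cl)
  qed
  show ?thesis
  proof (rule that[of W \<Gamma> E])
    have "bounded ?C" using N by (intro bounded_UN ballI) (auto simp: brick_def)
    then show "bounded W" unfolding W_def by (rule bounded_subset) (rule interior_subset)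
    show "frontier W = (\<Union>(a, b)\<in>set E. closed_segment a b)"
      unfolding E_def set_map Ls(2) fr side_def by simp
  qed (use bc KW CS cl symW sum\<Gamma> Cauchy in \<open>auto simp: W_def\<close>)
qed

section \<open>The Hahn-Banach theorem\<close>

text \<open>
  Partial linear functionals are represented by their graphs, so that extension is inclusion and the
  union of a chain needs no separate construction.
\<close>

locale sublinear_functional =
  fixes p :: "'a::real_vector \<Rightarrow> real"
  assumes sub: "p (x + y) \<le> p x + p y" and hom: "c \<ge> 0 \<Longrightarrow> p (c *\<^sub>R x) = c * p x"
begin

definition graph :: "('a \<times> real) set \<Rightarrow> bool" where
  "graph G \<longleftrightarrow> subspace G \<and> (\<forall>(x, a)\<in>G. a \<le> p x)"

lemma graph_fun:
  assumes "graph G" "(x, a) \<in> G" "(x, b) \<in> G"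
  shows "a = b"
proof -
  have p0: "p 0 = 0" using hom[of 0 0] by simp
  have "(0, a - b) \<in> G" "(0, b - a) \<in> G"
    using assms subspace_diff[of G "(x,a)" "(x,b)"] subspace_diff[of G "(x,b)" "(x,a)"] by (auto simp: graph_def)
  moreover have "a \<le> p x" if "(x, a) \<in> G" for x a using assms(1) that by (auto simp: graph_def)
  ultimately have "a - b \<le> p 0" "b - a \<le> p 0" by blast+
  then show ?thesis using p0 by simp
qed

text \<open>
  The one-dimensional extension step: the value \<open>c\<close> at \<open>x0\<close> has to satisfy \<open>a - p (x - x0) \<le> c \<le> p (y + x0) - b\<close> for all
  \<open>(x, a)\<close> and \<open>(y, b)\<close> in the graph, and sublinearity puts each lower bound below each upper one.
\<close>

lemma graph_extend:
  assumes G: "graph G" and x0: "\<And>a. (x0, a) \<notin> G"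
  shows "\<exists>G'. graph G' \<and> G \<subset> G'"
proof -
  have s: "subspace G" and le: "\<And>x a. (x, a) \<in> G \<Longrightarrow> a \<le> p x" using G by (auto simp: graph_def)
  define L where "L = {a - p (x - x0) |x a. (x, a) \<in> G}"
  have ub: "a - p (x - x0) \<le> p (y + x0) - b" if "(x, a) \<in> G" "(y, b) \<in> G" for x a y b
  proof -
    have "a + b \<le> p (x + y)" using le[of "x + y" "a + b"] subspace_add[OF s that] by simp
    also have "\<dots> \<le> p (x - x0) + p (y + x0)" using sub[of "x - x0" "y + x0"] by simp
    finally show ?thesis by simp
  qed
  have z: "(0, 0) \<in> G" using subspace_0[OF s] by (simp add: zero_prod_def)
  define c where "c = Sup L"
  have "bdd_above L" unfolding L_def bdd_above_def using ub[OF _ z] by blast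
  then have c1: "a - p (x - x0) \<le> c" if "(x, a) \<in> G" for x a
    unfolding c_def by (rule cSup_upper[rotated]) (use that in \<open>auto simp: L_def\<close>)
  have c2: "c \<le> p (y + x0) - b" if "(y, b) \<in> G" for y b
    unfolding c_def by (rule cSup_least) (use that ub z in \<open>auto simp: L_def\<close>)
  define G' where "G' = {(x + t *\<^sub>R x0, a + t * c) |x a t. (x, a) \<in> G}"
  have "subspace G'"
  proof (rule subspaceI)
    show "0 \<in> G'" unfolding G'_def zero_prod_def using z by force
    show "u + v \<in> G'" if uv: "u \<in> G'" "v \<in> G'" for u v
    proof -
      obtain x a t y b r where "u = (x + t *\<^sub>R x0, a + t * c)" "(x, a) \<in> G" "v = (y + r *\<^sub>R x0, b + r * c)" "(y, b) \<in> G"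
        using uv unfolding G'_def by blast
      then show ?thesis using subspace_add[OF s, of "(x,a)" "(y,b)"] unfolding G'_def
        by (intro CollectI exI[of _ "x + y"] exI[of _ "a + b"] exI[of _ "t + r"]) (auto simp: algebra_simps)
    qed
    show "k *\<^sub>R u \<in> G'" if u: "u \<in> G'" for k u
    proof -
      obtain x a t where "u = (x + t *\<^sub>R x0, a + t * c)" "(x, a) \<in> G" using u unfolding G'_def by blast
      then show ?thesis using subspace_scale[OF s, of "(x,a)" k] unfolding G'_def
        by (intro CollectI exI[of _ "k *\<^sub>R x"] exI[of _ "k * a"] exI[of _ "k * t"]) (auto simp: algebra_simps)
    qed
  qed
  moreover have "a + t * c \<le> p (x + t *\<^sub>R x0)" if xa: "(x, a) \<in> G" for x a t
  proof -
    consider "t = 0" | "t > 0" | "t < 0" by linarith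
    then show ?thesis
    proof cases
      case 1 then show ?thesis using le xa by simp
    next
      case 2
      have "c \<le> p (inverse t *\<^sub>R x + x0) - inverse t * a"
        using c2 subspace_scale[OF s xa, of "inverse t"] by simp
      then have "t * c \<le> t * p (inverse t *\<^sub>R x + x0) - a" using 2 by (simp add: field_simps)
      also have "t * p (inverse t *\<^sub>R x + x0) = p (x + t *\<^sub>R x0)"
        using 2 hom[of t "inverse t *\<^sub>R x + x0"] by (simp add: algebra_simps)
      finally show ?thesis by simp
    next
      case 3
      define r where "r = - t"
      have r: "r > 0" "t = - r" using 3 by (auto simp: r_def)
      have "inverse r * a - p (inverse r *\<^sub>R x - x0) \<le> c"
        using c1 subspace_scale[OF s xa, of "inverse r"] by simp
      then have "a - r * p (inverse r *\<^sub>R x - x0) \<le> r * c" using r by (simp add: field_simps)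
      also have "r * p (inverse r *\<^sub>R x - x0) = p (x - r *\<^sub>R x0)"
        using r hom[of r "inverse r *\<^sub>R x - x0"] by (simp add: algebra_simps)
      finally show ?thesis using r by simp
    qed
  qed
  then have "\<forall>(x, a)\<in>G'. a \<le> p x" unfolding G'_def by auto
  moreover have "G \<subseteq> G'"
  proof
    fix u assume u: "u \<in> G"
    then show "u \<in> G'" unfolding G'_def
      by (cases u, intro CollectI exI[of _ "fst u"] exI[of _ "snd u"] exI[of _ "0::real"]) auto
  qed
  moreover have "(x0, c) \<in> G'" unfolding G'_def using z by force
  ultimately show ?thesis using x0 unfolding graph_def by (intro exI[of _ G']) auto
qed

lemma Hahn_Banach_graph:
  assumes "graph G0"
  shows "\<exists>G. graph G \<and> G0 \<subseteq> G \<and> (\<forall>x. \<exists>!a. (x, a) \<in> G)"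
proof -
  have "\<exists>M\<in>{G. graph G \<and> G0 \<subseteq> G}. \<forall>X\<in>{G. graph G \<and> G0 \<subseteq> G}. M \<subseteq> X \<longrightarrow> X = M"
  proof (rule subset_Zorn_nonempty)
    show "{G. graph G \<and> G0 \<subseteq> G} \<noteq> {}" using assms by auto
    fix C assume C: "C \<noteq> {}" "subset.chain {G. graph G \<and> G0 \<subseteq> G} C"
    have "subspace (\<Union>C)"
    proof (rule subspaceI)
      show "0 \<in> \<Union>C" using C by (auto simp: subset_chain_def graph_def subspace_def)
      show "u + v \<in> \<Union>C" if uv: "u \<in> \<Union>C" "v \<in> \<Union>C" for u v
      proof -
        obtain A B where "A \<in> C" "B \<in> C" "u \<in> A" "v \<in> B" using uv by auto
        then obtain A where "A \<in> C" "u \<in> A" "v \<in> A" using C(2) unfolding subset_chain_def by blast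
        then show ?thesis using C(2) by (auto simp: subset_chain_def graph_def intro!: subspace_add)
      qed
      show "k *\<^sub>R u \<in> \<Union>C" if "u \<in> \<Union>C" for k u
        using that C(2) by (auto simp: subset_chain_def graph_def intro!: subspace_scale)
    qed
    then show "\<Union>C \<in> {G. graph G \<and> G0 \<subseteq> G}" using C unfolding subset_chain_def graph_def by blast
  qed
  then obtain M where M: "graph M" "G0 \<subseteq> M" "\<And>X. graph X \<Longrightarrow> M \<subseteq> X \<Longrightarrow> X = M" by auto
  have "\<exists>a. (x, a) \<in> M" for x
  proof (rule ccontr)
    assume "\<nexists>a. (x, a) \<in> M"
    then obtain G' where "graph G'" "M \<subset> G'" using graph_extend[OF M(1)] by blast
    then show False using M(3) by blast
  qed
  then show ?thesis using M graph_fun[OF M(1)] by blast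
qed

end

theorem Hahn_Banach_separation:
  fixes x :: "'a::real_normed_vector"
  assumes "x \<noteq> 0"
  obtains \<phi> :: "'a \<Rightarrow> real" where "bounded_linear \<phi>" "\<phi> x \<noteq> 0"
proof -
  interpret sublinear_functional "norm :: 'a \<Rightarrow> real" by standard (auto simp: norm_triangle_ineq)
  have "graph (range (\<lambda>t. (t *\<^sub>R x, t * norm x)))"
    unfolding graph_def
  proof
    have "linear (\<lambda>t::real. (t *\<^sub>R x, t * norm x))" by (rule linearI) (auto simp: algebra_simps)
    then show "subspace (range (\<lambda>t. (t *\<^sub>R x, t * norm x)))" by (rule linear_subspace_image) simp
    show "\<forall>(y, a)\<in>range (\<lambda>t. (t *\<^sub>R x, t * norm x)). a \<le> norm y"
      by (auto intro!: mult_right_mono)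
  qed
  from Hahn_Banach_graph[OF this] obtain G where
    *: "graph G \<and> range (\<lambda>t. (t *\<^sub>R x, t * norm x)) \<subseteq> G \<and> (\<forall>y. \<exists>!a. (y, a) \<in> G)" ..
  note G = *[THEN conjunct1] *[THEN conjunct2, THEN conjunct1] *[THEN conjunct2, THEN conjunct2]
  define \<phi> where "\<phi> y = (THE a. (y, a) \<in> G)" for y
  have g: "(y, \<phi> y) \<in> G" for y unfolding \<phi>_def by (rule theI'[OF G(3)[rule_format]])
  have u: "(y, a) \<in> G \<Longrightarrow> \<phi> y = a" for y a using graph_fun[OF G(1) g] .
  have s: "subspace G" and le: "\<And>y. \<phi> y \<le> norm y" using G(1) g unfolding graph_def by auto
  have add: "\<phi> (y + z) = \<phi> y + \<phi> z" for y z using subspace_add[OF s g g, of y z] by (intro u) simp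
  have scl: "\<phi> (k *\<^sub>R y) = k * \<phi> y" for k y using subspace_scale[OF s g, of k y] by (intro u) simp
  have "bounded_linear \<phi>"
  proof (rule bounded_linear_intro[where K = 1])
    show "norm (\<phi> y) \<le> norm y * 1" for y
      using le[of y] le[of "- y"] scl[of "-1" y] by simp
  qed (auto simp: add scl)
  moreover have "\<phi> x = norm x" using G(2) by (intro u) (auto intro!: image_eqI[of _ _ 1])
  ultimately show ?thesis using that assms by simp
qed

lemma eq_by_functionals:
  fixes x y :: "'a::real_normed_vector"
  assumes "\<And>\<phi> :: 'a \<Rightarrow> real. bounded_linear \<phi> \<Longrightarrow> \<phi> x = \<phi> y"
  shows "x = y"
proof (rule ccontr)
  assume "x \<noteq> y"
  then obtain \<phi> :: "'a \<Rightarrow> real" where "bounded_linear \<phi>" "\<phi> (x - y) \<noteq> 0" using Hahn_Banach_separation[of "x - y"] by auto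
  then show False using assms[of \<phi>] by (simp add: linear_diff bounded_linear.linear)
qed

section \<open>Contour integrals with values in a complexified Banach space\<close>

text \<open>
  The pair \<open>(a, b)\<close> stands for \<open>a + i b\<close> in the complexification of a real space; this is the multiplication by a complex number.
\<close>

definition cscale :: "complex \<Rightarrow> 'a \<times> 'a \<Rightarrow> 'a::real_vector \<times> 'a" where
  "cscale c X = (Re c *\<^sub>R fst X - Im c *\<^sub>R snd X, Re c *\<^sub>R snd X + Im c *\<^sub>R fst X)"

lemma bounded_bilinear_cscale: "bounded_bilinear (cscale :: complex \<Rightarrow> 'a \<times> 'a \<Rightarrow> 'a::real_normed_vector \<times> 'a)"
proof
  show "\<exists>K. \<forall>a b. norm (cscale a (b :: 'a \<times> 'a)) \<le> norm a * norm b * K"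
  proof (intro exI allI)
    fix a :: complex and b :: "'a \<times> 'a"
    have b: "norm (fst b) \<le> norm b" "norm (snd b) \<le> norm b" using norm_fst_le[of "fst b" "snd b"] norm_snd_le[of "snd b" "fst b"] by simp_all
    have a: "\<bar>Re a\<bar> \<le> norm a" "\<bar>Im a\<bar> \<le> norm a" by (auto simp: abs_Re_le_cmod abs_Im_le_cmod)
    have *: "norm (Re a *\<^sub>R u) \<le> norm a * norm b" "norm (Im a *\<^sub>R u) \<le> norm a * norm b" if "norm u \<le> norm b" for u :: 'a
      using a that by (auto intro!: mult_mono)
    have "norm (cscale a b) \<le> norm (fst (cscale a b)) + norm (snd (cscale a b))"
      using norm_Pair_le[of "fst (cscale a b)" "snd (cscale a b)"] by simp
    also have "\<dots> \<le> (norm a * norm b + norm a * norm b) + (norm a * norm b + norm a * norm b)"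
      unfolding cscale_def fst_conv snd_conv
      by (intro add_mono order.trans[OF norm_triangle_ineq4] order.trans[OF norm_triangle_ineq] * b)
    finally show "norm (cscale a b) \<le> norm a * norm b * 4" by simp
  qed
qed (auto simp: cscale_def algebra_simps)

lemma cscale_cscale: "cscale a (cscale b X) = cscale (a * b) X"
  by (auto simp: cscale_def algebra_simps)

text \<open>
  The complex-linear extension of a real functional. A pair is determined by the values of all of these.
\<close>

definition cfun :: "('a \<Rightarrow> real) \<Rightarrow> 'a \<times> 'a \<Rightarrow> complex" where
  "cfun \<phi> X = Complex (\<phi> (fst X)) (\<phi> (snd X))"

lemma bounded_linear_cfun:
  assumes "bounded_linear \<phi>"
  shows "bounded_linear (cfun \<phi>)"
proof -
  interpret bounded_linear \<phi> by fact
  have "bounded_linear (\<lambda>X. of_real (\<phi> (fst X)) + \<i> * of_real (\<phi> (snd X)) :: complex)"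
    by (intro bounded_linear_add bounded_linear_const_mult
        bounded_linear_compose[OF bounded_linear_of_real] bounded_linear_compose[OF assms] bounded_linear_fst bounded_linear_snd)
  also have "(\<lambda>X. of_real (\<phi> (fst X)) + \<i> * of_real (\<phi> (snd X))) = cfun \<phi>"
    by (auto simp: cfun_def complex_eq_iff)
  finally show ?thesis .
qed

lemma cfun_cscale: "bounded_linear \<phi> \<Longrightarrow> cfun \<phi> (cscale c X) = c * cfun \<phi> X"
  by (auto simp: cfun_def cscale_def complex_eq_iff linear_diff linear_add linear_scale bounded_linear.linear algebra_simps)

lemma eq_by_cfun:
  assumes "\<And>\<phi>. bounded_linear \<phi> \<Longrightarrow> cfun \<phi> X = cfun \<phi> Y"
  shows "X = Y"
proof -
  have "fst X = fst Y" "snd X = snd Y"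
    by (rule eq_by_functionals, drule assms, simp add: cfun_def)+
  then show ?thesis by (simp add: prod_eq_iff)
qed

definition weakly_holomorphic :: "(complex \<Rightarrow> 'a \<times> 'a::real_normed_vector) \<Rightarrow> complex set \<Rightarrow> bool" where
  "weakly_holomorphic h S \<longleftrightarrow> continuous_on S h \<and> (\<forall>\<phi>. bounded_linear \<phi> \<longrightarrow> (\<lambda>z. cfun \<phi> (h z)) holomorphic_on S)"

text \<open>
  Henstock-Kurzweil integrals are used since the derivative of a piecewise continuously differentiable path need not
  be bounded near the exceptional points.
\<close>

definition has_vcontour :: "(complex \<Rightarrow> 'a \<times> 'a::real_normed_vector) \<Rightarrow> 'a \<times> 'a \<Rightarrow> (real \<Rightarrow> complex) \<Rightarrow> bool" where
  "has_vcontour h I \<gamma> \<longleftrightarrow> ((\<lambda>t. cscale (vector_derivative \<gamma> (at t within {0..1})) (h (\<gamma> t))) has_integral I) {0..1}"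

lemma cfun_has_vcontour:
  assumes "has_vcontour h I \<gamma>" "bounded_linear \<phi>"
  shows "((\<lambda>z. cfun \<phi> (h z)) has_contour_integral cfun \<phi> I) \<gamma>"
  using has_integral_linear[OF assms(1)[unfolded has_vcontour_def] bounded_linear_cfun[OF assms(2)]]
  by (simp add: has_contour_integral_def o_def cfun_cscale[OF assms(2)] mult.commute)

text \<open>
  Integration along radii, as in the scalar case. That the integral over a triangle vanishes is tested by functionals.
\<close>

lemma local_primitive:
  fixes h :: "complex \<Rightarrow> 'a \<times> 'a::banach"
  assumes h: "weakly_holomorphic h (ball c r)"
  obtains H where "\<And>z. z \<in> ball c r \<Longrightarrow> (H has_derivative (\<lambda>d. cscale d (h z))) (at z)"
proof -
  have cont: "continuous_on (ball c r) h" using h by (simp add: weakly_holomorphic_def)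
  define J where "J w z = integral {0..1} (\<lambda>t. cscale (z - w) (h (linepath w z t)))" for w z
  have seg: "closed_segment w z \<subseteq> ball c r" if "w \<in> ball c r" "z \<in> ball c r" for w z
    using that by (simp add: closed_segment_subset)
  have J: "((\<lambda>t. cscale (z - w) (h (linepath w z t))) has_integral J w z) {0..1}" if wz: "w \<in> ball c r" "z \<in> ball c r" for w z
  proof -
    have "continuous_on {0..1} (\<lambda>t. h (linepath w z t))"
      by (rule continuous_on_compose2[OF cont])
         (use seg[OF wz] in \<open>auto simp: path_image_linepath[symmetric] path_image_def simp del: path_image_linepath intro!: continuous_on_linepath\<close>)
    then have "continuous_on {0..1} (\<lambda>t. cscale (z - w) (h (linepath w z t)))"
      by (intro bounded_bilinear.continuous_on[OF bounded_bilinear_cscale] continuous_on_const)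
    then show ?thesis unfolding J_def by (simp add: integrable_continuous_interval integrable_integral)
  qed
  then have Jv: "has_vcontour h (J w z) (linepath w z)" if "w \<in> ball c r" "z \<in> ball c r" for w z
    using that unfolding has_vcontour_def
    by (auto intro!: has_integral_eq[OF _ J] simp: vector_derivative_linepath_within)
  have tri: "J c z - J c w = J w z" if wz: "w \<in> ball c r" "z \<in> ball c r" for w z
  proof (rule eq_by_cfun)
    fix \<phi> :: "'a \<Rightarrow> real" assume \<phi>: "bounded_linear \<phi>"
    have c: "c \<in> ball c r" using wz(1) by (auto intro: le_less_trans[OF zero_le_dist])
    have hol: "(\<lambda>z. cfun \<phi> (h z)) holomorphic_on ball c r" using h \<phi> by (simp add: weakly_holomorphic_def)
    have "convex hull {c, w, z} \<subseteq> ball c r" using wz c by (intro hull_minimal) auto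
    then have "((\<lambda>z. cfun \<phi> (h z)) has_contour_integral 0) (linepath c w +++ linepath w z +++ linepath z c)"
      by (intro Cauchy_theorem_triangle holomorphic_on_subset[OF hol])
    moreover have e: "contour_integral (linepath w z) (\<lambda>z. cfun \<phi> (h z)) = cfun \<phi> (J w z)"
       "(\<lambda>z. cfun \<phi> (h z)) contour_integrable_on linepath w z"
      if "w \<in> ball c r" "z \<in> ball c r" for w z
      using cfun_has_vcontour[OF Jv[OF that] \<phi>] by (auto simp: contour_integral_unique has_contour_integral_integrable)
    ultimately have "cfun \<phi> (J c w) + (cfun \<phi> (J w z) + cfun \<phi> (J z c)) = 0"
      using wz c by (auto dest!: contour_integral_unique simp: contour_integral_join)
    moreover have "cfun \<phi> (J z c) = - cfun \<phi> (J c z)"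
      using e wz c contour_integral_reverse_linepath[of z c "\<lambda>z. cfun \<phi> (h z)"]
        continuous_on_subset[OF holomorphic_on_imp_continuous_on[OF hol] seg[OF wz(2) c]] by simp
    ultimately have "cfun \<phi> (J c z) - cfun \<phi> (J c w) = cfun \<phi> (J w z)" by algebra
    then show "cfun \<phi> (J c z - J c w) = cfun \<phi> (J w z)"
      by (simp only: linear_diff[OF bounded_linear.linear[OF bounded_linear_cfun[OF \<phi>]]])
  qed
  obtain K where K: "\<And>a b. norm (cscale a (b :: 'a \<times> 'a)) \<le> norm a * norm b * K" "K > 0"
    using bounded_bilinear.pos_bounded[OF bounded_bilinear_cscale] by blast
  have "(J c has_derivative (\<lambda>d. cscale d (h w))) (at w)" if w: "w \<in> ball c r" for w
    unfolding has_derivative_at_alt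
  proof (intro conjI allI impI)
    show "bounded_linear (\<lambda>d. cscale d (h w))" by (rule bounded_bilinear.bounded_linear_left[OF bounded_bilinear_cscale])
    fix e :: real assume e: "e > 0"
    then have eK: "e / K > 0" using K by simp
    obtain r' where r': "r' > 0" "ball w r' \<subseteq> ball c r" using w open_ball openE by metis
    obtain d where d: "d > 0" "\<And>z. z \<in> ball c r \<Longrightarrow> dist z w < d \<Longrightarrow> dist (h z) (h w) < e / K"
      using cont w eK unfolding continuous_on_iff by metis
    show "\<exists>d>0. \<forall>y. norm (y - w) < d \<longrightarrow> norm (J c y - J c w - cscale (y - w) (h w)) \<le> e * norm (y - w)"
    proof (intro exI[of _ "min d r'"] conjI allI impI)
      show "min d r' > 0" using d r' by simp
      fix y assume y: "norm (y - w) < min d r'"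
      then have yb: "y \<in> ball c r" using r' by (auto simp: dist_norm norm_minus_commute)
      have "((\<lambda>t. cscale (y - w) (h (linepath w y t)) - cscale (y - w) (h w)) has_integral (J w y - cscale (y - w) (h w))) {0..1}"
        using has_integral_diff[OF J[OF w yb] has_integral_const_real[of "cscale (y - w) (h w)" 0 1]] by simp
      moreover have "norm (cscale (y - w) (h (linepath w y t)) - cscale (y - w) (h w)) \<le> e * norm (y - w)" if "t \<in> {0..1}" for t
      proof -
        have "linepath w y t \<in> closed_segment w y" using that by (auto simp: linepath_def closed_segment_def)
        then have "linepath w y t \<in> ball c r" "dist (linepath w y t) w < d"
          using seg[OF w yb] y segment_bound(1)[of "linepath w y t" w y] by (auto simp: dist_norm)
        then have "norm (h (linepath w y t) - h w) \<le> e / K" using d(2) by (fastforce simp: dist_norm)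
        then have "norm (y - w) * norm (h (linepath w y t) - h w) * K \<le> norm (y - w) * (e / K) * K"
          using K by (intro mult_right_mono mult_left_mono) auto
        then show ?thesis
          unfolding bounded_bilinear.diff_right[OF bounded_bilinear_cscale, symmetric]
          using K(1)[of "y - w" "h (linepath w y t) - h w"] K(2) by (simp add: mult.commute)
      qed
      ultimately have "norm (J w y - cscale (y - w) (h w)) \<le> e * norm (y - w)"
        using e has_integral_bound_real[where S = "{}" and B = "e * norm (y - w)" and a = 0 and b = 1
            and f = "\<lambda>t. cscale (y - w) (h (linepath w y t)) - cscale (y - w) (h w)"] by simp
      then show "norm (J c y - J c w - cscale (y - w) (h w)) \<le> e * norm (y - w)"
        using tri[OF w yb] by simp
    qed
  qed
  then show ?thesis using that by blast
qed

text \<open>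
  Locally the integrand is the derivative of a primitive along the path, except at finitely
  many parameters, so the fundamental theorem of calculus gives integrability on short intervals, and compactness
  gives it on the whole interval.
\<close>

lemma vcontour_integrable:
  fixes h :: "complex \<Rightarrow> 'a \<times> 'a::banach"
  assumes h: "weakly_holomorphic h S" and S: "open S" and \<gamma>: "valid_path \<gamma>" "path_image \<gamma> \<subseteq> S"
  shows "\<exists>I. has_vcontour h I \<gamma>"
proof -
  obtain B where B: "finite B" "\<And>t. t \<in> {0..1} - B \<Longrightarrow> \<gamma> differentiable (at t)" and cont: "continuous_on {0..1} \<gamma>"
    using \<gamma>(1) unfolding valid_path_def piecewise_C1_differentiable_on_def C1_differentiable_on_eq by auto
  let ?g = "\<lambda>t. cscale (vector_derivative \<gamma> (at t within {0..1})) (h (\<gamma> t))"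
  have loc: "\<exists>d>0. \<forall>a b. a \<le> b \<longrightarrow> {a..b} \<subseteq> {0..1} \<inter> ball t d \<longrightarrow> ?g integrable_on {a..b}" if t: "t \<in> {0..1}" for t
  proof -
    have "\<gamma> t \<in> S" using t \<gamma>(2) by (auto simp: path_image_def)
    then obtain r where r: "r > 0" "ball (\<gamma> t) r \<subseteq> S" using S openE by blast
    have "weakly_holomorphic h (ball (\<gamma> t) r)"
      using h r unfolding weakly_holomorphic_def by (meson continuous_on_subset holomorphic_on_subset)
    then obtain H where H: "\<And>z. z \<in> ball (\<gamma> t) r \<Longrightarrow> (H has_derivative (\<lambda>d. cscale d (h z))) (at z)"
      by (rule local_primitive) blast
    obtain d where d: "d > 0" "\<And>s. s \<in> {0..1} \<Longrightarrow> dist s t < d \<Longrightarrow> dist (\<gamma> s) (\<gamma> t) < r"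
      using cont t r(1) unfolding continuous_on_iff by metis
    have "?g integrable_on {a..b}" if ab: "a \<le> b" "{a..b} \<subseteq> {0..1} \<inter> ball t d" for a b
    proof -
      have im: "\<gamma> s \<in> ball (\<gamma> t) r" if "s \<in> {a..b}" for s
        using d(2)[of s] that ab(2) by (auto simp: dist_commute subset_iff)
      have "(?g has_integral (H (\<gamma> b) - H (\<gamma> a))) {a..b}"
      proof (rule fundamental_theorem_of_calculus_interior_strong[OF B(1) ab(1), of "\<lambda>s. H (\<gamma> s)"])
        show "continuous_on {a..b} (\<lambda>s. H (\<gamma> s))"
        proof (rule continuous_on_compose2[of "ball (\<gamma> t) r"])
          show "continuous_on (ball (\<gamma> t) r) H"
            by (intro continuous_at_imp_continuous_on ballI has_derivative_continuous[OF H])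
          show "continuous_on {a..b} \<gamma>" using cont ab(2) by (meson continuous_on_subset le_inf_iff)
        qed (use im in auto)
        fix s assume s: "s \<in> {a<..<b} - B"
        then have s1: "0 < s" "s < 1" "s \<in> {a..b}" using ab(2) by (auto simp: subset_iff)
          (metis atLeastAtMost_iff ab(1) le_less_trans less_imp_le linorder_not_le ab(2) order_refl Int_iff subsetD)+
        have "(\<gamma> has_vector_derivative vector_derivative \<gamma> (at s)) (at s)"
          using B(2)[of s] s s1 by (auto simp: vector_derivative_works)
        then have "((\<lambda>s. H (\<gamma> s)) has_derivative (\<lambda>k. cscale (k *\<^sub>R vector_derivative \<gamma> (at s)) (h (\<gamma> s)))) (at s)"
          using has_derivative_compose[of \<gamma> "\<lambda>k. k *\<^sub>R vector_derivative \<gamma> (at s)" s UNIV H "\<lambda>d. cscale d (h (\<gamma> s))"]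
            H[OF im[OF s1(3)]] unfolding has_vector_derivative_def by blast
        then have "((\<lambda>s. H (\<gamma> s)) has_vector_derivative cscale (vector_derivative \<gamma> (at s)) (h (\<gamma> s))) (at s)"
          unfolding has_vector_derivative_def
          by (simp add: bounded_bilinear.scaleR_left[OF bounded_bilinear_cscale])
        moreover have "vector_derivative \<gamma> (at s within {0..1}) = vector_derivative \<gamma> (at s)"
          using s1 at_within_interior[of s "{0..1}"] by simp
        ultimately show "((\<lambda>s. H (\<gamma> s)) has_vector_derivative ?g s) (at s)" by simp
      qed
      then show ?thesis by blast
    qed
    then show ?thesis using d(1) by blast
  qed
  then have "\<forall>t\<in>{0..1}. \<exists>d. d > 0 \<and> (\<forall>a b. a \<le> b \<longrightarrow> {a..b} \<subseteq> {0..1} \<inter> ball t d \<longrightarrow> ?g integrable_on {a..b})"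
    by blast
  from bchoice[OF this] obtain d where dd: "\<forall>t\<in>{0..1}. d t > 0 \<and>
     (\<forall>a b. a \<le> b \<longrightarrow> {a..b} \<subseteq> {0..1} \<inter> ball t (d t) \<longrightarrow> ?g integrable_on {a..b})" ..
  have d: "d t > 0" "a \<le> b \<Longrightarrow> {a..b} \<subseteq> {0..1} \<inter> ball t (d t) \<Longrightarrow> ?g integrable_on {a..b}"
    if "t \<in> {0..1}" for t a b using dd that by blast+
  define d' where "d' t = (if t \<in> {0..1} then d t else 1)" for t
  have "gauge (\<lambda>t. ball t (d' t))" using d(1) by (intro gauge_ball_dependent) (auto simp: d'_def)
  then obtain p where p: "p tagged_division_of cbox 0 (1::real)" "(\<lambda>t. ball t (d' t)) fine p"
    using fine_division_exists by blast
  have "?g integrable_on {0..1}"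
  proof (rule integrable_combine_division)
    show "(snd ` p) division_of {0..1}" using division_of_tagged_division[OF p(1)] by simp
    fix i assume "i \<in> snd ` p"
    then obtain t where t: "(t, i) \<in> p" by auto
    then have ti: "t \<in> i" "i \<subseteq> cbox 0 1" "i \<subseteq> ball t (d' t)" "\<exists>a b. i = cbox a b"
      using p by (auto simp: tagged_division_of fine_def)
    then obtain a b where i: "i = {a..b}" by auto
    then show "?g integrable_on i" using d(2)[of t a b] ti by (auto simp: d'_def subset_iff)
  qed
  then show ?thesis unfolding has_vcontour_def by blast
qed

section \<open>The Cauchy theorem for systems of closed curves\<close>

lemma contour_integral_sum_list:
  assumes "\<And>x. x \<in> set xs \<Longrightarrow> h x contour_integrable_on \<gamma>"
  shows "(\<lambda>w. \<Sum>x\<leftarrow>xs. h x w) contour_integrable_on \<gamma> \<and>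
    contour_integral \<gamma> (\<lambda>w. \<Sum>x\<leftarrow>xs. h x w) = (\<Sum>x\<leftarrow>xs. contour_integral \<gamma> (h x))"
  using assms
proof (induction xs)
  case (Cons x xs)
  then show ?case by (simp add: contour_integrable_add contour_integral_add)
qed (simp add: contour_integrable_on_def, metis has_contour_integral_0)

lemma sum_list_swap: "(\<Sum>x\<leftarrow>xs. \<Sum>y\<leftarrow>ys. h x y) = (\<Sum>y\<leftarrow>ys. \<Sum>x\<leftarrow>xs. h x (y::'b) :: 'a::comm_monoid_add)"
  by (induction xs) (auto simp: sum_list_addf)

lemma sum_list_neutral: "(\<And>x. x \<in> set xs \<Longrightarrow> x = 0) \<Longrightarrow> sum_list xs = (0::'a::monoid_add)"
  by (induction xs) auto

text \<open>
  Let \<open>K\<close> consist of the curves and all points with nonzero total winding number. It is a compact subset of \<open>S\<close>, so there is a region \<open>W\<close> around it with a Cauchy formula. Inserting the formula for \<open>f\<close> and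
  interchanging the integrals leaves, at each point of the boundary of \<open>W\<close>, the total winding number as a factor,
  which is zero there.
\<close>

lemma Cauchy_theorem_cycle_smooth:
  assumes S: "open S" and f: "f holomorphic_on S"
    and \<Gamma>: "\<And>\<gamma>. \<gamma> \<in> set \<Gamma> \<Longrightarrow> valid_path \<gamma> \<and> pathfinish \<gamma> = pathstart \<gamma> \<and> path_image \<gamma> \<subseteq> S"
    and smooth: "\<And>\<gamma>. \<gamma> \<in> set \<Gamma> \<Longrightarrow> continuous_on {0..1} (\<lambda>t. vector_derivative \<gamma> (at t))"
    and zero: "\<And>w. w \<notin> S \<Longrightarrow> (\<Sum>\<gamma>\<leftarrow>\<Gamma>. winding_number \<gamma> w) = 0"
  shows "(\<Sum>\<gamma>\<leftarrow>\<Gamma>. contour_integral \<gamma> f) = 0"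
proof -
  define P where "P = (\<Union>\<gamma>\<in>set \<Gamma>. path_image \<gamma>)"
  define n where "n w = (\<Sum>\<gamma>\<leftarrow>\<Gamma>. winding_number \<gamma> w)" for w
  define K where "K = - {w \<in> - P. n w = 0}"
  have path: "path \<gamma>" if "\<gamma> \<in> set \<Gamma>" for \<gamma> using \<Gamma>[OF that] valid_path_imp_path by blast
  have P: "compact P" unfolding P_def using path by (intro compact_UN) (auto simp: compact_path_image)
  have "open {w \<in> - P. n w = 0}"
  proof -
    \<comment> \<open>Being integer-valued and continuous, \<open>n\<close> vanishes in a neighbourhood of each of its zeros.\<close>
    have int: "n w \<in> \<int>" if "w \<notin> P" for w
    proof -
      have "\<forall>\<gamma>\<in>set \<Gamma>. winding_number \<gamma> w \<in> \<int>"
        using \<open>w \<notin> P\<close> \<Gamma> path by (auto simp: P_def intro!: integer_winding_number)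
      then show ?thesis unfolding n_def by (induction \<Gamma>) auto
    qed
    have "continuous_on (- P) n"
    proof -
      have "\<forall>\<gamma>\<in>set \<Gamma>. continuous_on (- P) (winding_number \<gamma>)"
      proof
        fix \<gamma> assume g: "\<gamma> \<in> set \<Gamma>"
        show "continuous_on (- P) (winding_number \<gamma>)"
          by (rule continuous_on_subset[OF continuous_on_winding_number[OF path[OF g]]]) (use g in \<open>auto simp: P_def\<close>)
      qed
      then show ?thesis unfolding n_def by (induction \<Gamma>) (auto intro!: continuous_intros)
    qed
    then have "open (- P \<inter> n -` ball 0 1)"
      using P by (intro continuous_open_preimage) (auto simp: compact_imp_closed open_Compl)
    also have eq: "- P \<inter> n -` ball 0 1 = {w \<in> - P. n w = 0}"
    proof -
    have "n w = 0" if w: "n w \<in> \<int>" "norm (n w) < 1" for w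
    proof -
      obtain k where "n w = of_int k" using w(1) by (elim Ints_cases)
      then show ?thesis using w(2) by simp
    qed
    then show ?thesis using int by auto
    qed
    finally show ?thesis .
  qed
  then have "closed K" by (simp add: K_def closed_def)
  moreover have "bounded K"
  proof -
    have "\<exists>B. \<forall>z. B \<le> norm z \<longrightarrow> winding_number \<gamma> z = 0" if "\<gamma> \<in> set \<Gamma>" for \<gamma>
      using winding_number_zero_at_infinity[OF path[OF that]] \<Gamma>[OF that] by auto
    then obtain B where B: "\<And>\<gamma> z. \<gamma> \<in> set \<Gamma> \<Longrightarrow> B \<gamma> \<le> norm z \<Longrightarrow> winding_number \<gamma> z = 0" by metis
    obtain C where C: "\<And>z. z \<in> P \<Longrightarrow> norm z \<le> C" using P compact_imp_bounded bounded_iff by metis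
    define D where "D = Max (insert C (B ` set \<Gamma>))"
    have D: "C \<le> D" "\<And>\<gamma>. \<gamma> \<in> set \<Gamma> \<Longrightarrow> B \<gamma> \<le> D" by (auto simp: D_def)
    have "norm z \<le> D" if "z \<in> K" for z
    proof (rule ccontr)
      assume nz: "\<not> norm z \<le> D"
      then have "z \<notin> P" using C D(1) by force
      moreover have "n z = 0" unfolding n_def
      proof (rule sum_list_neutral)
        show "x = 0" if "x \<in> set (map (\<lambda>\<gamma>. winding_number \<gamma> z) \<Gamma>)" for x
          using that B D(2) nz by force
      qed
      ultimately show False using that by (simp add: K_def)
    qed
    then show ?thesis by (auto simp: bounded_iff)
  qed
  ultimately have K: "compact K" by (simp add: compact_eq_bounded_closed)
  have "P \<subseteq> S" using \<Gamma> by (auto simp: P_def)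
  then have KS: "K \<subseteq> S" using zero by (auto simp: K_def n_def)
  obtain W E where W: "K \<subseteq> W" "closure W \<subseteq> S" "open W"
    and fr: "frontier W = (\<Union>(a, b)\<in>set E. closed_segment a b)"
    and formula: "\<And>f w. f holomorphic_on S \<Longrightarrow> w \<in> W \<Longrightarrow>
       (\<Sum>(a, b)\<leftarrow>E. contour_integral (linepath a b) (\<lambda>z. f z / (z - w))) = 2 * pi * \<i> * f w"
    by (rule exists_Cauchy_region[OF K S KS]) (rule that; assumption)
  define I where "I x w = contour_integral (linepath (fst x) (snd x)) (\<lambda>z. f z / (z - w))" for x w
  have seg: "closed_segment (fst x) (snd x) \<subseteq> S - K" if "x \<in> set E" for x
  proof -
    have "closed_segment (fst x) (snd x) \<subseteq> frontier W" using that fr by (force simp: case_prod_beta)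
    then show ?thesis using W by (auto simp: frontier_def interior_open)
  qed
  have hol: "I x holomorphic_on - closed_segment (fst x) (snd x)" if "x \<in> set E" for x
    unfolding I_def using seg[OF that] f
    by (intro linepath_Cauchy_kernel continuous_on_subset[OF holomorphic_on_imp_continuous_on]) auto
  have PK: "P \<subseteq> K" by (auto simp: K_def)
  have img: "path_image \<gamma> \<subseteq> - closed_segment (fst x) (snd x)" if "x \<in> set E" "\<gamma> \<in> set \<Gamma>" for x \<gamma>
    using seg[OF that(1)] that(2) PK by (auto simp: P_def)
  have int: "I x contour_integrable_on \<gamma>" if "x \<in> set E" "\<gamma> \<in> set \<Gamma>" for x \<gamma>
    using \<Gamma>[OF that(2)] img[OF that] by (intro contour_integrable_holomorphic_simple[OF hol[OF that(1)]]) auto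
  have "contour_integral \<gamma> f = 1 / (2 * pi * \<i>) * (\<Sum>x\<leftarrow>E. contour_integral \<gamma> (I x))" if g: "\<gamma> \<in> set \<Gamma>" for \<gamma>
  proof -
    have "contour_integral \<gamma> f = contour_integral \<gamma> (\<lambda>w. 1 / (2 * pi * \<i>) * (\<Sum>x\<leftarrow>E. I x w))"
    proof (rule contour_integral_eq)
      fix w assume "w \<in> path_image \<gamma>"
      then have "w \<in> W" using g PK W by (auto simp: P_def)
      then show "f w = 1 / (2 * pi * \<i>) * (\<Sum>x\<leftarrow>E. I x w)"
        using formula[OF f, unfolded case_prod_unfold] by (simp add: I_def)
    qed
    then show ?thesis
      using contour_integral_sum_list[of E I \<gamma>] int g by (simp add: contour_integral_div)
  qed
  then have "map (\<lambda>\<gamma>. contour_integral \<gamma> f) \<Gamma> = map (\<lambda>\<gamma>. 1 / (2 * pi * \<i>) * (\<Sum>x\<leftarrow>E. contour_integral \<gamma> (I x))) \<Gamma>"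
    by simp
  then have "(\<Sum>\<gamma>\<leftarrow>\<Gamma>. contour_integral \<gamma> f) = 1 / (2 * pi * \<i>) * (\<Sum>\<gamma>\<leftarrow>\<Gamma>. \<Sum>x\<leftarrow>E. contour_integral \<gamma> (I x))"
    by (simp only: sum_list_const_mult)
  also have "\<dots> = 1 / (2 * pi * \<i>) * (\<Sum>x\<leftarrow>E. \<Sum>\<gamma>\<leftarrow>\<Gamma>. contour_integral \<gamma> (I x))"
    by (subst sum_list_swap) rule
  also have "(\<Sum>x\<leftarrow>E. \<Sum>\<gamma>\<leftarrow>\<Gamma>. contour_integral \<gamma> (I x)) = 0"
  proof (rule sum_list_neutral)
    fix y assume "y \<in> set (map (\<lambda>x. \<Sum>\<gamma>\<leftarrow>\<Gamma>. contour_integral \<gamma> (I x)) E)"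
    then obtain x where x: "x \<in> set E" and y: "y = (\<Sum>\<gamma>\<leftarrow>\<Gamma>. contour_integral \<gamma> (I x))" by auto
    let ?l = "linepath (fst x) (snd x)"
    let ?h = "\<lambda>\<gamma> z. contour_integral \<gamma> (\<lambda>w. f z / (z - w))"
    \<comment> \<open>After the interchange, the inner integral is a winding number.\<close>
    have eq: "?h \<gamma> z = - f z * (2 * pi * \<i> * winding_number \<gamma> z)"
      if "\<gamma> \<in> set \<Gamma>" "z \<in> closed_segment (fst x) (snd x)" for \<gamma> z
    proof -
      have z: "z \<notin> path_image \<gamma>" using img[OF x that(1)] that(2) by blast
      have "?h \<gamma> z = contour_integral \<gamma> (\<lambda>w. - f z * (1 / (w - z)))"
        by (rule contour_integral_eq) (simp add: minus_divide_right)
      also have "\<dots> = - f z * contour_integral \<gamma> (\<lambda>w. 1 / (w - z))"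
        using z \<Gamma>[OF that(1)]
        by (intro contour_integral_lmul contour_integrable_inversediff) auto
      finally show ?thesis using \<Gamma>[OF that(1)] z by (simp add: winding_number_valid_path)
    qed
    have sw: "contour_integral \<gamma> (I x) = contour_integral ?l (?h \<gamma>)" if g: "\<gamma> \<in> set \<Gamma>" for \<gamma>
      unfolding I_def
    proof (rule contour_integral_swap)
      have "continuous_on (closed_segment (fst x) (snd x)) f"
        using seg[OF x] f by (intro continuous_on_subset[OF holomorphic_on_imp_continuous_on]) auto
      then have "continuous_on (path_image \<gamma> \<times> closed_segment (fst x) (snd x)) (\<lambda>p. f (snd p))"
        by (rule continuous_on_compose2) (auto intro!: continuous_intros)
      then show "continuous_on (path_image \<gamma> \<times> path_image ?l) (\<lambda>(w, z). f z / (z - w))"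
        using img[OF x g] unfolding case_prod_beta by (auto intro!: continuous_intros)
    qed (use \<Gamma>[OF g] smooth[OF g] in auto)
    have hint: "?h \<gamma> contour_integrable_on ?l" if g: "\<gamma> \<in> set \<Gamma>" for \<gamma>
    proof -
      have "continuous_on (closed_segment (fst x) (snd x)) (\<lambda>z. - f z * (2 * pi * \<i> * winding_number \<gamma> z))"
        using img[OF x g] seg[OF x]
        by (intro continuous_intros continuous_on_subset[OF holomorphic_on_imp_continuous_on[OF f]]
           continuous_on_subset[OF continuous_on_winding_number[OF path[OF g]]]) auto
      then have "continuous_on (closed_segment (fst x) (snd x)) (?h \<gamma>)"
        by (rule continuous_on_eq) (simp add: eq[OF g])
      then show ?thesis by (rule contour_integrable_continuous_linepath)
    qed
    have "y = (\<Sum>\<gamma>\<leftarrow>\<Gamma>. contour_integral ?l (?h \<gamma>))" unfolding y using sw by (simp cong: map_cong)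
    also have "\<dots> = contour_integral ?l (\<lambda>z. \<Sum>\<gamma>\<leftarrow>\<Gamma>. ?h \<gamma> z)"
      using contour_integral_sum_list[of \<Gamma> ?h ?l] hint by simp
    also have "\<dots> = 0"
    proof (rule contour_integral_eq_0)
      fix z assume z: "z \<in> path_image ?l"
      have "map (\<lambda>\<gamma>. ?h \<gamma> z) \<Gamma> = map (\<lambda>\<gamma>. - f z * (2 * pi * \<i>) * winding_number \<gamma> z) \<Gamma>"
        using eq z by simp
      then have "(\<Sum>\<gamma>\<leftarrow>\<Gamma>. ?h \<gamma> z) = - f z * (2 * pi * \<i>) * n z"
        by (simp only: sum_list_const_mult n_def)
      moreover have "n z = 0" using seg[OF x] z by (auto simp: K_def)
      ultimately show "(\<Sum>\<gamma>\<leftarrow>\<Gamma>. ?h \<gamma> z) = 0" by simp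
    qed
    finally show "y = 0" .
  qed
  finally show ?thesis by simp
qed

text \<open>
  Interchanging two contour integrals requires continuously differentiable paths. Polynomial loops near the given
  ones have the same integrals of holomorphic functions, in particular the same winding numbers.
\<close>

theorem Cauchy_theorem_cycle:
  assumes S: "open S" and f: "f holomorphic_on S"
    and \<Gamma>: "\<And>\<gamma>. \<gamma> \<in> set \<Gamma> \<Longrightarrow> valid_path \<gamma> \<and> pathfinish \<gamma> = pathstart \<gamma> \<and> path_image \<gamma> \<subseteq> S"
    and zero: "\<And>w. w \<notin> S \<Longrightarrow> (\<Sum>\<gamma>\<leftarrow>\<Gamma>. winding_number \<gamma> w) = 0"
  shows "(\<Sum>\<gamma>\<leftarrow>\<Gamma>. contour_integral \<gamma> f) = 0"
proof -
  have "\<exists>p. valid_path p \<and> pathfinish p = pathstart p \<and> path_image p \<subseteq> S \<and>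
      continuous_on {0..1} (\<lambda>t. vector_derivative p (at t)) \<and>
      (\<forall>h. h holomorphic_on S \<longrightarrow> contour_integral p h = contour_integral \<gamma> h)" if g: "\<gamma> \<in> set \<Gamma>" for \<gamma>
  proof -
    have path: "path \<gamma>" using \<Gamma>[OF g] valid_path_imp_path by blast
    obtain d where d: "d > 0" "\<And>g h. valid_path g \<and> valid_path h \<and>
                    (\<forall>t \<in> {0..1}. norm(g t - \<gamma> t) < d \<and> norm(h t - \<gamma> t) < d) \<and>
                    pathfinish g = pathstart g \<and> pathfinish h = pathstart h
                    \<Longrightarrow> path_image g \<subseteq> S \<and> path_image h \<subseteq> S \<and>
                        (\<forall>f. f holomorphic_on S \<longrightarrow> contour_integral h f = contour_integral g f)"
      using contour_integral_nearby_loops[OF S path] \<Gamma>[OF g] by metis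
    obtain p where p: "polynomial_function p" "pathstart p = pathstart \<gamma>" "pathfinish p = pathfinish \<gamma>"
      "\<And>t. t \<in> {0..1} \<Longrightarrow> norm (p t - \<gamma> t) < d"
      using path_approx_polynomial_function[OF path d(1)] by metis
    obtain p' where p': "polynomial_function p'" "\<And>t. (p has_vector_derivative p' t) (at t)"
      using has_vector_derivative_polynomial_function[OF p(1)] by metis
    have "(\<lambda>t. vector_derivative p (at t)) = p'" using vector_derivative_at[OF p'(2)] by blast
    then have "continuous_on {0..1} (\<lambda>t. vector_derivative p (at t))"
      using continuous_on_polymonial_function[OF p'(1)] by (simp only:)
    moreover have "valid_path p" using p(1) by (rule valid_path_polynomial_function)
    ultimately show ?thesis
      using d(2)[of \<gamma> p] p \<Gamma>[OF g] d(1) by (intro exI[of _ p]) auto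
  qed
  then obtain p where p: "\<And>\<gamma>. \<gamma> \<in> set \<Gamma> \<Longrightarrow> valid_path (p \<gamma>) \<and> pathfinish (p \<gamma>) = pathstart (p \<gamma>) \<and> path_image (p \<gamma>) \<subseteq> S \<and>
      continuous_on {0..1} (\<lambda>t. vector_derivative (p \<gamma>) (at t)) \<and>
      (\<forall>h. h holomorphic_on S \<longrightarrow> contour_integral (p \<gamma>) h = contour_integral \<gamma> h)"
    by metis
  have "(\<Sum>\<gamma>\<leftarrow>map p \<Gamma>. contour_integral \<gamma> f) = 0"
  proof (rule Cauchy_theorem_cycle_smooth[OF S f])
    fix w assume w: "w \<notin> S"
    have "winding_number (p \<gamma>) w = winding_number \<gamma> w" if g: "\<gamma> \<in> set \<Gamma>" for \<gamma>
    proof -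
      have "(\<lambda>z. 1 / (z - w)) holomorphic_on S" using w by (intro holomorphic_intros) auto
      then have "contour_integral (p \<gamma>) (\<lambda>z. 1 / (z - w)) = contour_integral \<gamma> (\<lambda>z. 1 / (z - w))"
        using p[OF g] by blast
      moreover have "w \<notin> path_image \<gamma>" "w \<notin> path_image (p \<gamma>)" using w p[OF g] \<Gamma>[OF g] by auto
      ultimately show ?thesis using p[OF g] \<Gamma>[OF g] by (simp add: winding_number_valid_path)
    qed
    then show "(\<Sum>\<gamma>\<leftarrow>map p \<Gamma>. winding_number \<gamma> w) = 0"
      using zero[OF w] by (simp add: o_def cong: map_cong)
  qed (use p in auto)
  moreover have "(\<Sum>\<gamma>\<leftarrow>map p \<Gamma>. contour_integral \<gamma> f) = (\<Sum>\<gamma>\<leftarrow>\<Gamma>. contour_integral \<gamma> f)"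
    using p f by (simp add: o_def cong: map_cong)
  ultimately show ?thesis by simp
qed

lemma boundary_curvesD:
  assumes "boundary_curves \<Gamma> W" "\<gamma> \<in> set \<Gamma>"
  shows "valid_path \<gamma>" "path \<gamma>" "pathfinish \<gamma> = pathstart \<gamma>" "path_image \<gamma> \<subseteq> frontier W"
  using assms valid_path_imp_path unfolding boundary_curves_def by auto

lemma boundary_curves_winding:
  assumes "boundary_curves \<Gamma> W"
  shows "z \<in> W \<Longrightarrow> (\<Sum>\<gamma>\<leftarrow>\<Gamma>. winding_number \<gamma> z) = 1"
    "z \<notin> closure W \<Longrightarrow> (\<Sum>\<gamma>\<leftarrow>\<Gamma>. winding_number \<gamma> z) = 0"
  using assms unfolding boundary_curves_def by blast+

text \<open>
  The first system together with the reversed second one has total winding number zero about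
  the points of \<open>K\<close> (one minus one) and about the points outside \<open>D\<close> (zero minus zero).
\<close>

lemma boundary_integral_unique:
  assumes \<Gamma>: "boundary_curves \<Gamma> W" "open W" "K \<subseteq> W" "closure W \<subseteq> D"
    and \<Gamma>': "boundary_curves \<Gamma>' W'" "open W'" "K \<subseteq> W'" "closure W' \<subseteq> D"
    and h: "h holomorphic_on D - K" "open (D - K)"
  shows "(\<Sum>\<gamma>\<leftarrow>\<Gamma>. contour_integral \<gamma> h) = (\<Sum>\<gamma>\<leftarrow>\<Gamma>'. contour_integral \<gamma> h)"
proof -
  have fr: "frontier W \<subseteq> D - K" "frontier W' \<subseteq> D - K"
    using \<Gamma>(2-4) \<Gamma>'(2-4) by (auto simp: frontier_def interior_open)
  have wn: "(\<Sum>\<gamma>\<leftarrow>\<Gamma>. winding_number \<gamma> w) = (\<Sum>\<gamma>\<leftarrow>\<Gamma>'. winding_number \<gamma> w)" if "w \<notin> D - K" for w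
  proof (cases "w \<in> K")
    case True
    then show ?thesis
      using boundary_curves_winding(1)[OF \<Gamma>(1)] boundary_curves_winding(1)[OF \<Gamma>'(1)] \<Gamma>(3) \<Gamma>'(3) by (metis subsetD)
  next
    case False
    then have "w \<notin> closure W" "w \<notin> closure W'" using that \<Gamma>(4) \<Gamma>'(4) by auto
    then show ?thesis
      using boundary_curves_winding(2)[OF \<Gamma>(1)] boundary_curves_winding(2)[OF \<Gamma>'(1)] by metis
  qed
  have "(\<Sum>\<gamma>\<leftarrow>\<Gamma> @ map reversepath \<Gamma>'. contour_integral \<gamma> h) = 0"
  proof (rule Cauchy_theorem_cycle[OF h(2,1)])
    show "valid_path \<gamma> \<and> pathfinish \<gamma> = pathstart \<gamma> \<and> path_image \<gamma> \<subseteq> D - K" if "\<gamma> \<in> set (\<Gamma> @ map reversepath \<Gamma>')" for \<gamma>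
      using that boundary_curvesD[OF \<Gamma>(1)] boundary_curvesD[OF \<Gamma>'(1)] fr by fastforce
    fix w assume w: "w \<notin> D - K"
    have "winding_number (reversepath \<gamma>) w = - winding_number \<gamma> w" if "\<gamma> \<in> set \<Gamma>'" for \<gamma>
      using boundary_curvesD[OF \<Gamma>'(1) that] fr w by (intro winding_number_reversepath) auto
    then show "(\<Sum>\<gamma>\<leftarrow>\<Gamma> @ map reversepath \<Gamma>'. winding_number \<gamma> w) = 0"
      using wn[OF w] by (simp add: o_def uminus_sum_list_map[unfolded o_def, symmetric] cong: map_cong)
  qed
  moreover have "contour_integral (reversepath \<gamma>) h = - contour_integral \<gamma> h" if "\<gamma> \<in> set \<Gamma>'" for \<gamma>
    using boundary_curvesD[OF \<Gamma>'(1) that] by (simp add: contour_integral_reversepath)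
  ultimately show ?thesis
    by (simp add: o_def uminus_sum_list_map[unfolded o_def, symmetric] cong: map_cong)
qed

text \<open>
  Conjugating the curves reverses their orientation, so they cancel the original system up to homology
  and \<open>I + cnj I = 0\<close> for the value \<open>I\<close> of the integral.
\<close>

lemma boundary_integral_cnj:
  assumes \<Gamma>: "boundary_curves \<Gamma> W" "open W" "K \<subseteq> W" "closure W \<subseteq> D"
    and sym: "\<And>z. z \<in> W \<Longrightarrow> cnj z \<in> W" "\<And>z. z \<in> K \<Longrightarrow> cnj z \<in> K" "\<And>z. z \<in> D \<Longrightarrow> cnj z \<in> D"
    and h: "h holomorphic_on D - K" "open (D - K)" "\<And>z. z \<in> D - K \<Longrightarrow> h (cnj z) = cnj (h z)"
  shows "Re (\<Sum>\<gamma>\<leftarrow>\<Gamma>. contour_integral \<gamma> h) = 0"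
proof -
  have fr: "frontier W \<subseteq> D - K"
    using \<Gamma>(2-4) by (auto simp: frontier_def interior_open)
  have symc: "cnj z \<in> D - K" if "z \<in> D - K" for z using sym(2,3)[of "cnj z"] sym(3)[of z] that by auto
  have wn: "(\<Sum>\<gamma>\<leftarrow>\<Gamma>. winding_number \<gamma> (cnj w)) = (\<Sum>\<gamma>\<leftarrow>\<Gamma>. winding_number \<gamma> w) \<and> (\<Sum>\<gamma>\<leftarrow>\<Gamma>. winding_number \<gamma> w) \<in> \<real>"
    if w: "w \<notin> D - K" for w
  proof (cases "w \<in> K")
    case True
    then have "w \<in> W" "cnj w \<in> W" using \<Gamma>(3) sym(1) by auto
    then show ?thesis by (simp add: boundary_curves_winding(1)[OF \<Gamma>(1)])
  next
    case False
    then have "w \<notin> D" using w by auto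
    then have "w \<notin> closure W" "cnj w \<notin> closure W" using \<Gamma>(4) sym(3)[of "cnj w"] by auto
    then show ?thesis by (simp add: boundary_curves_winding(2)[OF \<Gamma>(1)])
  qed
  have "(\<Sum>\<gamma>\<leftarrow>\<Gamma> @ map ((\<circ>) cnj) \<Gamma>. contour_integral \<gamma> h) = 0"
  proof (rule Cauchy_theorem_cycle[OF h(2,1)])
    show "valid_path \<gamma> \<and> pathfinish \<gamma> = pathstart \<gamma> \<and> path_image \<gamma> \<subseteq> D - K" if g: "\<gamma> \<in> set (\<Gamma> @ map ((\<circ>) cnj) \<Gamma>)" for \<gamma>
    proof -
      consider "\<gamma> \<in> set \<Gamma>" | \<delta> where "\<gamma> = cnj \<circ> \<delta>" "\<delta> \<in> set \<Gamma>"
        using g unfolding set_append set_map by blast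
      then show ?thesis
      proof cases
        case 1
        then show ?thesis using boundary_curvesD[OF \<Gamma>(1) 1] fr by auto
      next
        case 2
        have "path_image \<delta> \<subseteq> D - K" using boundary_curvesD[OF \<Gamma>(1) 2(2)] fr by auto
        then have "path_image \<gamma> \<subseteq> D - K" unfolding 2(1) path_image_compose using symc by blast
        then show ?thesis using boundary_curvesD[OF \<Gamma>(1) 2(2)]
          by (simp add: 2(1) valid_path_cnj pathstart_compose pathfinish_compose)
      qed
    qed
    fix w assume w: "w \<notin> D - K"
    then have cw: "cnj w \<notin> D - K" using symc[of "cnj w"] by auto
    have "winding_number (cnj \<circ> \<gamma>) w = - cnj (winding_number \<gamma> (cnj w))" if "\<gamma> \<in> set \<Gamma>" for \<gamma>
      using boundary_curvesD[OF \<Gamma>(1) that] fr cw winding_number_cnj[of \<gamma> "cnj w"] by auto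
    then have "(\<Sum>\<gamma>\<leftarrow>map ((\<circ>) cnj) \<Gamma>. winding_number \<gamma> w) = - cnj (\<Sum>\<gamma>\<leftarrow>\<Gamma>. winding_number \<gamma> (cnj w))"
      by (induction \<Gamma>) auto
    then show "(\<Sum>\<gamma>\<leftarrow>\<Gamma> @ map ((\<circ>) cnj) \<Gamma>. winding_number \<gamma> w) = 0"
      using wn[OF w] by (simp add: Reals_cnj_iff)
  qed
  moreover have "contour_integral (cnj \<circ> \<gamma>) h = cnj (contour_integral \<gamma> h)" if g: "\<gamma> \<in> set \<Gamma>" for \<gamma>
  proof -
    have "contour_integral \<gamma> (cnj \<circ> h \<circ> cnj) = contour_integral \<gamma> h"
      using boundary_curvesD[OF \<Gamma>(1) g] fr h(3) by (intro contour_integral_eq) auto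
    then show ?thesis using boundary_curvesD[OF \<Gamma>(1) g] by (simp add: contour_integral_cnj)
  qed
  then have "(\<Sum>\<gamma>\<leftarrow>map ((\<circ>) cnj) \<Gamma>. contour_integral \<gamma> h) = cnj (\<Sum>\<gamma>\<leftarrow>\<Gamma>. contour_integral \<gamma> h)"
    by (induction \<Gamma>) auto
  ultimately show ?thesis by (simp add: complex_eq_iff)
qed

section \<open>Composition of bounded operators\<close>

lemma blinfun_compose_assoc: "(a o\<^sub>L b) o\<^sub>L c = a o\<^sub>L (b o\<^sub>L c)"
  by (rule blinfun_eqI) simp

lemma blinfun_compose_id [simp]: "id_blinfun o\<^sub>L a = a" "a o\<^sub>L id_blinfun = a"
  by (rule blinfun_eqI, simp)+

lemmas compose_simps =
  bounded_bilinear.add_left[OF bounded_bilinear_blinfun_compose] bounded_bilinear.add_right[OF bounded_bilinear_blinfun_compose]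
  bounded_bilinear.diff_left[OF bounded_bilinear_blinfun_compose] bounded_bilinear.diff_right[OF bounded_bilinear_blinfun_compose]
  bounded_bilinear.minus_left[OF bounded_bilinear_blinfun_compose] bounded_bilinear.minus_right[OF bounded_bilinear_blinfun_compose]
  bounded_bilinear.zero_left[OF bounded_bilinear_blinfun_compose] bounded_bilinear.zero_right[OF bounded_bilinear_blinfun_compose]
  bounded_bilinear.scaleR_left[OF bounded_bilinear_blinfun_compose] bounded_bilinear.scaleR_right[OF bounded_bilinear_blinfun_compose]

lemmas compose_sum = bounded_bilinear.sum_left[OF bounded_bilinear_blinfun_compose]
  bounded_bilinear.sum_right[OF bounded_bilinear_blinfun_compose]

lemmas bounded_linear_compose_left = bounded_bilinear.bounded_linear_left[OF bounded_bilinear_blinfun_compose]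
lemmas bounded_linear_compose_right = bounded_bilinear.bounded_linear_right[OF bounded_bilinear_blinfun_compose]

section \<open>The Clifford algebra\<close>

lemma bounded_bilinear_cmult: "bounded_bilinear ((\<odot>) :: 'n::{finite,linorder} clifford \<Rightarrow> _)"
  unfolding bilinear_conv_bounded_bilinear[symmetric] bilinear_def cmult_def
  by (auto intro!: linearI simp: algebra_simps sum.distrib scaleR_sum_right)

lemmas cmult_simps [simp] =
  bounded_bilinear.add_left[OF bounded_bilinear_cmult] bounded_bilinear.add_right[OF bounded_bilinear_cmult]
  bounded_bilinear.diff_left[OF bounded_bilinear_cmult] bounded_bilinear.diff_right[OF bounded_bilinear_cmult]
  bounded_bilinear.minus_left[OF bounded_bilinear_cmult] bounded_bilinear.minus_right[OF bounded_bilinear_cmult]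
  bounded_bilinear.scaleR_left[OF bounded_bilinear_cmult] bounded_bilinear.scaleR_right[OF bounded_bilinear_cmult]
  bounded_bilinear.zero_left[OF bounded_bilinear_cmult] bounded_bilinear.zero_right[OF bounded_bilinear_cmult]

lemmas cmult_sum_left = bounded_bilinear.sum_left[OF bounded_bilinear_cmult]
lemmas cmult_sum_right = bounded_bilinear.sum_right[OF bounded_bilinear_cmult]

lemma clifford_expansion: "x = (\<Sum>A\<in>UNIV. (x $ A) *\<^sub>R cbasis A)"
  by (simp add: cbasis_def vec_eq_iff axis_def if_distrib[of "(*) _"] cong: if_cong)

lemma clifford_linear_eqI:
  fixes f g :: "'n::finite clifford \<Rightarrow> 'b::real_vector"
  assumes "linear f" "linear g" "\<And>A. f (cbasis A) = g (cbasis A)"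
  shows "f x = g x"
proof -
  have "f x = (\<Sum>A\<in>UNIV. (x $ A) *\<^sub>R f (cbasis A))"
    by (subst clifford_expansion[of x]) (simp add: linear_sum[OF assms(1)] linear_scale[OF assms(1)])
  also have "\<dots> = g x"
    by (subst (2) clifford_expansion[of x]) (simp add: linear_sum[OF assms(2)] linear_scale[OF assms(2)] assms(3))
  finally show ?thesis .
qed

text \<open>
  In this form the sign is multiplicative in both arguments with respect to symmetric differences,
  which yields associativity of the product.
\<close>

lemma csign_prod:
  "csign A B = (\<Prod>a\<in>A. \<Prod>b\<in>B. if b \<le> a then - 1 else 1)"
proof -
  have "csign A B = (\<Prod>p\<in>{p \<in> A \<times> B. snd p \<le> fst p}. - 1)"
    by (auto simp: csign_def intro!: arg_cong[where f = "\<lambda>S. (- 1) ^ card S"])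
  also have "\<dots> = (\<Prod>p\<in>A \<times> B. if snd p \<le> fst p then - 1 else 1)"
    by (rule prod.inter_filter) simp
  also have "\<dots> = (\<Prod>a\<in>A. \<Prod>b\<in>B. if b \<le> a then - 1 else 1)"
    by (simp add: prod.cartesian_product case_prod_beta)
  finally show ?thesis .
qed

lemma prod_sym_diff:
  fixes f :: "'n::finite \<Rightarrow> real"
  assumes "\<And>a. f a * f a = 1"
  shows "prod f (sym_diff A B) = prod f A * prod f B"
proof -
  have "prod f A = prod f (A - B) * prod f (A \<inter> B)" "prod f B = prod f (B - A) * prod f (A \<inter> B)"
    using prod.Int_Diff[of A f B] prod.Int_Diff[of B f A] by (simp_all add: Int_commute mult.commute)
  moreover have "prod f (A \<inter> B) * prod f (A \<inter> B) = 1"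
    by (simp add: assms flip: prod.distrib)
  moreover have "prod f (sym_diff A B) = prod f (A - B) * prod f (B - A)"
    by (intro prod.union_disjoint) auto
  ultimately show ?thesis by algebra
qed

lemma csign_sym_diff_left: "csign (sym_diff A B) C = csign A C * csign B C"
  unfolding csign_prod by (rule prod_sym_diff) (auto simp flip: prod.distrib intro!: prod.neutral)

lemma csign_sym_diff_right: "csign C (sym_diff A B) = csign C A * csign C B"
  unfolding csign_prod by (subst prod_sym_diff) (auto simp: prod.distrib)

lemma csign_empty [simp]: "csign {} A = 1" "csign A {} = 1"
  by (simp_all add: csign_prod)

lemma sym_diff_assoc: "sym_diff (sym_diff A B) C = sym_diff A (sym_diff B C)"
  by blast

lemma cmult_assoc:
  fixes x y z :: "'n::{finite,linorder} clifford"
  shows "(x \<odot> y) \<odot> z = x \<odot> (y \<odot> z)"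
proof -
  have 1: "(cbasis A \<odot> cbasis B) \<odot> cbasis C = cbasis A \<odot> (cbasis B \<odot> cbasis C)" for A B C :: "'n set"
    by (simp add: cbasis_mult csign_sym_diff_left csign_sym_diff_right sym_diff_assoc del: Un_Diff)
  have 2: "(cbasis A \<odot> cbasis B) \<odot> z = cbasis A \<odot> (cbasis B \<odot> z)" for A B and z :: "'n clifford"
    by (rule clifford_linear_eqI[where x = z]) (auto intro!: linearI simp: 1)
  have 3: "(cbasis A \<odot> y) \<odot> z = cbasis A \<odot> (y \<odot> z)" for A and y z :: "'n clifford"
    by (rule clifford_linear_eqI[where x = y]) (auto intro!: linearI simp: 2)
  show ?thesis
    by (rule clifford_linear_eqI[where x = x]) (auto intro!: linearI simp: 3)
qed

lemma cmult_one [simp]: "cbasis {} \<odot> x = x" "x \<odot> cbasis {} = x"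
  by (rule clifford_linear_eqI[where x = x], auto intro!: linearI simp: cbasis_mult)+

lemma imag_unit_sum: "imag_unit j = (\<Sum>i\<in>UNIV. (j $ i) *\<^sub>R cbasis {i})"
  by (simp add: imag_unit_def para_def)

lemma para_eq: "para x = fst x *\<^sub>R cbasis {} + imag_unit (snd x)"
  by (simp add: imag_unit_sum para_def)

lemma imag_unit_linear [simp]:
  "imag_unit (r *\<^sub>R j) = r *\<^sub>R imag_unit j" "imag_unit (- j) = - imag_unit j" "imag_unit 0 = 0"
  by (simp_all add: imag_unit_sum scaleR_sum_right sum_negf)

lemma imag_unit_square: "imag_unit j \<odot> imag_unit j = - ((norm j)\<^sup>2 *\<^sub>R cbasis {})"
proof -
  let ?e = "\<lambda>i. cbasis {i}"
  have e: "?e i \<odot> ?e k + ?e k \<odot> ?e i = (if i = k then - cbasis {} - cbasis {} else 0)" for i k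
    using cbasis_generators_anticommute[of i k] cbasis_generator_square[of i] by auto
  have S: "imag_unit j \<odot> imag_unit j = (\<Sum>i\<in>UNIV. \<Sum>k\<in>UNIV. (j $ i * j $ k) *\<^sub>R (?e i \<odot> ?e k))"
    by (simp add: imag_unit_sum cmult_sum_left cmult_sum_right scaleR_sum_right)
       (subst sum.swap, simp add: mult.commute)
  also have "\<dots> = (\<Sum>i\<in>UNIV. \<Sum>k\<in>UNIV. (j $ i * j $ k) *\<^sub>R (?e k \<odot> ?e i))"
    by (subst sum.swap) (simp add: mult.commute)
  finally have "2 *\<^sub>R (imag_unit j \<odot> imag_unit j) =
     (\<Sum>i\<in>UNIV. \<Sum>k\<in>UNIV. (j $ i * j $ k) *\<^sub>R (?e i \<odot> ?e k + ?e k \<odot> ?e i))"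
    unfolding scaleR_2 by (subst (1) S) (simp add: sum.distrib scaleR_add_right)
  also have "\<dots> = (\<Sum>i\<in>UNIV. (j $ i * j $ i) *\<^sub>R (- cbasis {} - cbasis {}))"
    unfolding e by (simp add: if_distrib[of "scaleR _"] cong: if_cong)
  also have "\<dots> = (norm j)\<^sup>2 *\<^sub>R (- cbasis {} - cbasis {})"
    by (simp only: scaleR_sum_left[symmetric] power2_norm_eq_inner inner_vec_def inner_real_def)
  also have "\<dots> = 2 *\<^sub>R (- ((norm j)\<^sup>2 *\<^sub>R cbasis {}))"
    by (simp only: scaleR_2) (simp add: scaleR_diff_right)
  finally have "2 *\<^sub>R (imag_unit j \<odot> imag_unit j) = 2 *\<^sub>R (- ((norm j)\<^sup>2 *\<^sub>R cbasis {}))" .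
  then show ?thesis by (simp only: real_vector.scale_cancel_left) simp
qed

lemma imag_unit_square_unit: "j \<in> \<S> \<Longrightarrow> imag_unit j \<odot> imag_unit j = - cbasis {}"
  by (simp add: imag_unit_square unit_vectors_def)

lemma imag_unit_twice:
  assumes "j \<in> \<S>"
  shows "imag_unit j \<odot> (imag_unit j \<odot> x) = - x" "(x \<odot> imag_unit j) \<odot> imag_unit j = - x"
  using imag_unit_square_unit[OF assms] by (simp_all add: cmult_assoc flip: cmult_assoc[of _ _ x])

section \<open>Clifford operators\<close>

lemma vec_axis_expansion: "v = (\<Sum>B\<in>UNIV. axis B (v $ B))"
  by (simp add: vec_eq_iff axis_def)

text \<open>
  An operator on \<open>V\<^sub>n\<close> is determined by its values on the vectors \<open>w e\<^sub>B\<close>.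
\<close>

lemma cop_eqI:
  fixes X Y :: "('v::real_normed_vector, 'n::finite) cop"
  assumes "\<And>B w. blinfun_apply X (axis B w) = blinfun_apply Y (axis B w)"
  shows "X = Y"
proof (rule blinfun_eqI)
  fix v
  show "blinfun_apply X v = blinfun_apply Y v"
    by (subst (1 2) vec_axis_expansion[of v]) (simp add: blinfun.sum_right assms)
qed

lemma axis_linear: "axis B (x + y) = axis B x + axis B y" "axis B (r *\<^sub>R x) = r *\<^sub>R axis B x"
  "axis B (- x) = - axis B x" "axis B (x - y) = axis B x - (axis B y :: 'a::real_vector ^ 'n::finite)"
  by (auto simp: vec_eq_iff axis_def)

lemma cop_of_axis:
  "blinfun_apply (cop_of T) (axis B w) = (\<Sum>A\<in>UNIV. axis (sym_diff A B) (csign A B *\<^sub>R blinfun_apply (T A) w))"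
proof -
  have "(\<Sum>C\<in>UNIV. axis (sym_diff A C) (csign A C *\<^sub>R blinfun_apply (T A) (axis B w $ C)))
     = (\<Sum>C\<in>UNIV. if C = B then axis (sym_diff A B) (csign A B *\<^sub>R blinfun_apply (T A) w) else 0)" for A
    by (intro sum.cong) (auto simp: axis_def vec_eq_iff)
  then show ?thesis by (simp add: blinfun_apply_cop_of cop_fun_def)
qed

lemma cop_of_linear:
  "cop_of (\<lambda>A. S A + T A) = cop_of S + cop_of T" "cop_of (\<lambda>A. r *\<^sub>R T A) = r *\<^sub>R cop_of T"
  by (rule cop_eqI, simp add: cop_of_axis blinfun.bilinear_simps axis_linear scaleR_add_right sum.distrib scaleR_sum_right
      mult.commute)+

lemma linear_lmul: "linear lmul"
  unfolding lmul_def by (rule linearI) (simp_all add: scaleR_add_left cop_of_linear flip: scaleR_scaleR)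

lemmas lmul_linear_simps = linear_add[OF linear_lmul] linear_scale[OF linear_lmul] linear_neg[OF linear_lmul]
  linear_diff[OF linear_lmul] linear_sum[OF linear_lmul] linear_0[OF linear_lmul]

lemma lmul_cbasis_axis: "blinfun_apply (lmul (cbasis A)) (axis B w) = axis (sym_diff A B) (csign A B *\<^sub>R w)"
proof -
  have "(\<Sum>C\<in>UNIV. axis (sym_diff C B) (csign C B *\<^sub>R blinfun_apply ((cbasis A $ C) *\<^sub>R id_blinfun) w))
     = (\<Sum>C\<in>UNIV. if C = A then axis (sym_diff A B) (csign A B *\<^sub>R w) else 0)"
    by (intro sum.cong) (auto simp: cbasis_def axis_def vec_eq_iff blinfun.bilinear_simps)
  then show ?thesis unfolding lmul_def cop_of_axis by simp
qed

lemma lmul_one: "lmul (cbasis {}) = id_blinfun"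
  by (rule cop_eqI) (simp add: lmul_cbasis_axis)

lemma lmul_cmult: "lmul (a \<odot> b) = lmul a o\<^sub>L (lmul b :: ('v::real_normed_vector, 'n::{finite,linorder}) cop)"
proof -
  have 1: "lmul (cbasis A \<odot> cbasis B) = lmul (cbasis A) o\<^sub>L (lmul (cbasis B) :: ('v, 'n) cop)" for A B
    by (rule cop_eqI)
       (simp add: cbasis_mult lmul_linear_simps blinfun.bilinear_simps lmul_cbasis_axis axis_linear csign_sym_diff_left
          csign_sym_diff_right sym_diff_assoc mult_ac del: Un_Diff)
  have 2: "lmul (cbasis A \<odot> b) = lmul (cbasis A) o\<^sub>L (lmul b :: ('v, 'n) cop)" for A b
    by (rule clifford_linear_eqI[where x = b]) (auto intro!: linearI simp: 1 lmul_linear_simps compose_simps)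
  show ?thesis
    by (rule clifford_linear_eqI[where x = a]) (auto intro!: linearI simp: 2 lmul_linear_simps compose_simps)
qed

text \<open>
  The multiplication of vectors by \<open>e\<^sub>C\<close> from the right.
\<close>

definition rmul_basis :: "'n::{finite,linorder} set \<Rightarrow> ('v::real_normed_vector, 'n) cop" where
  "rmul_basis C = Blinfun (\<lambda>v. \<Sum>A\<in>UNIV. axis (sym_diff A C) (csign A C *\<^sub>R (v $ A)))"

lemma rmul_basis_axis:
  fixes w :: "'v::real_normed_vector" and B C :: "'n::{finite,linorder} set"
  shows "blinfun_apply (rmul_basis C) (axis B w) = axis (sym_diff B C) (csign B C *\<^sub>R w)"
proof -
  have "bounded_linear (\<lambda>v::'v ^ ('n set). \<Sum>A\<in>UNIV. axis (sym_diff A C) (csign A C *\<^sub>R (v $ A)))"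
    by (intro bounded_linear_sum bounded_linear_compose[OF bounded_linear_axis]
      bounded_linear_const_scaleR bounded_linear_vec_nth)
  then have "blinfun_apply (rmul_basis C) (axis B w) = (\<Sum>A\<in>UNIV. axis (sym_diff A C) (csign A C *\<^sub>R (axis B w $ A)))"
    unfolding rmul_basis_def by (simp add: bounded_linear_Blinfun_apply)
  also have "\<dots> = (\<Sum>A\<in>UNIV. if A = B then axis (sym_diff B C) (csign B C *\<^sub>R w) else 0)"
    by (intro sum.cong) (auto simp: axis_def vec_eq_iff)
  finally show ?thesis by simp
qed

text \<open>
  An operator that commutes with all right multiplications is determined by its values on the vectors \<open>w\<close> in \<open>V\<close>, and
  the coefficients of these values are the components \<open>T\<^sub>A\<close>. In this form it is evident that the Clifford operators
  contain the inverses of their elements, so that the S-resolvent set only asks for an inverse among all bounded operators.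
\<close>

lemma clifford_operators_commutant:
  fixes X :: "('v::real_normed_vector, 'n::{finite,linorder}) cop"
  shows "X \<in> clifford_operators \<longleftrightarrow> (\<forall>C. X o\<^sub>L rmul_basis C = rmul_basis C o\<^sub>L X)"
proof
  assume "X \<in> clifford_operators"
  then obtain T where T: "X = cop_of T" by (auto simp: clifford_operators_def)
  show "\<forall>C. X o\<^sub>L rmul_basis C = rmul_basis C o\<^sub>L X"
    by (intro allI cop_eqI)
       (simp add: T rmul_basis_axis cop_of_axis blinfun.bilinear_simps axis_linear csign_sym_diff_left
         csign_sym_diff_right sym_diff_assoc mult_ac blinfun.sum_right scaleR_sum_right del: Un_Diff)
next
  assume X: "\<forall>C. X o\<^sub>L rmul_basis C = rmul_basis C o\<^sub>L X"
  define T :: "'n set \<Rightarrow> 'v \<Rightarrow>\<^sub>L 'v" where "T A = Blinfun (\<lambda>w. blinfun_apply X (axis {} w) $ A)" for A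
  have T: "blinfun_apply (T A) w = blinfun_apply X (axis {} w) $ A" for A w
    unfolding T_def
    by (subst bounded_linear_Blinfun_apply)
       (auto intro!: bounded_linear_compose[OF bounded_linear_vec_nth] bounded_linear_compose[OF blinfun.bounded_linear_right]
         bounded_linear_axis)
  have "X = cop_of T"
  proof (rule cop_eqI)
    fix B :: "'n set" and w :: 'v
    have "axis B w = blinfun_apply (rmul_basis B) (axis {} w)" by (simp add: rmul_basis_axis)
    then have "blinfun_apply X (axis B w) = blinfun_apply (X o\<^sub>L rmul_basis B) (axis {} w)" by simp
    also have "\<dots> = blinfun_apply (rmul_basis B) (blinfun_apply X (axis {} w))" using X by simp
    also have "\<dots> = blinfun_apply (rmul_basis B) (\<Sum>A\<in>UNIV. axis A (blinfun_apply (T A) w))"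
      by (subst vec_axis_expansion[of "blinfun_apply X (axis {} w)"]) (simp add: T)
    also have "\<dots> = blinfun_apply (cop_of T) (axis B w)"
      by (simp add: blinfun.sum_right rmul_basis_axis cop_of_axis)
    finally show "blinfun_apply X (axis B w) = blinfun_apply (cop_of T) (axis B w)" .
  qed
  then show "X \<in> clifford_operators" by (simp add: clifford_operators_def)
qed

lemma clifford_operators_inverse:
  assumes "X \<in> clifford_operators" "X o\<^sub>L Y = id_blinfun" "Y o\<^sub>L X = id_blinfun"
  shows "Y \<in> clifford_operators"
  unfolding clifford_operators_commutant
proof
  fix C
  have "Y o\<^sub>L rmul_basis C = Y o\<^sub>L rmul_basis C o\<^sub>L (X o\<^sub>L Y)" using assms by simp
  also have "\<dots> = Y o\<^sub>L (rmul_basis C o\<^sub>L X) o\<^sub>L Y" by (simp add: blinfun_compose_assoc)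
  also have "\<dots> = Y o\<^sub>L (X o\<^sub>L rmul_basis C) o\<^sub>L Y" using assms(1) by (simp add: clifford_operators_commutant)
  also have "\<dots> = (Y o\<^sub>L X) o\<^sub>L rmul_basis C o\<^sub>L Y" by (simp add: blinfun_compose_assoc)
  finally show "Y o\<^sub>L rmul_basis C = rmul_basis C o\<^sub>L Y" using assms by simp
qed

lemma cop_invertible_iff:
  assumes "X \<in> clifford_operators"
  shows "cop_invertible X \<longleftrightarrow> (\<exists>Y. X o\<^sub>L Y = id_blinfun \<and> Y o\<^sub>L X = id_blinfun)"
  using clifford_operators_inverse[OF assms] by (auto simp: cop_invertible_def)

lemma cop_inverse:
  assumes "cop_invertible X"
  shows "X o\<^sub>L cop_inverse X = id_blinfun" "cop_inverse X o\<^sub>L X = id_blinfun"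
proof -
  \<comment> \<open>The definite description in \<open>cop_inverse\<close> is justified by the uniqueness of inverses.\<close>
  have u: "Y = Y'" if "X o\<^sub>L Y = id_blinfun" "Y' o\<^sub>L X = id_blinfun" for Y Y'
  proof -
    have "Y = (Y' o\<^sub>L X) o\<^sub>L Y" using that by simp
    also have "\<dots> = Y' o\<^sub>L (X o\<^sub>L Y)" by (simp only: blinfun_compose_assoc)
    finally show ?thesis using that by simp
  qed
  have "\<exists>!Y. Y \<in> clifford_operators \<and> X o\<^sub>L Y = id_blinfun \<and> Y o\<^sub>L X = id_blinfun"
    using assms u unfolding cop_invertible_def by blast
  from theI'[OF this] show "X o\<^sub>L cop_inverse X = id_blinfun" "cop_inverse X o\<^sub>L X = id_blinfun"
    unfolding cop_inverse_def by auto
qed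

lemma Qop_clifford: "Qop s T \<in> clifford_operators"
proof -
  have "pop T \<in> clifford_operators" by (simp add: clifford_operators_def pop_def)
  then have c: "pop T o\<^sub>L rmul_basis C = rmul_basis C o\<^sub>L pop T" for C
    by (simp add: clifford_operators_commutant)
  have c2: "pop T o\<^sub>L pop T o\<^sub>L rmul_basis C = rmul_basis C o\<^sub>L (pop T o\<^sub>L pop T)" for C
  proof -
    have "pop T o\<^sub>L pop T o\<^sub>L rmul_basis C = pop T o\<^sub>L (rmul_basis C o\<^sub>L pop T)"
      by (simp only: blinfun_compose_assoc c)
    also have "\<dots> = rmul_basis C o\<^sub>L pop T o\<^sub>L pop T"
      by (simp only: blinfun_compose_assoc[symmetric] c)
    finally show ?thesis by (simp only: blinfun_compose_assoc)
  qed
  show ?thesis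
    unfolding clifford_operators_commutant Qop_def
    by (simp add: compose_simps c c2)
qed

lemma pop_conj_commute:
  fixes T :: "('v::real_normed_vector, 'n::{finite,linorder}) pvop"
  assumes "T \<in> BC01"
  shows "pop T o\<^sub>L pop (pop_conj T) = pop (pop_conj T) o\<^sub>L pop T"
proof -
  define D :: "('v, 'n) cop" where "D = cop_of (\<lambda>A. if A = {} then fst T else 0)"
  let ?S = "\<lambda>A. if A = {} then fst T else if \<exists>i. A = {i} then snd T $ (the_elem A) else 0"
  have D: "blinfun_apply D (axis B w) = axis B (blinfun_apply (fst T) w)" for B w
  proof -
    have "blinfun_apply D (axis B w) = (\<Sum>A\<in>(UNIV :: 'n set set). if A = {} then axis B (blinfun_apply (fst T) w) else 0)"
      unfolding D_def cop_of_axis by (rule sum.cong) (auto simp: axis_def vec_eq_iff)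
    then show ?thesis by simp
  qed
  have c: "blinfun_apply (fst T) (blinfun_apply (?S A) w) = blinfun_apply (?S A) (blinfun_apply (fst T) w)" for A w
  proof -
    have "fst T o\<^sub>L ?S A = ?S A o\<^sub>L fst T" using assms by (auto simp: BC01_def)
    then have "blinfun_apply (fst T o\<^sub>L ?S A) w = blinfun_apply (?S A o\<^sub>L fst T) w" by (rule arg_cong)
    then show ?thesis by (simp only: blinfun_apply_blinfun_compose)
  qed
  have D1: "D o\<^sub>L pop T = pop T o\<^sub>L D"
    by (rule cop_eqI) (simp only: blinfun_apply_blinfun_compose D pop_def cop_of_axis blinfun.sum_right blinfun.scaleR_right c)
  have D2: "pop (pop_conj T) = 2 *\<^sub>R D - pop T"
  proof -
    have "pop (pop_conj T) + pop T = cop_of (\<lambda>A. 2 *\<^sub>R (if A = {} then fst T else 0))"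
      unfolding pop_def cop_of_linear(1)[symmetric]
      by (rule arg_cong[where f = cop_of]) (auto simp: pop_conj_def scaleR_2)
    then show ?thesis by (simp add: cop_of_linear(2) D_def algebra_simps)
  qed
  show ?thesis unfolding D2
    by (simp add: compose_simps D1)
qed

section \<open>The resolvent of an operator on a real Banach space\<close>

text \<open>
  The geometric series.
\<close>

lemma Neumann_inverse:
  fixes Y :: "'b::banach \<Rightarrow>\<^sub>L 'b"
  assumes "norm Y < 1"
  shows "\<exists>Z. (id_blinfun - Y) o\<^sub>L Z = id_blinfun \<and> Z o\<^sub>L (id_blinfun - Y) = id_blinfun"
proof -
  define p where "p n = ((o\<^sub>L) Y ^^ n) id_blinfun" for n
  have p0: "p 0 = id_blinfun" and ps: "p (Suc n) = Y o\<^sub>L p n" for n by (simp_all add: p_def)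
  have comm: "p n o\<^sub>L Y = p (Suc n)" for n
    by (induction n) (simp_all add: ps p0 blinfun_compose_assoc)
  have nb: "norm (p n) \<le> norm Y ^ n" for n
  proof (induction n)
    case 0 show ?case by (simp add: p0 norm_blinfun_id_le)
  next
    case (Suc n)
    have "norm (p (Suc n)) \<le> norm Y * norm (p n)" unfolding ps by (rule norm_blinfun_compose)
    also have "\<dots> \<le> norm Y * norm Y ^ n" by (intro mult_left_mono Suc) auto
    finally show ?case by simp
  qed
  have "summable (\<lambda>n. norm Y ^ n)" using assms by (intro summable_geometric) auto
  then have mul: "summable p" by (rule summable_comparison_test'[where N = 0]) (use nb in auto)
  define Z where "Z = suminf p"
  have s: "Z = id_blinfun + (\<Sum>n. p (Suc n))" using suminf_split_head[OF mul] by (simp add: Z_def p0)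
  have "Y o\<^sub>L Z = (\<Sum>n. p (Suc n))"
    unfolding Z_def bounded_linear.suminf[OF bounded_linear_compose_right mul] ps ..
  moreover have "Z o\<^sub>L Y = (\<Sum>n. p (Suc n))"
    unfolding Z_def bounded_linear.suminf[OF bounded_linear_compose_left mul] comm ..
  ultimately have "Y o\<^sub>L Z = Z - id_blinfun" "Z o\<^sub>L Y = Z - id_blinfun" using s by simp_all
  then show ?thesis by (intro exI[of _ Z]) (simp add: compose_simps)
qed

definition is_inverse :: "('b::real_normed_vector \<Rightarrow>\<^sub>L 'b) \<Rightarrow> ('b \<Rightarrow>\<^sub>L 'b) \<Rightarrow> bool" where
  "is_inverse Q P \<longleftrightarrow> Q o\<^sub>L P = id_blinfun \<and> P o\<^sub>L Q = id_blinfun"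

lemma is_inverse_commute:
  assumes "is_inverse Q P" "Q o\<^sub>L C = C o\<^sub>L Q"
  shows "P o\<^sub>L C = C o\<^sub>L P"
proof -
  have "P o\<^sub>L C = P o\<^sub>L (C o\<^sub>L Q) o\<^sub>L P" using assms(1) by (simp add: is_inverse_def blinfun_compose_assoc)
  also have "\<dots> = (P o\<^sub>L Q) o\<^sub>L C o\<^sub>L P" by (simp only: assms(2)[symmetric] blinfun_compose_assoc)
  finally show ?thesis using assms(1) by (simp add: is_inverse_def)
qed

lemma is_inverse_open:
  fixes Q Q0 :: "'b::banach \<Rightarrow>\<^sub>L 'b"
  assumes "is_inverse Q0 P0" "norm (Q - Q0) * norm P0 < 1"
  shows "\<exists>P. is_inverse Q P"
proof -
  have n: "norm ((Q0 - Q) o\<^sub>L P0) < 1" "norm (P0 o\<^sub>L (Q0 - Q)) < 1"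
    using assms(2) norm_blinfun_compose[of "Q0 - Q" P0] norm_blinfun_compose[of P0 "Q0 - Q"]
    by (auto simp: norm_minus_commute mult.commute)
  obtain Z where Z: "(id_blinfun - ((Q0 - Q) o\<^sub>L P0)) o\<^sub>L Z = id_blinfun" using Neumann_inverse[OF n(1)] by blast
  obtain Z' where Z': "Z' o\<^sub>L (id_blinfun - (P0 o\<^sub>L (Q0 - Q))) = id_blinfun" using Neumann_inverse[OF n(2)] by blast
  have "id_blinfun - ((Q0 - Q) o\<^sub>L P0) = Q o\<^sub>L P0" "id_blinfun - (P0 o\<^sub>L (Q0 - Q)) = P0 o\<^sub>L Q"
    using assms(1) by (simp_all add: is_inverse_def compose_simps)
  then have 1: "Q o\<^sub>L (P0 o\<^sub>L Z) = id_blinfun" and 2: "(Z' o\<^sub>L P0) o\<^sub>L Q = id_blinfun"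
    using Z Z' by (simp_all add: blinfun_compose_assoc)
  have "Z' o\<^sub>L P0 = (Z' o\<^sub>L P0) o\<^sub>L (Q o\<^sub>L (P0 o\<^sub>L Z))" using 1 by simp
  also have "\<dots> = ((Z' o\<^sub>L P0) o\<^sub>L Q) o\<^sub>L (P0 o\<^sub>L Z)" by (simp only: blinfun_compose_assoc)
  finally have "Z' o\<^sub>L P0 = P0 o\<^sub>L Z" using 2 by simp
  then show ?thesis using 1 2 unfolding is_inverse_def by (intro exI[of _ "P0 o\<^sub>L Z"]) auto
qed

lemma is_inverse_dist:
  assumes "is_inverse Q0 P0" "is_inverse Q P" "norm (Q - Q0) * norm P0 \<le> 1 / 2"
  shows "norm (P - P0) \<le> 2 * norm P0 * norm P0 * norm (Q - Q0)"
proof -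
  have "P o\<^sub>L (Q0 - Q) o\<^sub>L P0 = (P o\<^sub>L (Q0 o\<^sub>L P0)) - ((P o\<^sub>L Q) o\<^sub>L P0)"
    by (simp only: compose_simps blinfun_compose_assoc)
  then have e: "P - P0 = P o\<^sub>L (Q0 - Q) o\<^sub>L P0"
    using assms(1,2) by (simp add: is_inverse_def)
  have b: "norm (P - P0) \<le> norm P * norm (Q - Q0) * norm P0"
    unfolding e using norm_blinfun_compose[of "P o\<^sub>L (Q0 - Q)" P0]
      mult_right_mono[OF norm_blinfun_compose[of P "Q0 - Q"], of "norm P0"]
    by (simp add: norm_minus_commute)
  also have "\<dots> = norm P * (norm (Q - Q0) * norm P0)" by simp
  also have "\<dots> \<le> norm P * (1 / 2)" using assms(3) by (intro mult_left_mono) auto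
  finally have "norm P \<le> 2 * norm P0" using norm_triangle_ineq[of "P - P0" P0] by simp
  then have "norm P * (norm (Q - Q0) * norm P0) \<le> 2 * norm P0 * (norm (Q - Q0) * norm P0)"
    by (intro mult_right_mono) auto
  then show ?thesis using b by (simp add: mult_ac)
qed

text \<open>
  The product of the complexified operator algebra.
\<close>

definition cprod :: "('b \<Rightarrow>\<^sub>L 'b) \<times> ('b \<Rightarrow>\<^sub>L 'b) \<Rightarrow> ('b \<Rightarrow>\<^sub>L 'b) \<times> ('b \<Rightarrow>\<^sub>L 'b) \<Rightarrow> ('b::real_normed_vector \<Rightarrow>\<^sub>L 'b) \<times> ('b \<Rightarrow>\<^sub>L 'b)" where
  "cprod Z W = ((fst Z o\<^sub>L fst W) - (snd Z o\<^sub>L snd W), (fst Z o\<^sub>L snd W) + (snd Z o\<^sub>L fst W))"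

text \<open>
  For an operator \<open>X\<close> on a real space, \<open>z - X\<close> with a complex number \<open>z\<close> lives in the complexification. Its inverse is
  expressed by real data: \<open>Q z = (X - z)(X - \<bar>z)\<close> is real, and \<open>(z - X)\<^sup>-\<^sup>1 = (\<bar>z - X) (Q z)\<^sup>-\<^sup>1\<close>.
\<close>

locale operator_resolvent =
  fixes X :: "'b::banach \<Rightarrow>\<^sub>L 'b"
begin

definition Q :: "complex \<Rightarrow> 'b \<Rightarrow>\<^sub>L 'b" where
  "Q z = (X o\<^sub>L X) - (2 * Re z) *\<^sub>R X + (norm z)\<^sup>2 *\<^sub>R id_blinfun"

definition \<rho> :: "complex set" where "\<rho> = {z. \<exists>P. is_inverse (Q z) P}"

definition P :: "complex \<Rightarrow> 'b \<Rightarrow>\<^sub>L 'b" where "P z = (SOME P. is_inverse (Q z) P)"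

definition R :: "complex \<Rightarrow> ('b \<Rightarrow>\<^sub>L 'b) \<times> ('b \<Rightarrow>\<^sub>L 'b)" where
  "R z = (P z o\<^sub>L (Re z *\<^sub>R id_blinfun - X), - Im z *\<^sub>R P z)"

lemma P_inverse: "z \<in> \<rho> \<Longrightarrow> is_inverse (Q z) (P z)"
  unfolding \<rho>_def P_def by (auto intro: someI_ex)

lemma P_eqI: "is_inverse (Q z) Y \<Longrightarrow> P z = Y"
proof -
  assume Y: "is_inverse (Q z) Y"
  then have "is_inverse (Q z) (P z)" by (intro P_inverse) (auto simp: \<rho>_def)
  then have "P z = P z o\<^sub>L (Q z o\<^sub>L Y)" "(P z o\<^sub>L Q z) o\<^sub>L Y = Y" using Y by (simp_all add: is_inverse_def)
  then show ?thesis by (simp add: blinfun_compose_assoc)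
qed

lemma Q_cnj: "Q (cnj z) = Q z" by (simp add: Q_def)
lemma \<rho>_cnj: "cnj z \<in> \<rho> \<longleftrightarrow> z \<in> \<rho>" by (simp add: \<rho>_def Q_cnj)
lemma P_cnj: "P (cnj z) = P z" by (simp add: P_def Q_cnj)
lemma R_cnj: "R (cnj z) = (fst (R z), - snd (R z))" by (simp add: R_def P_cnj)

lemma continuous_Q: "continuous_on UNIV Q"
  unfolding Q_def by (intro continuous_intros)

lemma Q_commute: "X o\<^sub>L C = C o\<^sub>L X \<Longrightarrow> Q z o\<^sub>L C = C o\<^sub>L Q z"
proof -
  assume c: "X o\<^sub>L C = C o\<^sub>L X"
  have "X o\<^sub>L X o\<^sub>L C = X o\<^sub>L (C o\<^sub>L X)" by (simp only: blinfun_compose_assoc c)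
  also have "\<dots> = C o\<^sub>L (X o\<^sub>L X)" by (simp only: blinfun_compose_assoc[symmetric] c)
  finally show ?thesis by (simp add: Q_def compose_simps c)
qed

lemma P_commute: "z \<in> \<rho> \<Longrightarrow> X o\<^sub>L C = C o\<^sub>L X \<Longrightarrow> P z o\<^sub>L C = C o\<^sub>L P z"
  using is_inverse_commute[OF P_inverse] Q_commute by blast

lemma R_commute:
  assumes "z \<in> \<rho>" "X o\<^sub>L C = C o\<^sub>L X"
  shows "fst (R z) o\<^sub>L C = C o\<^sub>L fst (R z)" "snd (R z) o\<^sub>L C = C o\<^sub>L snd (R z)"
proof -
  have "P z o\<^sub>L X o\<^sub>L C = P z o\<^sub>L C o\<^sub>L X" by (simp only: blinfun_compose_assoc assms(2))
  also have "\<dots> = C o\<^sub>L P z o\<^sub>L X" by (simp only: P_commute[OF assms])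
  finally show "fst (R z) o\<^sub>L C = C o\<^sub>L fst (R z)" "snd (R z) o\<^sub>L C = C o\<^sub>L snd (R z)"
    by (simp_all add: R_def compose_simps P_commute[OF assms] blinfun_compose_assoc)
qed

lemma \<rho>_nhd:
  assumes "z \<in> \<rho>" "e > 0"
  shows "\<exists>d>0. \<forall>w. dist w z < d \<longrightarrow> w \<in> \<rho> \<and> dist (P w) (P z) < e"
proof -
  let ?p = "norm (P z)"
  define k where "k = min (1 / 2) (e / 2) / (1 + ?p + 2 * ?p * ?p)"
  have pos: "1 + ?p + 2 * ?p * ?p > 0" by (simp add: add_pos_nonneg)
  then have k: "k > 0" using assms(2) by (simp add: k_def)
  obtain d where d: "d > 0" "\<And>w. dist w z < d \<Longrightarrow> dist (Q w) (Q z) < k"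
    using continuous_Q k unfolding continuous_on_iff by blast
  have "w \<in> \<rho> \<and> dist (P w) (P z) < e" if w: "dist w z < d" for w
  proof -
    have kk: "norm (Q w - Q z) * (1 + ?p + 2 * ?p * ?p) \<le> min (1 / 2) (e / 2)"
      using d(2)[OF w] pos by (simp add: k_def dist_norm field_simps)
    have "norm (Q w - Q z) * ?p \<le> norm (Q w - Q z) * (1 + ?p + 2 * ?p * ?p)"
      by (intro mult_left_mono) auto
    then have 1: "norm (Q w - Q z) * ?p \<le> 1 / 2" using kk by linarith
    have "norm (Q w - Q z) * (2 * ?p * ?p) \<le> norm (Q w - Q z) * (1 + ?p + 2 * ?p * ?p)"
      by (intro mult_left_mono) auto
    then have 2: "2 * ?p * ?p * norm (Q w - Q z) \<le> e / 2" using kk by (simp add: mult.commute)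
    have "w \<in> \<rho>" using is_inverse_open[OF P_inverse[OF assms(1)], of "Q w"] 1 by (simp add: \<rho>_def)
    moreover have "norm (P w - P z) \<le> e / 2"
      using is_inverse_dist[OF P_inverse[OF assms(1)] P_inverse[OF \<open>w \<in> \<rho>\<close>] 1] 2 by linarith
    ultimately show ?thesis using assms(2) by (simp add: dist_norm)
  qed
  then show ?thesis using d(1) by blast
qed

lemma open_\<rho>: "open \<rho>"
  unfolding open_dist using \<rho>_nhd[of _ 1] by (metis zero_less_one)

lemma continuous_P: "continuous_on \<rho> P"
  unfolding continuous_on_iff using \<rho>_nhd by metis

lemma continuous_R: "continuous_on \<rho> R"
  unfolding R_def by (intro continuous_intros continuous_P)

lemma resolvent_identity:
  assumes "z \<in> \<rho>" "w \<in> \<rho>"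
  shows "cscale (w - z) (cprod (R z) (R w)) = R z - R w"
proof -
  define N where "N z = (Re z *\<^sub>R id_blinfun - X, - Im z *\<^sub>R (id_blinfun :: 'b \<Rightarrow>\<^sub>L 'b))" for z
  have R: "R z = (P z o\<^sub>L fst (N z), P z o\<^sub>L snd (N z))" for z
    by (simp add: R_def N_def compose_simps)
  have Xc: "X o\<^sub>L fst (N z) = fst (N z) o\<^sub>L X" "X o\<^sub>L snd (N z) = snd (N z) o\<^sub>L X" for z
    by (simp_all add: N_def compose_simps)
  have Pc: "fst (N z) o\<^sub>L P w = P w o\<^sub>L fst (N z)" "snd (N z) o\<^sub>L P w = P w o\<^sub>L snd (N z)" for z
    using P_commute[OF assms(2) Xc(1)] P_commute[OF assms(2) Xc(2)] by simp_all
  have mid: "(P z o\<^sub>L A) o\<^sub>L (P w o\<^sub>L B) = (P z o\<^sub>L P w) o\<^sub>L (A o\<^sub>L B)" if "A o\<^sub>L P w = P w o\<^sub>L A" for A B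
  proof -
    have "(P z o\<^sub>L A) o\<^sub>L (P w o\<^sub>L B) = P z o\<^sub>L (A o\<^sub>L P w) o\<^sub>L B" by (simp only: blinfun_compose_assoc)
    then show ?thesis unfolding that by (simp only: blinfun_compose_assoc)
  qed
  let ?PP = "P z o\<^sub>L P w"
  have prod: "cprod (R z) (R w) = (?PP o\<^sub>L fst (cprod (N z) (N w)), ?PP o\<^sub>L snd (cprod (N z) (N w)))"
    by (simp add: cprod_def R mid Pc compose_simps)
  have lhs: "cscale c (?PP o\<^sub>L A, ?PP o\<^sub>L B) = (?PP o\<^sub>L fst (cscale c (A, B)), ?PP o\<^sub>L snd (cscale c (A, B)))" for c A B
    by (simp add: cscale_def compose_simps)
  have Pzw: "P z = ?PP o\<^sub>L Q w" "P w = ?PP o\<^sub>L Q z"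
  proof -
    have "P z o\<^sub>L (P w o\<^sub>L Q w) = P z" using P_inverse[OF assms(2)] by (simp add: is_inverse_def)
    then show "P z = ?PP o\<^sub>L Q w" by (simp only: blinfun_compose_assoc)
    have "X o\<^sub>L P z = P z o\<^sub>L X" using P_commute[OF assms(1) refl] by simp
    then have "P w o\<^sub>L P z = ?PP" using P_commute[OF assms(2)] by simp
    moreover have "P w o\<^sub>L (P z o\<^sub>L Q z) = P w" using P_inverse[OF assms(1)] by (simp add: is_inverse_def)
    ultimately show "P w = ?PP o\<^sub>L Q z" by (simp only: blinfun_compose_assoc[symmetric])
  qed
  have diff: "R z - R w = (?PP o\<^sub>L ((Q w o\<^sub>L fst (N z)) - (Q z o\<^sub>L fst (N w))), ?PP o\<^sub>L ((Q w o\<^sub>L snd (N z)) - (Q z o\<^sub>L snd (N w))))"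
    unfolding R by (subst (1 2) Pzw(1), subst (3 4) Pzw(2)) (simp add: compose_simps blinfun_compose_assoc)
  have poly: "cscale (w - z) (cprod (N z) (N w)) = ((Q w o\<^sub>L fst (N z)) - (Q z o\<^sub>L fst (N w)), (Q w o\<^sub>L snd (N z)) - (Q z o\<^sub>L snd (N w)))"
    unfolding cscale_def cprod_def N_def Q_def cmod_power2
    by (simp add: compose_simps blinfun_compose_assoc algebra_simps power2_eq_square)
       (simp add: add.assoc[symmetric] scaleR_add_left[symmetric])
  show ?thesis
    unfolding prod lhs prod.collapse poly diff by simp
qed

text \<open>
  By the resolvent identity the difference quotients of \<open>R\<close> are \<open>- R(z) R(w)\<close>, and these converge since \<open>R\<close> is continuous.
\<close>

lemma weakly_holomorphic_R: "weakly_holomorphic R \<rho>"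
  unfolding weakly_holomorphic_def
proof (intro conjI allI impI continuous_R)
  fix \<phi> :: "('b \<Rightarrow>\<^sub>L 'b) \<Rightarrow> real" assume \<phi>: "bounded_linear \<phi>"
  show "(\<lambda>z. cfun \<phi> (R z)) holomorphic_on \<rho>"
    unfolding holomorphic_on_def
  proof
    fix w assume w: "w \<in> \<rho>"
    have cont: "continuous_on \<rho> (\<lambda>z. cfun \<phi> (cprod (R z) (R w)))"
      unfolding cprod_def
      by (intro bounded_linear.continuous_on[OF bounded_linear_cfun[OF \<phi>]] continuous_intros continuous_R)
    then have "((\<lambda>z. cfun \<phi> (cprod (R z) (R w))) \<longlongrightarrow> cfun \<phi> (cprod (R w) (R w))) (at w)"
      using w open_\<rho> by (simp add: continuous_on_eq_continuous_at isCont_def)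
    then have "((\<lambda>z. - cfun \<phi> (cprod (R z) (R w))) \<longlongrightarrow> - cfun \<phi> (cprod (R w) (R w))) (at w)"
      by (rule tendsto_minus)
    then have "((\<lambda>z. (cfun \<phi> (R z) - cfun \<phi> (R w)) / (z - w)) \<longlongrightarrow> - cfun \<phi> (cprod (R w) (R w))) (at w)"
    proof (rule Lim_transform_within_open[OF _ open_\<rho> w])
      fix z assume z: "z \<in> \<rho>" "z \<noteq> w"
      have "(w - z) * cfun \<phi> (cprod (R z) (R w)) = cfun \<phi> (R z - R w)"
        by (simp add: cfun_cscale[OF \<phi>, symmetric] resolvent_identity[OF z(1) w])
      also have "\<dots> = cfun \<phi> (R z) - cfun \<phi> (R w)"
        by (rule linear_diff[OF bounded_linear.linear[OF bounded_linear_cfun[OF \<phi>]]])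
      finally show "- cfun \<phi> (cprod (R z) (R w)) = (cfun \<phi> (R z) - cfun \<phi> (R w)) / (z - w)"
        using z(2) by (auto simp: field_simps)
    qed
    then have "((\<lambda>z. cfun \<phi> (R z)) has_field_derivative - cfun \<phi> (cprod (R w) (R w))) (at w)"
      by (simp add: has_field_derivative_iff)
    then show "(\<lambda>z. cfun \<phi> (R z)) field_differentiable at w within \<rho>"
      unfolding field_differentiable_def using has_field_derivative_at_within by blast
  qed
qed

end

section \<open>The functional calculus for intrinsic holomorphic functions\<close>

context operator_resolvent
begin

text \<open>
  The complement of the resolvent set plays the role of the spectrum; \<open>D\<close> is the domain of the functions to be applied.
\<close>

definition surrounds :: "(real \<Rightarrow> complex) list \<Rightarrow> complex set \<Rightarrow> complex set \<Rightarrow> bool" where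
  "surrounds \<Gamma> W D \<longleftrightarrow> open W \<and> bounded W \<and> (\<forall>z\<in>W. cnj z \<in> W) \<and> - \<rho> \<subseteq> W \<and> closure W \<subseteq> D \<and> boundary_curves \<Gamma> W"

end

definition cnj_symmetric :: "complex set \<Rightarrow> bool" where
  "cnj_symmetric D \<longleftrightarrow> open D \<and> (\<forall>z\<in>D. cnj z \<in> D)"

definition intrinsic_on :: "complex set \<Rightarrow> (complex \<Rightarrow> complex) \<Rightarrow> bool" where
  "intrinsic_on D f \<longleftrightarrow> f holomorphic_on D \<and> (\<forall>z\<in>D. f (cnj z) = cnj (f z))"

lemma intrinsic_on_subset: "intrinsic_on D f \<Longrightarrow> D' \<subseteq> D \<Longrightarrow> intrinsic_on D' f"
  by (auto simp: intrinsic_on_def intro: holomorphic_on_subset)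

lemma intrinsic_on_intros:
  "intrinsic_on D (\<lambda>z. 0)"
  "intrinsic_on D f \<Longrightarrow> intrinsic_on D g \<Longrightarrow> intrinsic_on D (\<lambda>z. f z + g z)"
  "intrinsic_on D f \<Longrightarrow> intrinsic_on D g \<Longrightarrow> intrinsic_on D (\<lambda>z. f z * g z)"
  by (auto simp: intrinsic_on_def intro!: holomorphic_intros)

lemma intrinsic_on_sum:
  "(\<And>i. i \<in> I \<Longrightarrow> intrinsic_on D (f i)) \<Longrightarrow> intrinsic_on D (\<lambda>z. \<Sum>i\<in>I. f i z)"
  by (auto simp: intrinsic_on_def intro!: holomorphic_intros)

lemma weakly_holomorphic_cscale:
  assumes "f holomorphic_on S" "weakly_holomorphic h S'" "S \<subseteq> S'"
  shows "weakly_holomorphic (\<lambda>z. cscale (f z) (h z)) S"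
  using assms unfolding weakly_holomorphic_def
  by (auto simp: cfun_cscale intro!: holomorphic_intros bounded_bilinear.continuous_on[OF bounded_bilinear_cscale]
      holomorphic_on_imp_continuous_on intro: holomorphic_on_subset continuous_on_subset)

definition vcontour :: "(real \<Rightarrow> complex) \<Rightarrow> (complex \<Rightarrow> 'a \<times> 'a) \<Rightarrow> 'a::real_normed_vector \<times> 'a" where
  "vcontour \<gamma> h = integral {0..1} (\<lambda>t. cscale (vector_derivative \<gamma> (at t within {0..1})) (h (\<gamma> t)))"

lemma has_vcontour_vcontour:
  fixes h :: "complex \<Rightarrow> 'a \<times> 'a::banach"
  assumes "weakly_holomorphic h S" "open S" "valid_path \<gamma>" "path_image \<gamma> \<subseteq> S"
  shows "has_vcontour h (vcontour \<gamma> h) \<gamma>"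
proof -
  obtain I where I: "has_vcontour h I \<gamma>" using vcontour_integrable[OF assms] by blast
  then have "vcontour \<gamma> h = I" unfolding has_vcontour_def vcontour_def by (rule integral_unique)
  then show ?thesis using I by simp
qed

lemma cfun_vcontour:
  fixes h :: "complex \<Rightarrow> 'a \<times> 'a::banach"
  assumes "weakly_holomorphic h S" "open S" "valid_path \<gamma>" "path_image \<gamma> \<subseteq> S" "bounded_linear \<phi>"
  shows "cfun \<phi> (vcontour \<gamma> h) = contour_integral \<gamma> (\<lambda>z. cfun \<phi> (h z))"
  using cfun_has_vcontour[OF has_vcontour_vcontour[OF assms(1-4)] assms(5)] by (simp add: contour_integral_unique)

context operator_resolvent
begin

lemma surroundsD:
  assumes "surrounds \<Gamma> W D"
  shows "frontier W \<subseteq> D \<inter> \<rho>" "\<And>\<gamma>. \<gamma> \<in> set \<Gamma> \<Longrightarrow> valid_path \<gamma> \<and> path_image \<gamma> \<subseteq> D \<inter> \<rho> \<and> pathfinish \<gamma> = pathstart \<gamma>"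
proof -
  show fr: "frontier W \<subseteq> D \<inter> \<rho>"
    using assms by (auto simp: surrounds_def frontier_def interior_open)
  show "valid_path \<gamma> \<and> path_image \<gamma> \<subseteq> D \<inter> \<rho> \<and> pathfinish \<gamma> = pathstart \<gamma>" if "\<gamma> \<in> set \<Gamma>" for \<gamma>
    using boundary_curvesD[of \<Gamma> W \<gamma>] that assms fr by (auto simp: surrounds_def)
qed

text \<open>
  The factor \<open>- i\<close> corresponds to the measure \<open>ds (- j)\<close> in the slice integrals.
\<close>

definition kernel :: "(complex \<Rightarrow> complex) \<Rightarrow> complex \<Rightarrow> ('b \<Rightarrow>\<^sub>L 'b) \<times> ('b \<Rightarrow>\<^sub>L 'b)" where
  "kernel f z = cscale (- \<i> * f z) (R z)"

definition kernel_integral :: "(real \<Rightarrow> complex) list \<Rightarrow> (complex \<Rightarrow> complex) \<Rightarrow> ('b \<Rightarrow>\<^sub>L 'b) \<times> ('b \<Rightarrow>\<^sub>L 'b)" where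
  "kernel_integral \<Gamma> f = (\<Sum>\<gamma>\<leftarrow>\<Gamma>. vcontour \<gamma> (kernel f))"

text \<open>
  Taking the first component loses nothing for intrinsic functions, because there the second one vanishes.
\<close>

definition fcalc :: "(real \<Rightarrow> complex) list \<Rightarrow> (complex \<Rightarrow> complex) \<Rightarrow> 'b \<Rightarrow>\<^sub>L 'b" where
  "fcalc \<Gamma> f = (1 / (2 * pi)) *\<^sub>R fst (kernel_integral \<Gamma> f)"

lemma weakly_holomorphic_kernel: "f holomorphic_on D \<Longrightarrow> weakly_holomorphic (kernel f) (D \<inter> \<rho>)"
  unfolding kernel_def
  by (intro weakly_holomorphic_cscale[OF _ weakly_holomorphic_R] holomorphic_intros) (auto intro: holomorphic_on_subset)

lemma cfun_R_holomorphic: "bounded_linear \<phi> \<Longrightarrow> (\<lambda>z. cfun \<phi> (R z)) holomorphic_on \<rho>"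
  using weakly_holomorphic_R by (simp add: weakly_holomorphic_def)

lemma fR_holomorphic:
  "bounded_linear \<phi> \<Longrightarrow> f holomorphic_on D \<Longrightarrow> (\<lambda>z. f z * cfun \<phi> (R z)) holomorphic_on (D \<inter> \<rho>)"
  by (intro holomorphic_intros) (auto intro: holomorphic_on_subset cfun_R_holomorphic)

lemma cfun_kernel_integral:
  assumes "surrounds \<Gamma> W D" "open D" "f holomorphic_on D" "bounded_linear \<phi>"
  shows "cfun \<phi> (kernel_integral \<Gamma> f) = - \<i> * (\<Sum>\<gamma>\<leftarrow>\<Gamma>. contour_integral \<gamma> (\<lambda>z. f z * cfun \<phi> (R z)))"
proof -
  have "cfun \<phi> (vcontour \<gamma> (kernel f)) = - \<i> * contour_integral \<gamma> (\<lambda>z. f z * cfun \<phi> (R z))" if "\<gamma> \<in> set \<Gamma>" for \<gamma>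
  proof -
    note g = surroundsD(2)[OF assms(1) that]
    have o: "open (D \<inter> \<rho>)" using assms(2) open_\<rho> by auto
    have "cfun \<phi> (vcontour \<gamma> (kernel f)) = contour_integral \<gamma> (\<lambda>z. cfun \<phi> (kernel f z))"
      using cfun_vcontour[OF weakly_holomorphic_kernel[OF assms(3)] o _ _ assms(4)] g by blast
    also have "\<dots> = contour_integral \<gamma> (\<lambda>z. - \<i> * (f z * cfun \<phi> (R z)))"
      by (simp add: kernel_def cfun_cscale[OF assms(4)] mult.assoc)
    also have "\<dots> = - \<i> * contour_integral \<gamma> (\<lambda>z. f z * cfun \<phi> (R z))"
      using g by (intro contour_integral_lmul contour_integrable_holomorphic_simple[OF fR_holomorphic[OF assms(4,3)] o]) auto
    finally show ?thesis .
  qed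
  then have "(\<Sum>\<gamma>\<leftarrow>\<Gamma>. cfun \<phi> (vcontour \<gamma> (kernel f))) = - \<i> * (\<Sum>\<gamma>\<leftarrow>\<Gamma>. contour_integral \<gamma> (\<lambda>z. f z * cfun \<phi> (R z)))"
    unfolding sum_list_const_mult[symmetric] by (intro arg_cong[where f = sum_list] map_cong) auto
  moreover have "cfun \<phi> (sum_list (map k xs)) = (\<Sum>x\<leftarrow>xs. cfun \<phi> (k x))" for k and xs :: "(real \<Rightarrow> complex) list"
    using linear_add[OF bounded_linear.linear[OF bounded_linear_cfun[OF assms(4)]]]
      linear_0[OF bounded_linear.linear[OF bounded_linear_cfun[OF assms(4)]]]
    by (induction xs) simp_all
  ultimately show ?thesis unfolding kernel_integral_def by simp
qed

text \<open>
  The integrand takes conjugate values at conjugate points and everything else is symmetric as well.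
\<close>

lemma kernel_integral_real:
  assumes "surrounds \<Gamma> W D" "cnj_symmetric D" "intrinsic_on D f"
  shows "snd (kernel_integral \<Gamma> f) = 0"
proof (rule eq_by_functionals)
  fix \<phi> :: "('b \<Rightarrow>\<^sub>L 'b) \<Rightarrow> real" assume \<phi>: "bounded_linear \<phi>"
  have D: "open D" "\<And>z. z \<in> D \<Longrightarrow> cnj z \<in> D" using assms(2) by (auto simp: cnj_symmetric_def)
  have f: "f holomorphic_on D" "\<And>z. z \<in> D \<Longrightarrow> f (cnj z) = cnj (f z)" using assms(3) by (auto simp: intrinsic_on_def)
  have W: "open W" "\<And>z. z \<in> W \<Longrightarrow> cnj z \<in> W" "- \<rho> \<subseteq> W" "closure W \<subseteq> D" "boundary_curves \<Gamma> W"
    using assms(1) by (auto simp: surrounds_def)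
  have DK: "D - (- \<rho>) = D \<inter> \<rho>" by auto
  have "cfun \<phi> (R (cnj z)) = cnj (cfun \<phi> (R z))" for z
    by (simp add: R_cnj cfun_def complex_eq_iff linear_neg[OF bounded_linear.linear[OF \<phi>]])
  then have "Re (\<Sum>\<gamma>\<leftarrow>\<Gamma>. contour_integral \<gamma> (\<lambda>z. f z * cfun \<phi> (R z))) = 0"
    using W D f(2) fR_holomorphic[OF \<phi> f(1)] open_\<rho> \<rho>_cnj
    by (intro boundary_integral_cnj[of \<Gamma> W "- \<rho>" D]) (auto simp: DK)
  moreover have "\<phi> (snd (kernel_integral \<Gamma> f)) = Im (cfun \<phi> (kernel_integral \<Gamma> f))" by (simp add: cfun_def)
  ultimately show "\<phi> (snd (kernel_integral \<Gamma> f)) = \<phi> 0"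
    by (simp add: cfun_kernel_integral[OF assms(1) D(1) f(1) \<phi>] linear_0[OF bounded_linear.linear[OF \<phi>]])
qed

lemma functional_fcalc:
  assumes "surrounds \<Gamma> W D" "cnj_symmetric D" "intrinsic_on D f" "bounded_linear \<phi>"
  shows "of_real (\<phi> (fcalc \<Gamma> f)) = 1 / (2 * pi * \<i>) * (\<Sum>\<gamma>\<leftarrow>\<Gamma>. contour_integral \<gamma> (\<lambda>z. f z * cfun \<phi> (R z)))"
proof -
  have "of_real (\<phi> (fst (kernel_integral \<Gamma> f))) = cfun \<phi> (kernel_integral \<Gamma> f)"
    using kernel_integral_real[OF assms(1-3)] linear_0[OF bounded_linear.linear[OF assms(4)]] by (simp add: cfun_def complex_eq_iff)
  also have "\<dots> = - \<i> * (\<Sum>\<gamma>\<leftarrow>\<Gamma>. contour_integral \<gamma> (\<lambda>z. f z * cfun \<phi> (R z)))"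
    using assms by (intro cfun_kernel_integral) (auto simp: cnj_symmetric_def intrinsic_on_def)
  finally show ?thesis
    by (simp add: fcalc_def linear_scale[OF bounded_linear.linear[OF assms(4)]] field_simps)
qed

lemma fcalc_unique:
  assumes "surrounds \<Gamma> W D" "surrounds \<Gamma>' W' D" "cnj_symmetric D" "intrinsic_on D f"
  shows "fcalc \<Gamma> f = fcalc \<Gamma>' f"
proof (rule eq_by_functionals)
  fix \<phi> :: "('b \<Rightarrow>\<^sub>L 'b) \<Rightarrow> real" assume \<phi>: "bounded_linear \<phi>"
  have DK: "D - (- \<rho>) = D \<inter> \<rho>" by auto
  have f: "f holomorphic_on D" "open D" using assms by (auto simp: intrinsic_on_def cnj_symmetric_def)
  have "(\<Sum>\<gamma>\<leftarrow>\<Gamma>. contour_integral \<gamma> (\<lambda>z. f z * cfun \<phi> (R z))) = (\<Sum>\<gamma>\<leftarrow>\<Gamma>'. contour_integral \<gamma> (\<lambda>z. f z * cfun \<phi> (R z)))"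
    using assms(1,2) fR_holomorphic[OF \<phi> f(1)] f(2) open_\<rho>
    by (intro boundary_integral_unique[of \<Gamma> W "- \<rho>" D \<Gamma>' W']) (auto simp: surrounds_def DK)
  then have "complex_of_real (\<phi> (fcalc \<Gamma> f)) = of_real (\<phi> (fcalc \<Gamma>' f))"
    using functional_fcalc[OF assms(1,3,4) \<phi>] functional_fcalc[OF assms(2,3,4) \<phi>] by simp
  then show "\<phi> (fcalc \<Gamma> f) = \<phi> (fcalc \<Gamma>' f)" by simp
qed

lemma fcalc_commute:
  assumes "surrounds \<Gamma> W D" "cnj_symmetric D" "intrinsic_on D f" "X o\<^sub>L C = C o\<^sub>L X"
  shows "fcalc \<Gamma> f o\<^sub>L C = C o\<^sub>L fcalc \<Gamma> f"
proof (rule eq_by_functionals)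
  fix \<phi> :: "('b \<Rightarrow>\<^sub>L 'b) \<Rightarrow> real" assume \<phi>: "bounded_linear \<phi>"
  have l: "bounded_linear (\<lambda>Y. \<phi> (Y o\<^sub>L C))" "bounded_linear (\<lambda>Y. \<phi> (C o\<^sub>L Y))"
    by (intro bounded_linear_compose[OF \<phi>] bounded_linear_compose_left bounded_linear_compose_right)+
  have "contour_integral \<gamma> (\<lambda>z. f z * cfun (\<lambda>Y. \<phi> (Y o\<^sub>L C)) (R z)) = contour_integral \<gamma> (\<lambda>z. f z * cfun (\<lambda>Y. \<phi> (C o\<^sub>L Y)) (R z))"
    if "\<gamma> \<in> set \<Gamma>" for \<gamma>
    using surroundsD(2)[OF assms(1) that] R_commute[OF _ assms(4)] by (intro contour_integral_eq) (auto simp: cfun_def)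
  then have "(\<Sum>\<gamma>\<leftarrow>\<Gamma>. contour_integral \<gamma> (\<lambda>z. f z * cfun (\<lambda>Y. \<phi> (Y o\<^sub>L C)) (R z))) = (\<Sum>\<gamma>\<leftarrow>\<Gamma>. contour_integral \<gamma> (\<lambda>z. f z * cfun (\<lambda>Y. \<phi> (C o\<^sub>L Y)) (R z)))"
    by (intro arg_cong[where f = sum_list] map_cong) auto
  then have "complex_of_real (\<phi> (fcalc \<Gamma> f o\<^sub>L C)) = of_real (\<phi> (C o\<^sub>L fcalc \<Gamma> f))"
    using functional_fcalc[OF assms(1-3) l(1)] functional_fcalc[OF assms(1-3) l(2)] by simp
  then show "\<phi> (fcalc \<Gamma> f o\<^sub>L C) = \<phi> (C o\<^sub>L fcalc \<Gamma> f)" by simp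
qed

lemma fcalc_add:
  assumes "surrounds \<Gamma> W D" "cnj_symmetric D" "intrinsic_on D f" "intrinsic_on D g"
  shows "fcalc \<Gamma> (\<lambda>z. f z + g z) = fcalc \<Gamma> f + fcalc \<Gamma> g"
proof (rule eq_by_functionals)
  fix \<phi> :: "('b \<Rightarrow>\<^sub>L 'b) \<Rightarrow> real" assume \<phi>: "bounded_linear \<phi>"
  have o: "open (D \<inter> \<rho>)" using assms(2) open_\<rho> by (auto simp: cnj_symmetric_def)
  have "contour_integral \<gamma> (\<lambda>z. (f z + g z) * cfun \<phi> (R z)) =
     contour_integral \<gamma> (\<lambda>z. f z * cfun \<phi> (R z)) + contour_integral \<gamma> (\<lambda>z. g z * cfun \<phi> (R z))"
    if "\<gamma> \<in> set \<Gamma>" for \<gamma>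
    unfolding distrib_right using surroundsD(2)[OF assms(1) that] assms(3,4)
    by (intro contour_integral_add contour_integrable_holomorphic_simple[OF fR_holomorphic[OF \<phi>] o]) (auto simp: intrinsic_on_def)
  then have "(\<Sum>\<gamma>\<leftarrow>\<Gamma>. contour_integral \<gamma> (\<lambda>z. (f z + g z) * cfun \<phi> (R z))) =
     (\<Sum>\<gamma>\<leftarrow>\<Gamma>. contour_integral \<gamma> (\<lambda>z. f z * cfun \<phi> (R z))) + (\<Sum>\<gamma>\<leftarrow>\<Gamma>. contour_integral \<gamma> (\<lambda>z. g z * cfun \<phi> (R z)))"
    unfolding sum_list_addf[symmetric] by (intro arg_cong[where f = sum_list] map_cong) auto
  then have "complex_of_real (\<phi> (fcalc \<Gamma> (\<lambda>z. f z + g z))) = of_real (\<phi> (fcalc \<Gamma> f) + \<phi> (fcalc \<Gamma> g))"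
    unfolding of_real_add functional_fcalc[OF assms(1-3) \<phi>] functional_fcalc[OF assms(1,2,4) \<phi>]
      functional_fcalc[OF assms(1,2) intrinsic_on_intros(2)[OF assms(3,4)] \<phi>]
    by (simp only: distrib_left)
  then show "\<phi> (fcalc \<Gamma> (\<lambda>z. f z + g z)) = \<phi> (fcalc \<Gamma> f + fcalc \<Gamma> g)"
    using linear_add[OF bounded_linear.linear[OF \<phi>]] by (simp only: of_real_eq_iff)
qed

lemma fcalc_zero: "fcalc \<Gamma> (\<lambda>z. 0) = 0"
  by (simp add: fcalc_def kernel_integral_def kernel_def vcontour_def cscale_def o_def sum_list_0 flip: zero_prod_def)

lemma fcalc_sum:
  assumes "surrounds \<Gamma> W D" "cnj_symmetric D" "finite I" "\<And>i. i \<in> I \<Longrightarrow> intrinsic_on D (f i)"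
  shows "fcalc \<Gamma> (\<lambda>z. \<Sum>i\<in>I. f i z) = (\<Sum>i\<in>I. fcalc \<Gamma> (f i))"
  using assms(3,4)
proof (induction I)
  case (insert i I)
  then show ?case using fcalc_add[OF assms(1,2), of "f i" "\<lambda>z. \<Sum>i\<in>I. f i z"] intrinsic_on_sum[of I D f] by simp
qed (simp add: fcalc_zero)

text \<open>
  The classical argument with two nested systems of curves: surround the closure of \<open>W\<close> by a larger \<open>W'\<close> and compute \<open>f(X)\<close>
  on its boundary. By the resolvent identity, \<open>f(X) R(w) = f(w) R(w) - C H(w)\<close> for \<open>w\<close> in \<open>W'\<close>, where \<open>C = 1 / (2 \<pi> i)\<close> and
  \<open>H\<close> is the Cauchy transform of \<open>f R\<close> over the outer boundary. Multiplied by \<open>g\<close> and integrated over the inner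
  system, the term with \<open>H\<close> vanishes because \<open>g H\<close> is holomorphic in \<open>W'\<close>.
\<close>

lemma fcalc_mult:
  assumes s: "surrounds \<Gamma> W D" and D: "cnj_symmetric D" and f: "intrinsic_on D f" and g: "intrinsic_on D g"
  shows "fcalc \<Gamma> (\<lambda>z. f z * g z) = fcalc \<Gamma> f o\<^sub>L fcalc \<Gamma> g"
proof (rule eq_by_functionals)
  fix \<phi> :: "('b \<Rightarrow>\<^sub>L 'b) \<Rightarrow> real" assume \<phi>: "bounded_linear \<phi>"
  define C where "C = 1 / (2 * pi * \<i>)"
  let ?r = "\<lambda>z. cfun \<phi> (R z)"
  have oD: "open D" and fh: "f holomorphic_on D" and gh: "g holomorphic_on D"
    using D f g by (auto simp: cnj_symmetric_def intrinsic_on_def)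
  have oDr: "open (D \<inter> \<rho>)" using oD open_\<rho> by auto
  have W: "open W" "bounded W" "\<And>z. z \<in> W \<Longrightarrow> cnj z \<in> W" "- \<rho> \<subseteq> W" "closure W \<subseteq> D" "boundary_curves \<Gamma> W"
    using s by (auto simp: surrounds_def)
  have cW: "compact (closure W)" using W(2) by (simp add: compact_closure)
  have symc: "\<forall>z\<in>closure W. cnj z \<in> closure W"
  proof
    fix z assume "z \<in> closure W"
    then have "cnj z \<in> cnj ` closure W" by auto
    also have "\<dots> \<subseteq> closure (cnj ` W)" by (intro continuous_image_closure_subset[of UNIV] continuous_intros) auto
    also have "\<dots> \<subseteq> closure W" using W(3) by (intro closure_mono) auto
    finally show "cnj z \<in> closure W" .
  qed
  obtain W' \<Gamma>' E where W': "open W'" "bounded W'" "closure W \<subseteq> W'" "closure W' \<subseteq> D" "\<And>z. (\<forall>z\<in>closure W. cnj z \<in> closure W) \<Longrightarrow> z \<in> W' \<Longrightarrow> cnj z \<in> W'"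
    "boundary_curves \<Gamma>' W'" and fr: "frontier W' = (\<Union>(a, b)\<in>set E. closed_segment a b)"
    and sumE: "\<And>g. continuous_on (frontier W') g \<Longrightarrow>
       (\<Sum>\<gamma>\<leftarrow>\<Gamma>'. contour_integral \<gamma> g) = (\<Sum>(a, b)\<leftarrow>E. contour_integral (linepath a b) g)"
    and form: "\<And>f w. f holomorphic_on D \<Longrightarrow> w \<in> W' \<Longrightarrow>
       (\<Sum>(a, b)\<leftarrow>E. contour_integral (linepath a b) (\<lambda>z. f z / (z - w))) = 2 * pi * \<i> * f w"
    by (rule exists_Cauchy_region[OF cW oD W(5)]) (rule that; assumption)
  have WW': "W \<subseteq> W'" using W'(3) closure_subset by blast
  have s': "surrounds \<Gamma>' W' D"
    unfolding surrounds_def using W' WW' W(4) symc by auto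
  have frD: "frontier W' \<subseteq> D \<inter> \<rho>" by (rule surroundsD(1)[OF s'])
  define H where "H w = (\<Sum>x\<leftarrow>E. contour_integral (linepath (fst x) (snd x)) (\<lambda>z. f z * ?r z / (z - w)))" for w
  have seg: "closed_segment (fst x) (snd x) \<subseteq> frontier W'" if "x \<in> set E" for x
    using that fr by (force simp: case_prod_beta)
  have frW: "frontier W' \<inter> W' = {}" using W'(1) by (auto simp: frontier_def interior_open)
  have contfr: "continuous_on (frontier W') (\<lambda>z. f z * ?r z)"
    using frD by (intro continuous_on_subset[OF holomorphic_on_imp_continuous_on[OF fR_holomorphic[OF \<phi> fh]]])
  have H: "H holomorphic_on W'"
  proof -
    have "(\<lambda>w. contour_integral (linepath (fst x) (snd x)) (\<lambda>z. f z * ?r z / (z - w))) holomorphic_on W'" if "x \<in> set E" for x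
    proof (rule holomorphic_on_subset[OF linepath_Cauchy_kernel])
      show "continuous_on (closed_segment (fst x) (snd x)) (\<lambda>z. f z * ?r z)"
        by (rule continuous_on_subset[OF contfr seg[OF that]])
      show "W' \<subseteq> - closed_segment (fst x) (snd x)" using seg[OF that] frW by auto
    qed
    then show ?thesis unfolding H_def by (induction E) (auto intro!: holomorphic_intros)
  qed
  define F where "F = fcalc \<Gamma> f"
  \<comment> \<open>The outer system computes the same operator.\<close>
  have FF: "F = fcalc \<Gamma>' f" unfolding F_def by (rule fcalc_unique[OF s s' D f])
  let ?\<psi> = "\<lambda>Y. \<phi> (F o\<^sub>L Y)"
  have \<psi>: "bounded_linear ?\<psi>" by (intro bounded_linear_compose[OF \<phi>] bounded_linear_compose_right)
  have key: "cfun ?\<psi> (R w) = f w * ?r w - C * H w" if w: "w \<in> W'" "w \<in> \<rho>" for w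
  proof -
    let ?\<chi> = "\<lambda>B Y. \<phi> (Y o\<^sub>L B)"
    have \<chi>: "bounded_linear (?\<chi> B)" for B by (intro bounded_linear_compose[OF \<phi>] bounded_linear_compose_left)
    have "cfun ?\<psi> (R w) = of_real (?\<chi> (fst (R w)) F) + \<i> * of_real (?\<chi> (snd (R w)) F)"
      by (simp add: cfun_def complex_eq_iff)
    also have "\<dots> = C * ((\<Sum>\<gamma>\<leftarrow>\<Gamma>'. contour_integral \<gamma> (\<lambda>z. f z * cfun (?\<chi> (fst (R w))) (R z))) +
        \<i> * (\<Sum>\<gamma>\<leftarrow>\<Gamma>'. contour_integral \<gamma> (\<lambda>z. f z * cfun (?\<chi> (snd (R w))) (R z))))"
      unfolding FF functional_fcalc[OF s' D f \<chi>] C_def by (simp add: algebra_simps)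
    also have "(\<Sum>\<gamma>\<leftarrow>\<Gamma>'. contour_integral \<gamma> (\<lambda>z. f z * cfun (?\<chi> (fst (R w))) (R z))) +
        \<i> * (\<Sum>\<gamma>\<leftarrow>\<Gamma>'. contour_integral \<gamma> (\<lambda>z. f z * cfun (?\<chi> (snd (R w))) (R z)))
      = (\<Sum>\<gamma>\<leftarrow>\<Gamma>'. contour_integral \<gamma> (\<lambda>z. f z * (?r z / (w - z)) - ?r w * (f z / (w - z))))"
    proof -
      have "contour_integral \<gamma> (\<lambda>z. f z * cfun (?\<chi> (fst (R w))) (R z)) +
        \<i> * contour_integral \<gamma> (\<lambda>z. f z * cfun (?\<chi> (snd (R w))) (R z)) =
         contour_integral \<gamma> (\<lambda>z. f z * (?r z / (w - z)) - ?r w * (f z / (w - z)))" if g: "\<gamma> \<in> set \<Gamma>'" for \<gamma>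
      proof -
        note g' = surroundsD(2)[OF s' g]
        have int: "(\<lambda>z. f z * cfun (?\<chi> B) (R z)) contour_integrable_on \<gamma>" for B
          using g' by (intro contour_integrable_holomorphic_simple[OF fR_holomorphic[OF \<chi> fh] oDr]) auto
        have "contour_integral \<gamma> (\<lambda>z. f z * cfun (?\<chi> (fst (R w))) (R z)) +
          \<i> * contour_integral \<gamma> (\<lambda>z. f z * cfun (?\<chi> (snd (R w))) (R z)) =
          contour_integral \<gamma> (\<lambda>z. f z * cfun (?\<chi> (fst (R w))) (R z) + \<i> * (f z * cfun (?\<chi> (snd (R w))) (R z)))"
          by (simp only: contour_integral_lmul[OF int, symmetric] contour_integral_add[OF int contour_integrable_lmul[OF int]])
        also have "\<dots> = contour_integral \<gamma> (\<lambda>z. f z * (?r z / (w - z)) - ?r w * (f z / (w - z)))"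
        proof (rule contour_integral_eq)
          fix z assume z: "z \<in> path_image \<gamma>"
          have zr: "z \<in> \<rho>" using z g' by auto
          have zw: "z \<noteq> w" using boundary_curvesD(4)[OF W'(6) g] z frW w(1) by auto
          have "cfun (?\<chi> (fst (R w))) (R z) + \<i> * cfun (?\<chi> (snd (R w))) (R z) = cfun \<phi> (cprod (R z) (R w))"
            by (simp add: cfun_def cprod_def complex_eq_iff linear_diff[OF bounded_linear.linear[OF \<phi>]] linear_add[OF bounded_linear.linear[OF \<phi>]])
          moreover have "(w - z) * cfun \<phi> (cprod (R z) (R w)) = ?r z - ?r w"
            using cfun_cscale[OF \<phi>, symmetric] resolvent_identity[OF zr w(2)]
              linear_diff[OF bounded_linear.linear[OF bounded_linear_cfun[OF \<phi>]]] by metis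
          then have "cfun \<phi> (cprod (R z) (R w)) = (?r z - ?r w) / (w - z)" using zw by (simp add: field_simps)
          ultimately have "f z * (cfun (?\<chi> (fst (R w))) (R z) + \<i> * cfun (?\<chi> (snd (R w))) (R z)) = f z * ((?r z - ?r w) / (w - z))"
            by simp
          then show "f z * cfun (?\<chi> (fst (R w))) (R z) + \<i> * (f z * cfun (?\<chi> (snd (R w))) (R z)) =
            f z * (?r z / (w - z)) - ?r w * (f z / (w - z))"
            by (simp add: diff_divide_distrib algebra_simps)
        qed
        finally show ?thesis .
      qed
      then show ?thesis
        unfolding sum_list_const_mult[symmetric] sum_list_addf[symmetric]
        by (intro arg_cong[where f = sum_list] map_cong) auto
    qed
    also have "\<dots> = (\<Sum>x\<leftarrow>E. contour_integral (linepath (fst x) (snd x)) (\<lambda>z. f z * (?r z / (w - z)) - ?r w * (f z / (w - z))))"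
      unfolding sumE[unfolded case_prod_unfold, symmetric]
    proof (rule sumE[unfolded case_prod_unfold])
      have "continuous_on (frontier W') f" "continuous_on (frontier W') ?r"
        using frD holomorphic_on_imp_continuous_on[OF fh] holomorphic_on_imp_continuous_on[OF cfun_R_holomorphic[OF \<phi>]]
        by (auto intro: continuous_on_subset)
      then show "continuous_on (frontier W') (\<lambda>z. f z * (?r z / (w - z)) - ?r w * (f z / (w - z)))"
        using frW w(1) by (intro continuous_intros) auto
    qed
    also have "\<dots> = - H w + ?r w * (\<Sum>x\<leftarrow>E. contour_integral (linepath (fst x) (snd x)) (\<lambda>z. f z / (z - w)))"
    proof -
      have "contour_integral (linepath (fst x) (snd x)) (\<lambda>z. f z * (?r z / (w - z)) - ?r w * (f z / (w - z))) =
         - contour_integral (linepath (fst x) (snd x)) (\<lambda>z. f z * ?r z / (z - w)) +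
         ?r w * contour_integral (linepath (fst x) (snd x)) (\<lambda>z. f z / (z - w))" if x: "x \<in> set E" for x
      proof -
        let ?l = "linepath (fst x) (snd x)"
        have c1: "continuous_on (closed_segment (fst x) (snd x)) (\<lambda>z. f z * ?r z / (z - w))"
          using seg[OF x] frW w(1) by (intro continuous_intros continuous_on_subset[OF contfr]) auto
        have c2: "continuous_on (closed_segment (fst x) (snd x)) (\<lambda>z. f z / (z - w))"
          using seg[OF x] frW w(1) frD by (intro continuous_intros continuous_on_subset[OF holomorphic_on_imp_continuous_on[OF fh]]) auto
        note i = c1[THEN contour_integrable_continuous_linepath] c2[THEN contour_integrable_continuous_linepath]
        have e: "x / (w - z) = - (x / (z - w))" for x z :: complex
          by (metis minus_diff_eq minus_divide_right)
        have "(\<lambda>z. f z * (?r z / (w - z)) - ?r w * (f z / (w - z))) = (\<lambda>z. - (f z * ?r z / (z - w)) + ?r w * (f z / (z - w)))"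
          by (rule ext) (simp only: e, simp add: algebra_simps)
        then show ?thesis
          using i by (simp only: contour_integral_add contour_integral_neg contour_integral_lmul contour_integrable_neg contour_integrable_lmul)
      qed
      then show ?thesis
        unfolding H_def sum_list_const_mult[symmetric] uminus_sum_list_map[unfolded o_def] sum_list_addf[symmetric]
        by (intro arg_cong[where f = sum_list] map_cong) auto
    qed
    also have "(\<Sum>x\<leftarrow>E. contour_integral (linepath (fst x) (snd x)) (\<lambda>z. f z / (z - w))) = 2 * pi * \<i> * f w"
      using form[OF fh w(1)] by (simp add: case_prod_unfold)
    finally show ?thesis by (simp add: C_def algebra_simps)
  qed
  have gH: "(\<lambda>w. g w * H w) holomorphic_on W'"
    using W'(4) closure_subset by (intro holomorphic_intros H holomorphic_on_subset[OF gh]) blast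
  \<comment> \<open>The inner curves wind around no point outside \<open>W\'\<close>.\<close>
  have zero: "(\<Sum>\<gamma>\<leftarrow>\<Gamma>. contour_integral \<gamma> (\<lambda>w. g w * H w)) = 0"
  proof (rule Cauchy_theorem_cycle[OF W'(1) gH])
    show "valid_path \<gamma> \<and> pathfinish \<gamma> = pathstart \<gamma> \<and> path_image \<gamma> \<subseteq> W'" if "\<gamma> \<in> set \<Gamma>" for \<gamma>
      using boundary_curvesD[OF W(6) that] W'(3) by (auto simp: frontier_def)
    show "(\<Sum>\<gamma>\<leftarrow>\<Gamma>. winding_number \<gamma> w) = 0" if "w \<notin> W'" for w
      using that W'(3) by (intro boundary_curves_winding(2)[OF W(6)]) auto
  qed
  have split: "contour_integral \<gamma> (\<lambda>w. g w * cfun ?\<psi> (R w)) =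
     contour_integral \<gamma> (\<lambda>z. f z * g z * ?r z) + - C * contour_integral \<gamma> (\<lambda>w. g w * H w)" if g: "\<gamma> \<in> set \<Gamma>" for \<gamma>
  proof -
    note g' = surroundsD(2)[OF s g]
    have im: "path_image \<gamma> \<subseteq> W'" using boundary_curvesD[OF W(6) g] W'(3) by (auto simp: frontier_def)
    have i1: "(\<lambda>z. f z * g z * ?r z) contour_integrable_on \<gamma>"
      using g' fh gh by (intro contour_integrable_holomorphic_simple[OF fR_holomorphic[OF \<phi>] oDr] holomorphic_intros) auto
    have i2: "(\<lambda>w. g w * H w) contour_integrable_on \<gamma>"
      using g' im by (intro contour_integrable_holomorphic_simple[OF gH W'(1)]) auto
    have "contour_integral \<gamma> (\<lambda>w. g w * cfun ?\<psi> (R w)) = contour_integral \<gamma> (\<lambda>w. f w * g w * ?r w + - C * (g w * H w))"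
    proof (rule contour_integral_eq)
      fix w assume "w \<in> path_image \<gamma>"
      then have "cfun ?\<psi> (R w) = f w * ?r w - C * H w" using key im g' by blast
      then show "g w * cfun ?\<psi> (R w) = f w * g w * ?r w + - C * (g w * H w)" by algebra
    qed
    then show ?thesis by (simp only: contour_integral_add[OF i1 contour_integrable_lmul[OF i2]] contour_integral_lmul[OF i2])
  qed
  have "(\<Sum>\<gamma>\<leftarrow>\<Gamma>. contour_integral \<gamma> (\<lambda>w. g w * cfun ?\<psi> (R w))) =
     (\<Sum>\<gamma>\<leftarrow>\<Gamma>. contour_integral \<gamma> (\<lambda>z. f z * g z * ?r z)) + - C * (\<Sum>\<gamma>\<leftarrow>\<Gamma>. contour_integral \<gamma> (\<lambda>w. g w * H w))"
    unfolding sum_list_const_mult[symmetric] sum_list_addf[symmetric]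
    using split by (intro arg_cong[where f = sum_list] map_cong) auto
  then have "complex_of_real (?\<psi> (fcalc \<Gamma> g)) = of_real (\<phi> (fcalc \<Gamma> (\<lambda>z. f z * g z)))"
    unfolding functional_fcalc[OF s D g \<psi>] functional_fcalc[OF s D intrinsic_on_intros(3)[OF f g] \<phi>] zero by simp
  then show "\<phi> (fcalc \<Gamma> (\<lambda>z. f z * g z)) = \<phi> (fcalc \<Gamma> f o\<^sub>L fcalc \<Gamma> g)"
    by (simp add: F_def)
qed

end

section \<open>Polyanalytic functions of a complex variable\<close>

definition polyanalytic :: "nat \<Rightarrow> complex set \<Rightarrow> (complex \<Rightarrow> complex) \<Rightarrow> bool" where
  "polyanalytic M \<Omega> g \<longleftrightarrow> (\<exists>f. (\<forall>k<M. f k holomorphic_on \<Omega>) \<and> (\<forall>z\<in>\<Omega>. g z = (\<Sum>k<M. cnj z ^ k * f k z)))"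

text \<open>
  The coefficients of \<open>d\<close> and of \<open>cnj d\<close> are the two Wirtinger derivatives.
\<close>

lemma polyanalytic_derivative_sum:
  assumes \<Omega>: "open \<Omega>" and f: "\<And>k. k < M \<Longrightarrow> f k holomorphic_on \<Omega>" and z: "z \<in> \<Omega>"
  shows "((\<lambda>z. \<Sum>k<M. cnj z ^ k * f k z) has_derivative
     (\<lambda>d. d * (\<Sum>k<M. cnj z ^ k * deriv (f k) z) + cnj d * (\<Sum>k<M - 1. of_nat (Suc k) * cnj z ^ k * f (Suc k) z))) (at z)"
proof -
  have t: "((\<lambda>z. cnj z ^ k * f k z) has_derivative
     (\<lambda>d. d * (cnj z ^ k * deriv (f k) z) + cnj d * (of_nat k * cnj z ^ (k - 1) * f k z))) (at z)" if "k < M" for k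
  proof -
    have "(f k has_derivative (\<lambda>d. deriv (f k) z * d)) (at z)"
      using holomorphic_derivI[OF f[OF that] \<Omega> z] by (simp add: has_field_derivative_def)
    moreover have "((\<lambda>z. cnj z) has_derivative cnj) (at z)" by (rule bounded_linear_imp_has_derivative[OF bounded_linear_cnj])
    ultimately show ?thesis
      by (auto intro!: derivative_eq_intros simp: algebra_simps)
  qed
  have e: "(\<Sum>k<M. of_nat k * cnj z ^ (k - 1) * f k z) = (\<Sum>k<M - 1. of_nat (Suc k) * cnj z ^ k * f (Suc k) z)"
    by (cases M) (simp_all add: sum.lessThan_Suc_shift del: sum.lessThan_Suc)
  have "((\<lambda>z. \<Sum>k<M. cnj z ^ k * f k z) has_derivative
     (\<lambda>d. \<Sum>k<M. d * (cnj z ^ k * deriv (f k) z) + cnj d * (of_nat k * cnj z ^ (k - 1) * f k z))) (at z)"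
    by (intro has_derivative_sum t) simp
  then show ?thesis
    by (simp only: sum.distrib sum_distrib_left[symmetric] e)
qed

lemma complex_sum_diff_zero: "a + b = 0 \<Longrightarrow> \<i> * a - \<i> * b = 0 \<Longrightarrow> b = 0"
  by (auto simp: complex_eq_iff)

text \<open>
  The derivative with respect to \<open>cnj z\<close> of a vanishing sum vanishes, and it is a sum with one
  term less; so all coefficients but the first are zero by induction, and then the first is.
\<close>

lemma polyanalytic_unique:
  assumes \<Omega>: "open \<Omega>"
  shows "\<lbrakk>\<And>k. k < M \<Longrightarrow> f k holomorphic_on \<Omega>; \<And>z. z \<in> \<Omega> \<Longrightarrow> (\<Sum>k<M. cnj z ^ k * f k z) = 0; k < M; z \<in> \<Omega>\<rbrakk> \<Longrightarrow> f k z = 0"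
proof (induction M arbitrary: f k z)
  case (Suc M)
  have "(\<Sum>k<M. cnj z ^ k * (of_nat (Suc k) * f (Suc k) z)) = 0" if z: "z \<in> \<Omega>" for z
  proof -
    let ?a = "\<Sum>k<Suc M. cnj z ^ k * deriv (f k) z" and ?b = "\<Sum>k<M. of_nat (Suc k) * cnj z ^ k * f (Suc k) z"
    have "((\<lambda>z. \<Sum>k<Suc M. cnj z ^ k * f k z) has_derivative (\<lambda>d. d * ?a + cnj d * ?b)) (at z)"
      using polyanalytic_derivative_sum[of \<Omega> "Suc M" f z] \<Omega> Suc.prems(1) z by (simp only: diff_Suc_1)
    then have "((\<lambda>z. 0) has_derivative (\<lambda>d. d * ?a + cnj d * ?b)) (at z)"
      by (rule has_derivative_transform_within_open[OF _ \<Omega> z]) (rule Suc.prems(2))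
    then have "(\<lambda>d. d * ?a + cnj d * ?b) = (\<lambda>d. 0)" by (rule has_derivative_unique) simp
    from fun_cong[OF this, of 1] fun_cong[OF this, of \<i>] have "?a + ?b = 0" "\<i> * ?a - \<i> * ?b = 0" by simp_all
    then have "?b = 0" by (rule complex_sum_diff_zero)
    then show ?thesis by (simp add: mult_ac)
  qed
  moreover have "(\<lambda>z. of_nat (Suc k) * f (Suc k) z) holomorphic_on \<Omega>" if "k < M" for k
    using Suc.prems(1)[of "Suc k"] that by (intro holomorphic_intros) auto
  ultimately have "of_nat (Suc k) * f (Suc k) z = 0" if "k < M" "z \<in> \<Omega>" for k z
    using that by (intro Suc.IH[of "\<lambda>k z. of_nat (Suc k) * f (Suc k) z"])
  then have s: "f (Suc k) z = 0" if "k < M" "z \<in> \<Omega>" for k z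
    using that of_nat_neq_0[of k, where ?'a = complex] by (metis mult_eq_0_iff)
  then have "f 0 z = 0" if "z \<in> \<Omega>" for z
    using Suc.prems(2)[OF that] that by (simp add: sum.lessThan_Suc_shift del: sum.lessThan_Suc)
  then show ?case using s Suc.prems(3,4) by (cases k) auto
qed simp

text \<open>
  The combination \<open>gu + i gv\<close> is twice the derivative with respect to \<open>cnj z\<close>, which lowers the order.
\<close>

lemma polyanalytic_partials:
  assumes \<Omega>: "open \<Omega>" and g: "polyanalytic M \<Omega> g"
  shows "\<exists>gu gv. polyanalytic M \<Omega> gu \<and> polyanalytic M \<Omega> gv \<and> polyanalytic (M - 1) \<Omega> (\<lambda>z. gu z + \<i> * gv z) \<and>
    (\<forall>z\<in>\<Omega>. (g has_derivative (\<lambda>d. Re d *\<^sub>R gu z + Im d *\<^sub>R gv z)) (at z))"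
proof -
  obtain f where f: "\<And>k. k < M \<Longrightarrow> f k holomorphic_on \<Omega>" "\<And>z. z \<in> \<Omega> \<Longrightarrow> g z = (\<Sum>k<M. cnj z ^ k * f k z)"
    using g by (auto simp: polyanalytic_def)
  define b where "b k z = (if k < M - 1 then of_nat (Suc k) * f (Suc k) z else 0)" for k z
  have bh: "b k holomorphic_on \<Omega>" for k
    unfolding b_def by (cases "k < M - 1") (use f(1) in \<open>auto intro!: holomorphic_intros\<close>)
  have fd: "deriv (f k) holomorphic_on \<Omega>" if "k < M" for k by (rule holomorphic_deriv[OF f(1)[OF that] \<Omega>])
  define A where "A z = (\<Sum>k<M. cnj z ^ k * deriv (f k) z)" for z
  define B where "B z = (\<Sum>k<M - 1. of_nat (Suc k) * cnj z ^ k * f (Suc k) z)" for z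
  have B1: "B z = (\<Sum>k<M - 1. cnj z ^ k * b k z)" for z by (simp add: B_def b_def mult_ac)
  also have "\<dots> z = (\<Sum>k<M. cnj z ^ k * b k z)" for z
    by (rule sum.mono_neutral_left) (auto simp: b_def)
  finally have B2: "B z = (\<Sum>k<M. cnj z ^ k * b k z)" for z .
  have "polyanalytic M \<Omega> (\<lambda>z. A z + B z)" unfolding polyanalytic_def A_def B2
    by (intro exI[of _ "\<lambda>k z. deriv (f k) z + b k z"]) (auto intro!: holomorphic_intros fd bh simp: sum.distrib algebra_simps)
  moreover have "polyanalytic M \<Omega> (\<lambda>z. \<i> * (A z - B z))" unfolding polyanalytic_def A_def B2
    by (intro exI[of _ "\<lambda>k z. \<i> * (deriv (f k) z - b k z)"])
       (auto intro!: holomorphic_intros fd bh simp: sum_subtractf[symmetric] sum_distrib_left algebra_simps)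
  moreover have "(A z + B z) + \<i> * (\<i> * (A z - B z)) = 2 * B z" for z
    by (simp add: complex_eq_iff)
  then have "polyanalytic (M - 1) \<Omega> (\<lambda>z. (A z + B z) + \<i> * (\<i> * (A z - B z)))" unfolding polyanalytic_def
    by (intro exI[of _ "\<lambda>k z. 2 * b k z"])
       (auto intro!: holomorphic_intros bh simp: B1 sum_distrib_left mult_ac)
  moreover have "(g has_derivative (\<lambda>d. Re d *\<^sub>R (A z + B z) + Im d *\<^sub>R (\<i> * (A z - B z)))) (at z)" if z: "z \<in> \<Omega>" for z
  proof -
    have "(g has_derivative (\<lambda>d. d * A z + cnj d * B z)) (at z)"
    proof (rule has_derivative_transform_within_open[OF _ \<Omega> z])
      show "((\<lambda>z. \<Sum>k<M. cnj z ^ k * f k z) has_derivative (\<lambda>d. d * A z + cnj d * B z)) (at z)"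
        using polyanalytic_derivative_sum[of \<Omega> M f z] \<Omega> f(1) z by (simp only: A_def B_def)
    qed (use f(2) in auto)
    moreover have "d * A z + cnj d * B z = Re d *\<^sub>R (A z + B z) + Im d *\<^sub>R (\<i> * (A z - B z))" for d
      by (simp add: complex_eq_iff algebra_simps)
    ultimately show ?thesis by simp
  qed
  ultimately show ?thesis by blast
qed

lemma polyanalytic_partials_family:
  assumes \<Omega>: "open \<Omega>" and g: "\<And>A. polyanalytic M \<Omega> (g A)"
  obtains gu gv where "\<And>A. polyanalytic M \<Omega> (gu A)" "\<And>A. polyanalytic M \<Omega> (gv A)"
    "\<And>A. polyanalytic (M - 1) \<Omega> (\<lambda>z. gu A z + \<i> * gv A z)"
    "\<And>A z. z \<in> \<Omega> \<Longrightarrow> (g A has_derivative (\<lambda>d. Re d *\<^sub>R gu A z + Im d *\<^sub>R gv A z)) (at z)"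
proof -
  let ?Q = "\<lambda>A x. polyanalytic M \<Omega> (fst x) \<and> polyanalytic M \<Omega> (snd x) \<and> polyanalytic (M - 1) \<Omega> (\<lambda>z. fst x z + \<i> * snd x z) \<and>
    (\<forall>z\<in>\<Omega>. (g A has_derivative (\<lambda>d. Re d *\<^sub>R fst x z + Im d *\<^sub>R snd x z)) (at z))"
  have "\<exists>x. ?Q A x" for A
  proof -
    obtain gu gv where "?Q A (gu, gv)" using polyanalytic_partials[OF \<Omega> g[of A]] by auto
    then show ?thesis by blast
  qed
  then obtain x where x: "\<And>A. ?Q A (x A)" using choice[of ?Q] by blast
  show ?thesis using x by (intro that[of "\<lambda>A. fst (x A)" "\<lambda>A. snd (x A)"]) blast+
qed

section \<open>Differential calculus of the stem functions\<close>

lemma eventually_slices: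
  fixes p :: "real \<times> real"
  assumes S: "open S" "p \<in> S" and h: "\<And>p. p \<in> S \<Longrightarrow> h p = h' p"
  shows "\<forall>\<^sub>F t in nhds (fst p). h (t, snd p) = h' (t, snd p)" "\<forall>\<^sub>F t in nhds (snd p). h (fst p, t) = h' (fst p, t)"
proof -
  have o: "open ((\<lambda>t. (t, snd p)) -` S)" "open ((\<lambda>t. (fst p, t)) -` S)"
    by (intro open_vimage S(1) continuous_intros)+
  show "\<forall>\<^sub>F t in nhds (fst p). h (t, snd p) = h' (t, snd p)"
    using o(1) S(2) h unfolding eventually_nhds by (intro exI[of _ "(\<lambda>t. (t, snd p)) -` S"]) auto
  show "\<forall>\<^sub>F t in nhds (snd p). h (fst p, t) = h' (fst p, t)"
    using o(2) S(2) h unfolding eventually_nhds by (intro exI[of _ "(\<lambda>t. (fst p, t)) -` S"]) auto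
qed

lemma differentiable_cong_nhds:
  assumes "eventually (\<lambda>y. f y = g y) (nhds x)" "f differentiable at x"
  shows "g differentiable at x"
proof -
  obtain S where S: "open S" "x \<in> S" "\<And>y. y \<in> S \<Longrightarrow> f y = g y" using assms(1) unfolding eventually_nhds by blast
  obtain D where "(f has_derivative D) (at x)" using assms(2) by (auto simp: differentiable_def)
  then have "(g has_derivative D) (at x)" by (rule has_derivative_transform_within_open[OF _ S])
  then show ?thesis by (auto simp: differentiable_def)
qed

lemma Ck_on_cong:
  assumes "open S" "\<And>p. p \<in> S \<Longrightarrow> h p = h' p"
  shows "Ck_on k S h \<Longrightarrow> Ck_on k S h'"
  using assms(2)
proof (induction k arbitrary: h h')
  case 0
  then show ?case using continuous_on_cong[of S S h h'] by simp
next
  case (Suc k)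
  have ev: "\<forall>\<^sub>F t in nhds (fst p). h (t, snd p) = h' (t, snd p)" "\<forall>\<^sub>F t in nhds (snd p). h (fst p, t) = h' (fst p, t)"
    if p: "p \<in> S" for p
    using eventually_slices[of S p h h'] assms(1) p Suc.prems(2) by simp_all
  have d: "dpart_u h p = dpart_u h' p" "dpart_v h p = dpart_v h' p" if "p \<in> S" for p
    unfolding dpart_u_def dpart_v_def using ev[OF that] by (auto intro!: vector_derivative_cong_eq)
  have "(\<lambda>t. h' (t, snd p)) differentiable at (fst p) \<and> (\<lambda>t. h' (fst p, t)) differentiable at (snd p)" if p: "p \<in> S" for p
    using Suc.prems(1) p differentiable_cong_nhds[OF ev(1)[OF p]] differentiable_cong_nhds[OF ev(2)[OF p]] by auto
  moreover have "Ck_on k S (dpart_u h')" "Ck_on k S (dpart_v h')"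
    using Suc.prems(1) Suc.IH[of "dpart_u h" "dpart_u h'"] Suc.IH[of "dpart_v h" "dpart_v h'"] d by simp_all
  moreover have "continuous_on S h'"
    using Suc.prems(1) continuous_on_cong[of S S h h'] Suc.prems(2) by simp
  ultimately show ?case by simp
qed

lemma Ck_on_continuous: "Ck_on k S h \<Longrightarrow> continuous_on S h"
  by (cases k) auto

text \<open>
  The Cauchy-Riemann operator, up to the factor one half, with \<open>m\<close> in the place of the imaginary unit.
\<close>

definition CR_op :: "('a \<Rightarrow> 'a) \<Rightarrow> (real \<times> real \<Rightarrow> 'a::real_normed_vector) \<Rightarrow> real \<times> real \<Rightarrow> 'a" where
  "CR_op m h q = dpart_u h q + m (dpart_v h q)"

lemma CR_op_cong:
  assumes "open S" "\<And>p. p \<in> S \<Longrightarrow> h p = h' p" "p \<in> S"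
  shows "CR_op m h p = CR_op m h' p"
proof -
  note ev = eventually_slices[of S p h h', OF assms(1,3,2)]
  show ?thesis unfolding CR_op_def dpart_u_def dpart_v_def
    using ev by (auto intro!: vector_derivative_cong_eq arg_cong2[where f = plus] arg_cong[where f = m])
qed

lemma CR_op_funpow_cong:
  assumes "open S" "\<And>p. p \<in> S \<Longrightarrow> h p = h' p" "p \<in> S"
  shows "(CR_op m ^^ k) h p = (CR_op m ^^ k) h' p"
  using assms(2,3)
proof (induction k arbitrary: h h' p)
  case (Suc k)
  have "(CR_op m ^^ k) h q = (CR_op m ^^ k) h' q" if "q \<in> S" for q
    by (rule Suc.IH[OF Suc.prems(1) that])
  from CR_op_cong[OF assms(1) this Suc.prems(2)] show ?case by simp
qed simp

lemma Ck_on_add: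
  assumes "open S"
  shows "Ck_on k S h \<Longrightarrow> Ck_on k S h' \<Longrightarrow> Ck_on k S (\<lambda>p. a *\<^sub>R h p + b *\<^sub>R h' p)"
proof (induction k arbitrary: h h')
  case 0
  then show ?case by (auto intro!: continuous_intros)
next
  case (Suc k)
  have diff: "(\<lambda>t. h (t, snd p)) differentiable at (fst p)" "(\<lambda>t. h (fst p, t)) differentiable at (snd p)"
     "(\<lambda>t. h' (t, snd p)) differentiable at (fst p)" "(\<lambda>t. h' (fst p, t)) differentiable at (snd p)" if "p \<in> S" for p
    using Suc.prems that by auto
  have vd: "((\<lambda>t. a *\<^sub>R h (t, snd p) + b *\<^sub>R h' (t, snd p)) has_vector_derivative a *\<^sub>R dpart_u h p + b *\<^sub>R dpart_u h' p) (at (fst p))"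
     "((\<lambda>t. a *\<^sub>R h (fst p, t) + b *\<^sub>R h' (fst p, t)) has_vector_derivative a *\<^sub>R dpart_v h p + b *\<^sub>R dpart_v h' p) (at (snd p))"
    if "p \<in> S" for p
    using diff[OF that] unfolding vector_derivative_works dpart_u_def dpart_v_def by (auto intro!: derivative_eq_intros)
  have "Ck_on k S (dpart_u (\<lambda>p. a *\<^sub>R h p + b *\<^sub>R h' p))"
  proof (rule Ck_on_cong[OF assms])
    show "Ck_on k S (\<lambda>p. a *\<^sub>R dpart_u h p + b *\<^sub>R dpart_u h' p)" using Suc by simp
  qed (use vd in \<open>auto simp: dpart_u_def[of "\<lambda>p. a *\<^sub>R h p + b *\<^sub>R h' p"] intro!: vector_derivative_at[symmetric]\<close>)
  moreover have "Ck_on k S (dpart_v (\<lambda>p. a *\<^sub>R h p + b *\<^sub>R h' p))"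
  proof (rule Ck_on_cong[OF assms])
    show "Ck_on k S (\<lambda>p. a *\<^sub>R dpart_v h p + b *\<^sub>R dpart_v h' p)" using Suc by simp
  qed (use vd in \<open>auto simp: dpart_v_def[of "\<lambda>p. a *\<^sub>R h p + b *\<^sub>R h' p"] intro!: vector_derivative_at[symmetric]\<close>)
  moreover have "(\<lambda>t. a *\<^sub>R h (t, snd p) + b *\<^sub>R h' (t, snd p)) differentiable at (fst p) \<and>
     (\<lambda>t. a *\<^sub>R h (fst p, t) + b *\<^sub>R h' (fst p, t)) differentiable at (snd p)" if "p \<in> S" for p
    using vd[OF that] by (auto simp: differentiableI_vector)
  moreover have "continuous_on S (\<lambda>p. a *\<^sub>R h p + b *\<^sub>R h' p)"
    using Suc.prems by (auto intro!: continuous_intros)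
  ultimately show ?case by simp
qed

lemma has_derivative_of_Ck:
  fixes h :: "real \<times> real \<Rightarrow> 'a::real_normed_vector"
  assumes S: "open S" "p \<in> S" and h: "Ck_on (Suc k) S h"
  shows "(h has_derivative (\<lambda>d. fst d *\<^sub>R dpart_u h p + snd d *\<^sub>R dpart_v h p)) (at p)"
proof -
  obtain x y where p: "p = (x, y)" by (cases p)
  obtain A B where AB: "open A" "open B" "A \<times> B \<subseteq> S" "x \<in> A" "y \<in> B"
    using S unfolding p open_prod_def by auto
  obtain e where e: "e > 0" "ball y e \<subseteq> B" using AB openE by blast
  have sub: "A \<times> ball y e \<subseteq> S" using AB(3) e(2) by auto
  have diff: "((\<lambda>t. h (t, snd q)) has_vector_derivative dpart_u h q) (at (fst q))"
     "((\<lambda>t. h (fst q, t)) has_vector_derivative dpart_v h q) (at (snd q))" if "q \<in> S" for q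
    using h that unfolding dpart_u_def dpart_v_def by (auto simp: vector_derivative_works[symmetric])
  have "((\<lambda>(x, y). h (x, y)) has_derivative (\<lambda>(tx, ty). tx *\<^sub>R dpart_u h (x, y) + blinfun_apply (blinfun_scaleR_left (dpart_v h (x, y))) ty)) (at (x, y) within A \<times> ball y e)"
  proof (rule has_derivative_partialsI[where fy = "\<lambda>x y. blinfun_scaleR_left (dpart_v h (x, y))"])
    show "((\<lambda>x. h (x, y)) has_derivative (\<lambda>t. t *\<^sub>R dpart_u h (x, y))) (at x within A)"
      using diff(1)[OF S(2)] by (simp add: p has_vector_derivative_def has_derivative_at_withinI)
    show "((\<lambda>y. h (a, y)) has_derivative blinfun_apply (blinfun_scaleR_left (dpart_v h (a, b)))) (at b within ball y e)"
      if ab: "a \<in> A" "b \<in> ball y e" for a b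
    proof -
      have "(a, b) \<in> S" using ab sub by blast
      from diff(2)[OF this] show ?thesis by (simp add: has_vector_derivative_def has_derivative_at_withinI)
    qed
    have "continuous_on S (dpart_v h)" using h Ck_on_continuous by auto
    then have "continuous (at (x, y)) (dpart_v h)" using S p by (simp add: continuous_on_eq_continuous_at)
    then have "continuous (at (x, y) within A \<times> ball y e) (\<lambda>q. blinfun_scaleR_left (dpart_v h q))"
      by (rule bounded_linear.continuous[OF bounded_linear_blinfun_scaleR_left continuous_at_imp_continuous_at_within])
    then show "continuous (at (x, y) within A \<times> ball y e) (\<lambda>(x, y). blinfun_scaleR_left (dpart_v h (x, y)))"
      by (simp add: case_prod_unfold)
  qed (use e AB in auto)
  moreover have "at (x, y) within A \<times> ball y e = at (x, y)"
    using AB e by (intro at_within_open open_Times) auto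
  ultimately show ?thesis by (simp add: p case_prod_unfold)
qed

section \<open>Clifford-valued functions from families of complex functions\<close>

definition rvec :: "('n set \<Rightarrow> complex) \<Rightarrow> 'n::finite clifford" where "rvec c = (\<chi> A. Re (c A))"
definition ivec :: "('n set \<Rightarrow> complex) \<Rightarrow> 'n::finite clifford" where "ivec c = (\<chi> A. Im (c A))"
text \<open>
  Evaluates a family of complex coefficients, one for each basis element, with \<open>m\<close> in the place of \<open>i\<close>.
\<close>

definition lift :: "('n clifford \<Rightarrow> 'n clifford) \<Rightarrow> ('n set \<Rightarrow> complex) \<Rightarrow> 'n::finite clifford" where
  "lift m c = rvec c + m (ivec c)"

definition pt :: "real \<times> real \<Rightarrow> complex" where "pt p = Complex (fst p) (snd p)"

lemma lift_sum:
  assumes "bounded_linear m"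
  shows "lift m c = (\<Sum>A\<in>UNIV. Re (c A) *\<^sub>R cbasis A + Im (c A) *\<^sub>R m (cbasis A))"
proof -
  interpret bounded_linear m by fact
  have "rvec c = (\<Sum>A\<in>UNIV. Re (c A) *\<^sub>R cbasis A)" "ivec c = (\<Sum>A\<in>UNIV. Im (c A) *\<^sub>R cbasis A)"
    using clifford_expansion[of "rvec c"] clifford_expansion[of "ivec c"] by (simp_all add: rvec_def ivec_def)
  then show ?thesis by (simp add: lift_def sum scaleR sum.distrib)
qed

lemma has_vector_derivative_lift:
  assumes m: "bounded_linear m" and c: "\<And>A. ((\<lambda>t. c A t) has_vector_derivative d A) F"
  shows "((\<lambda>t. lift m (\<lambda>A. c A t)) has_vector_derivative lift m d) F"
  unfolding lift_sum[OF m]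
  by (intro has_vector_derivative_sum has_vector_derivative_add
      bounded_linear.has_vector_derivative[OF bounded_linear_scaleR_left]
      bounded_linear.has_vector_derivative[OF bounded_linear_Re] bounded_linear.has_vector_derivative[OF bounded_linear_Im] c)

lemma slice_derivatives:
  assumes "(g has_derivative (\<lambda>d. Re d *\<^sub>R gu + Im d *\<^sub>R gv)) (at (Complex u v))"
  shows "((\<lambda>t. g (Complex t v)) has_vector_derivative gu) (at u)" "((\<lambda>t. g (Complex u t)) has_vector_derivative gv) (at v)"
proof -
  have 1: "((\<lambda>t. Complex t v) has_derivative (\<lambda>d. Complex d 0)) (at u)"
    unfolding Complex_eq by (auto intro!: derivative_eq_intros)
  have 2: "((\<lambda>t. Complex u t) has_derivative (\<lambda>d. Complex 0 d)) (at v)"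
    unfolding Complex_eq by (auto intro!: derivative_eq_intros)
  show "((\<lambda>t. g (Complex t v)) has_vector_derivative gu) (at u)"
    using has_derivative_compose[OF 1, of g "\<lambda>d. Re d *\<^sub>R gu + Im d *\<^sub>R gv"] assms by (simp add: has_vector_derivative_def)
  show "((\<lambda>t. g (Complex u t)) has_vector_derivative gv) (at v)"
    using has_derivative_compose[OF 2, of g "\<lambda>d. Re d *\<^sub>R gu + Im d *\<^sub>R gv"] assms by (simp add: has_vector_derivative_def)
qed

lemma dpart_lift:
  assumes m: "bounded_linear m"
    and g: "\<And>A. (g A has_derivative (\<lambda>d. Re d *\<^sub>R gu A + Im d *\<^sub>R gv A)) (at (pt p))"
  shows "((\<lambda>t. lift m (\<lambda>A. g A (pt (t, snd p)))) has_vector_derivative lift m gu) (at (fst p))"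
    "((\<lambda>t. lift m (\<lambda>A. g A (pt (fst p, t)))) has_vector_derivative lift m gv) (at (snd p))"
  using slice_derivatives[OF g[unfolded pt_def]]
  by (auto intro!: has_vector_derivative_lift[OF m] simp: pt_def)

context
  fixes P :: "(real \<times> real) set" and \<Omega> :: "complex set"
  assumes P: "open P" and \<Omega>: "\<Omega> = {z. (Re z, Im z) \<in> P}"
begin

lemma open_\<Omega>: "open \<Omega>"
proof -
  have "\<Omega> = (\<lambda>z. (Re z, Im z)) -` P" by (auto simp: \<Omega>)
  then show ?thesis by (simp add: open_vimage P continuous_intros)
qed

lemma continuous_pt: "continuous_on X pt"
  unfolding pt_def[abs_def] Complex_eq by (intro continuous_intros)

lemma pt_\<Omega>: "pt p \<in> \<Omega> \<longleftrightarrow> p \<in> P" by (cases p) (simp add: \<Omega> pt_def)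

lemma Ck_on_lift_polyanalytic:
  assumes m: "bounded_linear m"
  shows "(\<And>A. polyanalytic M \<Omega> (g A)) \<Longrightarrow> Ck_on k P (\<lambda>p. lift m (\<lambda>A. g A (pt p)))"
proof (induction k arbitrary: g)
  case 0
  have "continuous_on \<Omega> (g A)" for A
  proof -
    obtain gu gv where "\<And>z. z \<in> \<Omega> \<Longrightarrow> (g A has_derivative (\<lambda>d. Re d *\<^sub>R gu z + Im d *\<^sub>R gv z)) (at z)"
      using polyanalytic_partials[OF open_\<Omega> 0] by blast
    from has_derivative_continuous[OF this] show ?thesis
      by (intro continuous_at_imp_continuous_on ballI)
  qed
  then have "continuous_on P (\<lambda>p. g A (pt p))" for A
    by (rule continuous_on_compose2[OF _ continuous_pt]) (auto simp: pt_\<Omega>)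
  then show ?case by (auto simp: lift_sum[OF m] intro!: continuous_intros)
next
  case (Suc k)
  obtain gu gv where gu: "\<And>A. polyanalytic M \<Omega> (gu A)" and gv: "\<And>A. polyanalytic M \<Omega> (gv A)"
    and d: "\<And>A z. z \<in> \<Omega> \<Longrightarrow> (g A has_derivative (\<lambda>d. Re d *\<^sub>R gu A z + Im d *\<^sub>R gv A z)) (at z)"
    by (rule polyanalytic_partials_family[where g = g, OF open_\<Omega> Suc.prems]) (rule that; assumption)
  let ?h = "\<lambda>p. lift m (\<lambda>A. g A (pt p))"
  have vd: "((\<lambda>t. ?h (t, snd p)) has_vector_derivative lift m (\<lambda>A. gu A (pt p))) (at (fst p))"
    "((\<lambda>t. ?h (fst p, t)) has_vector_derivative lift m (\<lambda>A. gv A (pt p))) (at (snd p))" if "p \<in> P" for p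
    using that by (auto intro!: dpart_lift[OF m] d simp: pt_\<Omega>)
  have "Ck_on k P (dpart_u ?h)"
  proof (rule Ck_on_cong[OF P _ Suc.IH[OF gu]])
    fix p assume p: "p \<in> P"
    show "lift m (\<lambda>A. gu A (pt p)) = dpart_u ?h p"
      unfolding dpart_u_def using vector_derivative_at[OF vd(1)[OF p]] by simp
  qed
  moreover have "Ck_on k P (dpart_v ?h)"
  proof (rule Ck_on_cong[OF P _ Suc.IH[OF gv]])
    fix p assume p: "p \<in> P"
    show "lift m (\<lambda>A. gv A (pt p)) = dpart_v ?h p"
      unfolding dpart_v_def using vector_derivative_at[OF vd(2)[OF p]] by simp
  qed
  moreover have "continuous_on P ?h"
  proof -
    have "continuous_on \<Omega> (g A)" for A
      by (intro continuous_at_imp_continuous_on ballI has_derivative_continuous[OF d])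
    then have "continuous_on P (\<lambda>p. g A (pt p))" for A
      by (rule continuous_on_compose2[OF _ continuous_pt]) (auto simp: pt_\<Omega>)
    then show ?thesis by (auto simp: lift_sum[OF m] intro!: continuous_intros)
  qed
  moreover have "(\<lambda>t. ?h (t, snd p)) differentiable at (fst p) \<and> (\<lambda>t. ?h (fst p, t)) differentiable at (snd p)" if "p \<in> P" for p
    using vd[OF that] differentiableI_vector by blast
  ultimately show ?case by simp
qed

lemma CR_op_lift_polyanalytic:
  assumes m: "bounded_linear m" "\<And>x. m (m x) = - x"
  shows "(\<And>A. polyanalytic M \<Omega> (g A)) \<Longrightarrow> p \<in> P \<Longrightarrow> (CR_op m ^^ M) (\<lambda>p. lift m (\<lambda>A. g A (pt p))) p = 0"
proof (induction M arbitrary: g p)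
  case 0
  interpret m: bounded_linear m by (rule m(1))
  have "g A (pt p) = 0" for A using 0 by (auto simp: polyanalytic_def pt_\<Omega>)
  then show ?case by (simp add: lift_def rvec_def ivec_def m.zero zero_vec_def[symmetric])
next
  case (Suc M)
  obtain gu gv where gu: "\<And>A. polyanalytic M \<Omega> (\<lambda>z. gu A z + \<i> * gv A z)"
    and d: "\<And>A z. z \<in> \<Omega> \<Longrightarrow> (g A has_derivative (\<lambda>d. Re d *\<^sub>R gu A z + Im d *\<^sub>R gv A z)) (at z)"
    by (rule polyanalytic_partials_family[where g = g, OF open_\<Omega> Suc.prems(1), unfolded diff_Suc_1])
       (rule that; assumption)
  let ?h = "\<lambda>p. lift m (\<lambda>A. g A (pt p))"
  have vd: "((\<lambda>t. ?h (t, snd p)) has_vector_derivative lift m (\<lambda>A. gu A (pt p))) (at (fst p))"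
    "((\<lambda>t. ?h (fst p, t)) has_vector_derivative lift m (\<lambda>A. gv A (pt p))) (at (snd p))" if "p \<in> P" for p
    using that by (auto intro!: dpart_lift[OF m(1)] d simp: pt_\<Omega>)
  have "CR_op m ?h p = lift m (\<lambda>A. gu A (pt p) + \<i> * gv A (pt p))" if p: "p \<in> P" for p
  proof -
    interpret m: bounded_linear m by (rule m(1))
    have "CR_op m ?h p = lift m (\<lambda>A. gu A (pt p)) + m (lift m (\<lambda>A. gv A (pt p)))"
      unfolding CR_op_def dpart_u_def dpart_v_def
      using vector_derivative_at[OF vd(1)[OF p]] vector_derivative_at[OF vd(2)[OF p]] by simp
    also have "\<dots> = (rvec (\<lambda>A. gu A (pt p)) - ivec (\<lambda>A. gv A (pt p))) + m (ivec (\<lambda>A. gu A (pt p)) + rvec (\<lambda>A. gv A (pt p)))"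
      by (simp add: lift_def m.add m(2))
    also have "rvec (\<lambda>A. gu A (pt p)) - ivec (\<lambda>A. gv A (pt p)) = rvec (\<lambda>A. gu A (pt p) + \<i> * gv A (pt p))"
      by (simp add: rvec_def ivec_def vec_eq_iff)
    also have "ivec (\<lambda>A. gu A (pt p)) + rvec (\<lambda>A. gv A (pt p)) = ivec (\<lambda>A. gu A (pt p) + \<i> * gv A (pt p))"
      by (simp add: rvec_def ivec_def vec_eq_iff)
    finally show ?thesis by (simp add: lift_def)
  qed
  then have "(CR_op m ^^ M) (CR_op m ?h) p = (CR_op m ^^ M) (\<lambda>p. lift m (\<lambda>A. gu A (pt p) + \<i> * gv A (pt p))) p"
    by (rule CR_op_funpow_cong[OF P _ Suc.prems(2)])
  also have "\<dots> = 0" by (rule Suc.IH[OF gu Suc.prems(2)])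
  finally show ?case by (simp only: funpow_Suc_right o_apply)
qed

text \<open>
  Induction on the order. The Cauchy-Riemann operator maps the stem pair to one of lower order, which has a decomposition. A
  primitive of it with respect to \<open>cnj z\<close> is written down explicitly, and the difference to the original
  function satisfies the Cauchy-Riemann equations. The condition is used for \<open>m\<close> and \<open>- m\<close>, which for slice functions are
  the units \<open>j\<close> and \<open>- j\<close>; together they determine both stem functions.
\<close>

lemma polyanalytic_decomposition:
  fixes m :: "'n::finite clifford \<Rightarrow> 'n clifford"
  assumes m: "bounded_linear m" "\<And>x. m (m x) = - x"
  shows "\<lbrakk>Ck_on M P F0; Ck_on M P F1;
     \<And>p. p \<in> P \<Longrightarrow> (CR_op m ^^ M) (\<lambda>q. F0 q + m (F1 q)) p = 0;
     \<And>p. p \<in> P \<Longrightarrow> (CR_op (\<lambda>x. - m x) ^^ M) (\<lambda>q. F0 q - m (F1 q)) p = 0\<rbrakk> \<Longrightarrow>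
   \<exists>f. (\<forall>k A. f k A holomorphic_on \<Omega>) \<and>
     (\<forall>p\<in>P. \<forall>A. Complex (F0 p $ A) (F1 p $ A) = (\<Sum>k<M. cnj (pt p) ^ k * f k A (pt p)))"
proof (induction M arbitrary: F0 F1)
  case 0
  have "F0 p = 0 \<and> F1 p = 0" if "p \<in> P" for p
  proof -
    have e: "F0 p + m (F1 p) = 0" "F0 p - m (F1 p) = 0" using 0(3,4)[OF that] by auto
    then have "2 *\<^sub>R F0 p = 0" unfolding scaleR_2 by (metis add.right_neutral diff_add_cancel add.commute add_diff_cancel_left' eq_iff_diff_eq_0)
    then have "F0 p = 0" by simp
    then have "m (F1 p) = 0" using e by simp
    then have "F1 p = 0" using m(2)[of "F1 p"] linear_0[OF bounded_linear.linear[OF m(1)]] by simp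
    then show ?thesis using \<open>F0 p = 0\<close> by simp
  qed
  then show ?case by (intro exI[of _ "\<lambda>_ _ _. 0"]) (auto simp: complex_eq_iff)
next
  case (Suc M)
  interpret m: bounded_linear m by (rule m(1))
  \<comment> \<open>\<open>G0 + m G1\<close> is the image of \<open>F0 + m F1\<close> under the Cauchy-Riemann operator.\<close>
  define G0 where "G0 p = 1 *\<^sub>R dpart_u F0 p + (- 1) *\<^sub>R dpart_v F1 p" for p
  define G1 where "G1 p = 1 *\<^sub>R dpart_u F1 p + 1 *\<^sub>R dpart_v F0 p" for p
  have C: "Ck_on M P (dpart_u F0)" "Ck_on M P (dpart_v F0)" "Ck_on M P (dpart_u F1)" "Ck_on M P (dpart_v F1)"
    using Suc.prems(1,2) by auto
  have CG: "Ck_on M P G0" "Ck_on M P G1"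
    unfolding G0_def[abs_def] G1_def[abs_def] by (intro Ck_on_add[OF P] C)+
  have vd: "((\<lambda>t. F (t, snd p)) has_vector_derivative dpart_u F p) (at (fst p))"
    "((\<lambda>t. F (fst p, t)) has_vector_derivative dpart_v F p) (at (snd p))" if "p \<in> P" "Ck_on (Suc M) P F" for p and F :: "real \<times> real \<Rightarrow> 'n clifford"
    using that unfolding dpart_u_def dpart_v_def by (auto simp: vector_derivative_works[symmetric])
  have D: "CR_op m' (\<lambda>q. F0 q + m' (F1 q)) p = G0 p + m' (G1 p)"
    if p: "p \<in> P" and m': "bounded_linear m'" "\<And>x. m' (m' x) = - x" for p m'
  proof -
    interpret m': bounded_linear m' by (rule m'(1))
    have "((\<lambda>t. F0 (t, snd p) + m' (F1 (t, snd p))) has_vector_derivative dpart_u F0 p + m' (dpart_u F1 p)) (at (fst p))"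
      "((\<lambda>t. F0 (fst p, t) + m' (F1 (fst p, t))) has_vector_derivative dpart_v F0 p + m' (dpart_v F1 p)) (at (snd p))"
      by (intro has_vector_derivative_add m'.has_vector_derivative
          vd[OF p Suc.prems(1)] vd[OF p Suc.prems(2)])+
    then show ?thesis
      unfolding CR_op_def dpart_u_def[of "\<lambda>q. F0 q + m' (F1 q)"] dpart_v_def[of "\<lambda>q. F0 q + m' (F1 q)"]
      by (simp add: vector_derivative_at G0_def G1_def m'.add m'(2))
  qed
  have mm: "bounded_linear (\<lambda>x. - m x)" "- m (- m x) = - x" for x
    using bounded_linear_minus[OF m(1)] by (simp_all add: linear_neg[OF bounded_linear.linear[OF m(1)]] m(2))
  have "(CR_op m ^^ M) (\<lambda>q. G0 q + m (G1 q)) p = 0" if p: "p \<in> P" for p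
  proof -
    have "(CR_op m ^^ M) (\<lambda>q. G0 q + m (G1 q)) p = (CR_op m ^^ M) (CR_op m (\<lambda>q. F0 q + m (F1 q))) p"
      by (rule CR_op_funpow_cong[OF P _ p]) (simp add: D m)
    also have "\<dots> = (CR_op m ^^ Suc M) (\<lambda>q. F0 q + m (F1 q)) p" by (simp only: funpow_Suc_right o_apply)
    finally show ?thesis using Suc.prems(3)[OF p] by simp
  qed
  moreover have "(CR_op (\<lambda>x. - m x) ^^ M) (\<lambda>q. G0 q - m (G1 q)) p = 0" if p: "p \<in> P" for p
  proof -
    have "(CR_op (\<lambda>x. - m x) ^^ M) (\<lambda>q. G0 q - m (G1 q)) p = (CR_op (\<lambda>x. - m x) ^^ M) (CR_op (\<lambda>x. - m x) (\<lambda>q. F0 q - m (F1 q))) p"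
    proof (rule CR_op_funpow_cong[OF P _ p])
      fix q assume "q \<in> P"
      from D[OF this mm] show "G0 q - m (G1 q) = CR_op (\<lambda>x. - m x) (\<lambda>q. F0 q - m (F1 q)) q" by simp
    qed
    also have "\<dots> = (CR_op (\<lambda>x. - m x) ^^ Suc M) (\<lambda>q. F0 q - m (F1 q)) p" by (simp only: funpow_Suc_right o_apply)
    finally show ?thesis using Suc.prems(4)[OF p] by simp
  qed
  ultimately obtain h where h: "\<And>k A. h k A holomorphic_on \<Omega>"
    "\<And>p A. p \<in> P \<Longrightarrow> Complex (G0 p $ A) (G1 p $ A) = (\<Sum>k<M. cnj (pt p) ^ k * h k A (pt p))"
    using Suc.IH[OF CG] by blast
  \<comment> \<open>A primitive of \<open>\<Sum> cnj z ^ k * h k\<close> with respect to \<open>cnj z\<close>, halved as \<open>CR_op\<close> is twice the derivative.\<close>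
  define f' where "f' A k z = (case k of 0 \<Rightarrow> 0 | Suc k \<Rightarrow> h k A z / (2 * of_nat (Suc k)))" for A k z
  have f': "f' A k holomorphic_on \<Omega>" for A k
    unfolding f'_def by (cases k) (auto intro!: holomorphic_intros h)
  define g where "g A z = Complex (F0 (Re z, Im z) $ A) (F1 (Re z, Im z) $ A)" for A z
  define \<phi> where "\<phi> A z = g A z - (\<Sum>k<Suc M. cnj z ^ k * f' A k z)" for A z
  have \<phi>: "\<phi> A holomorphic_on \<Omega>" for A
  proof (rule holomorphic_onI)
    fix z assume z: "z \<in> \<Omega>"
    define p where "p = (Re z, Im z)"
    have p: "p \<in> P" "pt p = z" using z by (auto simp: p_def \<Omega> pt_def)
    define gu where "gu = Complex (dpart_u F0 p $ A) (dpart_u F1 p $ A)"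
    define gv where "gv = Complex (dpart_v F0 p $ A) (dpart_v F1 p $ A)"
    have hd: "((\<lambda>z. F (Re z, Im z) $ A) has_derivative (\<lambda>d. Re d * dpart_u F p $ A + Im d * dpart_v F p $ A)) (at z)"
      if F: "Ck_on (Suc M) P F" for F :: "real \<times> real \<Rightarrow> 'n clifford"
    proof -
      have "((\<lambda>z. (Re z, Im z)) has_derivative (\<lambda>d. (Re d, Im d))) (at z)"
        by (auto intro!: derivative_eq_intros)
      from has_derivative_compose[OF this, of F "\<lambda>d. fst d *\<^sub>R dpart_u F p + snd d *\<^sub>R dpart_v F p"]
        has_derivative_of_Ck[OF P p(1) F]
      have "((\<lambda>z. F (Re z, Im z)) has_derivative (\<lambda>d. Re d *\<^sub>R dpart_u F p + Im d *\<^sub>R dpart_v F p)) (at z)"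
        by (simp add: p_def)
      from bounded_linear.has_derivative[OF bounded_linear_vec_nth this, of A] show ?thesis by simp
    qed
    have "((\<lambda>z. of_real (F0 (Re z, Im z) $ A) + \<i> * of_real (F1 (Re z, Im z) $ A)) has_derivative
       (\<lambda>d. of_real (Re d * dpart_u F0 p $ A + Im d * dpart_v F0 p $ A) + \<i> * of_real (Re d * dpart_u F1 p $ A + Im d * dpart_v F1 p $ A))) (at z)"
      by (intro has_derivative_add bounded_linear.has_derivative[OF bounded_linear_of_real] has_derivative_mult_right hd Suc.prems)
    then have "(g A has_derivative (\<lambda>d. Re d *\<^sub>R gu + Im d *\<^sub>R gv)) (at z)"
      by (simp add: g_def[abs_def] gu_def gv_def Complex_eq algebra_simps scaleR_conv_of_real)
    moreover define a where "a = (\<Sum>k<Suc M. cnj z ^ k * deriv (f' A k) z)"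
    have "((\<lambda>z. \<Sum>k<Suc M. cnj z ^ k * f' A k z) has_derivative (\<lambda>d. d * a + cnj d * ((gu + \<i> * gv) / 2))) (at z)"
    proof -
      have "gu + \<i> * gv = Complex (G0 p $ A) (G1 p $ A)" by (simp add: gu_def gv_def G0_def G1_def complex_eq_iff)
      also have "\<dots> = (\<Sum>k<M. cnj z ^ k * h k A z)" using h(2)[OF p(1)] p(2) by simp
      finally have "(gu + \<i> * gv) / 2 = (\<Sum>k<M. of_nat (Suc k) * cnj z ^ k * f' A (Suc k) z)"
        by (simp add: f'_def sum_divide_distrib field_simps del: of_nat_Suc)
      then show ?thesis
        using polyanalytic_derivative_sum[of \<Omega> "Suc M" "f' A" z] open_\<Omega> f' z unfolding a_def by (simp only: diff_Suc_1)
    qed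
    ultimately have "(\<phi> A has_derivative (\<lambda>d. (Re d *\<^sub>R gu + Im d *\<^sub>R gv) - (d * a + cnj d * ((gu + \<i> * gv) / 2)))) (at z)"
      unfolding \<phi>_def[abs_def] by (rule has_derivative_diff)
    moreover have "(Re d *\<^sub>R gu + Im d *\<^sub>R gv) - (d * a + cnj d * ((gu + \<i> * gv) / 2)) = ((gu - \<i> * gv) / 2 - a) * d" for d
      by (simp add: complex_eq_iff field_simps)
    ultimately have "(\<phi> A has_field_derivative ((gu - \<i> * gv) / 2 - a)) (at z)"
      by (simp add: has_field_derivative_def)
    then show "\<phi> A field_differentiable at z within \<Omega>"
      using field_differentiable_at_within field_differentiable_def by blast
  qed
  define f where "f k A = (case k of 0 \<Rightarrow> \<phi> A | Suc k \<Rightarrow> f' A (Suc k))" for k A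
  have "Complex (F0 p $ A) (F1 p $ A) = (\<Sum>k<Suc M. cnj (pt p) ^ k * f k A (pt p))" if "p \<in> P" for p A
  proof -
    have "(\<Sum>k<Suc M. cnj (pt p) ^ k * f k A (pt p)) = \<phi> A (pt p) + (\<Sum>k<M. cnj (pt p) ^ Suc k * f' A (Suc k) (pt p))"
      by (simp add: f_def sum.lessThan_Suc_shift del: sum.lessThan_Suc)
    also have "\<dots> = g A (pt p)"
      by (simp add: \<phi>_def sum.lessThan_Suc_shift f'_def del: sum.lessThan_Suc)
    finally show ?thesis by (simp add: g_def pt_def)
  qed
  moreover have "f k A holomorphic_on \<Omega>" for k A unfolding f_def by (cases k) (auto simp: \<phi> f')
  ultimately show ?case by blast
qed

end

section \<open>Slices of axially symmetric sets\<close>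

definition complex_domain :: "('n::finite) point set \<Rightarrow> complex set" where
  "complex_domain D = {z. (Re z, Im z) \<in> plane_domain D}"

lemma unit_vector_exists: "\<exists>j. j \<in> (\<S> :: (real ^ 'n::finite) set)"
  by (intro exI[of _ "axis undefined 1"]) (simp add: unit_vectors_def norm_axis_1)

lemma minus_unit_vector: "j \<in> \<S> \<Longrightarrow> - j \<in> \<S>"
  by (simp add: unit_vectors_def)

lemma plane_domain_iff:
  assumes "axially_symmetric D" "j \<in> \<S>"
  shows "(u, v) \<in> plane_domain D \<longleftrightarrow> (u, v *\<^sub>R j) \<in> D"
proof
  assume x: "(u, v *\<^sub>R j) \<in> D"
  have n: "norm (v *\<^sub>R j) = \<bar>v\<bar>" using assms(2) by (simp add: unit_vectors_def)
  have "(u, \<bar>v\<bar> *\<^sub>R k) \<in> D" if "k \<in> \<S>" for k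
    using assms(1) x that n unfolding axially_symmetric_def by force
  then have "(u, v *\<^sub>R k) \<in> D" if "k \<in> \<S>" for k
    using that minus_unit_vector[OF that] by (cases "v \<ge> 0") fastforce+
  then show "(u, v) \<in> plane_domain D" by (simp add: plane_domain_def)
qed (use assms in \<open>auto simp: plane_domain_def\<close>)

lemma slice_eq_complex_domain: "axially_symmetric D \<Longrightarrow> j \<in> \<S> \<Longrightarrow> slice j D = complex_domain D"
  by (auto simp: slice_def complex_domain_def slice_point_def plane_domain_iff)

lemma open_plane_domain:
  fixes D :: "'n::finite point set"
  assumes "open D" "axially_symmetric D"
  shows "open (plane_domain D)"
proof -
  obtain j :: "real ^ 'n" where j: "j \<in> \<S>" using unit_vector_exists by blast
  have "plane_domain D = (\<lambda>p. (fst p, snd p *\<^sub>R j)) -` D"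
    using plane_domain_iff[OF assms(2) j] by auto
  then show ?thesis by (simp add: open_vimage assms(1) continuous_intros)
qed

lemma complex_domain_cnj_symmetric:
  assumes "open D" "axially_symmetric D"
  shows "cnj_symmetric (complex_domain D)"
proof -
  have "complex_domain D = (\<lambda>z. (Re z, Im z)) -` plane_domain D" by (auto simp: complex_domain_def)
  then have "open (complex_domain D)" using open_plane_domain[OF assms] by (simp add: open_vimage continuous_intros)
  moreover have "cnj z \<in> complex_domain D" if "z \<in> complex_domain D" for z
    using that minus_unit_vector by (fastforce simp: complex_domain_def plane_domain_def)
  ultimately show ?thesis by (simp add: cnj_symmetric_def)
qed

lemma complex_domain_Int: "complex_domain (A \<inter> B) = complex_domain A \<inter> complex_domain B"
  by (auto simp: complex_domain_def plane_domain_def)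

lemma axially_symmetric_Int: "axially_symmetric A \<Longrightarrow> axially_symmetric B \<Longrightarrow> axially_symmetric (A \<inter> B)"
  by (auto simp: axially_symmetric_def)

lemma slice_point_cases:
  fixes x :: "'n::finite point"
  obtains j where "j \<in> \<S>" "x = slice_point j (Complex (fst x) (norm (snd x)))"
proof (cases "snd x = 0")
  case True
  obtain j :: "real ^ 'n" where "j \<in> \<S>" using unit_vector_exists by blast
  then show ?thesis using that[of j] True by (cases x) (simp add: slice_point_def)
next
  case False
  then show ?thesis using that[of "sgn (snd x)"]
    by (cases x) (simp add: slice_point_def unit_vectors_def norm_sgn sgn_div_norm)
qed

lemma slice_point_in: "z \<in> complex_domain D \<Longrightarrow> j \<in> \<S> \<Longrightarrow> slice_point j z \<in> D"
  by (auto simp: complex_domain_def plane_domain_def slice_point_def)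

lemma in_domain_cases:
  assumes "axially_symmetric D" "x \<in> D"
  obtains j z where "j \<in> \<S>" "z \<in> complex_domain D" "x = slice_point j z"
proof -
  obtain j where j: "j \<in> \<S>" "x = slice_point j (Complex (fst x) (norm (snd x)))" by (rule slice_point_cases)
  then have "Complex (fst x) (norm (snd x)) \<in> slice j D" using assms(2) by (simp add: slice_def)
  then show ?thesis using that j slice_eq_complex_domain[OF assms(1) j(1)] by blast
qed

section \<open>Poly slice monogenic functions and families of intrinsic functions\<close>

text \<open>
  The conditions on left and right stem functions in one formula: \<open>act j\<close> is the multiplication by \<open>j\<close> from the left or from the
  right.
\<close>

definition action_stem :: "(real ^ 'n \<Rightarrow> 'n clifford \<Rightarrow> 'n clifford) \<Rightarrow> nat \<Rightarrow> ('n::finite) point set \<Rightarrow> ('n point \<Rightarrow> 'n clifford) \<Rightarrow>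
    (real \<times> real \<Rightarrow> 'n clifford) \<Rightarrow> (real \<times> real \<Rightarrow> 'n clifford) \<Rightarrow> bool" where
  "action_stem act M U F F0 F1 \<longleftrightarrow> stem_pair M U F0 F1 \<and>
     (\<forall>(u, v) \<in> plane_domain U. \<forall>j\<in>\<S>. F (u, v *\<^sub>R j) = F0 (u, v) + act j (F1 (u, v))) \<and>
     (\<forall>j\<in>\<S>. \<forall>p \<in> plane_domain U. (1 / 2 ^ M) *\<^sub>R (CR_op (act j) ^^ M) (\<lambda>q. F0 q + act j (F1 q)) p = 0)"

definition action_monogenic :: "(real ^ 'n \<Rightarrow> 'n clifford \<Rightarrow> 'n clifford) \<Rightarrow> nat \<Rightarrow> ('n::finite) point set \<Rightarrow> ('n point \<Rightarrow> 'n clifford) \<Rightarrow> bool" where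
  "action_monogenic act M U F \<longleftrightarrow> open U \<and> axially_symmetric U \<and> (\<exists>F0 F1. action_stem act M U F F0 F1)"

text \<open>
  The reduction to scalar functions: \<open>c k A\<close> is the coefficient of \<open>e\<^sub>A\<close> in the \<open>k\<close>-th component.
\<close>

definition has_rep :: "(real ^ 'n \<Rightarrow> 'n clifford \<Rightarrow> 'n clifford) \<Rightarrow> nat \<Rightarrow> ('n::finite) point set \<Rightarrow> ('n point \<Rightarrow> 'n clifford) \<Rightarrow>
    (nat \<Rightarrow> 'n set \<Rightarrow> complex \<Rightarrow> complex) \<Rightarrow> bool" where
  "has_rep act M U F c \<longleftrightarrow> (\<forall>k A. intrinsic_on (complex_domain U) (c k A)) \<and>
     (\<forall>z\<in>complex_domain U. \<forall>j\<in>\<S>. F (slice_point j z) = lift (act j) (\<lambda>A. \<Sum>k<M. cnj z ^ k * c k A z))"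

text \<open>
  On the real axis \<open>sgn\<close> gives the zero vector, so the imaginary part is dropped; for intrinsic coefficients it is zero there.
\<close>

definition slice_extension :: "(real ^ 'n \<Rightarrow> 'n clifford \<Rightarrow> 'n clifford) \<Rightarrow> ('n set \<Rightarrow> complex \<Rightarrow> complex) \<Rightarrow> 'n::finite point \<Rightarrow> 'n clifford" where
  "slice_extension act c x = lift (act (sgn (snd x))) (\<lambda>A. c A (Complex (fst x) (norm (snd x))))"

definition action_components :: "(real ^ 'n \<Rightarrow> 'n clifford \<Rightarrow> 'n clifford) \<Rightarrow> (real ^ 'n \<Rightarrow> complex \<Rightarrow> 'n clifford \<Rightarrow> 'n clifford) \<Rightarrow>
   nat \<Rightarrow> ('n::finite) point set \<Rightarrow> ('n point \<Rightarrow> 'n clifford) \<Rightarrow> (nat \<Rightarrow> 'n point \<Rightarrow> 'n clifford) \<Rightarrow> bool" where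
  "action_components act mul M U F f \<longleftrightarrow> (\<forall>k<M. action_monogenic act 1 U (f k)) \<and>
     (\<forall>z\<in>complex_domain U. \<forall>j\<in>\<S>. F (slice_point j z) = (\<Sum>k<M. mul j (cnj z ^ k) (f k (slice_point j z))))"

lemma lift_sum_family:
  assumes "bounded_linear m"
  shows "(\<Sum>k\<in>I. lift m (c k)) = lift m (\<lambda>A. \<Sum>k\<in>I. c k A)"
  unfolding lift_sum[OF assms] by (subst sum.swap) (simp add: sum.distrib scaleR_sum_left)

text \<open>
  What the left and the right theory have in common; \<open>mul j a\<close> is the multiplication by \<open>a\<close>, read as an
  element of \<open>\<complex>\<^sub>j\<close>, from the respective side.
\<close>

locale slice_action =
  fixes act :: "real ^ 'n \<Rightarrow> 'n clifford \<Rightarrow> ('n::finite) clifford"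
    and mul :: "real ^ 'n \<Rightarrow> complex \<Rightarrow> 'n clifford \<Rightarrow> 'n clifford"
  assumes lin: "bounded_linear (act j)"
    and sq: "j \<in> \<S> \<Longrightarrow> act j (act j x) = - x"
    and neg: "act (- j) x = - act j x"
    and scal: "j \<in> \<S> \<Longrightarrow> mul j a (lift (act j) c) = lift (act j) (\<lambda>A. a * c A)"
begin

lemma act_minus: "act j (- x) = - act j x"
  by (rule linear_neg[OF bounded_linear.linear[OF lin]])

lemma act_zero: "act j 0 = 0"
  by (rule linear_0[OF bounded_linear.linear[OF lin]])

text \<open>
  The values for \<open>j\<close> and \<open>- j\<close> separate the part without \<open>j\<close> from the part with \<open>j\<close>.
\<close>

lemma lift_inject:
  assumes j: "j \<in> \<S>" "lift (act j) c = lift (act j) d" "lift (act (- j)) c = lift (act (- j)) d"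
  shows "c A = d A"
proof -
  have e: "rvec c + act j (ivec c) = rvec d + act j (ivec d)" "rvec c - act j (ivec c) = rvec d - act j (ivec d)"
    using j(2,3) by (simp_all add: lift_def neg)
  have "2 *\<^sub>R rvec c = (rvec c + act j (ivec c)) + (rvec c - act j (ivec c))" by (simp add: scaleR_2)
  also have "\<dots> = 2 *\<^sub>R rvec d" unfolding e by (simp add: scaleR_2)
  finally have r: "rvec c = rvec d" by simp
  then have "act j (act j (ivec c)) = act j (act j (ivec d))" using e(1) by simp
  then have "ivec c = ivec d" by (simp add: sq[OF j(1)])
  with r show ?thesis by (simp add: rvec_def ivec_def vec_eq_iff complex_eq_iff)
qed

text \<open>
  The decomposition of the stem functions has holomorphic coefficients. Since \<open>F0\<close> is even and \<open>F1\<close> is odd, their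
  symmetrizations \<open>(f(z) + cnj (f(cnj z))) / 2\<close> represent the same function, and they are intrinsic.
\<close>

lemma action_stem_rep:
  fixes F0 F1 :: "real \<times> real \<Rightarrow> 'n clifford"
  assumes U: "open U" "axially_symmetric U" and F: "action_stem act M U F F0 F1"
  obtains c where "has_rep act M U F c"
    "\<And>p A. p \<in> plane_domain U \<Longrightarrow> Complex (F0 p $ A) (F1 p $ A) = (\<Sum>k<M. cnj (pt p) ^ k * c k A (pt p))"
proof -
  let ?P = "plane_domain U"
  obtain j :: "real ^ 'n" where j: "j \<in> \<S>" using unit_vector_exists by blast
  have Ck: "Ck_on M ?P F0" "Ck_on M ?P F1" and par: "\<And>u v. (u, v) \<in> ?P \<Longrightarrow> F0 (u, - v) = F0 (u, v) \<and> F1 (u, - v) = - F1 (u, v)"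
    using F by (auto simp: action_stem_def stem_pair_def)
  have D: "(CR_op (act j) ^^ M) (\<lambda>q. F0 q + act j (F1 q)) p = 0" if "j \<in> \<S>" "p \<in> ?P" for j p
  proof -
    have "(1 / 2 ^ M) *\<^sub>R (CR_op (act j) ^^ M) (\<lambda>q. F0 q + act j (F1 q)) p = 0"
      using F that unfolding action_stem_def by blast
    then show ?thesis by simp
  qed
  have am: "act (- j) = (\<lambda>x. - act j x)" by (rule ext) (rule neg)
  have D': "(CR_op (\<lambda>x. - act j x) ^^ M) (\<lambda>q. F0 q - act j (F1 q)) p = 0" if "p \<in> ?P" for p
    using D[OF minus_unit_vector[OF j] that] unfolding am by simp
  obtain f where f: "\<And>k A. f k A holomorphic_on complex_domain U"
     "\<And>p A. p \<in> ?P \<Longrightarrow> Complex (F0 p $ A) (F1 p $ A) = (\<Sum>k<M. cnj (pt p) ^ k * f k A (pt p))"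
    using polyanalytic_decomposition[OF open_plane_domain[OF U] complex_domain_def lin[of j] sq[OF j] Ck D[OF j] D'] by blast
  have sym: "cnj_symmetric (complex_domain U)" by (rule complex_domain_cnj_symmetric[OF U])
  define c where "c k A z = (f k A z + cnj (f k A (cnj z))) / 2" for k A z
  have cc: "intrinsic_on (complex_domain U) (c k A)" for k A
  proof -
    have "z \<in> cnj ` complex_domain U" if "z \<in> complex_domain U" for z
      using sym that by (intro image_eqI[of _ _ "cnj z"]) (auto simp: cnj_symmetric_def)
    then have "cnj ` complex_domain U = complex_domain U" using sym by (auto simp: cnj_symmetric_def)
    then have "(\<lambda>z. cnj (f k A (cnj z))) holomorphic_on complex_domain U"
      using holomorphic_on_compose_cnj_cnj[of "f k A" "complex_domain U"] f(1) sym by (simp add: o_def cnj_symmetric_def)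
    then show ?thesis unfolding intrinsic_on_def c_def by (auto intro!: holomorphic_intros f(1) simp: add.commute)
  qed
  have rep: "Complex (F0 p $ A) (F1 p $ A) = (\<Sum>k<M. cnj (pt p) ^ k * c k A (pt p))" if p: "p \<in> ?P" for p A
  proof -
    obtain u v where uv: "p = (u, v)" by (cases p)
    have "Complex u v \<in> complex_domain U" using p by (simp add: complex_domain_def uv)
    then have "cnj (Complex u v) \<in> complex_domain U" using sym unfolding cnj_symmetric_def by blast
    then have p': "(u, - v) \<in> ?P" "pt (u, - v) = cnj (pt p)" by (simp_all add: complex_domain_def uv pt_def complex_eq_iff)
    have "Complex (F0 p $ A) (F1 p $ A) = cnj (Complex (F0 (u, - v) $ A) (F1 (u, - v) $ A))"
      using par[of u v] p by (simp add: uv complex_eq_iff)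
    also have "\<dots> = (\<Sum>k<M. cnj (pt p) ^ k * cnj (f k A (cnj (pt p))))"
      using f(2)[OF p'(1)] by (simp add: p'(2))
    finally show ?thesis using f(2)[OF p, of A]
      by (simp add: c_def distrib_left sum.distrib add_divide_distrib flip: sum_divide_distrib)
  qed
  have "F (slice_point j z) = lift (act j) (\<lambda>A. \<Sum>k<M. cnj z ^ k * c k A z)" if "z \<in> complex_domain U" "j \<in> \<S>" for z j
  proof -
    have p: "(Re z, Im z) \<in> ?P" "pt (Re z, Im z) = z" using that by (auto simp: complex_domain_def pt_def)
    have "F (slice_point j z) = F0 (Re z, Im z) + act j (F1 (Re z, Im z))"
      using F p(1) that(2) by (auto simp: action_stem_def slice_point_def)
    also have "F0 (Re z, Im z) = rvec (\<lambda>A. \<Sum>k<M. cnj z ^ k * c k A z)"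
      using arg_cong[OF rep[OF p(1)], of Re] unfolding p(2) complex.sel rvec_def vec_eq_iff vec_lambda_beta by blast
    also have "F1 (Re z, Im z) = ivec (\<lambda>A. \<Sum>k<M. cnj z ^ k * c k A z)"
      using arg_cong[OF rep[OF p(1)], of Im] unfolding p(2) complex.sel ivec_def vec_eq_iff vec_lambda_beta by blast
    finally show ?thesis by (simp add: lift_def)
  qed
  then have "has_rep act M U F c" using cc by (simp add: has_rep_def)
  then show ?thesis using rep that by blast
qed

text \<open>
  The converse direction; it shows that the product and the components are poly slice monogenic.
\<close>

lemma rep_action_stem:
  assumes U: "open U" "axially_symmetric U" and c: "has_rep act M U F c"
  shows "action_monogenic act M U F"
proof -
  define g where "g A z = (\<Sum>k<M. cnj z ^ k * c k A z)" for A z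
  let ?P = "plane_domain U"
  note oP = open_plane_domain[OF U]
  have int: "intrinsic_on (complex_domain U) (c k A)" for k A using c by (simp add: has_rep_def)
  then have gp: "polyanalytic M (complex_domain U) (g A)" for A
    unfolding polyanalytic_def g_def
    by (intro exI[of _ "\<lambda>k. c k A"]) (auto simp: intrinsic_on_def)
  have gp': "polyanalytic M (complex_domain U) (\<lambda>z. - \<i> * g A z)" for A
    unfolding polyanalytic_def g_def using int
    by (intro exI[of _ "\<lambda>k z. - \<i> * c k A z"]) (auto simp: intrinsic_on_def sum_distrib_left mult_ac intro!: holomorphic_intros)
  have zero: "bounded_linear (\<lambda>x::'n clifford. 0 :: 'n clifford)" by (rule bounded_linear_zero)
  define F0 where "F0 p = rvec (\<lambda>A. g A (pt p))" for p
  define F1 where "F1 p = ivec (\<lambda>A. g A (pt p))" for p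
  have "F1 = (\<lambda>p. lift (\<lambda>x. 0) (\<lambda>A. - \<i> * g A (pt p)))" "F0 = (\<lambda>p. lift (\<lambda>x. 0) (\<lambda>A. g A (pt p)))"
    by (auto simp: F0_def F1_def lift_def rvec_def ivec_def fun_eq_iff)
  then have Ck: "Ck_on M ?P F0" "Ck_on M ?P F1"
    using Ck_on_lift_polyanalytic[OF oP complex_domain_def zero gp] Ck_on_lift_polyanalytic[OF oP complex_domain_def zero gp'] by simp_all
  have par: "F0 (u, - v) = F0 (u, v) \<and> F1 (u, - v) = - F1 (u, v)" if "(u, v) \<in> ?P" for u v
  proof -
    have z: "pt (u, v) \<in> complex_domain U" "pt (u, - v) = cnj (pt (u, v))" using that by (auto simp: pt_def complex_domain_def complex_eq_iff)
    have "g A (cnj (pt (u, v))) = cnj (g A (pt (u, v)))" for A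
      unfolding g_def using int z(1) by (auto simp: intrinsic_on_def)
    then show ?thesis using z(2) by (simp add: F0_def F1_def rvec_def ivec_def vec_eq_iff)
  qed
  have val: "F (u, v *\<^sub>R j) = F0 (u, v) + act j (F1 (u, v))" if "(u, v) \<in> ?P" "j \<in> \<S>" for u v j
  proof -
    have "pt (u, v) \<in> complex_domain U" "slice_point j (pt (u, v)) = (u, v *\<^sub>R j)" using that by (auto simp: pt_def complex_domain_def slice_point_def)
    moreover have "F (slice_point j (pt (u, v))) = lift (act j) (\<lambda>A. g A (pt (u, v)))"
      using c that(2) \<open>pt (u, v) \<in> complex_domain U\<close> by (simp add: has_rep_def g_def)
    ultimately show ?thesis by (simp add: F0_def F1_def lift_def)
  qed
  have "(CR_op (act j) ^^ M) (\<lambda>q. F0 q + act j (F1 q)) p = 0" if "j \<in> \<S>" "p \<in> ?P" for j p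
    using CR_op_lift_polyanalytic[OF oP complex_domain_def lin sq[OF that(1)] gp that(2)] by (simp add: F0_def F1_def lift_def)
  then have "action_stem act M U F F0 F1"
    unfolding action_stem_def stem_pair_def using Ck par val by auto
  then show ?thesis using U by (auto simp: action_monogenic_def)
qed

lemma slice_extension_slice_point:
  assumes c: "\<And>A. c A (cnj z) = cnj (c A z)" and j: "j \<in> \<S>"
  shows "slice_extension act c (slice_point j z) = lift (act j) (\<lambda>A. c A z)"
proof -
  have n: "norm j = 1" using j by (simp add: unit_vectors_def)
  consider "Im z > 0" | "Im z < 0" | "Im z = 0" by linarith
  then show ?thesis
  proof cases
    case 1
    then have "sgn (snd (slice_point j z)) = j" "Complex (fst (slice_point j z)) (norm (snd (slice_point j z))) = z"
      using n by (simp_all add: slice_point_def sgn_scaleR sgn_div_norm complex_eq_iff)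
    then show ?thesis by (simp add: slice_extension_def)
  next
    case 2
    then have "sgn (snd (slice_point j z)) = - j" "Complex (fst (slice_point j z)) (norm (snd (slice_point j z))) = cnj z"
      using n by (simp_all add: slice_point_def sgn_scaleR sgn_div_norm complex_eq_iff)
    moreover have "ivec (\<lambda>A. cnj (c A z)) = - ivec (\<lambda>A. c A z)" "rvec (\<lambda>A. cnj (c A z)) = rvec (\<lambda>A. c A z)"
      by (simp_all add: ivec_def rvec_def vec_eq_iff)
    ultimately show ?thesis by (simp add: slice_extension_def lift_def c neg act_minus)
  next
    case 3
    then have z: "cnj z = z" by (simp add: complex_eq_iff)
    then have "Im (c A z) = 0" for A using arg_cong[OF c[of A], of Im] z by simp
    then have "ivec (\<lambda>A. c A z) = 0" by (simp add: ivec_def vec_eq_iff)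
    moreover have "Complex (fst (slice_point j z)) (norm (snd (slice_point j z))) = z" using 3 by (simp add: slice_point_def complex_eq_iff)
    ultimately show ?thesis by (simp add: slice_extension_def lift_def act_zero)
  qed
qed

lemma rep_action_components:
  assumes U: "open U" "axially_symmetric U" and c: "has_rep act M U F c"
  shows "action_components act mul M U F (\<lambda>k. slice_extension act (c k))"
proof -
  have ext: "slice_extension act (c k) (slice_point j z) = lift (act j) (\<lambda>A. c k A z)" if "z \<in> complex_domain U" "j \<in> \<S>" for k j z
    using c that by (intro slice_extension_slice_point) (auto simp: has_rep_def intrinsic_on_def)
  have "action_monogenic act 1 U (slice_extension act (c k))" for k
    using c ext by (intro rep_action_stem[OF U, of _ _ "\<lambda>_. c k"]) (simp add: has_rep_def)
  moreover have "F (slice_point j z) = (\<Sum>k<M. mul j (cnj z ^ k) (slice_extension act (c k) (slice_point j z)))" if "z \<in> complex_domain U" "j \<in> \<S>" for z j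
    using c that by (simp add: ext scal lift_sum_family[OF lin] has_rep_def)
  ultimately show ?thesis by (simp add: action_components_def)
qed

text \<open>
  Each component is slice monogenic, hence it has a representation of order one; comparing coefficients by
  \<open>polyanalytic_unique\<close> identifies it.
\<close>

lemma action_components_unique:
  assumes U: "open U" "axially_symmetric U" and c: "has_rep act M U F c" and f: "action_components act mul M U F f"
    and k: "k < M" and z: "z \<in> complex_domain U" and j: "j \<in> \<S>"
  shows "f k (slice_point j z) = lift (act j) (\<lambda>A. c k A z)"
proof -
  have "\<exists>d. has_rep act 1 U (f k) d" if "k < M" for k
  proof -
    have "\<exists>F0 F1. action_stem act 1 U (f k) F0 F1" using f that unfolding action_components_def action_monogenic_def by blast
    then obtain F0 F1 where "action_stem act 1 U (f k) F0 F1" by blast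
    from action_stem_rep[OF U this] show ?thesis by blast
  qed
  then obtain d where d: "\<And>k. k < M \<Longrightarrow> has_rep act 1 U (f k) (d k)" by metis
  have fd: "f k (slice_point j z) = lift (act j) (\<lambda>A. d k 0 A z)" if "k < M" "z \<in> complex_domain U" "j \<in> \<S>" for k z j
    using d[OF that(1)] that(2,3) by (simp add: has_rep_def)
  have Fd: "F (slice_point j z) = lift (act j) (\<lambda>A. \<Sum>k<M. cnj z ^ k * d k 0 A z)" if "z \<in> complex_domain U" "j \<in> \<S>" for z j
    using f that by (simp add: action_components_def fd scal lift_sum_family[OF lin])
  have "(\<Sum>k<M. cnj z ^ k * d k 0 A z) = (\<Sum>k<M. cnj z ^ k * c k A z)" if zz: "z \<in> complex_domain U" for z A
  proof -
    have eq: "lift (act j) (\<lambda>A. \<Sum>k<M. cnj z ^ k * d k 0 A z) = lift (act j) (\<lambda>A. \<Sum>k<M. cnj z ^ k * c k A z)" if "j \<in> \<S>" for j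
      using Fd[OF zz that] c zz that by (simp add: has_rep_def)
    show ?thesis using lift_inject[OF j eq[OF j] eq[OF minus_unit_vector[OF j]], of A] .
  qed
  then have "(\<Sum>k<M. cnj z ^ k * (d k 0 A z - c k A z)) = 0" if "z \<in> complex_domain U" for z A
    using that by (simp add: right_diff_distrib sum_subtractf)
  moreover have "(\<lambda>z. d k 0 A z - c k A z) holomorphic_on complex_domain U" if "k < M" for k A
    using d[OF that] c by (intro holomorphic_intros) (auto simp: has_rep_def intrinsic_on_def)
  moreover have "open (complex_domain U)" using complex_domain_cnj_symmetric[OF U] by (simp add: cnj_symmetric_def)
  ultimately have "d k 0 A z - c k A z = 0" for A
    using polyanalytic_unique[of "complex_domain U" M "\<lambda>k z. d k 0 A z - c k A z" k z] k z by blast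
  then show ?thesis using fd[OF k z j] by simp
qed

end

section \<open>The left and the right theory\<close>

definition cj :: "real ^ 'n \<Rightarrow> complex \<Rightarrow> ('n::finite) clifford" where
  "cj j c = Re c *\<^sub>R cbasis {} + Im c *\<^sub>R imag_unit j"

lemma cj_mult: "j \<in> \<S> \<Longrightarrow> cj j a \<odot> cj j b = cj j (a * b)"
  by (simp add: cj_def imag_unit_square_unit algebra_simps scaleR_diff_left)

lemma cpow_cj:
  assumes "j \<in> \<S>" shows "cpow (cj j c) k = cj j (c ^ k)"
  by (induction k) (simp_all add: cpow_def cj_mult[OF assms], simp add: cj_def)

lemma para_slice_point: "para (slice_point j z) = cj j z" "para (pconj (slice_point j z)) = cj j (cnj z)"
  by (simp_all add: para_eq slice_point_def cj_def pconj_def flip: scaleR_minus_left)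

definition lact :: "real ^ ('n::{finite,linorder}) \<Rightarrow> 'n clifford \<Rightarrow> 'n clifford" where "lact j x = imag_unit j \<odot> x"
definition ract :: "real ^ ('n::{finite,linorder}) \<Rightarrow> 'n clifford \<Rightarrow> 'n clifford" where "ract j x = x \<odot> imag_unit j"

lemma bounded_linear_acts: "bounded_linear (lact j)" "bounded_linear (ract j)"
  unfolding lact_def[abs_def] ract_def[abs_def]
  by (rule bounded_bilinear.bounded_linear_right[OF bounded_bilinear_cmult] bounded_bilinear.bounded_linear_left[OF bounded_bilinear_cmult])+

lemma lift_lact: "lift (lact j) c = (\<Sum>A\<in>UNIV. cj j (c A) \<odot> cbasis A)"
  unfolding lift_sum[OF bounded_linear_acts(1)] by (simp add: cj_def lact_def)

lemma lift_ract: "lift (ract j) c = (\<Sum>A\<in>UNIV. cbasis A \<odot> cj j (c A))"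
  unfolding lift_sum[OF bounded_linear_acts(2)] by (simp add: cj_def ract_def)

lemma cj_lift_lact: "j \<in> \<S> \<Longrightarrow> cj j a \<odot> lift (lact j) c = lift (lact j) (\<lambda>A. a * c A)"
  by (simp add: lift_lact cmult_sum_right cj_mult flip: cmult_assoc)

lemma lift_ract_cj: "j \<in> \<S> \<Longrightarrow> lift (ract j) c \<odot> cj j a = lift (ract j) (\<lambda>A. a * c A)"
  by (simp add: lift_ract cmult_sum_left cj_mult cmult_assoc mult.commute)

interpretation left: slice_action lact "\<lambda>j a x. cj j a \<odot> x"
proof (rule slice_action.intro)
  show "bounded_linear (lact j)" for j by (rule bounded_linear_acts)
  show "lact j (lact j x) = - x" if "j \<in> \<S>" for j x using that by (simp add: lact_def imag_unit_twice)
  show "lact (- j) x = - lact j x" for j x by (simp add: lact_def)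
  show "cj j a \<odot> lift (lact j) c = lift (lact j) (\<lambda>A. a * c A)" if "j \<in> \<S>" for j a c using that by (rule cj_lift_lact)
qed

interpretation right: slice_action ract "\<lambda>j a x. x \<odot> cj j a"
proof (rule slice_action.intro)
  show "bounded_linear (ract j)" for j by (rule bounded_linear_acts)
  show "ract j (ract j x) = - x" if "j \<in> \<S>" for j x using that by (simp add: ract_def imag_unit_twice)
  show "ract (- j) x = - ract j x" for j x by (simp add: ract_def)
  show "lift (ract j) c \<odot> cj j a = lift (ract j) (\<lambda>A. a * c A)" if "j \<in> \<S>" for j a c using that by (rule lift_ract_cj)
qed

lemma left_stem_action_stem: "left_stem M U F F0 F1 = action_stem lact M U F F0 F1"
  by (simp add: left_stem_def action_stem_def CR_op_def[abs_def] lact_def)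

lemma right_stem_action_stem: "right_stem M U F F0 F1 = action_stem ract M U F F0 F1"
  by (simp add: right_stem_def action_stem_def CR_op_def[abs_def] ract_def)

lemma left_poly_action_monogenic: "left_poly_slice_monogenic M U F = action_monogenic lact M U F"
  by (simp add: left_poly_slice_monogenic_def action_monogenic_def left_stem_action_stem)

lemma right_poly_action_monogenic: "right_poly_slice_monogenic M U F = action_monogenic ract M U F"
  by (simp add: right_poly_slice_monogenic_def action_monogenic_def right_stem_action_stem)

lemma all_in_domain:
  assumes "axially_symmetric U"
  shows "(\<forall>x\<in>U. Q x) \<longleftrightarrow> (\<forall>z\<in>complex_domain U. \<forall>j\<in>\<S>. Q (slice_point j z))"
  using in_domain_cases[OF assms] slice_point_in by metis

lemma left_components_action_components:
  assumes "axially_symmetric U"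
  shows "left_components M U F f = action_components lact (\<lambda>j a x. cj j a \<odot> x) M U F f"
  unfolding left_components_def action_components_def all_in_domain[OF assms] left_poly_action_monogenic
  by (simp add: para_slice_point cpow_cj)

lemma right_components_action_components:
  assumes "axially_symmetric U"
  shows "right_components M U F f = action_components ract (\<lambda>j a x. x \<odot> cj j a) M U F f"
  unfolding right_components_def action_components_def all_in_domain[OF assms] right_poly_action_monogenic
  by (simp add: para_slice_point cpow_cj)

section \<open>From slice integrals to the scalar calculus\<close>

lemma bounded_linear_fst_snd_comp: "bounded_linear L \<Longrightarrow> bounded_linear L' \<Longrightarrow> bounded_linear (\<lambda>Y. L (fst Y) + L' (snd Y))"
  by (intro bounded_linear_add bounded_linear_compose[OF _ bounded_linear_fst] bounded_linear_compose[OF _ bounded_linear_snd])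

lemma linear_sum_list: "linear L \<Longrightarrow> L (\<Sum>x\<leftarrow>xs. h x) = (\<Sum>x\<leftarrow>xs. L (h x))"
  by (induction xs) (simp_all add: linear_add linear_0)

context operator_resolvent
begin

text \<open>
  A slice integral is a sum of images, under bounded real-linear maps \<open>\<Phi>\<close>, of the pair-valued integrals which define the scalar
  calculus.
\<close>

lemma transfer_integral:
  fixes \<Phi> :: "nat \<Rightarrow> 'i::finite \<Rightarrow> ('b \<Rightarrow>\<^sub>L 'b) \<times> ('b \<Rightarrow>\<^sub>L 'b) \<Rightarrow> 'b \<Rightarrow>\<^sub>L 'b"
  assumes s: "surrounds \<Gamma> W D" and D: "cnj_symmetric D" and c: "\<And>l A. intrinsic_on D (c l A)"
    and \<Phi>: "\<And>l A. bounded_linear (\<Phi> l A)"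
    and G: "\<And>\<gamma> t. \<gamma> \<in> set \<Gamma> \<Longrightarrow> t \<in> {0..1} \<Longrightarrow>
       G \<gamma> t = (\<Sum>l<M. \<Sum>A\<in>UNIV. \<Phi> l A (cscale (vector_derivative \<gamma> (at t within {0..1})) (kernel (c l A) (\<gamma> t))))"
  shows "(1 / (2 * pi)) *\<^sub>R (\<Sum>\<gamma>\<leftarrow>\<Gamma>. integral {0..1} (G \<gamma>)) = (\<Sum>l<M. \<Sum>A\<in>UNIV. \<Phi> l A (fcalc \<Gamma> (c l A), 0))"
proof -
  have o: "open (D \<inter> \<rho>)" using D open_\<rho> by (auto simp: cnj_symmetric_def)
  have int: "integral {0..1} (G \<gamma>) = (\<Sum>l<M. \<Sum>A\<in>UNIV. \<Phi> l A (vcontour \<gamma> (kernel (c l A))))" if g: "\<gamma> \<in> set \<Gamma>" for \<gamma>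
  proof (rule integral_unique, rule has_integral_eq[OF G[OF g, symmetric]])
    have "has_vcontour (kernel (c l A)) (vcontour \<gamma> (kernel (c l A))) \<gamma>" for l A
      using has_vcontour_vcontour[OF weakly_holomorphic_kernel o, of "c l A" \<gamma>] surroundsD(2)[OF s g] c[of l A]
      by (auto simp: intrinsic_on_def)
    from has_integral_linear[OF this[unfolded has_vcontour_def] \<Phi>]
    show "((\<lambda>t. \<Sum>l<M. \<Sum>A\<in>UNIV. \<Phi> l A (cscale (vector_derivative \<gamma> (at t within {0..1})) (kernel (c l A) (\<gamma> t))))
       has_integral (\<Sum>l<M. \<Sum>A\<in>UNIV. \<Phi> l A (vcontour \<gamma> (kernel (c l A))))) {0..1}"
      by (intro has_integral_sum) (auto simp: o_def)
  qed
  have "(\<Sum>\<gamma>\<leftarrow>\<Gamma>. integral {0..1} (G \<gamma>)) = (\<Sum>\<gamma>\<leftarrow>\<Gamma>. \<Sum>l<M. \<Sum>A\<in>UNIV. \<Phi> l A (vcontour \<gamma> (kernel (c l A))))"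
    by (intro arg_cong[where f = sum_list] map_cong refl int)
  also have "\<dots> = (\<Sum>l<M. \<Sum>A\<in>UNIV. \<Phi> l A (kernel_integral \<Gamma> (c l A)))"
    unfolding kernel_integral_def linear_sum_list[OF bounded_linear.linear[OF \<Phi>]]
    by (induction \<Gamma>) (simp_all add: sum.distrib)
  finally have "(1 / (2 * pi)) *\<^sub>R (\<Sum>\<gamma>\<leftarrow>\<Gamma>. integral {0..1} (G \<gamma>)) = (\<Sum>l<M. \<Sum>A\<in>UNIV. \<Phi> l A ((1 / (2 * pi)) *\<^sub>R kernel_integral \<Gamma> (c l A)))"
    by (simp add: scaleR_sum_right linear_scale[OF bounded_linear.linear[OF \<Phi>]])
  moreover have "(1 / (2 * pi)) *\<^sub>R kernel_integral \<Gamma> (c l A) = (fcalc \<Gamma> (c l A), 0)" for l A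
    using kernel_integral_real[OF s D c[of l A]] by (simp add: prod_eq_iff fcalc_def)
  ultimately show ?thesis by simp
qed

end

lemma lmul_cj: "lmul (cj j c) = Re c *\<^sub>R id_blinfun + Im c *\<^sub>R lmul (imag_unit j)"
  by (simp add: cj_def lmul_linear_simps lmul_one)

lemma lmul_imag_unit_square: "j \<in> \<S> \<Longrightarrow> lmul (imag_unit j) o\<^sub>L lmul (imag_unit j) = - id_blinfun"
  by (simp add: imag_unit_square_unit lmul_linear_simps lmul_one flip: lmul_cmult)

text \<open>
  Reading a pair \<open>(a, b)\<close> as \<open>a + b j\<close> (or \<open>a + j b\<close>) turns complex scaling into multiplication by an element of \<open>\<complex>\<^sub>j\<close> from
  the right (or left).
\<close>

lemma compose_lmul_cj:
  assumes "j \<in> \<S>"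
  shows "(fst Y + (snd Y o\<^sub>L lmul (imag_unit j))) o\<^sub>L lmul (cj j w) = fst (cscale w Y) + (snd (cscale w Y) o\<^sub>L lmul (imag_unit j))"
    and "lmul (cj j w) o\<^sub>L (fst Y + (lmul (imag_unit j) o\<^sub>L snd Y)) = fst (cscale w Y) + (lmul (imag_unit j) o\<^sub>L snd (cscale w Y))"
proof -
  let ?J = "lmul (imag_unit j)"
  have "(snd Y o\<^sub>L ?J) o\<^sub>L ?J = - snd Y" "?J o\<^sub>L (?J o\<^sub>L snd Y) = - snd Y"
    by (simp_all add: blinfun_compose_assoc lmul_imag_unit_square[OF assms] compose_simps, simp_all only: blinfun_compose_assoc[symmetric] lmul_imag_unit_square[OF assms] compose_simps blinfun_compose_id)
  then show "(fst Y + (snd Y o\<^sub>L ?J)) o\<^sub>L lmul (cj j w) = fst (cscale w Y) + (snd (cscale w Y) o\<^sub>L ?J)"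
    "lmul (cj j w) o\<^sub>L (fst Y + (?J o\<^sub>L snd Y)) = fst (cscale w Y) + (?J o\<^sub>L snd (cscale w Y))"
    by (simp_all add: lmul_cj compose_simps cscale_def algebra_simps)
qed

lemma norm_slice_point: "j \<in> \<S> \<Longrightarrow> norm (slice_point j z) = norm z"
  by (simp add: slice_point_def norm_Pair cmod_def unit_vectors_def power_mult_distrib)

lemma Qop_eq: "j \<in> \<S> \<Longrightarrow> Qop (slice_point j z) T = operator_resolvent.Q (pop T) z"
  by (simp add: Qop_def operator_resolvent.Q_def norm_slice_point) (simp add: slice_point_def)

context
  fixes T :: "('v::banach, 'n::{finite,linorder}) pvop"
  assumes T: "T \<in> BC01"
begin

interpretation R: operator_resolvent "pop T" .

abbreviation "Tb \<equiv> pop (pop_conj T)"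
abbreviation "J j \<equiv> lmul (imag_unit j) :: ('v, 'n) cop"

lemma resolvent_slice: "j \<in> \<S> \<Longrightarrow> slice_point j z \<in> S_resolvent_set T \<longleftrightarrow> z \<in> R.\<rho>"
  unfolding S_resolvent_set_def mem_Collect_eq cop_invertible_iff[OF Qop_clifford]
  by (simp add: Qop_eq R.\<rho>_def is_inverse_def)

lemma P_cop_inverse: "j \<in> \<S> \<Longrightarrow> z \<in> R.\<rho> \<Longrightarrow> cop_inverse (Qop (slice_point j z) T) = R.P z"
proof -
  assume "j \<in> \<S>" "z \<in> R.\<rho>"
  then have "cop_invertible (Qop (slice_point j z) T)"
    using resolvent_slice by (auto simp: S_resolvent_set_def)
  from cop_inverse[OF this] show ?thesis
    using R.P_eqI[of z] \<open>j \<in> \<S>\<close> by (simp add: Qop_eq is_inverse_def)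
qed

lemma SL_inv_eq:
  assumes "j \<in> \<S>" "z \<in> R.\<rho>"
  shows "SL_inv (slice_point j z) T = fst (R.R z) + (snd (R.R z) o\<^sub>L J j)"
  by (simp add: SL_inv_def P_cop_inverse[OF assms] para_slice_point lmul_cj R.R_def compose_simps algebra_simps)

lemma SR_inv_eq:
  assumes "j \<in> \<S>" "z \<in> R.\<rho>"
  shows "SR_inv (slice_point j z) T = fst (R.R z) + (J j o\<^sub>L snd (R.R z))"
  by (simp add: SR_inv_def P_cop_inverse[OF assms] para_slice_point lmul_cj R.R_def compose_simps algebra_simps
      R.P_commute[OF assms(2) refl])

lemma ds_slice_eq: "j \<in> \<S> \<Longrightarrow> ds_slice j \<gamma> t = cj j (vector_derivative \<gamma> (at t within {0..1}) * (- \<i>))"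
proof -
  assume j: "j \<in> \<S>"
  have "- imag_unit j = cj j (- \<i>)" by (simp add: cj_def)
  then show ?thesis by (simp only: ds_slice_def para_slice_point cj_mult[OF j])
qed

text \<open>
  The measure, the scalar coefficient and the resolvent all belong to \<open>\<complex>\<^sub>j\<close> up to operators on the left, so they
  combine to the kernel of the scalar calculus with \<open>i\<close> read as right multiplication by \<open>j\<close>; \<open>e\<^sub>A\<close> stays outside on the right.
\<close>

lemma left_integral_eq:
  assumes s: "R.surrounds \<Gamma> W D" and D: "cnj_symmetric D" and c: "\<And>l A. intrinsic_on D (c l A)" and j: "j \<in> \<S>"
    and f: "\<And>l z. l < M \<Longrightarrow> z \<in> D \<Longrightarrow> f l (slice_point j z) = lift (lact j) (\<lambda>A. c l A z)"
  shows "left_integral M T j \<Gamma> f = (\<Sum>l<M. \<Sum>A\<in>UNIV. cop_pow Tb l o\<^sub>L R.fcalc \<Gamma> (c l A) o\<^sub>L lmul (cbasis A))"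
proof -
  define \<Phi> where "\<Phi> l A Y = cop_pow Tb l o\<^sub>L (fst Y + (snd Y o\<^sub>L J j)) o\<^sub>L lmul (cbasis A)" for l A Y
  have \<Phi>: "bounded_linear (\<Phi> l A)" for l A
    unfolding \<Phi>_def[abs_def]
    by (intro bounded_linear_compose[OF bounded_linear_compose_left] bounded_linear_compose[OF bounded_linear_compose_right]
        bounded_linear_fst_snd_comp bounded_linear_ident bounded_linear_compose_left)
  have "left_integral M T j \<Gamma> f = (\<Sum>l<M. \<Sum>A\<in>UNIV. \<Phi> l A (R.fcalc \<Gamma> (c l A), 0))"
    unfolding left_integral_def
  proof (rule R.transfer_integral[OF s D c \<Phi>])
    fix \<gamma> t assume g: "\<gamma> \<in> set \<Gamma>" and t: "t \<in> {0..(1::real)}"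
    let ?d = "vector_derivative \<gamma> (at t within {0..1})"
    have z: "\<gamma> t \<in> D" "\<gamma> t \<in> R.\<rho>" using R.surroundsD(2)[OF s g] t by (auto simp: path_image_def)
    have "cop_pow Tb l o\<^sub>L SL_inv (slice_point j (\<gamma> t)) T o\<^sub>L lmul (ds_slice j \<gamma> t) o\<^sub>L lmul (f l (slice_point j (\<gamma> t)))
       = (\<Sum>A\<in>UNIV. \<Phi> l A (cscale ?d (R.kernel (c l A) (\<gamma> t))))" if l: "l < M" for l
    proof -
      let ?S = "fst (R.R (\<gamma> t)) + (snd (R.R (\<gamma> t)) o\<^sub>L J j)"
      have "lmul (ds_slice j \<gamma> t) o\<^sub>L lmul (f l (slice_point j (\<gamma> t))) =
         (\<Sum>A\<in>UNIV. lmul (cj j (?d * (- \<i> * c l A (\<gamma> t)))) o\<^sub>L (lmul (cbasis A) :: ('v, 'n) cop))"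
      proof -
        have "cj j (?d * - \<i>) \<odot> lift (lact j) (\<lambda>A. c l A (\<gamma> t)) = (\<Sum>A\<in>UNIV. cj j (?d * (- \<i> * c l A (\<gamma> t))) \<odot> cbasis A)"
          unfolding lift_lact cmult_sum_right by (simp only: cmult_assoc[symmetric] cj_mult[OF j] mult.assoc)
        then show ?thesis
          unfolding ds_slice_eq[OF j] f[OF l z(1)] by (simp only: lmul_cmult[symmetric] lmul_linear_simps)
      qed
      then have "?S o\<^sub>L (lmul (ds_slice j \<gamma> t) o\<^sub>L lmul (f l (slice_point j (\<gamma> t)))) =
         (\<Sum>A\<in>UNIV. (?S o\<^sub>L lmul (cj j (?d * (- \<i> * c l A (\<gamma> t))))) o\<^sub>L lmul (cbasis A))"
        by (simp only: compose_sum blinfun_compose_assoc)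
      also have "\<dots> = (\<Sum>A\<in>UNIV. (let Y = cscale ?d (R.kernel (c l A) (\<gamma> t)) in fst Y + (snd Y o\<^sub>L J j)) o\<^sub>L lmul (cbasis A))"
        unfolding compose_lmul_cj(1)[OF j] R.kernel_def cscale_cscale Let_def ..
      finally show ?thesis
        unfolding SL_inv_eq[OF j z(2)] \<Phi>_def
        by (simp only: blinfun_compose_assoc compose_sum Let_def)
    qed
    then show "(\<Sum>l<M. cop_pow Tb l o\<^sub>L SL_inv (slice_point j (\<gamma> t)) T o\<^sub>L lmul (ds_slice j \<gamma> t) o\<^sub>L lmul (f l (slice_point j (\<gamma> t))))
       = (\<Sum>l<M. \<Sum>A\<in>UNIV. \<Phi> l A (cscale ?d (R.kernel (c l A) (\<gamma> t))))" by simp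
  qed
  then show ?thesis by (simp add: \<Phi>_def compose_simps)
qed

lemma right_integral_eq:
  assumes s: "R.surrounds \<Gamma> W D" and D: "cnj_symmetric D" and c: "\<And>l A. intrinsic_on D (c l A)" and j: "j \<in> \<S>"
    and f: "\<And>l z. l < M \<Longrightarrow> z \<in> D \<Longrightarrow> f l (slice_point j z) = lift (ract j) (\<lambda>A. c l A z)"
  shows "right_integral M T j \<Gamma> f = (\<Sum>l<M. \<Sum>A\<in>UNIV. lmul (cbasis A) o\<^sub>L R.fcalc \<Gamma> (c l A) o\<^sub>L cop_pow Tb l)"
proof -
  define \<Phi> where "\<Phi> l A Y = lmul (cbasis A) o\<^sub>L (fst Y + (J j o\<^sub>L snd Y)) o\<^sub>L cop_pow Tb l" for l A Y
  have \<Phi>: "bounded_linear (\<Phi> l A)" for l A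
    unfolding \<Phi>_def[abs_def]
    by (intro bounded_linear_compose[OF bounded_linear_compose_left] bounded_linear_compose[OF bounded_linear_compose_right]
        bounded_linear_fst_snd_comp bounded_linear_ident bounded_linear_compose_right)
  have "right_integral M T j \<Gamma> f = (\<Sum>l<M. \<Sum>A\<in>UNIV. \<Phi> l A (R.fcalc \<Gamma> (c l A), 0))"
    unfolding right_integral_def
  proof (rule R.transfer_integral[OF s D c \<Phi>])
    fix \<gamma> t assume g: "\<gamma> \<in> set \<Gamma>" and t: "t \<in> {0..(1::real)}"
    let ?d = "vector_derivative \<gamma> (at t within {0..1})"
    have z: "\<gamma> t \<in> D" "\<gamma> t \<in> R.\<rho>" using R.surroundsD(2)[OF s g] t by (auto simp: path_image_def)
    have "lmul (f l (slice_point j (\<gamma> t))) o\<^sub>L lmul (ds_slice j \<gamma> t) o\<^sub>L SR_inv (slice_point j (\<gamma> t)) T o\<^sub>L cop_pow Tb l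
       = (\<Sum>A\<in>UNIV. \<Phi> l A (cscale ?d (R.kernel (c l A) (\<gamma> t))))" if l: "l < M" for l
    proof -
      let ?S = "fst (R.R (\<gamma> t)) + (J j o\<^sub>L snd (R.R (\<gamma> t)))"
      have e: "c l A (\<gamma> t) * (?d * - \<i>) = ?d * (- \<i> * c l A (\<gamma> t))" for A by simp
      have "lmul (f l (slice_point j (\<gamma> t))) o\<^sub>L lmul (ds_slice j \<gamma> t) =
         (\<Sum>A\<in>UNIV. (lmul (cbasis A) :: ('v, 'n) cop) o\<^sub>L lmul (cj j (?d * (- \<i> * c l A (\<gamma> t)))))"
      proof -
        have "lift (ract j) (\<lambda>A. c l A (\<gamma> t)) \<odot> cj j (?d * - \<i>) = (\<Sum>A\<in>UNIV. cbasis A \<odot> cj j (?d * (- \<i> * c l A (\<gamma> t))))"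
          unfolding lift_ract cmult_sum_left by (simp only: cmult_assoc cj_mult[OF j] e)
        then show ?thesis
          unfolding ds_slice_eq[OF j] f[OF l z(1)] by (simp only: lmul_cmult[symmetric] lmul_linear_simps)
      qed
      then have "(lmul (f l (slice_point j (\<gamma> t))) o\<^sub>L lmul (ds_slice j \<gamma> t)) o\<^sub>L ?S =
         (\<Sum>A\<in>UNIV. lmul (cbasis A) o\<^sub>L (lmul (cj j (?d * (- \<i> * c l A (\<gamma> t)))) o\<^sub>L ?S))"
        by (simp only: compose_sum blinfun_compose_assoc)
      also have "\<dots> = (\<Sum>A\<in>UNIV. lmul (cbasis A) o\<^sub>L (let Y = cscale ?d (R.kernel (c l A) (\<gamma> t)) in fst Y + (J j o\<^sub>L snd Y)))"
        unfolding compose_lmul_cj(2)[OF j] R.kernel_def cscale_cscale Let_def ..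
      finally show ?thesis
        unfolding SR_inv_eq[OF j z(2)] \<Phi>_def
        by (simp only: compose_sum Let_def)
    qed
    then show "(\<Sum>l<M. lmul (f l (slice_point j (\<gamma> t))) o\<^sub>L lmul (ds_slice j \<gamma> t) o\<^sub>L SR_inv (slice_point j (\<gamma> t)) T o\<^sub>L cop_pow Tb l)
       = (\<Sum>l<M. \<Sum>A\<in>UNIV. \<Phi> l A (cscale ?d (R.kernel (c l A) (\<gamma> t))))" by simp
  qed
  then show ?thesis by (simp add: \<Phi>_def compose_simps)
qed

lemma admissible_surrounds:
  assumes "admissible T D U" "axially_symmetric D" "j \<in> \<S>" "boundary_curves \<Gamma> (slice j U)"
  shows "R.surrounds \<Gamma> (slice j U) (complex_domain D)"
proof -
  have U: "bounded U" "open U" "axially_symmetric U" "S_spectrum T \<subseteq> U" "closure U \<subseteq> D"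
    using assms(1) by (auto simp: admissible_def bounded_slice_Cauchy_domain_def)
  have sl: "slice j U = slice_point j -` U" by (auto simp: slice_def)
  have cont: "continuous_on X (slice_point j)" for X
    unfolding slice_point_def[abs_def] by (intro continuous_intros)
  have "open (slice j U)" unfolding sl by (intro open_vimage U cont)
  moreover have "bounded (slice j U)"
    using U(1) unfolding bounded_iff slice_def by (metis mem_Collect_eq norm_slice_point[OF assms(3)])
  moreover have "\<forall>z\<in>slice j U. cnj z \<in> slice j U"
    using complex_domain_cnj_symmetric[OF U(2,3)] by (simp add: slice_eq_complex_domain[OF U(3) assms(3)] cnj_symmetric_def)
  moreover have "- R.\<rho> \<subseteq> slice j U"
    using U(4) resolvent_slice[OF assms(3)] by (auto simp: S_spectrum_def slice_def)
  moreover have "closure (slice j U) \<subseteq> complex_domain D"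
  proof -
    have "closed (slice_point j -` closure U)" by (intro closed_vimage cont) auto
    then have "closure (slice j U) \<subseteq> slice_point j -` closure U"
      unfolding sl by (intro closure_minimal) (use closure_subset in auto)
    also have "\<dots> \<subseteq> slice j D" using U(5) by (auto simp: slice_def)
    finally show ?thesis using slice_eq_complex_domain[OF assms(2,3)] by simp
  qed
  ultimately show ?thesis using assms(4) by (simp add: R.surrounds_def)
qed

text \<open>
  The calculus is a definite description, so its value is determined only once all choices of domain, slice, curves and
  components are known to give the same operator. They do, by the uniqueness of the components and of the scalar calculus.
\<close>

lemma PS_calc_L_eq:
  assumes D: "open D" "axially_symmetric D" and c: "has_rep lact M D F c"
    and U: "admissible T D U" "j \<in> \<S>" "boundary_curves \<Gamma> (slice j U)"
  shows "PS_calc_L M T D F = (\<Sum>l<M. \<Sum>A\<in>UNIV. cop_pow Tb l o\<^sub>L R.fcalc \<Gamma> (c l A) o\<^sub>L lmul (cbasis A))"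
  unfolding PS_calc_L_def
proof (rule the_equality)
  have sym: "cnj_symmetric (complex_domain D)" by (rule complex_domain_cnj_symmetric[OF D])
  have int: "intrinsic_on (complex_domain D) (c l A)" for l A using c by (simp add: has_rep_def)
  have val: "left_integral M T k \<Delta> f = (\<Sum>l<M. \<Sum>A\<in>UNIV. cop_pow Tb l o\<^sub>L R.fcalc \<Gamma> (c l A) o\<^sub>L lmul (cbasis A))"
    if "admissible T D U'" "k \<in> \<S>" "boundary_curves \<Delta> (slice k U')" "left_components M D F f" for U' k \<Delta> f
  proof -
    have s: "R.surrounds \<Delta> (slice k U') (complex_domain D)" by (rule admissible_surrounds[OF that(1) D(2) that(2,3)])
    have "f l (slice_point k z) = lift (lact k) (\<lambda>A. c l A z)" if "l < M" "z \<in> complex_domain D" for l z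
      using left.action_components_unique[OF D c] \<open>left_components M D F f\<close> \<open>k \<in> \<S>\<close> that
      by (simp add: left_components_action_components[OF D(2)])
    moreover have "R.fcalc \<Delta> (c l A) = R.fcalc \<Gamma> (c l A)" for l A
      by (rule R.fcalc_unique[OF s admissible_surrounds[OF U(1) D(2) U(2,3)] sym int])
    ultimately show ?thesis using left_integral_eq[OF s sym int that(2)] by simp
  qed
  have comp: "left_components M D F (\<lambda>k. slice_extension lact (c k))"
    unfolding left_components_action_components[OF D(2)] by (rule left.rep_action_components[OF D c])
  then show "\<exists>U j \<Delta> f. admissible T D U \<and> j \<in> \<S> \<and> boundary_curves \<Delta> (slice j U) \<and> left_components M D F f \<and>
     (\<Sum>l<M. \<Sum>A\<in>UNIV. cop_pow Tb l o\<^sub>L R.fcalc \<Gamma> (c l A) o\<^sub>L lmul (cbasis A)) = left_integral M T j \<Delta> f"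
    using val[OF U comp] comp U
    by (intro exI[of _ U] exI[of _ j] exI[of _ \<Gamma>] exI[of _ "\<lambda>k. slice_extension lact (c k)"]) simp
  fix X assume "\<exists>U j \<Delta> f. admissible T D U \<and> j \<in> \<S> \<and> boundary_curves \<Delta> (slice j U) \<and> left_components M D F f \<and> X = left_integral M T j \<Delta> f"
  then show "X = (\<Sum>l<M. \<Sum>A\<in>UNIV. cop_pow Tb l o\<^sub>L R.fcalc \<Gamma> (c l A) o\<^sub>L lmul (cbasis A))"
    using val by blast
qed

lemma PS_calc_R_eq:
  assumes D: "open D" "axially_symmetric D" and c: "has_rep ract M D F c"
    and U: "admissible T D U" "j \<in> \<S>" "boundary_curves \<Gamma> (slice j U)"
  shows "PS_calc_R M T D F = (\<Sum>l<M. \<Sum>A\<in>UNIV. lmul (cbasis A) o\<^sub>L R.fcalc \<Gamma> (c l A) o\<^sub>L cop_pow Tb l)"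
  unfolding PS_calc_R_def
proof (rule the_equality)
  have sym: "cnj_symmetric (complex_domain D)" by (rule complex_domain_cnj_symmetric[OF D])
  have int: "intrinsic_on (complex_domain D) (c l A)" for l A using c by (simp add: has_rep_def)
  have val: "right_integral M T k \<Delta> f = (\<Sum>l<M. \<Sum>A\<in>UNIV. lmul (cbasis A) o\<^sub>L R.fcalc \<Gamma> (c l A) o\<^sub>L cop_pow Tb l)"
    if "admissible T D U'" "k \<in> \<S>" "boundary_curves \<Delta> (slice k U')" "right_components M D F f" for U' k \<Delta> f
  proof -
    have s: "R.surrounds \<Delta> (slice k U') (complex_domain D)" by (rule admissible_surrounds[OF that(1) D(2) that(2,3)])
    have "f l (slice_point k z) = lift (ract k) (\<lambda>A. c l A z)" if "l < M" "z \<in> complex_domain D" for l z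
      using right.action_components_unique[OF D c] \<open>right_components M D F f\<close> \<open>k \<in> \<S>\<close> that
      by (simp add: right_components_action_components[OF D(2)])
    moreover have "R.fcalc \<Delta> (c l A) = R.fcalc \<Gamma> (c l A)" for l A
      by (rule R.fcalc_unique[OF s admissible_surrounds[OF U(1) D(2) U(2,3)] sym int])
    ultimately show ?thesis using right_integral_eq[OF s sym int that(2)] by simp
  qed
  have comp: "right_components M D F (\<lambda>k. slice_extension ract (c k))"
    unfolding right_components_action_components[OF D(2)] by (rule right.rep_action_components[OF D c])
  then show "\<exists>U j \<Delta> f. admissible T D U \<and> j \<in> \<S> \<and> boundary_curves \<Delta> (slice j U) \<and> right_components M D F f \<and>
     (\<Sum>l<M. \<Sum>A\<in>UNIV. lmul (cbasis A) o\<^sub>L R.fcalc \<Gamma> (c l A) o\<^sub>L cop_pow Tb l) = right_integral M T j \<Delta> f"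
    using val[OF U comp] comp U
    by (intro exI[of _ U] exI[of _ j] exI[of _ \<Gamma>] exI[of _ "\<lambda>k. slice_extension ract (c k)"]) simp
  fix X assume "\<exists>U j \<Delta> f. admissible T D U \<and> j \<in> \<S> \<and> boundary_curves \<Delta> (slice j U) \<and> right_components M D F f \<and> X = right_integral M T j \<Delta> f"
  then show "X = (\<Sum>l<M. \<Sum>A\<in>UNIV. lmul (cbasis A) o\<^sub>L R.fcalc \<Gamma> (c l A) o\<^sub>L cop_pow Tb l)"
    using val by blast
qed

section \<open>Slice Cauchy domains in an intersection\<close>

text \<open>
  The union of the rotated copies of a conjugation symmetric plane region around the spectrum. Its slices are all equal to the
  region.
\<close>

lemma admissible_Int:
  assumes A: "open D" "axially_symmetric D" "admissible T D U" and B: "open D'" "axially_symmetric D'" "admissible T D' U'"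
  shows "\<exists>V. admissible T (D \<inter> D') V"
proof -
  let ?E = "D \<inter> D'"
  have E: "open ?E" "axially_symmetric ?E" using A B axially_symmetric_Int by auto
  obtain j :: "(real, 'n) vec" where j: "j \<in> \<S>" using unit_vector_exists ..
  have sp: "S_spectrum T \<subseteq> ?E" "bounded (S_spectrum T)"
  proof -
    have "bounded U" "S_spectrum T \<subseteq> U" "closure U \<subseteq> D" "S_spectrum T \<subseteq> U'" "closure U' \<subseteq> D'"
      using A(3) B(3) by (simp_all add: admissible_def bounded_slice_Cauchy_domain_def)
    then show "S_spectrum T \<subseteq> ?E" "bounded (S_spectrum T)"
      using closure_subset[of U] closure_subset[of U'] bounded_subset[of U "S_spectrum T"] by auto
  qed
  have K: "- R.\<rho> \<subseteq> complex_domain ?E" "bounded (- R.\<rho>)"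
  proof -
    have "slice_point j z \<in> S_spectrum T" if "z \<in> - R.\<rho>" for z
      using that resolvent_slice[OF j] by (simp add: S_spectrum_def)
    note in_spectrum = this
    have "z \<in> slice j ?E" if "z \<in> - R.\<rho>" for z
      unfolding slice_def mem_Collect_eq by (rule subsetD[OF sp(1) in_spectrum[OF that]])
    then show "- R.\<rho> \<subseteq> complex_domain ?E" unfolding slice_eq_complex_domain[OF E(2) j] by (rule subsetI)
    obtain B where "\<And>x. x \<in> S_spectrum T \<Longrightarrow> norm x \<le> B" using sp(2) unfolding bounded_iff by blast
    then have "norm z \<le> B" if "z \<in> - R.\<rho>" for z
      using in_spectrum[OF that] norm_slice_point[OF j, of z] by metis
    then show "bounded (- R.\<rho>)" unfolding bounded_iff by (intro exI[of _ B] ballI)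
  qed
  have cK: "compact (- R.\<rho>)" using K(2) R.open_\<rho> by (simp add: compact_eq_bounded_closed closed_Compl)
  have oE: "open (complex_domain ?E)" using complex_domain_cnj_symmetric[OF E] by (simp add: cnj_symmetric_def)
  have symK: "\<forall>z\<in>- R.\<rho>. cnj z \<in> - R.\<rho>" by (simp add: R.\<rho>_cnj)
  obtain W \<Gamma> where W: "open W" "bounded W" "- R.\<rho> \<subseteq> W" "closure W \<subseteq> complex_domain ?E"
     "\<And>z. (\<forall>z\<in>- R.\<rho>. cnj z \<in> - R.\<rho>) \<Longrightarrow> z \<in> W \<Longrightarrow> cnj z \<in> W" "boundary_curves \<Gamma> W"
    by (rule exists_Cauchy_region[OF cK oE K(1)]) (rule that; assumption)
  \<comment> \<open>Every point is of the form \<open>slice_point k (q x)\<close> for some unit vector \<open>k\<close>.\<close>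
  define q where "q x = Complex (fst x) (norm (snd x))" for x :: "'n point"
  define V where "V = q -` W"
  have q: "q (slice_point k z) \<in> W \<longleftrightarrow> z \<in> W" if "k \<in> \<S>" for k z
  proof -
    have "norm k = 1" using that by (simp add: unit_vectors_def)
    then have "q (slice_point k z) = z \<or> q (slice_point k z) = cnj z"
      by (auto simp: q_def slice_point_def complex_eq_iff abs_if)
    then show ?thesis using W(5)[OF symK, of z] W(5)[OF symK, of "cnj z"] by auto
  qed
  have sl: "slice k V = W" if "k \<in> \<S>" for k using q[OF that] by (auto simp: slice_def V_def)
  have qc: "continuous_on X q" for X
    unfolding q_def[abs_def] Complex_eq by (intro continuous_intros)
  have nq: "norm (q x) = norm x" for x by (cases x) (simp add: q_def cmod_def norm_Pair)
  have V: "open V" unfolding V_def by (intro open_vimage W qc)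
  have bV: "bounded V"
  proof -
    obtain B where "\<And>w. w \<in> W \<Longrightarrow> norm w \<le> B" using W(2) unfolding bounded_iff by blast
    then have "norm x \<le> B" if "x \<in> V" for x using that unfolding V_def nq[symmetric, of x] by simp
    then show ?thesis unfolding bounded_iff by (intro exI[of _ B] ballI)
  qed
  have aV: "axially_symmetric V"
    unfolding axially_symmetric_def V_def by (auto simp: q_def unit_vectors_def)
  have spV: "S_spectrum T \<subseteq> V"
  proof
    fix x assume x: "x \<in> S_spectrum T"
    obtain k where k: "k \<in> \<S>" "x = slice_point k (q x)" unfolding q_def by (rule slice_point_cases)
    then have "q x \<in> - R.\<rho>" using x resolvent_slice[OF k(1), of "q x"] by (auto simp: S_spectrum_def)
    then show "x \<in> V" using W(3) by (auto simp: V_def)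
  qed
  have clV: "closure V \<subseteq> ?E"
  proof
    fix x assume "x \<in> closure V"
    moreover have "closure V \<subseteq> q -` closure W"
      by (intro closure_minimal closed_vimage qc) (use closure_subset in \<open>auto simp: V_def\<close>)
    ultimately have "q x \<in> complex_domain ?E" using W(4) by auto
    moreover obtain k where k: "k \<in> \<S>" "x = slice_point k (q x)" unfolding q_def by (rule slice_point_cases)
    ultimately show "x \<in> ?E" using slice_point_in[of "q x" ?E k] by simp
  qed
  have "bounded_slice_Cauchy_domain V"
    unfolding bounded_slice_Cauchy_domain_def using V bV aV W(6) sl by auto
  then show ?thesis using spV clV by (auto simp: admissible_def)
qed

lemma admissible_mono: "admissible T D U \<Longrightarrow> D \<subseteq> D' \<Longrightarrow> admissible T D' U"
  by (auto simp: admissible_def)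

lemma admissible_boundary:
  assumes "admissible T D U"
  obtains j \<Gamma> where "j \<in> \<S>" "boundary_curves \<Gamma> (slice j U)"
proof -
  obtain j :: "(real, 'n) vec" where "j \<in> \<S>" using unit_vector_exists ..
  then show ?thesis using assms that[of j] by (auto simp: admissible_def bounded_slice_Cauchy_domain_def)
qed

section \<open>Products\<close>

text \<open>
  This is where the mutual commutation of the components of \<open>T\<close> enters.
\<close>

lemma fcalc_Tb:
  assumes "R.surrounds \<Gamma> W D" "cnj_symmetric D" "intrinsic_on D f"
  shows "R.fcalc \<Gamma> f o\<^sub>L cop_pow Tb k = cop_pow Tb k o\<^sub>L R.fcalc \<Gamma> f"
proof -
  have "pop T o\<^sub>L cop_pow Tb k = cop_pow Tb k o\<^sub>L pop T"
  proof (induction k)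
    case (Suc k)
    have "pop T o\<^sub>L (Tb o\<^sub>L cop_pow Tb k) = Tb o\<^sub>L (pop T o\<^sub>L cop_pow Tb k)"
      by (simp only: blinfun_compose_assoc[symmetric] pop_conj_commute[OF T])
    also have "\<dots> = Tb o\<^sub>L cop_pow Tb k o\<^sub>L pop T" by (simp only: Suc blinfun_compose_assoc)
    finally show ?case by (simp add: cop_pow_def)
  qed (simp add: cop_pow_def)
  then show ?thesis by (rule R.fcalc_commute[OF assms])
qed

lemma cop_pow_add: "cop_pow Tb (k + h) = cop_pow Tb k o\<^sub>L cop_pow Tb h"
  by (induction k) (simp_all add: cop_pow_def blinfun_compose_assoc)

lemma sum_pairs:
  fixes \<phi> :: "nat \<times> nat \<Rightarrow> 'x::comm_monoid_add"
  assumes "M \<ge> 1" "N \<ge> 1"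
  shows "(\<Sum>l<M + N - 1. \<Sum>x\<in>{x \<in> {..<N} \<times> {..<M}. fst x + snd x = l}. \<phi> x) = (\<Sum>k<N. \<Sum>h<M. \<phi> (k, h))"
proof -
  have "(\<Sum>l<M + N - 1. \<Sum>x\<in>{x \<in> {..<N} \<times> {..<M}. fst x + snd x = l}. \<phi> x) = (\<Sum>x\<in>{..<N} \<times> {..<M}. \<phi> x)"
    by (rule sum.group) (use assms in auto)
  then show ?thesis by (simp add: sum.cartesian_product)
qed

text \<open>
  The coefficients of the product of an intrinsic function and a left or right one.
\<close>

definition conv :: "nat \<Rightarrow> nat \<Rightarrow> (nat \<Rightarrow> complex \<Rightarrow> complex) \<Rightarrow> (nat \<Rightarrow> 'i \<Rightarrow> complex \<Rightarrow> complex) \<Rightarrow> nat \<Rightarrow> 'i \<Rightarrow> complex \<Rightarrow> complex" where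
  "conv N M a b l A z = (\<Sum>x\<in>{x \<in> {..<N} \<times> {..<M}. fst x + snd x = l}. a (fst x) z * b (snd x) A z)"

lemma conv_value:
  assumes "M \<ge> 1" "N \<ge> 1"
  shows "(\<Sum>l<M + N - 1. w ^ l * conv N M a b l A z) = (\<Sum>k<N. w ^ k * a k z) * (\<Sum>h<M. w ^ h * b h A z)"
proof -
  have "(\<Sum>l<M + N - 1. w ^ l * conv N M a b l A z) =
     (\<Sum>l<M + N - 1. \<Sum>x\<in>{x \<in> {..<N} \<times> {..<M}. fst x + snd x = l}. w ^ (fst x + snd x) * (a (fst x) z * b (snd x) A z))"
    unfolding conv_def sum_distrib_left by (intro sum.cong refl) auto
  also have "\<dots> = (\<Sum>k<N. \<Sum>h<M. w ^ (k + h) * (a k z * b h A z))" by (subst sum_pairs[OF assms]) simp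
  finally show ?thesis by (simp add: sum_product power_add mult_ac)
qed

lemma conv_intrinsic:
  assumes "\<And>k. intrinsic_on D (a k)" "\<And>h A. intrinsic_on D (b h A)"
  shows "intrinsic_on D (conv N M a b l A)"
  unfolding conv_def[abs_def] by (intro intrinsic_on_sum intrinsic_on_intros assms)

lemma conv_fcalc:
  assumes s: "R.surrounds \<Gamma> W D" and D: "cnj_symmetric D"
    and a: "\<And>k. intrinsic_on D (a k)" and b: "\<And>h A. intrinsic_on D (b h A)"
  shows "R.fcalc \<Gamma> (conv N M a b l A) = (\<Sum>x\<in>{x \<in> {..<N} \<times> {..<M}. fst x + snd x = l}. R.fcalc \<Gamma> (a (fst x)) o\<^sub>L R.fcalc \<Gamma> (b (snd x) A))"
proof -
  have fin: "finite {x \<in> {..<N} \<times> {..<M}. fst x + snd x = l}" by simp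
  have "R.fcalc \<Gamma> (conv N M a b l A) = (\<Sum>x\<in>{x \<in> {..<N} \<times> {..<M}. fst x + snd x = l}. R.fcalc \<Gamma> (\<lambda>z. a (fst x) z * b (snd x) A z))"
    unfolding conv_def[abs_def] by (rule R.fcalc_sum[OF s D fin]) (intro intrinsic_on_intros a b)
  then show ?thesis by (simp only: R.fcalc_mult[OF s D a b])
qed

text \<open>
  For real-valued stem functions the coefficient of \<open>e\<^sub>A\<close> with \<open>A \<noteq> {}\<close>, which is a sum over the components, vanishes;
  so zero may be put in the place of its summands.
\<close>

lemma intrinsic_rep:
  fixes F :: "'n point \<Rightarrow> 'n clifford"
  assumes "intrinsic_poly_slice_monogenic N D F"
  obtains a where "open D" "axially_symmetric D" "\<And>k. intrinsic_on (complex_domain D) (a k)"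
    "has_rep lact N D F (\<lambda>k A z. if A = {} then a k z else 0)"
    "\<And>z j. z \<in> complex_domain D \<Longrightarrow> j \<in> \<S> \<Longrightarrow> F (slice_point j z) = cj j (\<Sum>k<N. cnj z ^ k * a k z)"
proof -
  have D: "open D" "axially_symmetric D" using assms by (auto simp: intrinsic_poly_slice_monogenic_def)
  obtain F0 F1 where F: "action_stem lact N D F F0 F1"
    and real: "\<And>p. p \<in> plane_domain D \<Longrightarrow> (\<exists>r. F0 p = r *\<^sub>R cbasis {}) \<and> (\<exists>r. F1 p = r *\<^sub>R cbasis {})"
    using assms by (auto simp: intrinsic_poly_slice_monogenic_def left_stem_action_stem)
  obtain c where c: "has_rep lact N D F c"
    and e: "\<And>p A. p \<in> plane_domain D \<Longrightarrow> Complex (vec_nth (F0 p) A) (vec_nth (F1 p) A) = (\<Sum>k<N. cnj (pt p) ^ k * c k A (pt p))"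
    by (rule left.action_stem_rep[OF D F]) blast
  have z: "(\<Sum>k<N. cnj z ^ k * c k A z) = 0" if "z \<in> complex_domain D" "A \<noteq> {}" for z A
  proof -
    have p: "(Re z, Im z) \<in> plane_domain D" "pt (Re z, Im z) = z" using that by (auto simp: complex_domain_def pt_def)
    have "vec_nth (cbasis {} :: 'n clifford) A = 0" using that(2) by (simp add: cbasis_def axis_def)
    then have "vec_nth (F0 (Re z, Im z)) A = 0" "vec_nth (F1 (Re z, Im z)) A = 0"
      using real[OF p(1)] by auto
    then show ?thesis using e[OF p(1), of A] by (simp add: p(2) complex_eq_iff)
  qed
  have val: "F (slice_point j z) = lift (lact j) (\<lambda>A. \<Sum>k<N. cnj z ^ k * (if A = {} then c k {} z else 0))"
    if "z \<in> complex_domain D" "j \<in> \<S>" for z j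
  proof -
    have "(\<Sum>k<N. cnj z ^ k * c k A z) = (\<Sum>k<N. cnj z ^ k * (if A = {} then c k {} z else 0))" for A
      using z[OF that(1), of A] by (cases "A = {}") auto
    then show ?thesis using c that by (simp add: has_rep_def)
  qed
  have int: "intrinsic_on (complex_domain D) (c k A)" for k A using c by (simp add: has_rep_def)
  have "has_rep lact N D F (\<lambda>k A z. if A = {} then c k {} z else 0)"
    unfolding has_rep_def
  proof (intro conjI allI ballI)
    show "intrinsic_on (complex_domain D) (\<lambda>z. if A = {} then c k {} z else 0)" for k and A :: "'n set"
      using int intrinsic_on_intros(1) by (cases "A = {}") simp_all
  qed (rule val)
  moreover have "F (slice_point j z) = cj j (\<Sum>k<N. cnj z ^ k * c k {} z)" if "z \<in> complex_domain D" "j \<in> \<S>" for z j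
  proof -
    have "F (slice_point j z) = (\<Sum>A\<in>(UNIV :: 'n set set). if A = {} then cj j (\<Sum>k<N. cnj z ^ k * c k {} z) else 0)"
      unfolding val[OF that] lift_lact by (intro sum.cong refl) (auto simp: cj_def)
    then show ?thesis by simp
  qed
  ultimately show ?thesis using that[of "\<lambda>k. c k {}"] D int by blast
qed

lemma intrinsic_calc:
  assumes "open D" "axially_symmetric D" "has_rep lact N D F (\<lambda>k A z. if A = {} then a k z else 0)"
    "admissible T D U" "j \<in> \<S>" "boundary_curves \<Gamma> (slice j U)"
  shows "PN_calc N T D F = (\<Sum>k<N. cop_pow Tb k o\<^sub>L R.fcalc \<Gamma> (a k))"
proof -
  have "cop_pow Tb l o\<^sub>L R.fcalc \<Gamma> (\<lambda>z. if A = {} then a l z else 0) o\<^sub>L lmul (cbasis A) =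
     (if A = {} then cop_pow Tb l o\<^sub>L R.fcalc \<Gamma> (a l) else 0)" for l and A :: "'n set"
    by (cases "A = {}") (simp_all add: R.fcalc_zero compose_simps lmul_one)
  then show ?thesis unfolding PN_calc_def PS_calc_L_eq[OF assms] by simp
qed

text \<open>
  In the last rearrangement \<open>a\<^sub>k(T)\<close> moves past the powers of the conjugate operator.
\<close>

lemma product_left:
  assumes MN: "M \<ge> 1" "N \<ge> 1" and F: "PN N T DF F" and G: "PS_L M T DG G"
  shows "PS_L (M + N - 1) T (DF \<inter> DG) (\<lambda>x. F x \<odot> G x) \<and>
     PS_calc_L (M + N - 1) T (DF \<inter> DG) (\<lambda>x. F x \<odot> G x) = PN_calc N T DF F o\<^sub>L PS_calc_L M T DG G"
proof -
  let ?E = "DF \<inter> DG"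
  obtain a where DF: "open DF" "axially_symmetric DF" and a: "\<And>k. intrinsic_on (complex_domain DF) (a k)"
    "has_rep lact N DF F (\<lambda>k A z. if A = {} then a k z else 0)"
    "\<And>z j. z \<in> complex_domain DF \<Longrightarrow> j \<in> \<S> \<Longrightarrow> F (slice_point j z) = cj j (\<Sum>k<N. cnj z ^ k * a k z)"
    using intrinsic_rep[of N DF F] F unfolding PN_def by blast
  obtain G0 G1 where DG: "open DG" "axially_symmetric DG" and "action_stem lact M DG G G0 G1"
    using G unfolding PS_L_def left_poly_action_monogenic action_monogenic_def by blast
  then obtain b where b: "has_rep lact M DG G b" using left.action_stem_rep[OF DG] by blast
  have E: "open ?E" "axially_symmetric ?E" using DF DG axially_symmetric_Int by auto
  obtain V where V: "admissible T ?E V"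
    using admissible_Int[OF DF _ DG] F G unfolding PN_def PS_L_def by blast
  obtain j \<Gamma> where j: "j \<in> \<S>" "boundary_curves \<Gamma> (slice j V)" by (rule admissible_boundary[OF V])
  have sub: "complex_domain ?E \<subseteq> complex_domain DF" "complex_domain ?E \<subseteq> complex_domain DG" by (auto simp: complex_domain_Int)
  have ia: "intrinsic_on (complex_domain ?E) (a k)" for k by (rule intrinsic_on_subset[OF a(1) sub(1)])
  have ib: "intrinsic_on (complex_domain ?E) (b h A)" for h A
    using b by (intro intrinsic_on_subset[OF _ sub(2)]) (simp add: has_rep_def)
  have rep: "has_rep lact (M + N - 1) ?E (\<lambda>x. F x \<odot> G x) (conv N M a b)"
    unfolding has_rep_def
  proof (intro conjI allI ballI conv_intrinsic ia ib)
    fix z k assume z: "z \<in> complex_domain ?E" and k: "k \<in> (\<S> :: (real, 'n) vec set)"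
    have "G (slice_point k z) = lift (lact k) (\<lambda>A. \<Sum>h<M. cnj z ^ h * b h A z)"
      using b z k sub by (auto simp: has_rep_def)
    moreover have "F (slice_point k z) = cj k (\<Sum>i<N. cnj z ^ i * a i z)" using a(3) z k sub by blast
    ultimately show "F (slice_point k z) \<odot> G (slice_point k z) = lift (lact k) (\<lambda>A. \<Sum>l<M + N - 1. cnj z ^ l * conv N M a b l A z)"
      by (simp only: cj_lift_lact[OF k] conv_value[OF MN])
  qed
  have s: "R.surrounds \<Gamma> (slice j V) (complex_domain ?E)" by (rule admissible_surrounds[OF V E(2) j])
  have sym: "cnj_symmetric (complex_domain ?E)" by (rule complex_domain_cnj_symmetric[OF E])
  let ?t = "\<lambda>k h A. cop_pow Tb (k + h) o\<^sub>L (R.fcalc \<Gamma> (a k) o\<^sub>L R.fcalc \<Gamma> (b h A)) o\<^sub>L lmul (cbasis A)"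
  have "PS_calc_L (M + N - 1) T ?E (\<lambda>x. F x \<odot> G x) =
     (\<Sum>l<M + N - 1. \<Sum>A\<in>UNIV. \<Sum>x\<in>{x \<in> {..<N} \<times> {..<M}. fst x + snd x = l}. ?t (fst x) (snd x) A)"
    unfolding PS_calc_L_eq[OF E rep V j] conv_fcalc[OF s sym ia ib] compose_sum
    by (intro sum.cong refl) auto
  also have "\<dots> = (\<Sum>l<M + N - 1. \<Sum>x\<in>{x \<in> {..<N} \<times> {..<M}. fst x + snd x = l}. \<Sum>A\<in>UNIV. ?t (fst x) (snd x) A)"
    by (intro sum.cong refl sum.swap)
  also have "\<dots> = (\<Sum>k<N. \<Sum>h<M. \<Sum>A\<in>UNIV. ?t k h A)" by (subst sum_pairs[OF MN]) simp
  also have "\<dots> = (\<Sum>k<N. \<Sum>h<M. \<Sum>A\<in>UNIV. (cop_pow Tb k o\<^sub>L R.fcalc \<Gamma> (a k)) o\<^sub>L (cop_pow Tb h o\<^sub>L R.fcalc \<Gamma> (b h A) o\<^sub>L lmul (cbasis A)))"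
  proof (intro sum.cong refl)
    fix k h A
    have "R.fcalc \<Gamma> (a k) o\<^sub>L (cop_pow Tb h o\<^sub>L Y) = cop_pow Tb h o\<^sub>L (R.fcalc \<Gamma> (a k) o\<^sub>L Y)" for Y :: "('v, 'n) cop"
      unfolding blinfun_compose_assoc[symmetric] fcalc_Tb[OF s sym ia] ..
    then show "?t k h A = (cop_pow Tb k o\<^sub>L R.fcalc \<Gamma> (a k)) o\<^sub>L (cop_pow Tb h o\<^sub>L R.fcalc \<Gamma> (b h A) o\<^sub>L lmul (cbasis A))"
      by (simp only: cop_pow_add blinfun_compose_assoc)
  qed
  also have "\<dots> = PN_calc N T DF F o\<^sub>L PS_calc_L M T DG G"
    unfolding intrinsic_calc[OF DF a(2) admissible_mono[OF V Int_lower1] j] PS_calc_L_eq[OF DG b admissible_mono[OF V Int_lower2] j]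
    by (simp only: bounded_bilinear.sum_left[OF bounded_bilinear_blinfun_compose]) (simp only: bounded_bilinear.sum_right[OF bounded_bilinear_blinfun_compose])
  finally have "PS_calc_L (M + N - 1) T ?E (\<lambda>x. F x \<odot> G x) = PN_calc N T DF F o\<^sub>L PS_calc_L M T DG G" .
  moreover have "PS_L (M + N - 1) T ?E (\<lambda>x. F x \<odot> G x)"
    unfolding PS_L_def left_poly_action_monogenic using left.rep_action_stem[OF E rep] V by blast
  ultimately show ?thesis by blast
qed

lemma product_right:
  assumes MN: "M \<ge> 1" "N \<ge> 1" and F: "PS_R N T DF F" and G: "PN M T DG G"
  shows "PS_R (M + N - 1) T (DF \<inter> DG) (\<lambda>x. F x \<odot> G x) \<and>
     PS_calc_R (M + N - 1) T (DF \<inter> DG) (\<lambda>x. F x \<odot> G x) = PS_calc_R N T DF F o\<^sub>L PN_calc M T DG G"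
proof -
  let ?E = "DF \<inter> DG"
  obtain a where DG: "open DG" "axially_symmetric DG" and a: "\<And>k. intrinsic_on (complex_domain DG) (a k)"
    "has_rep lact M DG G (\<lambda>k A z. if A = {} then a k z else 0)"
    "\<And>z j. z \<in> complex_domain DG \<Longrightarrow> j \<in> \<S> \<Longrightarrow> G (slice_point j z) = cj j (\<Sum>k<M. cnj z ^ k * a k z)"
    using intrinsic_rep[of M DG G] G unfolding PN_def by blast
  obtain F0 F1 where DF: "open DF" "axially_symmetric DF" and "action_stem ract N DF F F0 F1"
    using F unfolding PS_R_def right_poly_action_monogenic action_monogenic_def by blast
  then obtain b where b: "has_rep ract N DF F b" using right.action_stem_rep[OF DF] by blast
  have E: "open ?E" "axially_symmetric ?E" using DF DG axially_symmetric_Int by auto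
  obtain V where V: "admissible T ?E V"
    using admissible_Int[OF DF _ DG] F G unfolding PN_def PS_R_def by blast
  obtain j \<Gamma> where j: "j \<in> \<S>" "boundary_curves \<Gamma> (slice j V)" by (rule admissible_boundary[OF V])
  have sub: "complex_domain ?E \<subseteq> complex_domain DF" "complex_domain ?E \<subseteq> complex_domain DG" by (auto simp: complex_domain_Int)
  have ia: "intrinsic_on (complex_domain ?E) (a k)" for k by (rule intrinsic_on_subset[OF a(1) sub(2)])
  have ib: "intrinsic_on (complex_domain ?E) (b h A)" for h A
    using b by (intro intrinsic_on_subset[OF _ sub(1)]) (simp add: has_rep_def)
  have MN': "N \<ge> 1" "M \<ge> 1" "N + M - 1 = M + N - 1" using MN by auto
  note val = conv_value[OF MN'(1,2), unfolded MN'(3)] and pairs = sum_pairs[OF MN'(1,2), unfolded MN'(3)]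
  have rep: "has_rep ract (M + N - 1) ?E (\<lambda>x. F x \<odot> G x) (conv M N a b)"
    unfolding has_rep_def
  proof (intro conjI allI ballI conv_intrinsic ia ib)
    fix z k assume z: "z \<in> complex_domain ?E" and k: "k \<in> (\<S> :: (real, 'n) vec set)"
    have "F (slice_point k z) = lift (ract k) (\<lambda>A. \<Sum>h<N. cnj z ^ h * b h A z)"
      using b z k sub by (auto simp: has_rep_def)
    moreover have "G (slice_point k z) = cj k (\<Sum>i<M. cnj z ^ i * a i z)" using a(3) z k sub by blast
    ultimately show "F (slice_point k z) \<odot> G (slice_point k z) = lift (ract k) (\<lambda>A. \<Sum>l<M + N - 1. cnj z ^ l * conv M N a b l A z)"
      by (simp only: lift_ract_cj[OF k] val)
  qed
  have s: "R.surrounds \<Gamma> (slice j V) (complex_domain ?E)" by (rule admissible_surrounds[OF V E(2) j])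
  have sym: "cnj_symmetric (complex_domain ?E)" by (rule complex_domain_cnj_symmetric[OF E])
  let ?t = "\<lambda>k h A. lmul (cbasis A) o\<^sub>L (R.fcalc \<Gamma> (a k) o\<^sub>L R.fcalc \<Gamma> (b h A)) o\<^sub>L cop_pow Tb (k + h)"
  have comm: "R.fcalc \<Gamma> (a k) o\<^sub>L R.fcalc \<Gamma> (b h A) = R.fcalc \<Gamma> (b h A) o\<^sub>L R.fcalc \<Gamma> (a k)" for k h A
    using R.fcalc_mult[OF s sym ia ib, of k h A] R.fcalc_mult[OF s sym ib ia, of h A k] by (simp add: mult.commute)
  have "PS_calc_R (M + N - 1) T ?E (\<lambda>x. F x \<odot> G x) =
     (\<Sum>l<M + N - 1. \<Sum>A\<in>UNIV. \<Sum>x\<in>{x \<in> {..<M} \<times> {..<N}. fst x + snd x = l}. ?t (fst x) (snd x) A)"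
    unfolding PS_calc_R_eq[OF E rep V j] conv_fcalc[OF s sym ia ib] compose_sum
    by (intro sum.cong refl) auto
  also have "\<dots> = (\<Sum>l<M + N - 1. \<Sum>x\<in>{x \<in> {..<M} \<times> {..<N}. fst x + snd x = l}. \<Sum>A\<in>UNIV. ?t (fst x) (snd x) A)"
    by (intro sum.cong refl sum.swap)
  also have "\<dots> = (\<Sum>k<M. \<Sum>h<N. \<Sum>A\<in>UNIV. ?t k h A)" by (subst pairs) simp
  also have "\<dots> = (\<Sum>k<M. \<Sum>h<N. \<Sum>A\<in>UNIV. (lmul (cbasis A) o\<^sub>L R.fcalc \<Gamma> (b h A) o\<^sub>L cop_pow Tb h) o\<^sub>L (cop_pow Tb k o\<^sub>L R.fcalc \<Gamma> (a k)))"
  proof (intro sum.cong refl)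
    fix k h A
    have "R.fcalc \<Gamma> (a k) o\<^sub>L cop_pow Tb (h + k) = cop_pow Tb h o\<^sub>L (cop_pow Tb k o\<^sub>L R.fcalc \<Gamma> (a k))"
      unfolding fcalc_Tb[OF s sym ia] by (simp only: cop_pow_add blinfun_compose_assoc)
    then show "?t k h A = (lmul (cbasis A) o\<^sub>L R.fcalc \<Gamma> (b h A) o\<^sub>L cop_pow Tb h) o\<^sub>L (cop_pow Tb k o\<^sub>L R.fcalc \<Gamma> (a k))"
      unfolding comm add.commute[of k h] by (simp only: blinfun_compose_assoc)
  qed
  also have "\<dots> = (\<Sum>h<N. \<Sum>A\<in>UNIV. \<Sum>k<M. (lmul (cbasis A) o\<^sub>L R.fcalc \<Gamma> (b h A) o\<^sub>L cop_pow Tb h) o\<^sub>L (cop_pow Tb k o\<^sub>L R.fcalc \<Gamma> (a k)))"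
    by (subst sum.swap) (intro sum.cong refl sum.swap)
  also have "\<dots> = PS_calc_R N T DF F o\<^sub>L PN_calc M T DG G"
    unfolding intrinsic_calc[OF DG a(2) admissible_mono[OF V Int_lower2] j] PS_calc_R_eq[OF DF b admissible_mono[OF V Int_lower1] j]
    by (simp only: bounded_bilinear.sum_left[OF bounded_bilinear_blinfun_compose]) (simp only: bounded_bilinear.sum_right[OF bounded_bilinear_blinfun_compose])
  finally have "PS_calc_R (M + N - 1) T ?E (\<lambda>x. F x \<odot> G x) = PS_calc_R N T DF F o\<^sub>L PN_calc M T DG G" .
  moreover have "PS_R (M + N - 1) T ?E (\<lambda>x. F x \<odot> G x)"
    unfolding PS_R_def right_poly_action_monogenic using right.rep_action_stem[OF E rep] V by blast
  ultimately show ?thesis by blast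
qed

end

theorem theorem7p5:
  fixes T :: "('v::banach, 'n::{finite,linorder}) pvop"
    and M N :: nat
    and F G :: "'n point \<Rightarrow> 'n clifford"
    and DF DG :: "'n point set"
  assumes "T \<in> BC01" and "M \<ge> 1" and "N \<ge> 1"
  shows "(PN N T DF F \<and> PS_L M T DG G \<longrightarrow>
            PS_L (M + N - 1) T (DF \<inter> DG) (\<lambda>x. F x \<odot> G x) \<and>
            PS_calc_L (M + N - 1) T (DF \<inter> DG) (\<lambda>x. F x \<odot> G x)
              = PN_calc N T DF F o\<^sub>L PS_calc_L M T DG G) \<and>
         (PS_R N T DF F \<and> PN M T DG G \<longrightarrow>
            PS_R (M + N - 1) T (DF \<inter> DG) (\<lambda>x. F x \<odot> G x) \<and>
            PS_calc_R (M + N - 1) T (DF \<inter> DG) (\<lambda>x. F x \<odot> G x)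
              = PS_calc_R N T DF F o\<^sub>L PN_calc M T DG G)"
  using product_left[OF assms] product_right[OF assms] by blast

end
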